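(* Let $g_k(z,u,t)$ and $h_k(z,u,t)$, $k\ge1$, be formal power series in $z,u,t$ with rational coefficients. Let $C(z,u,t)$ be the generating function of rooted planar maps with a weight $z$ per face, a weight $u$ per non-root vertex, a weight $t$ per edge, a weight $g_k(z,u,t)$ per non-root vertex of degree $k$ and a weight $h_k(z,u,t)$ if the root vertex has degree $k$. If $\sum_{k\ge1}g_k(z,u,t)v^k$ and $\sum_{k\ge1}h_k(z,u,t)v^k$ are holonomic series (with respect to the variables $z,u,t,v$), then $C$ is differentially algebraic with respect to $t$, with respect to $u$ and with respect to $z$.
   Context: A rooted planar map is a connected graph (loops and multiple edges allowed) embedded in the sphere up to orientation-preserving homeomorphism, with a distinguished corner whose incident vertex is the root vertex. A formal power series $A(z_1,\dots,z_m)$ with rational coefficients is holonomic (D-finite) if the $\mathbb Q(z_1,\dots,z_m)$-vector space spanned by all its partial derivatives $\partial^{i_1+\dots+i_m}A/\partial z_1^{i_1}\cdots\partial z_m^{i_m}$ is finite-dimensional. It is differentially algebraic with respect to $z_i$ if there exist $n\ge0$ and a nonzero polynomial $P$ with rational coefficients such that $P(A,\partial A/\partial z_i,\dots,\partial^nA/\partial z_i^n,z_1,\dots,z_m)=0$. *)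

theory Defs
  imports Complex_Main "HOL-Library.Poly_Mapping"
begin

section \<open>Multivariate formal power series over Q\<close>

text \<open>A formal power series with rational coefficients in the variables x_0, x_1, ...
  is a function from exponent vectors (finitely supported maps nat to nat) to rat.
  A series "in m variables" only has nonzero coefficients on monomials in x_0..x_(m-1).\<close>

type_synonym mser = "(nat \<Rightarrow>\<^sub>0 nat) \<Rightarrow> rat"

definition in_vars :: "nat \<Rightarrow> (nat \<Rightarrow>\<^sub>0 nat) \<Rightarrow> bool" where
  "in_vars m \<gamma> \<longleftrightarrow> Poly_Mapping.keys \<gamma> \<subseteq> {..<m}"

definition mser_in :: "nat \<Rightarrow> mser \<Rightarrow> bool" where
  "mser_in m f \<longleftrightarrow> (\<forall>\<gamma>. f \<gamma> \<noteq> 0 \<longrightarrow> in_vars m \<gamma>)"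

text \<open>Polynomials = series with finitely many nonzero coefficients.\<close>
definition mpoly_in :: "nat \<Rightarrow> mser \<Rightarrow> bool" where
  "mpoly_in m f \<longleftrightarrow> mser_in m f \<and> finite {\<gamma>. f \<gamma> \<noteq> 0}"

definition mconst :: "rat \<Rightarrow> mser" where
  "mconst c = (\<lambda>\<gamma>. if \<gamma> = 0 then c else 0)"

definition mvar :: "nat \<Rightarrow> mser" where
  "mvar i = (\<lambda>\<gamma>. if \<gamma> = Poly_Mapping.single i 1 then 1 else 0)"

definition mmul :: "mser \<Rightarrow> mser \<Rightarrow> mser" where
  "mmul f g = (\<lambda>\<gamma>. \<Sum>\<alpha>\<in>{\<alpha>. \<forall>i. Poly_Mapping.lookup \<alpha> i \<le> Poly_Mapping.lookup \<gamma> i}. f \<alpha> * g (\<gamma> - \<alpha>))"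

fun mpow :: "mser \<Rightarrow> nat \<Rightarrow> mser" where
  "mpow f 0 = mconst 1"
| "mpow f (Suc n) = mmul f (mpow f n)"

text \<open>Product of f 0, ..., f (N-1).\<close>
fun mprod_upto :: "nat \<Rightarrow> (nat \<Rightarrow> mser) \<Rightarrow> mser" where
  "mprod_upto 0 f = mconst 1"
| "mprod_upto (Suc N) f = mmul (mprod_upto N f) (f N)"

definition msum :: "'a set \<Rightarrow> ('a \<Rightarrow> mser) \<Rightarrow> mser" where
  "msum F f = (\<lambda>\<gamma>. \<Sum>x\<in>F. f x \<gamma>)"

text \<open>Partial derivative with respect to x_i.\<close>
definition mderiv :: "nat \<Rightarrow> mser \<Rightarrow> mser" where
  "mderiv i f = (\<lambda>\<gamma>. of_nat (Poly_Mapping.lookup \<gamma> i + 1) * f (\<gamma> + Poly_Mapping.single i 1))"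

text \<open>mdiffs m alpha A = d^(alpha_0) ... d^(alpha_(m-1)) A (partial derivatives in x_0..x_(m-1)).\<close>
fun mdiffs :: "nat \<Rightarrow> (nat \<Rightarrow>\<^sub>0 nat) \<Rightarrow> mser \<Rightarrow> mser" where
  "mdiffs 0 \<alpha> A = A"
| "mdiffs (Suc i) \<alpha> A = (mderiv i ^^ Poly_Mapping.lookup \<alpha> i) (mdiffs i \<alpha> A)"

text \<open>Holonomic (D-finite): the Q(x_0..x_(m-1))-span of all partial derivatives of A is
  finite-dimensional. Unfolded: finitely many derivatives (indexed by F) span all derivatives
  over the rational function field, i.e. after clearing denominators every derivative times a
  nonzero polynomial is a polynomial combination of the derivatives indexed by F
  (the span is taken inside the fraction field of the integral domain Q[[x]]).\<close>
definition holonomic :: "nat \<Rightarrow> mser \<Rightarrow> bool" where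
  "holonomic m A \<longleftrightarrow> mser_in m A \<and>
     (\<exists>F. finite F \<and> (\<forall>\<beta>\<in>F. in_vars m \<beta>) \<and>
        (\<forall>\<alpha>. in_vars m \<alpha> \<longrightarrow>
           (\<exists>p q. mpoly_in m p \<and> p \<noteq> mconst 0 \<and> (\<forall>\<beta>\<in>F. mpoly_in m (q \<beta>)) \<and>
                  mmul p (mdiffs m \<alpha> A) = msum F (\<lambda>\<beta>. mmul (q \<beta>) (mdiffs m \<beta> A)))))"

text \<open>Evaluation of a polynomial P (in variables y_0..y_(N-1)) at series vals j.\<close>
definition meval :: "nat \<Rightarrow> (nat \<Rightarrow> mser) \<Rightarrow> ((nat \<Rightarrow>\<^sub>0 nat) \<Rightarrow>\<^sub>0 rat) \<Rightarrow> mser" where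
  "meval N vals P = msum (Poly_Mapping.keys P)
     (\<lambda>\<mu>. mmul (mconst (Poly_Mapping.lookup P \<mu>)) (mprod_upto N (\<lambda>j. mpow (vals j) (Poly_Mapping.lookup \<mu> j))))"

text \<open>Differentially algebraic with respect to x_i, for a series in x_0..x_(m-1):
  P(A, d_i A, ..., d_i^n A, x_0, ..., x_(m-1)) = 0 for a nonzero polynomial P
  in the n+1+m variables y_0..y_(n+m), where y_j stands for d_i^j A (j \<le> n) and
  y_(n+1+k) stands for x_k.\<close>
definition diff_alg :: "nat \<Rightarrow> nat \<Rightarrow> mser \<Rightarrow> bool" where
  "diff_alg m i A \<longleftrightarrow>
     (\<exists>n P. P \<noteq> 0 \<and> (\<forall>\<mu>\<in>Poly_Mapping.keys P. Poly_Mapping.keys \<mu> \<subseteq> {..<n+1+m}) \<and>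
        meval (n+1+m) (\<lambda>j. if j \<le> n then (mderiv i ^^ j) A else mvar (j - n - 1)) P = mconst 0)"

section \<open>Rooted planar maps as combinatorial maps\<close>

text \<open>A map with n \<ge> 1 edges: darts {0..<2n}, a fixed-point-free involution a (edges),
  a permutation s (cyclic order of darts around vertices), both the identity outside the darts,
  generating a transitive group (connectedness); faces are cycles of s o a;
  planarity = Euler's formula V - E + F = 2. The root corner is encoded by the root dart 0.
  Rooted maps are the classes of such labelled maps modulo relabellings fixing dart 0.\<close>

definition darts :: "nat \<Rightarrow> nat set" where
  "darts n = {..<2*n}"

definition orbit :: "(nat \<Rightarrow> nat) \<Rightarrow> nat \<Rightarrow> nat set" where
  "orbit f x = {(f ^^ k) x | k. True}"

definition orbits :: "(nat \<Rightarrow> nat) \<Rightarrow> nat set \<Rightarrow> nat set set" where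
  "orbits f D = orbit f ` D"

definition lab_maps :: "nat \<Rightarrow> ((nat \<Rightarrow> nat) \<times> (nat \<Rightarrow> nat)) set" where
  "lab_maps n = {(a, s).
     bij_betw a (darts n) (darts n) \<and> (\<forall>d\<in>darts n. a d \<noteq> d \<and> a (a d) = d) \<and>
     bij_betw s (darts n) (darts n) \<and> (\<forall>x. x \<notin> darts n \<longrightarrow> a x = x \<and> s x = x) \<and>
     (\<forall>d\<in>darts n. (0, d) \<in> {(x, y). y = a x \<or> y = s x}\<^sup>*) \<and>
     int (card (orbits s (darts n))) - int n + int (card (orbits (s \<circ> a) (darts n))) = 2}"

definition map_iso :: "nat \<Rightarrow> (((nat \<Rightarrow> nat) \<times> (nat \<Rightarrow> nat)) \<times> ((nat \<Rightarrow> nat) \<times> (nat \<Rightarrow> nat))) set" where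
  "map_iso n = {((a, s), (a', s')). (a, s) \<in> lab_maps n \<and> (a', s') \<in> lab_maps n \<and>
     (\<exists>\<pi>. bij_betw \<pi> (darts n) (darts n) \<and> \<pi> 0 = 0 \<and>
        (\<forall>d\<in>darts n. \<pi> (a d) = a' (\<pi> d) \<and> \<pi> (s d) = s' (\<pi> d)))}"

text \<open>Variables: x_0 = z (faces), x_1 = u (non-root vertices), x_2 = t (edges).\<close>
definition map_weight :: "(nat \<Rightarrow> mser) \<Rightarrow> (nat \<Rightarrow> mser) \<Rightarrow> nat \<Rightarrow> (nat \<Rightarrow> nat) \<times> (nat \<Rightarrow> nat) \<Rightarrow> mser" where
  "map_weight g h n M = (case M of (a, s) \<Rightarrow>
     (let V = orbits s (darts n); root = orbit s 0; F = card (orbits (s \<circ> a) (darts n)) in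
      mmul (mpow (mvar 0) F)
       (mmul (mpow (mvar 1) (card V - 1))
        (mmul (mpow (mvar 2) n)
         (mmul (mprod_upto (2*n+1) (\<lambda>k. mpow (g k) (card {W\<in>V. W \<noteq> root \<and> card W = k})))
               (h (card root)))))))"

text \<open>Generating function C(z,u,t). Maps with n edges carry a factor t^n, so only n \<le> (t-exponent)
  contribute to a coefficient. The vertex map (no edge, one face, root degree 0) gets weight z.\<close>
definition Cmaps :: "(nat \<Rightarrow> mser) \<Rightarrow> (nat \<Rightarrow> mser) \<Rightarrow> mser" where
  "Cmaps g h = (\<lambda>\<gamma>. mvar 0 \<gamma> +
     (\<Sum>n\<in>{1..Poly_Mapping.lookup \<gamma> 2}. \<Sum>X\<in>lab_maps n // map_iso n.
        map_weight g h n (SOME M. M \<in> X) \<gamma>))"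

text \<open>sum_(k \<ge> 1) g_k(z,u,t) v^k, with v = x_3.\<close>
definition vgen :: "(nat \<Rightarrow> mser) \<Rightarrow> mser" where
  "vgen g = (\<lambda>\<gamma>. if 1 \<le> Poly_Mapping.lookup \<gamma> 3
                 then g (Poly_Mapping.lookup \<gamma> 3) (\<gamma> - Poly_Mapping.single 3 (Poly_Mapping.lookup \<gamma> 3)) else 0)"

end

(* Cutting the root edge encodes a rooted planar map as a term (an empty map, a pair of maps when
   the root edge is a loop, or one map with a marked split position otherwise), which is Tutte's
   recursion. Its solution is explicit: with X = v + S + R/v and Y = sum_k g_k X^(k-1), where
   S = t u [v^0] Y and R = t z + t u [v^(-1)] Y, the series t (C - z) is the residue in v of
   (sum_k h_k X^k) (1 - R/v^2) (R/v - t u Y_-), with Y_- the part of negative degree of Y.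
   Holonomicity puts all the series in modules over localized Laurent polynomials in v that are
   finite and closed under d/dv. Integration by parts and a dimension count show that the residues
   of the elements of such a module span a finite-dimensional space over the coefficient field.
   Applied to Y this gives a finitely generated field containing R and S and closed under the
   derivations in z, u, t; applied to the products Y_- * (sum_k h_k X^k) it gives one that also
   contains C. All derivatives of C lie in that field, so they are algebraically dependent. *)
theory Submission
  imports Defs "HOL-Computational_Algebra.Computational_Algebra" "HOL-Library.FuncSet"
begin

section \<open>Rooted maps as permutation pairs\<close>

text \<open>The main obstacle is that \<open>R\<close> and \<open>S\<close> are known only
  implicitly. Replacing the fourth variable by X turns holonomicity into a finite module, but over a
  field that must contain R and S, and differentiating in z, u or t then brings in their
  derivatives. These are recovered by differentiating the two equations for R and S: this gives a
  linear system whose matrix is the identity modulo t and whose entries involve only coefficients of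
  series in the module. Such coefficients are under control because multiplying by a power of v
  turns any coefficient into a residue. The second obstacle is Y_-, which leaves the module of Y.
  Taking the negative part commutes with multiplication by a Laurent polynomial up to a Laurent
  polynomial, so the negative parts of the generators together with the constant 1 again generate a
  finite module, stable under all derivations. On the combinatorial side Tutte's equation is not
  solved but verified for the explicit series. Its factor t forces uniqueness, so the equation
  identifies this series with the generating function of the terms.\<close>

lemma orbit_self [simp]: "x \<in> orbit f x"
  unfolding orbit_def by (metis (mono_tags, lifting) CollectI funpow_0)

lemma orbit_step: "y \<in> orbit f x \<Longrightarrow> f y \<in> orbit f x"
  unfolding orbit_def
  by (smt (verit, del_insts) funpow_simps_right(2) funpow_swap1 mem_Collect_eq o_apply)

lemma orbit_subset: assumes "x \<in> A" "\<And>y. y \<in> A \<Longrightarrow> f y \<in> A" shows "orbit f x \<subseteq> A"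
proof -
  have "(f ^^ k) x \<in> A" for k by (induction k) (use assms in auto)
  then show ?thesis unfolding orbit_def by blast
qed

lemma orbit_trans: "y \<in> orbit f x \<Longrightarrow> orbit f y \<subseteq> orbit f x"
  by (rule orbit_subset) (auto intro: orbit_step)

text \<open>Paths carry their end point as a parameter, so that they concatenate
  (\<open>path_append\<close>) and a cycle is a path ending at its own head. \<open>hd0 xs y\<close>
  is the first entry of \<open>xs\<close> followed by \<open>y\<close>.\<close>

fun hd0 :: "'a list \<Rightarrow> 'a \<Rightarrow> 'a" where
  "hd0 [] y = y"
| "hd0 (x # xs) y = x"

fun path :: "('a \<Rightarrow> 'a) \<Rightarrow> 'a list \<Rightarrow> 'a \<Rightarrow> bool" where
  "path f [] y = True"
| "path f (x # xs) y \<longleftrightarrow> f x = hd0 xs y \<and> path f xs y"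

definition cyc :: "('a \<Rightarrow> 'a) \<Rightarrow> 'a list \<Rightarrow> bool" where
  "cyc f xs \<longleftrightarrow> xs \<noteq> [] \<and> distinct xs \<and> path f xs (hd xs)"

lemma hd0_append [simp]: "hd0 (xs @ ys) y = hd0 xs (hd0 ys y)"
  by (cases xs) auto

lemma path_append [simp]: "path f (xs @ ys) y \<longleftrightarrow> path f xs (hd0 ys y) \<and> path f ys y"
  by (induction xs) auto

lemma cyc_rotate: "cyc f (as @ bs) \<Longrightarrow> cyc f (bs @ as)"
  by (cases as; cases bs) (auto simp: cyc_def)

lemma path_step: "path f xs y \<Longrightarrow> x \<in> set xs \<Longrightarrow> f x \<in> insert y (set xs)"
proof (induction xs)
  case (Cons a xs)
  then show ?case by (cases xs) auto
qed simp

lemma cyc_closed: "cyc f xs \<Longrightarrow> x \<in> set xs \<Longrightarrow> f x \<in> set xs"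
  using path_step[of f xs "hd xs" x] unfolding cyc_def by auto

lemma path_orbit:
  "path f (x # xs) y \<Longrightarrow> insert y (set (x # xs)) \<subseteq> orbit f x"
proof (induction xs arbitrary: x)
  case Nil
  then show ?case using orbit_step[of x f x] by auto
next
  case (Cons z zs)
  then have "f x = z" "insert y (set (z # zs)) \<subseteq> orbit f z" by auto
  then show ?case using orbit_trans[of z f x] orbit_step[of x f x] by auto
qed

lemma cyc_orbit: assumes "cyc f xs" "x \<in> set xs" shows "orbit f x = set xs"
proof
  show "orbit f x \<subseteq> set xs" using assms by (intro orbit_subset) (auto intro: cyc_closed)
  obtain as bs where xs: "xs = as @ x # bs" using assms(2) by (meson split_list)
  have "cyc f (x # bs @ as)" using cyc_rotate[of f as "x # bs"] assms(1) xs by simp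
  then have "path f (x # bs @ as) x" by (simp add: cyc_def)
  from path_orbit[OF this] show "set xs \<subseteq> orbit f x" using xs by auto
qed

lemma path_cong: "path f xs y \<Longrightarrow> (\<And>x. x \<in> set xs \<Longrightarrow> f x = g x) \<Longrightarrow> path g xs y"
  by (induction xs) auto

lemma cyc_cong: "cyc f xs \<Longrightarrow> (\<And>x. x \<in> set xs \<Longrightarrow> f x = g x) \<Longrightarrow> cyc g xs"
  unfolding cyc_def using path_cong by metis

text \<open>The cycle lists the iterates of \<open>x\<close> up to the first return to
  \<open>x\<close>. Injectivity turns any coincidence of two iterates into an earlier
  return.\<close>

lemma ex_cyc: assumes "bij_betw f C C" "finite C" "x \<in> C"
  obtains xs where "cyc f (x # xs)" "set (x # xs) \<subseteq> C"
proof -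
  have inj: "inj_on f C" and cl: "\<And>y. y \<in> C \<Longrightarrow> f y \<in> C"
    using assms(1) by (auto simp: bij_betw_def)
  have clk: "(f ^^ k) y \<in> C" if "y \<in> C" for k y using that cl by (induction k) auto
  have injk: "inj_on (f ^^ k) C" for k
    by (induction k) (auto simp: inj_on_def clk dest: inj_onD[OF inj])
  have red: "\<exists>k>0. k \<le> j - i \<and> (f ^^ k) x = x" if "i < j" "(f ^^ i) x = (f ^^ j) x" for i j
  proof -
    have "(f ^^ j) x = (f ^^ i) ((f ^^ (j - i)) x)"
      using that(1) by (metis comp_apply funpow_add le_add_diff_inverse less_imp_le)
    then have "(f ^^ (j - i)) x = x"
      using inj_onD[OF injk[of i], of x "(f ^^ (j - i)) x"] that(2) clk[OF assms(3)] assms(3) by metis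
    then show ?thesis using that(1) by (intro exI[of _ "j - i"]) auto
  qed
  have "\<not> inj (\<lambda>k. (f ^^ k) x)"
  proof
    assume "inj (\<lambda>k. (f ^^ k) x)"
    moreover have "finite (range (\<lambda>k. (f ^^ k) x))"
      using clk[OF assms(3)] assms(2) by (meson finite_subset image_subsetI)
    ultimately show False using finite_imageD infinite_UNIV_nat by blast
  qed
  then obtain i j where "i < j" "(f ^^ i) x = (f ^^ j) x"
    unfolding inj_def by (metis linorder_neqE_nat)
  then have ex: "\<exists>k. k > 0 \<and> (f ^^ k) x = x" using red by blast
  define n where "n = (LEAST k. k > 0 \<and> (f ^^ k) x = x)"
  have n: "n > 0" "(f ^^ n) x = x" using LeastI_ex[OF ex] unfolding n_def by auto
  have least: "k \<ge> n" if "k > 0" "(f ^^ k) x = x" for k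
    unfolding n_def using that by (intro Least_le) auto
  define xs where "xs = map (\<lambda>k. (f ^^ k) x) [0..<n]"
  have dist: "distinct xs" unfolding xs_def distinct_map
  proof (intro conjI distinct_upt inj_onI)
    fix i j assume ij: "i \<in> set [0..<n]" "j \<in> set [0..<n]" "(f ^^ i) x = (f ^^ j) x"
    show "i = j"
    proof (rule ccontr)
      assume "i \<noteq> j"
      then consider "i < j" | "j < i" by linarith
      then show False
      proof cases
        case 1 from red[OF 1 ij(3)] obtain k where "k > 0" "k \<le> j - i" "(f ^^ k) x = x" by blast
        then show False using least[of k] ij(1,2) 1 by auto
      next
        case 2 from red[OF 2 ij(3)[symmetric]] obtain k where "k > 0" "k \<le> i - j" "(f ^^ k) x = x" by blast
        then show False using least[of k] ij(1,2) 2 by auto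
      qed
    qed
  qed
  have suc: "path f (map (\<lambda>k. (f ^^ k) x) [0..<m]) ((f ^^ m) x)" for m
  proof (induction m)
    case (Suc m)
    have "map (\<lambda>k. (f ^^ k) x) [0..<Suc m] = map (\<lambda>k. (f ^^ k) x) [0..<m] @ [(f ^^ m) x]" by simp
    then show ?case using Suc by simp
  qed simp
  have hd: "hd xs = x" unfolding xs_def using n(1) by (simp add: hd_map upt_conv_Cons)
  have ne: "xs \<noteq> []" unfolding xs_def using n(1) by simp
  have "path f xs x" using suc[of n] n(2) unfolding xs_def by metis
  then have "cyc f xs" unfolding cyc_def using ne dist hd by metis
  moreover have "xs = x # tl xs" using hd ne by (cases xs) auto
  moreover have "set xs \<subseteq> C" unfolding xs_def using clk[OF assms(3)] by auto
  ultimately show thesis using that[of "tl xs"] by metis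
qed

lemma orbit_eq: assumes "bij_betw f C C" "finite C" "x \<in> C" "y \<in> orbit f x" shows "orbit f y = orbit f x"
  using ex_cyc[OF assms(1-3)] cyc_orbit assms(4) by (metis list.set_intros(1))

lemma orbit_sub: assumes "bij_betw f C C" "x \<in> C" shows "orbit f x \<subseteq> C"
  using assms by (intro orbit_subset) (auto simp: bij_betw_def)

lemma orbit_disj: assumes "bij_betw f C C" "finite C" "x \<in> C" "y \<in> C" "orbit f x \<inter> orbit f y \<noteq> {}"
  shows "orbit f x = orbit f y"
  using assms by (metis disjoint_iff orbit_eq)

lemma orbits_Un: "orbits f (A \<union> B) = orbits f A \<union> orbits f B"
  by (auto simp: orbits_def)

lemma orbits_cong: assumes "\<And>x. x \<in> A \<Longrightarrow> f x \<in> A" "\<And>x. x \<in> A \<Longrightarrow> f x = g x"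
  shows "orbits f A = orbits g A"
proof -
  have "(f ^^ k) x = (g ^^ k) x \<and> (f ^^ k) x \<in> A" if "x \<in> A" for x k
    using that assms by (induction k) auto
  then have "orbit f x = orbit g x" if "x \<in> A" for x using that by (auto simp: orbit_def)
  then show ?thesis by (auto simp: orbits_def)
qed

lemma finite_orbits [simp]: "finite C \<Longrightarrow> finite (orbits f C)"
  by (simp add: orbits_def)

lemma orbits_disj: assumes "\<And>x. x \<in> A \<Longrightarrow> f x \<in> A" "\<And>x. x \<in> B \<Longrightarrow> f x \<in> B" "A \<inter> B = {}"
  shows "orbits f A \<inter> orbits f B = {}"
proof -
  have 1: "O1 \<subseteq> A \<and> O1 \<noteq> {}" if "O1 \<in> orbits f A" for O1
  proof -
    from that obtain x where "x \<in> A" "O1 = orbit f x" by (auto simp: orbits_def)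
    then show ?thesis using orbit_subset[of x A f] assms(1) orbit_self[of x f] by blast
  qed
  have 2: "O1 \<subseteq> B" if "O1 \<in> orbits f B" for O1
  proof -
    from that obtain x where "x \<in> B" "O1 = orbit f x" by (auto simp: orbits_def)
    then show ?thesis using orbit_subset[of x B f] assms(2) by auto
  qed
  show ?thesis
  proof (rule ccontr)
    assume "orbits f A \<inter> orbits f B \<noteq> {}"
    then obtain W where W: "W \<in> orbits f A" "W \<in> orbits f B" by blast
    show False using 1[OF W(1)] 2[OF W(2)] assms(3) by blast
  qed
qed

text \<open>This is the map induced on the complement of \<open>x\<close>: the predecessor of
  \<open>x\<close> goes straight to the image of \<open>x\<close>, and \<open>x\<close> becomes a
  fixed point. It is how a dart is deleted from a rotation or from a face.\<close>

definition rem :: "'a \<Rightarrow> ('a \<Rightarrow> 'a) \<Rightarrow> 'a \<Rightarrow> 'a" where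
  "rem x f = (\<lambda>y. if y = x then x else if f y = x then f x else f y)"

lemma cyc_rem: assumes "cyc f (d # ys)" "ys \<noteq> []" shows "cyc (rem d f) ys"
proof -
  obtain z zs where ys: "ys = z # zs" using assms(2) by (cases ys) auto
  have d: "distinct ys" "d \<notin> set ys" and p: "path f ys d" "f d = z"
    using assms ys by (auto simp: cyc_def)
  have "path f xs d \<Longrightarrow> d \<notin> set xs \<Longrightarrow> path (rem d f) xs (f d)" for xs
  proof (induction xs)
    case (Cons x xs)
    then show ?case by (cases xs) (auto simp: rem_def)
  qed simp
  from this[OF p(1) d(2)] show ?thesis using d ys p(2) by (simp add: cyc_def)
qed

lemma orbit_rem: assumes "bij_betw f C C" "finite C" "d \<in> C" "f d \<noteq> d" "x \<in> C" "x \<noteq> d"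
  shows "orbit (rem d f) x = orbit f x - {d}"
proof (cases "d \<in> orbit f x")
  case True
  obtain ys where ys: "cyc f (d # ys)" "set (d # ys) \<subseteq> C" using ex_cyc[OF assms(1-3)] by blast
  have "ys \<noteq> []" using ys(1) assms(4) by (auto simp: cyc_def)
  have o: "orbit f x = set (d # ys)"
    using cyc_orbit[OF ys(1), of d] orbit_eq[OF assms(1,2,5) True] by simp
  then have "x \<in> set ys" using orbit_self[of x f] assms(6) by auto
  then show ?thesis using cyc_orbit[OF cyc_rem[OF ys(1) \<open>ys \<noteq> []\<close>]] o ys(1) by (auto simp: cyc_def)
next
  case False
  obtain ys where ys: "cyc f (x # ys)" "set (x # ys) \<subseteq> C" using ex_cyc[OF assms(1,2,5)] by blast
  have o: "orbit f x = set (x # ys)" using cyc_orbit[OF ys(1), of x] by simp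
  have "cyc (rem d f) (x # ys)"
    by (rule cyc_cong[OF ys(1)]) (use o False in \<open>auto simp: rem_def dest: orbit_step\<close>)
  then show ?thesis using cyc_orbit[of "rem d f" "x # ys" x] o False by simp
qed

lemma card_orbits_rem: assumes "bij_betw f C C" "finite C" "d \<in> C" "f d \<noteq> d"
  shows "card (orbits (rem d f) (C - {d})) = card (orbits f C)"
    and "orbits (rem d f) (C - {d}) = (\<lambda>W. W - {d}) ` orbits f C"
proof -
  have fd: "f d \<in> C" using assms by (auto simp: bij_betw_def)
  \<comment> \<open>As \<open>d\<close> is not fixed, every orbit has a representative other than
    \<open>d\<close>, so no orbit is lost when \<open>d\<close> is bypassed.\<close>
  have *: "\<exists>y\<in>C - {d}. W = orbit f y" if W: "W \<in> orbits f C" for W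
  proof -
    from W obtain y where y: "y \<in> C" "W = orbit f y" by (auto simp: orbits_def)
    show ?thesis
    proof (cases "y = d")
      case True
      then have "W = orbit f (f d)" using orbit_eq[OF assms(1,2,3), of "f d"] y orbit_step[of d f d] by simp
      then show ?thesis using fd assms(4) by blast
    qed (use y in auto)
  qed
  show eq: "orbits (rem d f) (C - {d}) = (\<lambda>W. W - {d}) ` orbits f C"
  proof
    show "orbits (rem d f) (C - {d}) \<subseteq> (\<lambda>W. W - {d}) ` orbits f C"
      using orbit_rem[OF assms] by (auto simp: orbits_def)
    show "(\<lambda>W. W - {d}) ` orbits f C \<subseteq> orbits (rem d f) (C - {d})"
    proof
      fix Z assume "Z \<in> (\<lambda>W. W - {d}) ` orbits f C"
      then obtain W where W: "W \<in> orbits f C" "Z = W - {d}" by auto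
      from *[OF W(1)] obtain y where "y \<in> C - {d}" "W = orbit f y" by blast
      then show "Z \<in> orbits (rem d f) (C - {d})" using orbit_rem[OF assms] W(2) by (auto simp: orbits_def)
    qed
  qed
  have "inj_on (\<lambda>W. W - {d}) (orbits f C)"
  proof (rule inj_onI)
    fix W W' assume W: "W \<in> orbits f C" "W' \<in> orbits f C" "W - {d} = W' - {d}"
    from *[OF W(1)] obtain y where y: "y \<in> C - {d}" "W = orbit f y" by blast
    from *[OF W(2)] obtain y' where y': "y' \<in> C - {d}" "W' = orbit f y'" by blast
    have "y \<in> W'" using y W(3) orbit_self[of y f] by blast
    then show "W = W'" using orbit_eq[OF assms(1,2), of y' y] y y' by auto
  qed
  then show "card (orbits (rem d f) (C - {d})) = card (orbits f C)" unfolding eq by (rule card_image)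
qed

lemma bij_rem: assumes "bij_betw f C C" "finite C" "d \<in> C"
  shows "bij_betw (rem d f) (C - {d}) (C - {d})"
proof -
  have inj: "inj_on f C" and cl: "\<And>y. y \<in> C \<Longrightarrow> f y \<in> C" using assms(1) by (auto simp: bij_betw_def)
  have 1: "inj_on (rem d f) (C - {d})"
    using inj assms(3) by (auto simp: inj_on_def rem_def)
  have 2: "rem d f ` (C - {d}) \<subseteq> C - {d}"
    using inj cl assms(3) by (auto simp: inj_on_def rem_def)
  show ?thesis using 1 2 assms(2) by (simp add: bij_betw_def endo_inj_surj)
qed

section \<open>Cutting the root edge\<close>

text \<open>Rooting by an extra dart \<open>r\<close> at the root corner, fixed by the edge involution, makes the vertex map
  an instance (\<open>C = {r}\<close>); it adds one dart to the root vertex and does not change the number of faces.\<close>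

definition pm :: "nat set \<Rightarrow> nat \<Rightarrow> (nat \<Rightarrow> nat) \<Rightarrow> (nat \<Rightarrow> nat) \<Rightarrow> bool" where
  "pm C r a s \<longleftrightarrow> finite C \<and> r \<in> C \<and> a r = r \<and>
     (\<forall>x\<in>C - {r}. a x \<in> C - {r} \<and> a x \<noteq> x \<and> a (a x) = x) \<and> bij_betw s C C"

text \<open>Cutting the root edge \<open>{d, e}\<close>, where \<open>d = s r\<close>: the dart \<open>e\<close> becomes the extra dart of a second map and
  \<open>d\<close> is isolated. If \<open>e\<close> is at the root vertex, that vertex is split in two; otherwise the two ends of
  the edge are merged.\<close>

definition cut_alpha :: "(nat \<Rightarrow> nat) \<Rightarrow> nat \<Rightarrow> nat \<Rightarrow> nat \<Rightarrow> nat" where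
  "cut_alpha a d e = a(d := d, e := e)"

definition cut_sigma :: "(nat \<Rightarrow> nat) \<Rightarrow> nat \<Rightarrow> nat \<Rightarrow> nat \<Rightarrow> nat \<Rightarrow> nat" where
  "cut_sigma s r d e = s(r := s e, e := s d, d := d)"

lemma bij_alpha: assumes "pm C r a s" shows "bij_betw a C C"
proof (rule bij_betw_byWitness[where f' = a])
  have "a x \<in> C \<and> a (a x) = x" if "x \<in> C" for x
    using assms that unfolding pm_def by (cases "x = r") simp_all
  then show "\<forall>x\<in>C. a (a x) = x" "\<forall>x\<in>C. a (a x) = x" "a ` C \<subseteq> C" "a ` C \<subseteq> C"
    by blast+
qed

lemma orbits_single: assumes "cyc s xs" shows "orbits s (set xs) = {set xs}"
proof -
  obtain x where x: "x \<in> set xs" using assms by (cases xs) (auto simp: cyc_def)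
  show ?thesis
  proof (intro equalityI subsetI)
    show "W \<in> {set xs}" if "W \<in> orbits s (set xs)" for W
      using that cyc_orbit[OF assms] by (auto simp: orbits_def)
    show "W \<in> orbits s (set xs)" if "W \<in> {set xs}" for W
      using that cyc_orbit[OF assms x] x unfolding orbits_def by (metis imageI singletonD)
  qed
qed

context
  fixes C r a s d e
  assumes pm: "pm C r a s" and d: "d = s r" "d \<noteq> r" and e: "e = a d"
begin

lemma cut_basic: "d \<in> C" "e \<in> C" "r \<in> C" "e \<noteq> r" "e \<noteq> d" "a e = d" "a r = r" "finite C" "s d \<noteq> d" "s e \<noteq> d"
  and cut_inj: "\<And>x y. x \<in> C \<Longrightarrow> y \<in> C \<Longrightarrow> s x = s y \<Longrightarrow> x = y"
  and cut_cl: "\<And>x. x \<in> C \<Longrightarrow> s x \<in> C" "\<And>x. x \<in> C \<Longrightarrow> a x \<in> C"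
  and cut_bij: "bij_betw s C C"
proof -
  show bij: "bij_betw s C C" using pm by (simp add: pm_def)
  show inj: "\<And>x y. x \<in> C \<Longrightarrow> y \<in> C \<Longrightarrow> s x = s y \<Longrightarrow> x = y"
    using bij by (auto simp: bij_betw_def inj_on_def)
  show cl: "\<And>x. x \<in> C \<Longrightarrow> s x \<in> C" "\<And>x. x \<in> C \<Longrightarrow> a x \<in> C"
    using bij bij_alpha[OF pm] by (auto simp: bij_betw_def)
  show 1: "d \<in> C" "r \<in> C" "a r = r" "finite C" using pm d cl by (auto simp: pm_def)
  show 2: "e \<in> C" "e \<noteq> r" "e \<noteq> d" "a e = d" using pm d 1 e by (auto simp: pm_def)
  show "s d \<noteq> d" "s e \<noteq> d" using inj[of d r] inj[of e r] 1 2 d by auto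
qed

lemma cut_bij': "bij_betw (cut_sigma s r d e) (C - {d}) (C - {d})"
proof -
  \<comment> \<open>On the remaining darts the new rotation is \<open>s\<close> after \<tau>, and
    \<tau> is injective there since \<open>d\<close> is outside its domain.\<close>
  define \<tau> where "\<tau> x = (if x = r then e else if x = e then d else x)" for x
  have t: "cut_sigma s r d e x = s (\<tau> x)" "\<tau> x \<in> C" if "x \<in> C - {d}" for x
    using that cut_basic by (simp_all add: \<tau>_def cut_sigma_def)
  have 1: "inj_on (cut_sigma s r d e) (C - {d})"
  proof (rule inj_onI)
    fix x y assume xy: "x \<in> C - {d}" "y \<in> C - {d}" "cut_sigma s r d e x = cut_sigma s r d e y"
    then have "\<tau> x = \<tau> y" using t[OF xy(1)] t[OF xy(2)] cut_inj by metis
    then show "x = y" using xy cut_basic(4) by (simp add: \<tau>_def split: if_splits)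
  qed
  have 2: "cut_sigma s r d e ` (C - {d}) \<subseteq> C - {d}"
    using cut_basic cut_cl cut_inj[of _ r] d by (auto simp: cut_sigma_def)
  show ?thesis using 1 2 cut_basic by (simp add: bij_betw_def endo_inj_surj)
qed

text \<open>In the face permutation the cut amounts to bypassing \<open>d\<close>. This is why the
  number of faces never changes, whether or not the root edge is a loop.\<close>

lemma cut_phi: "x \<in> C - {d} \<Longrightarrow> rem d (s \<circ> a) x = (cut_sigma s r d e \<circ> cut_alpha a d e) x"
proof -
  assume x: "x \<in> C - {d}"
  consider "x = e" | "x = r" | "x \<noteq> e" "x \<noteq> r" by blast
  then show ?thesis
  proof cases
    case 1 then show ?thesis using cut_basic by (auto simp: rem_def cut_sigma_def cut_alpha_def)
  next
    case 2 then show ?thesis using cut_basic d e by (auto simp: rem_def cut_sigma_def cut_alpha_def)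
  next
    case 3
    have ax: "a x \<in> C" "a (a x) = x" "a x \<noteq> r" using pm x 3 by (auto simp: pm_def)
    then have "a x \<noteq> d" "a x \<noteq> e" using 3 x cut_basic e by auto
    moreover have "s (a x) \<noteq> d" using cut_inj[of "a x" r] ax cut_basic d by auto
    ultimately show ?thesis using x 3 ax by (auto simp: rem_def cut_sigma_def cut_alpha_def)
  qed
qed

lemma bij_phi: "bij_betw (s \<circ> a) C C"
  using bij_alpha[OF pm] cut_bij by (rule bij_betw_trans)

lemma cut_faces:
  "card (orbits (cut_sigma s r d e \<circ> cut_alpha a d e) (C - {d})) = card (orbits (s \<circ> a) C)"
proof -
  have "(s \<circ> a) d \<noteq> d" using cut_basic e by simp
  then have "card (orbits (rem d (s \<circ> a)) (C - {d})) = card (orbits (s \<circ> a) C)"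
    by (rule card_orbits_rem(1)[OF bij_phi cut_basic(8) cut_basic(1)])
  moreover have "bij_betw (rem d (s \<circ> a)) (C - {d}) (C - {d})"
    by (rule bij_rem[OF bij_phi cut_basic(8) cut_basic(1)])
  moreover have "orbits (rem d (s \<circ> a)) (C - {d}) = orbits (cut_sigma s r d e \<circ> cut_alpha a d e) (C - {d})"
    by (rule orbits_cong) (use calculation(2) cut_phi in \<open>auto simp: bij_betw_def simp del: o_apply\<close>)
  ultimately show ?thesis by simp
qed

text \<open>The root vertex reads r d P e Q. The reassignments made by \<open>cut_sigma\<close>
  close up e P and r Q separately.\<close>

lemma loop_cyc: assumes "e \<in> orbit s r"
  obtains P Q where "cyc s (r # d # P @ e # Q)" "set (r # d # P @ e # Q) \<subseteq> C"
    "cyc (cut_sigma s r d e) (e # P)" "cyc (cut_sigma s r d e) (r # Q)"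
proof -
  obtain xs where xs: "cyc s (r # xs)" "set (r # xs) \<subseteq> C" using ex_cyc[OF cut_bij cut_basic(8,3)] by blast
  have "e \<in> set (r # xs)" using cyc_orbit[OF xs(1)] assms by auto
  moreover obtain ys where ys: "xs = d # ys" using xs d by (cases xs) (auto simp: cyc_def)
  ultimately have "e \<in> set ys" using cut_basic by auto
  then obtain P Q where PQ: "ys = P @ e # Q" by (meson split_list)
  have c: "cyc s (r # d # P @ e # Q)" using xs ys PQ by simp
  then have n: "r \<notin> set P" "d \<notin> set P" "e \<notin> set P" "r \<notin> set Q" "d \<notin> set Q" "e \<notin> set Q"
    and dd: "distinct P" "distinct Q" and p: "path s P e" "path s Q r" "s d = hd0 P e" "s e = hd0 Q r"
    by (auto simp: cyc_def)
  have "path (cut_sigma s r d e) P e"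
    by (rule path_cong[OF p(1)]) (use n in \<open>auto simp: cut_sigma_def\<close>)
  then have "cyc (cut_sigma s r d e) (e # P)"
    using n p(3) dd cut_basic by (simp add: cyc_def cut_sigma_def)
  moreover have "path (cut_sigma s r d e) Q r"
    by (rule path_cong[OF p(2)]) (use n in \<open>auto simp: cut_sigma_def\<close>)
  then have "cyc (cut_sigma s r d e) (r # Q)"
    using n p(4) dd cut_basic d(2) by (simp add: cyc_def cut_sigma_def)
  ultimately show thesis using that c xs ys PQ by auto
qed

lemma cut_rest:
  assumes "r \<in> U" "d \<in> U" "e \<in> U" "\<And>x. x \<in> C - U \<Longrightarrow> s x \<in> C - U"
  shows "orbits (cut_sigma s r d e) (C - U) = orbits s (C - U)"
  by (rule orbits_cong[symmetric]) (use assms in \<open>auto simp: cut_sigma_def\<close>)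

lemma compl_closed: assumes "cyc s xs" "set xs \<subseteq> C" "x \<in> C - set xs" shows "s x \<in> C - set xs"
proof -
  have "x \<in> set xs" if "s x \<in> set xs"
    using cyc_orbit[OF assms(1) that] orbit_eq[OF cut_bij cut_basic(8), of x "s x"] assms(3) orbit_self[of x s]
      orbit_step[OF orbit_self[of x s]] by blast
  then show ?thesis using assms cut_cl by auto
qed

lemma orbits_split: assumes "cyc s xs" "set xs \<subseteq> C"
  shows "orbits s C = insert (set xs) (orbits s (C - set xs))" "set xs \<notin> orbits s (C - set xs)"
proof -
  have "C = set xs \<union> (C - set xs)" using assms by auto
  then show "orbits s C = insert (set xs) (orbits s (C - set xs))"
    using orbits_Un[of s "set xs" "C - set xs"] orbits_single[OF assms(1)] by simp
  show "set xs \<notin> orbits s (C - set xs)"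
    using orbits_disj[of "set xs" s "C - set xs"] orbits_single[OF assms(1)] compl_closed[OF assms]
      cyc_closed[OF assms(1)] by auto
qed

lemma loop_orbits: assumes "e \<in> orbit s r"
  shows "orbits (cut_sigma s r d e) (C - {d}) =
    insert (orbit (cut_sigma s r d e) e) (insert (orbit (cut_sigma s r d e) r) (orbits s C - {orbit s r}))"
    "orbit (cut_sigma s r d e) e \<inter> orbit (cut_sigma s r d e) r = {}"
    "orbit (cut_sigma s r d e) e \<notin> orbits s C - {orbit s r}"
    "orbit (cut_sigma s r d e) r \<notin> orbits s C - {orbit s r}"
    "card (orbit s r) = card (orbit (cut_sigma s r d e) e) + card (orbit (cut_sigma s r d e) r) + 1"
proof -
  let ?s1 = "cut_sigma s r d e"
  obtain P Q where PQ: "cyc s (r # d # P @ e # Q)" "set (r # d # P @ e # Q) \<subseteq> C"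
    "cyc ?s1 (e # P)" "cyc ?s1 (r # Q)" using loop_cyc[OF assms] by blast
  let ?U = "set (r # d # P @ e # Q)"
  have o: "orbit s r = ?U" "orbit ?s1 e = set (e # P)" "orbit ?s1 r = set (r # Q)"
    using cyc_orbit[OF PQ(1), of r] cyc_orbit[OF PQ(3), of e] cyc_orbit[OF PQ(4), of r] by simp_all
  have rest: "orbits s C - {orbit s r} = orbits s (C - ?U)" using orbits_split[OF PQ(1,2)] o by auto
  have s1: "orbits ?s1 (C - ?U) = orbits s (C - ?U)"
    by (rule cut_rest) (use compl_closed[OF PQ(1,2)] in auto)
  have cl: "?s1 x \<in> C - ?U" if "x \<in> C - ?U" for x
    using compl_closed[OF PQ(1,2) that] that by (auto simp: cut_sigma_def)
  have "d \<notin> set (e # P)" "d \<notin> set (r # Q)" using PQ(1) by (auto simp: cyc_def)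
  then have C: "C - {d} = set (e # P) \<union> (set (r # Q) \<union> (C - ?U))" using PQ(2) by auto
  show "orbits ?s1 (C - {d}) = insert (orbit ?s1 e) (insert (orbit ?s1 r) (orbits s C - {orbit s r}))"
    unfolding C orbits_Un orbits_single[OF PQ(3)] orbits_single[OF PQ(4)] s1 rest unfolding o by blast
  show dis: "orbit ?s1 e \<inter> orbit ?s1 r = {}" using PQ(1) unfolding o by (auto simp: cyc_def)
  have "orbits ?s1 (set (e # P)) \<inter> orbits ?s1 (C - ?U) = {}"
    by (rule orbits_disj) (use cyc_closed[OF PQ(3)] cl in auto)
  then show "orbit ?s1 e \<notin> orbits s C - {orbit s r}"
    unfolding rest s1 orbits_single[OF PQ(3)] unfolding o by blast
  have "orbits ?s1 (set (r # Q)) \<inter> orbits ?s1 (C - ?U) = {}"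
    by (rule orbits_disj) (use cyc_closed[OF PQ(4)] cl in auto)
  then show "orbit ?s1 r \<notin> orbits s C - {orbit s r}"
    unfolding rest s1 orbits_single[OF PQ(4)] unfolding o by blast
  have "distinct (r # d # P @ e # Q)" using PQ(1) by (simp add: cyc_def)
  then show "card (orbit s r) = card (orbit ?s1 e) + card (orbit ?s1 r) + 1"
    unfolding o using distinct_card[of "r # d # P @ e # Q"] distinct_card[of "e # P"] distinct_card[of "r # Q"] by simp
qed

text \<open>The ends of the root edge read r d P and e Q. The cut inserts Q and e between r and P,
  and bypassing e leaves the merged vertex r Q P. The length of Q is all that is needed to split
  this vertex again.\<close>

lemma join_cyc: assumes "e \<notin> orbit s r"
  obtains P Q where "cyc s (r # d # P)" "cyc s (e # Q)" "set (r # d # P) \<subseteq> C" "set (e # Q) \<subseteq> C"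
    "set (r # d # P) \<inter> set (e # Q) = {}"
    "cyc (cut_sigma s r d e) (r # Q @ e # P)" "cyc (rem e (cut_sigma s r d e)) (r # Q @ P)"
proof -
  let ?s1 = "cut_sigma s r d e"
  obtain xs where xs: "cyc s (r # xs)" "set (r # xs) \<subseteq> C" using ex_cyc[OF cut_bij cut_basic(8,3)] by blast
  obtain P where P: "xs = d # P" using xs d by (cases xs) (auto simp: cyc_def)
  obtain Q where Q: "cyc s (e # Q)" "set (e # Q) \<subseteq> C" using ex_cyc[OF cut_bij cut_basic(8,2)] by blast
  have dis: "set (r # d # P) \<inter> set (e # Q) = {}"
  proof -
    have "set (r # d # P) = orbit s r" "set (e # Q) = orbit s e"
      using cyc_orbit[OF xs(1), of r] cyc_orbit[OF Q(1), of e] P by auto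
    then show ?thesis using orbit_disj[OF cut_bij cut_basic(8,3,2)] assms orbit_self[of e s] by blast
  qed
  have n: "r \<notin> set P" "d \<notin> set P" "e \<notin> set P" "r \<notin> set Q" "d \<notin> set Q" "e \<notin> set Q"
    and dd: "distinct P" "distinct Q" "set P \<inter> set Q = {}"
    and p: "path s P r" "path s Q e" "s d = hd0 P r" "s e = hd0 Q e"
    using xs P Q dis by (auto simp: cyc_def)
  have "path ?s1 Q e"
    by (rule path_cong[OF p(2)]) (use n in \<open>auto simp: cut_sigma_def\<close>)
  moreover have "path ?s1 P r"
    by (rule path_cong[OF p(1)]) (use n in \<open>auto simp: cut_sigma_def\<close>)
  ultimately have c: "cyc ?s1 (r # Q @ e # P)"
    using n p(3,4) dd cut_basic d(2) by (auto simp: cyc_def cut_sigma_def)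
  then have "cyc ?s1 (e # P @ r # Q)" using cyc_rotate[of ?s1 "r # Q" "e # P"] by simp
  from cyc_rem[OF this] have "cyc (rem e ?s1) (P @ r # Q)" by simp
  then have "cyc (rem e ?s1) (r # Q @ P)" using cyc_rotate[of _ P "r # Q"] by simp
  then show thesis using that c xs P Q dis by auto
qed

lemma join_orbits: assumes "e \<notin> orbit s r"
  shows "orbits (rem e (cut_sigma s r d e)) (C - {d, e}) =
    insert (orbit (rem e (cut_sigma s r d e)) r) (orbits s C - {orbit s r, orbit s e})"
    "orbit (rem e (cut_sigma s r d e)) r \<notin> orbits s C - {orbit s r, orbit s e}"
    "card (orbit s r) + card (orbit s e) = card (orbit (rem e (cut_sigma s r d e)) r) + 2"
    "cut_sigma s r d e e \<noteq> e" "orbit s e \<noteq> orbit s r"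
proof -
  let ?s1 = "cut_sigma s r d e" let ?s2 = "rem e (cut_sigma s r d e)"
  obtain P Q where PQ: "cyc s (r # d # P)" "cyc s (e # Q)" "set (r # d # P) \<subseteq> C" "set (e # Q) \<subseteq> C"
    "set (r # d # P) \<inter> set (e # Q) = {}" "cyc ?s1 (r # Q @ e # P)" "cyc ?s2 (r # Q @ P)"
    using join_cyc[OF assms] by blast
  let ?U = "set (r # d # P) \<union> set (e # Q)"
  have o: "orbit s r = set (r # d # P)" "orbit s e = set (e # Q)" "orbit ?s2 r = set (r # Q @ P)"
    using cyc_orbit[OF PQ(1), of r] cyc_orbit[OF PQ(2), of e] cyc_orbit[OF PQ(7), of r] by simp_all
  have cl0: "s x \<in> C - ?U" if "x \<in> C - ?U" for x
    using compl_closed[OF PQ(1,3), of x] compl_closed[OF PQ(2,4), of x] that by auto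
  have C0: "C = set (r # d # P) \<union> (set (e # Q) \<union> (C - ?U))" using PQ(3,4) by auto
  have "orbits s C = insert (orbit s r) (insert (orbit s e) (orbits s (C - ?U)))"
    by (subst C0) (simp only: orbits_Un orbits_single[OF PQ(1)] orbits_single[OF PQ(2)] o, blast)
  moreover have "orbits s (set (r # d # P)) \<inter> orbits s (C - ?U) = {}"
    by (rule orbits_disj) (use cyc_closed[OF PQ(1)] cl0 in auto)
  moreover have "orbits s (set (e # Q)) \<inter> orbits s (C - ?U) = {}"
    by (rule orbits_disj) (use cyc_closed[OF PQ(2)] cl0 in auto)
  ultimately have rest: "orbits s C - {orbit s r, orbit s e} = orbits s (C - ?U)"
    using orbits_single[OF PQ(1)] orbits_single[OF PQ(2)] o by auto
  have s2: "orbits s (C - ?U) = orbits ?s2 (C - ?U)"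
  proof (rule orbits_cong)
    fix x assume x: "x \<in> C - ?U"
    show "s x \<in> C - ?U" by (rule cl0[OF x])
    then show "s x = ?s2 x" using x by (auto simp: rem_def cut_sigma_def)
  qed
  have cl: "?s2 x \<in> C - ?U" if "x \<in> C - ?U" for x
    using cl0[OF that] that by (auto simp: cut_sigma_def rem_def)
  have "distinct (r # d # P)" "distinct (e # Q)" using PQ(1,2) by (auto simp: cyc_def)
  then have C: "C - {d, e} = set (r # Q @ P) \<union> (C - ?U)" using PQ(3,4,5) by auto
  show "orbits ?s2 (C - {d, e}) = insert (orbit ?s2 r) (orbits s C - {orbit s r, orbit s e})"
    unfolding C orbits_Un orbits_single[OF PQ(7)] rest unfolding o s2 by simp
  have "orbits ?s2 (set (r # Q @ P)) \<inter> orbits ?s2 (C - ?U) = {}"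
    by (rule orbits_disj) (use cyc_closed[OF PQ(7)] cl in auto)
  then show "orbit ?s2 r \<notin> orbits s C - {orbit s r, orbit s e}"
    unfolding rest s2 orbits_single[OF PQ(7)] unfolding o by blast
  show "card (orbit s r) + card (orbit s e) = card (orbit ?s2 r) + 2"
    unfolding o using PQ(1,2,7) distinct_card[of "r # d # P"] distinct_card[of "e # Q"] distinct_card[of "r # Q @ P"]
    by (simp add: cyc_def)
  have "?s1 e = hd0 P r" "e \<notin> set P" using PQ(6) unfolding cyc_def by simp_all
  then show "?s1 e \<noteq> e" using cut_basic(4) by (cases P) simp_all
  show "orbit s e \<noteq> orbit s r" using assms orbit_self[of e s] by auto
qed

end

section \<open>Connectedness\<close>

definition reach :: "(nat \<Rightarrow> nat) \<Rightarrow> (nat \<Rightarrow> nat) \<Rightarrow> nat \<Rightarrow> nat set" where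
  "reach a s x = {y. (x, y) \<in> {(x, y). y = a x \<or> y = s x}\<^sup>*}"

lemma reach_self [simp]: "x \<in> reach a s x"
  by (simp add: reach_def)

lemma reach_step: assumes "y \<in> reach a s x" shows "a y \<in> reach a s x" "s y \<in> reach a s x"
  using assms unfolding reach_def by (auto intro: rtrancl_into_rtrancl)

lemma reach_induct [consumes 1, case_names base step]:
  assumes "y \<in> reach a s x" "P x" "\<And>y. y \<in> reach a s x \<Longrightarrow> P y \<Longrightarrow> P (a y) \<and> P (s y)"
  shows "P y"
proof -
  have "(x, y) \<in> {(x, y). y = a x \<or> y = s x}\<^sup>*" using assms(1) by (simp add: reach_def)
  then show ?thesis
  proof (induction rule: rtrancl_induct)
    case (step y z)
    then show ?case using assms(3)[of y] by (auto simp: reach_def)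
  qed (rule assms(2))
qed

lemma reach_subset: assumes "x \<in> A" "\<And>y. y \<in> A \<Longrightarrow> a y \<in> A \<and> s y \<in> A" shows "reach a s x \<subseteq> A"
proof
  fix y assume "y \<in> reach a s x"
  then show "y \<in> A" by (induction rule: reach_induct) (use assms in auto)
qed

lemma reach_trans: "y \<in> reach a s x \<Longrightarrow> reach a s y \<subseteq> reach a s x"
  by (rule reach_subset) (auto intro: reach_step)

text \<open>On a finite set a step of a permutation is undone by following the rest of its cycle, so
  forward steps suffice to come back.\<close>

lemma reach_sym: assumes "bij_betw a C C" "bij_betw s C C" "finite C" "x \<in> C" "y \<in> reach a s x"
  shows "x \<in> reach a s y"
proof -
  have sub: "reach a s x \<subseteq> C" by (rule reach_subset) (use assms in \<open>auto simp: bij_betw_def\<close>)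
  have "orbit s z \<subseteq> reach a s z" "orbit a z \<subseteq> reach a s z" for z
    by (rule orbit_subset, simp, erule reach_step)+
  then have bk: "z \<in> reach a s (s z) \<and> z \<in> reach a s (a z)" if "z \<in> C" for z
    using orbit_eq[OF assms(2,3) that orbit_step[OF orbit_self]] orbit_eq[OF assms(1,3) that orbit_step[OF orbit_self]]
      orbit_self[of z] by blast
  show ?thesis using assms(5)
  proof (induction rule: reach_induct)
    case (step y)
    then have "y \<in> reach a s (s y)" "y \<in> reach a s (a y)" using bk sub by auto
    then show ?case using step.IH reach_trans by blast
  qed simp
qed

lemma bij_endo: "finite A \<Longrightarrow> inj_on f A \<Longrightarrow> (\<And>x. x \<in> A \<Longrightarrow> f x \<in> A) \<Longrightarrow> bij_betw f A A"
  by (simp add: bij_betw_def endo_inj_surj image_subsetI)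

lemma insert2_split:
  assumes U: "U1 \<union> U2 = insert A (insert B N)" and "A \<in> U1" "B \<in> U2" "U1 \<inter> U2 = {}" "A \<notin> N" "B \<notin> N"
  shows "N = (U1 - {A}) \<union> (U2 - {B})"
proof -
  have "N = (U1 \<union> U2) - {A, B}" unfolding U using assms(5,6) by auto
  also have "\<dots> = (U1 - {A}) \<union> (U2 - {B})" using assms(2,3,4) by auto
  finally show ?thesis .
qed

definition mp :: "nat set \<Rightarrow> nat \<Rightarrow> (nat \<Rightarrow> nat) \<Rightarrow> (nat \<Rightarrow> nat) \<Rightarrow> bool" where
  "mp C r a s \<longleftrightarrow> pm C r a s \<and> C \<subseteq> reach a s r"

lemma mp_reach: assumes "mp C r a s" shows "reach a s r = C"
proof -
  have "bij_betw a C C" "bij_betw s C C" "r \<in> C" using assms bij_alpha by (auto simp: mp_def pm_def)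
  then have "reach a s r \<subseteq> C" by (intro reach_subset) (auto simp: bij_betw_def)
  then show ?thesis using assms by (auto simp: mp_def)
qed

lemma mp_trivial: assumes "mp C r a s" "s r = r" shows "C = {r}"
proof -
  have "reach a s r \<subseteq> {r}" by (rule reach_subset) (use assms in \<open>auto simp: mp_def pm_def\<close>)
  then show ?thesis using mp_reach[OF assms(1)] assms(1) by (auto simp: mp_def pm_def)
qed

abbreviation nv where "nv s C \<equiv> card (orbits s C)"
abbreviation nf where "nf a s C \<equiv> card (orbits (s \<circ> a) C)"

context
  fixes C r a s d e
  assumes mp: "mp C r a s" and d: "d = s r" "d \<noteq> r" and e: "e = a d"
begin

lemma mp_pm: "pm C r a s" using mp by (simp add: mp_def)

lemmas cbasic = cut_basic[OF mp_pm d e]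
lemmas cinj = cut_inj[OF mp_pm d e]
lemmas ccl = cut_cl[OF mp_pm d e]

lemma calpha: assumes "x \<in> C - {d}"
  shows "cut_alpha a d e x \<in> C - {d}" "cut_alpha a d e (cut_alpha a d e x) = x"
    "x \<noteq> e \<Longrightarrow> cut_alpha a d e x \<noteq> e" "x \<noteq> e \<Longrightarrow> x \<noteq> r \<Longrightarrow> cut_alpha a d e x \<noteq> x"
    "x \<noteq> r \<Longrightarrow> cut_alpha a d e x \<noteq> r"
proof -
  have 1: "a x \<in> C - {r}" "a x \<noteq> x" "a (a x) = x" if "x \<noteq> r" using mp_pm that assms by (auto simp: pm_def)
  have 2: "a x \<noteq> e" "a x \<noteq> d" if "x \<noteq> r" "x \<noteq> e"
    using 1(3)[OF that(1)] cbasic e that assms by auto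
  show "cut_alpha a d e x \<in> C - {d}" "cut_alpha a d e (cut_alpha a d e x) = x"
    "x \<noteq> e \<Longrightarrow> cut_alpha a d e x \<noteq> e" "x \<noteq> e \<Longrightarrow> x \<noteq> r \<Longrightarrow> cut_alpha a d e x \<noteq> x"
    "x \<noteq> r \<Longrightarrow> cut_alpha a d e x \<noteq> r"
  proof -
    have xd: "x \<in> C" "x \<noteq> d" using assms by auto
    have v: "cut_alpha a d e r = r" "cut_alpha a d e e = e"
      using cbasic(4,7) d(2) by (simp_all add: cut_alpha_def)
    have w: "cut_alpha a d e x = a x" if "x \<noteq> r" "x \<noteq> e" using xd that by (simp add: cut_alpha_def)
    have w2: "cut_alpha a d e (a x) = x" if "x \<noteq> r" "x \<noteq> e"
      using 1(3)[OF that(1)] 2[OF that] by (simp add: cut_alpha_def)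
    consider "x = r" | "x = e" | "x \<noteq> r" "x \<noteq> e" by blast
    then have "cut_alpha a d e x \<in> C - {d} \<and> cut_alpha a d e (cut_alpha a d e x) = x \<and>
      (x \<noteq> e \<longrightarrow> cut_alpha a d e x \<noteq> e) \<and> (x \<noteq> e \<longrightarrow> x \<noteq> r \<longrightarrow> cut_alpha a d e x \<noteq> x) \<and>
      (x \<noteq> r \<longrightarrow> cut_alpha a d e x \<noteq> r)"
    proof cases
      case 1 then show ?thesis using v xd cbasic(4) by simp
    next
      case 2 then show ?thesis using v xd cbasic(4) by simp
    next
      case 3 then show ?thesis using w[OF 3] w2[OF 3] 1[OF 3(1)] 2[OF 3] by simp
    qed
    then show "cut_alpha a d e x \<in> C - {d}" "cut_alpha a d e (cut_alpha a d e x) = x"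
      "x \<noteq> e \<Longrightarrow> cut_alpha a d e x \<noteq> e" "x \<noteq> e \<Longrightarrow> x \<noteq> r \<Longrightarrow> cut_alpha a d e x \<noteq> x"
      "x \<noteq> r \<Longrightarrow> cut_alpha a d e x \<noteq> r" by blast+
  qed
qed

lemma csigma: assumes "x \<in> C - {d}" shows "cut_sigma s r d e x \<in> C - {d}"
  using cut_bij'[OF mp_pm d e] assms by (auto simp: bij_betw_def)

lemma bij_calpha: "bij_betw (cut_alpha a d e) (C - {d}) (C - {d})"
  by (rule bij_betw_byWitness[where f' = "cut_alpha a d e"]) (use calpha in auto)

lemma creach_sub: "x \<in> C - {d} \<Longrightarrow> reach (cut_alpha a d e) (cut_sigma s r d e) x \<subseteq> C - {d}"
  by (rule reach_subset) (use calpha csigma in auto)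

lemma creach_sym: "x \<in> C - {d} \<Longrightarrow> y \<in> reach (cut_alpha a d e) (cut_sigma s r d e) x \<Longrightarrow>
   x \<in> reach (cut_alpha a d e) (cut_sigma s r d e) y"
  using reach_sym[OF bij_calpha cut_bij'[OF mp_pm d e], of x y] cbasic by auto

text \<open>Follow a walk of the uncut map from \<open>r\<close>. The only steps altered by the cut
  start at \<open>d\<close>, \<open>e\<close> or \<open>r\<close>, and they end at one of
  \<open>d\<close>, \<open>e\<close>, \<open>r\<close>, \<open>s d\<close>, \<open>s e\<close>; all
  of these but \<open>d\<close> are reachable from \<open>e\<close> or \<open>r\<close> after the
  cut.\<close>

lemma cut_cover: assumes "x \<in> C - {d}"
  shows "x \<in> reach (cut_alpha a d e) (cut_sigma s r d e) e \<union> reach (cut_alpha a d e) (cut_sigma s r d e) r"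
proof -
  let ?a = "cut_alpha a d e" let ?s = "cut_sigma s r d e"
  let ?R = "reach ?a ?s e \<union> reach ?a ?s r"
  have cl: "?a y \<in> ?R \<and> ?s y \<in> ?R" if "y \<in> ?R" for y using that reach_step by blast
  have in_R: "e \<in> ?R" "r \<in> ?R" "s e \<in> ?R" "s d \<in> ?R"
  proof -
    have "?s r = s e" "?s e = s d" using cbasic d by (simp_all add: cut_sigma_def)
    then show "e \<in> ?R" "r \<in> ?R" "s e \<in> ?R" "s d \<in> ?R"
      using cl[of r] cl[of e] reach_self[of e ?a ?s] reach_self[of r ?a ?s] by auto
  qed
  have "x \<in> reach a s r" using assms mp_reach[OF mp] by auto
  then have "x = d \<or> x \<in> ?R"
  proof (induction rule: reach_induct)
    case (step y)
    show ?case
    proof (cases "y = d \<or> y = e \<or> y = r")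
      case True
      then show ?thesis using in_R cbasic d e by auto
    next
      case False
      then have "?a y = a y" "?s y = s y" by (auto simp: cut_alpha_def cut_sigma_def)
      then show ?thesis using cl[of y] step False by auto
    qed
  qed simp
  then show ?thesis using assms by auto
qed

text \<open>When the loop separates, each side is a map of its own, rooted at \<open>e\<close> and
  at \<open>r\<close>. The root vertex is counted on both sides, hence the \<open>+ 1\<close> for
  vertices, while the isolated dart \<open>d\<close> gives the \<open>+ 1\<close> for darts.\<close>

lemma loop_disjoint:
  defines "Ze \<equiv> reach (cut_alpha a d e) (cut_sigma s r d e) e"
    and "Zr \<equiv> reach (cut_alpha a d e) (cut_sigma s r d e) r"
  assumes l: "e \<in> orbit s r" and dis: "Ze \<inter> Zr = {}"
  shows "mp Ze e (cut_alpha a d e) (cut_sigma s r d e)" "mp Zr r (cut_alpha a d e) (cut_sigma s r d e)"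
    "C - {d} = Ze \<union> Zr" "card C = card Ze + card Zr + 1"
    "nf (cut_alpha a d e) (cut_sigma s r d e) Ze + nf (cut_alpha a d e) (cut_sigma s r d e) Zr = nf a s C"
    "orbits s C - {orbit s r} = (orbits (cut_sigma s r d e) Ze - {orbit (cut_sigma s r d e) e}) \<union>
       (orbits (cut_sigma s r d e) Zr - {orbit (cut_sigma s r d e) r})"
    "(orbits (cut_sigma s r d e) Ze - {orbit (cut_sigma s r d e) e}) \<inter>
       (orbits (cut_sigma s r d e) Zr - {orbit (cut_sigma s r d e) r}) = {}"
    "nv (cut_sigma s r d e) Ze + nv (cut_sigma s r d e) Zr = nv s C + 1"
proof -
  let ?a = "cut_alpha a d e" let ?s = "cut_sigma s r d e"
  have er: "e \<in> C - {d}" "r \<in> C - {d}" using cbasic d by auto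
  have sub: "Ze \<subseteq> C - {d}" "Zr \<subseteq> C - {d}" unfolding Ze_def Zr_def using creach_sub er by auto
  have self: "e \<in> Ze" "r \<in> Zr" unfolding Ze_def Zr_def by auto
  have cl: "?a x \<in> Ze \<and> ?s x \<in> Ze" if "x \<in> Ze" for x using that unfolding Ze_def by (auto intro: reach_step)
  have cl': "?a x \<in> Zr \<and> ?s x \<in> Zr" if "x \<in> Zr" for x using that unfolding Zr_def by (auto intro: reach_step)
  have inj: "inj_on ?s (C - {d})" using cut_bij'[OF mp_pm d e] by (simp add: bij_betw_def)
  have fin: "finite Ze" "finite Zr" using sub cbasic finite_subset by blast+
  have bij: "bij_betw ?s Ze Ze" "bij_betw ?s Zr Zr"
    using bij_endo[OF fin(1) inj_on_subset[OF inj sub(1)]] bij_endo[OF fin(2) inj_on_subset[OF inj sub(2)]] cl cl' by blast+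
  have a_fix: "?a e = e" "?a r = r" using cbasic d by (auto simp: cut_alpha_def)
  have ne: "e \<notin> Zr" "r \<notin> Ze" using self dis by auto
  have "\<forall>x\<in>Ze - {e}. ?a x \<in> Ze - {e} \<and> ?a x \<noteq> x \<and> ?a (?a x) = x"
    "\<forall>x\<in>Zr - {r}. ?a x \<in> Zr - {r} \<and> ?a x \<noteq> x \<and> ?a (?a x) = x"
  proof (intro ballI conjI)
    fix x assume x: "x \<in> Ze - {e}"
    then have x': "x \<in> C - {d}" "x \<noteq> r" "x \<noteq> e" using sub ne by auto
    show "?a x \<in> Ze - {e}" using cl x calpha(3)[OF x'(1,3)] by blast
    show "?a x \<noteq> x" by (rule calpha(4)[OF x'(1,3,2)])
    show "?a (?a x) = x" by (rule calpha(2)[OF x'(1)])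
  next
    show "\<forall>x\<in>Zr - {r}. ?a x \<in> Zr - {r} \<and> ?a x \<noteq> x \<and> ?a (?a x) = x"
    proof (intro ballI conjI)
      fix x assume x: "x \<in> Zr - {r}"
      then have x': "x \<in> C - {d}" "x \<noteq> r" "x \<noteq> e" using sub ne by auto
      show "?a x \<in> Zr - {r}" using cl' x calpha(5)[OF x'(1,2)] by blast
      show "?a x \<noteq> x" by (rule calpha(4)[OF x'(1,3,2)])
      show "?a (?a x) = x" by (rule calpha(2)[OF x'(1)])
    qed
  qed
  then have "pm Ze e ?a ?s" "pm Zr r ?a ?s" unfolding pm_def using fin self bij a_fix by simp_all
  then show m: "mp Ze e ?a ?s" "mp Zr r ?a ?s" unfolding mp_def Ze_def Zr_def by simp_all
  show C: "C - {d} = Ze \<union> Zr" using cut_cover sub unfolding Ze_def Zr_def by blast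
  have "card (C - {d}) = card Ze + card Zr" unfolding C using fin dis by (simp add: card_Un_disjoint)
  then show "card C = card Ze + card Zr + 1" using cbasic by (metis Suc_eq_plus1 card.remove)
  have "orbits (?s \<circ> ?a) Ze \<inter> orbits (?s \<circ> ?a) Zr = {}" by (rule orbits_disj) (use cl cl' dis in auto)
  then show "nf ?a ?s Ze + nf ?a ?s Zr = nf a s C"
    using cut_faces[OF mp_pm d e] fin unfolding C orbits_Un by (simp add: card_Un_disjoint)
  have od: "orbits ?s Ze \<inter> orbits ?s Zr = {}" by (rule orbits_disj) (use cl cl' dis in auto)
  have me: "orbit ?s e \<in> orbits ?s Ze" "orbit ?s r \<in> orbits ?s Zr" using self by (auto simp: orbits_def)
  note lo = loop_orbits[OF mp_pm d e l]
  have U: "orbits ?s Ze \<union> orbits ?s Zr = insert (orbit ?s e) (insert (orbit ?s r) (orbits s C - {orbit s r}))"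
    using lo(1) unfolding C orbits_Un by simp
  show "orbits s C - {orbit s r} = (orbits ?s Ze - {orbit ?s e}) \<union> (orbits ?s Zr - {orbit ?s r})"
    by (rule insert2_split[OF U me od lo(3,4)])
  show "(orbits ?s Ze - {orbit ?s e}) \<inter> (orbits ?s Zr - {orbit ?s r}) = {}" using od by blast
  have "card (orbits ?s Ze \<union> orbits ?s Zr) = nv ?s Ze + nv ?s Zr"
    using od fin by (simp add: card_Un_disjoint)
  moreover have "orbit ?s e \<noteq> orbit ?s r" using od me by auto
  then have "card (insert (orbit ?s e) (insert (orbit ?s r) (orbits s C - {orbit s r}))) = card (orbits s C - {orbit s r}) + 2"
    using lo(3,4) cbasic by simp
  moreover have "card (orbits s C) = card (orbits s C - {orbit s r}) + 1"
    using cbasic by (metis Suc_eq_plus1 card.remove finite_orbits imageI orbits_def)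
  ultimately show "nv ?s Ze + nv ?s Zr = nv s C + 1" using U by simp
qed

text \<open>If the cut leaves everything connected, \<open>e\<close> is a dangling dart fixed by the
  edge involution. Bypassing it in the rotation produces a map with one edge less.\<close>

lemma drop_e:
  assumes ne: "cut_sigma s r d e e \<noteq> e"
    and conn: "C - {d} \<subseteq> reach (cut_alpha a d e) (cut_sigma s r d e) r"
  shows "mp (C - {d, e}) r (cut_alpha a d e) (rem e (cut_sigma s r d e))"
    "card C = card (C - {d, e}) + 2"
    "nv (rem e (cut_sigma s r d e)) (C - {d, e}) = nv (cut_sigma s r d e) (C - {d})"
    "nf (cut_alpha a d e) (rem e (cut_sigma s r d e)) (C - {d, e}) = nf a s C"
proof -
  let ?a = "cut_alpha a d e" let ?s = "cut_sigma s r d e"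
  have C: "C - {d, e} = C - {d} - {e}" by auto
  have eC: "e \<in> C - {d}" and fin: "finite (C - {d})" using cbasic by auto
  note b1 = cut_bij'[OF mp_pm d e]
  show "card C = card (C - {d, e}) + 2" unfolding C using cbasic eC card_Suc_Diff1[of C d] card_Suc_Diff1[OF fin eC] by simp
  show "nv (rem e ?s) (C - {d, e}) = nv ?s (C - {d})" unfolding C by (rule card_orbits_rem(1)[OF b1 fin eC ne])
  have bp: "bij_betw (?s \<circ> ?a) (C - {d}) (C - {d})" using bij_calpha b1 by (rule bij_betw_trans)
  have ae: "?a e = e" by (simp add: cut_alpha_def)
  then have pe: "(?s \<circ> ?a) e \<noteq> e" using ne by simp
  have "nf ?a (rem e ?s) (C - {d, e}) = card (orbits (rem e (?s \<circ> ?a)) (C - {d} - {e}))"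
    unfolding C
  proof (rule arg_cong[where f = card], rule orbits_cong[symmetric])
    fix x assume x: "x \<in> C - {d} - {e}"
    then show "rem e (?s \<circ> ?a) x \<in> C - {d} - {e}" using bij_rem[OF bp fin eC] by (auto simp: bij_betw_def simp del: o_apply)
    have "?a x \<noteq> e" using calpha(3) x by auto
    then show "rem e (?s \<circ> ?a) x = (rem e ?s \<circ> ?a) x" using x ae by (auto simp: rem_def)
  qed
  also have "\<dots> = nf ?a ?s (C - {d})" by (rule card_orbits_rem(1)[OF bp fin eC pe])
  also have "\<dots> = nf a s C" by (rule cut_faces[OF mp_pm d e])
  finally show "nf ?a (rem e ?s) (C - {d, e}) = nf a s C" .
  have b2: "bij_betw (rem e ?s) (C - {d, e}) (C - {d, e})" unfolding C by (rule bij_rem[OF b1 fin eC])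
  have r: "r \<in> C - {d, e}" "?a r = r" using cbasic d by (auto simp: cut_alpha_def)
  have pm2: "pm (C - {d, e}) r ?a (rem e ?s)"
    unfolding pm_def
  proof (intro conjI ballI b2 r)
    show "finite (C - {d, e})" using cbasic by auto
    fix x assume x: "x \<in> C - {d, e} - {r}"
    then have x': "x \<in> C - {d}" "x \<noteq> e" "x \<noteq> r" by auto
    show "?a x \<in> C - {d, e} - {r}" using calpha(1,3,5)[OF x'(1)] x' by auto
    show "?a x \<noteq> x" "?a (?a x) = x" using calpha(2,4)[OF x'(1)] x' by auto
  qed
  let ?R = "reach ?a (rem e ?s) r"
  \<comment> \<open>A walk in the map with \<open>e\<close> is shadowed in the map without
    \<open>e\<close>: while it stands at \<open>e\<close>, the shadow already waits at the successor
    of \<open>e\<close>.\<close>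
  have "y \<in> C - {d} \<and> (if y = e then ?s e \<in> ?R else y \<in> ?R)" if "y \<in> reach ?a ?s r" for y
    using that
  proof (induction rule: reach_induct)
    case base
    then show ?case using cbasic d by auto
  next
    case (step y)
    then have yC: "y \<in> C - {d}" by simp
    then have C': "?a y \<in> C - {d}" "?s y \<in> C - {d}" using calpha(1) csigma by auto
    show ?case
    proof (cases "y = e")
      case True
      then show ?thesis using step C' ae ne by auto
    next
      case False
      then have yR: "y \<in> ?R" using step by auto
      have "?a y \<noteq> e" using calpha(3) yC False by auto
      moreover have "?a y \<in> ?R" "rem e ?s y \<in> ?R" using reach_step[OF yR] by auto
      ultimately show ?thesis using C' False by (auto simp: rem_def)
    qed
  qed
  note key = this
  have "C - {d, e} \<subseteq> ?R"
  proof
    fix y assume y: "y \<in> C - {d, e}"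
    then have "y \<in> reach ?a ?s r" using conn by blast
    from key[OF this] y show "y \<in> ?R" by simp
  qed
  then show "mp (C - {d, e}) r ?a (rem e ?s)" using pm2 by (simp add: mp_def)
qed

lemma join_step: assumes j: "e \<notin> orbit s r"
  shows "mp (C - {d, e}) r (cut_alpha a d e) (rem e (cut_sigma s r d e))"
    "card C = card (C - {d, e}) + 2"
    "nv (rem e (cut_sigma s r d e)) (C - {d, e}) + 1 = nv s C"
    "nf (cut_alpha a d e) (rem e (cut_sigma s r d e)) (C - {d, e}) = nf a s C"
    "orbits s C - {orbit s r} = insert (orbit s e) (orbits (rem e (cut_sigma s r d e)) (C - {d, e})
       - {orbit (rem e (cut_sigma s r d e)) r})"
    "orbit s e \<notin> orbits (rem e (cut_sigma s r d e)) (C - {d, e}) - {orbit (rem e (cut_sigma s r d e)) r}"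
proof -
  let ?a = "cut_alpha a d e" let ?s = "cut_sigma s r d e"
  note jo = join_orbits[OF mp_pm d e j]
  \<comment> \<open>After the cut \<open>e\<close> lies on the merged root vertex, so the two
    components of \<open>cut_cover\<close> are one.\<close>
  obtain P Q where "cyc ?s (r # Q @ e # P)" using join_cyc[OF mp_pm d e j] by metis
  then have "e \<in> orbit ?s r" using cyc_orbit[of ?s "r # Q @ e # P" r] by auto
  moreover have "orbit ?s r \<subseteq> reach ?a ?s r" by (rule orbit_subset) (auto intro: reach_step)
  ultimately have "reach ?a ?s e \<subseteq> reach ?a ?s r" using reach_trans by blast
  then have "C - {d} \<subseteq> reach ?a ?s r" using cut_cover by blast
  note de = drop_e[OF jo(4) this]
  show "mp (C - {d, e}) r ?a (rem e ?s)" "card C = card (C - {d, e}) + 2"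
    "nf ?a (rem e ?s) (C - {d, e}) = nf a s C" by (rule de)+
  have oe: "orbit s e \<in> orbits s C" "orbit s r \<in> orbits s C" using cbasic by (auto simp: orbits_def)
  show 5: "orbits s C - {orbit s r} = insert (orbit s e) (orbits (rem e ?s) (C - {d, e}) - {orbit (rem e ?s) r})"
    using jo(1,2,5) oe by blast
  show 6: "orbit s e \<notin> orbits (rem e ?s) (C - {d, e}) - {orbit (rem e ?s) r}"
    using jo(1,2) by blast
  have "nv s C = card (orbits s C - {orbit s r}) + 1"
    using cbasic oe by (metis Suc_eq_plus1 card.remove finite_orbits)
  also have "card (orbits s C - {orbit s r}) = card (orbits (rem e ?s) (C - {d, e}) - {orbit (rem e ?s) r}) + 1"
    unfolding 5 using 6 cbasic by simp
  also have "card (orbits (rem e ?s) (C - {d, e}) - {orbit (rem e ?s) r}) + 1 = nv (rem e ?s) (C - {d, e})"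
    using jo(1) cbasic by (metis Suc_eq_plus1 card.remove finite_Diff finite_orbits insertI1)
  finally show "nv (rem e ?s) (C - {d, e}) + 1 = nv s C" by simp
qed

text \<open>A nonseparating loop occurs only in positive genus: deleting it removes an edge and adds
  a vertex, so the Euler characteristic grows by 2.\<close>

lemma loop_connected:
  assumes l: "e \<in> orbit s r"
    and nd: "reach (cut_alpha a d e) (cut_sigma s r d e) e \<inter> reach (cut_alpha a d e) (cut_sigma s r d e) r \<noteq> {}"
  shows "mp (C - {d, e}) r (cut_alpha a d e) (rem e (cut_sigma s r d e))"
    "card C = card (C - {d, e}) + 2"
    "nv (rem e (cut_sigma s r d e)) (C - {d, e}) = nv s C + 1"
    "nf (cut_alpha a d e) (rem e (cut_sigma s r d e)) (C - {d, e}) = nf a s C"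
proof -
  let ?a = "cut_alpha a d e" let ?s = "cut_sigma s r d e"
  have er: "e \<in> C - {d}" "r \<in> C - {d}" using cbasic d by auto
  obtain y where y: "y \<in> reach ?a ?s e" "y \<in> reach ?a ?s r" using nd by blast
  have "e \<in> reach ?a ?s y" using creach_sym[OF er(1) y(1)] .
  then have eR: "e \<in> reach ?a ?s r" using y(2) reach_trans by blast
  then have "reach ?a ?s e \<subseteq> reach ?a ?s r" using reach_trans by blast
  then have cov: "C - {d} \<subseteq> reach ?a ?s r" using cut_cover by blast
  have ne: "?s e \<noteq> e"
  proof
    assume "?s e = e"
    then have "reach ?a ?s e \<subseteq> {e}" by (intro reach_subset) (auto simp: cut_alpha_def)
    moreover have "r \<in> reach ?a ?s e" using creach_sym[OF er(2) eR] .
    ultimately show False using cbasic by auto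
  qed
  note de = drop_e[OF ne cov]
  show "mp (C - {d, e}) r ?a (rem e ?s)" "card C = card (C - {d, e}) + 2"
    "nf ?a (rem e ?s) (C - {d, e}) = nf a s C" by (rule de)+
  note lo = loop_orbits[OF mp_pm d e l]
  have "orbit ?s e \<noteq> orbit ?s r" using lo(2) orbit_self by blast
  then have "nv ?s (C - {d}) = card (orbits s C - {orbit s r}) + 2"
    unfolding lo(1) using lo(3,4) cbasic by simp
  moreover have "card (orbits s C) = card (orbits s C - {orbit s r}) + 1"
    using cbasic by (metis Suc_eq_plus1 card.remove finite_orbits imageI orbits_def)
  ultimately show "nv (rem e ?s) (C - {d, e}) = nv s C + 1" using de(3) by simp
qed

end

section \<open>Euler's inequality and planar maps\<close>

lemma nv_single: assumes "s r = r" shows "orbits s {r} = {{r}}"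
proof -
  have "orbit s r = {r}" using orbit_subset[of r "{r}" s] assms orbit_self[of r s] by auto
  then show ?thesis by (auto simp: orbits_def)
qed

lemma euler_loop_arith:
  fixes c :: nat
  assumes "c = c1 + c2 + 1" "f1 + f2 = f" "v1 + v2 = v + 1" "2 * (v1 + f1) \<le> c1 + 3" "2 * (v2 + f2) \<le> c2 + 3"
  shows "2 * (v + f) \<le> c + 3" "2 * (v + f) = c + 3 \<Longrightarrow> 2 * (v1 + f1) = c1 + 3"
    "2 * (v + f) = c + 3 \<Longrightarrow> 2 * (v2 + f2) = c2 + 3"
  using assms by auto

lemma euler_connected_arith:
  fixes c :: nat
  assumes "c = c' + 2" "v' = v + 1" "f' = f" "2 * (v' + f') \<le> c' + 3"
  shows "2 * (v + f) \<le> c + 3" "2 * (v + f) \<noteq> c + 3"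
  using assms by auto

lemma euler_join_arith:
  fixes c :: nat
  assumes "c = c' + 2" "v' + 1 = v" "f' = f"
  shows "2 * (v' + f') \<le> c' + 3 \<longleftrightarrow> 2 * (v + f) \<le> c + 3" "2 * (v' + f') = c' + 3 \<longleftrightarrow> 2 * (v + f) = c + 3"
  using assms by auto

text \<open>A map with n edges has 2n + 1 darts, extra dart included, so this is V - E + F <= 2
  without subtraction. By induction over the cut, a separating loop adds the two inequalities, a
  nonloop edge preserves the defect, and a nonseparating loop leaves room to spare.\<close>

theorem euler: "mp C r a s \<Longrightarrow> 2 * (nv s C + nf a s C) \<le> card C + 3"
proof (induction "card C" arbitrary: C r a s rule: less_induct)
  case less
  note m = less.prems
  define d where "d = s r"
  define e where "e = a d"
  show ?case
  proof (cases "d = r")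
    case True
    then have "C = {r}" "(s \<circ> a) r = r" "s r = r" using mp_trivial[OF m] m by (auto simp: d_def mp_def pm_def)
    then show ?thesis using nv_single[of s r] nv_single[of "s \<circ> a" r] by simp
  next
    case False
    note ctx = m d_def False e_def
    let ?a = "cut_alpha a d e" let ?s = "cut_sigma s r d e"
    show ?thesis
    proof (cases "e \<in> orbit s r")
      case l: True
      show ?thesis
      proof (cases "reach ?a ?s e \<inter> reach ?a ?s r = {}")
        case True
        note ld = loop_disjoint[OF ctx l True]
        have "card (reach ?a ?s e) < card C" "card (reach ?a ?s r) < card C" using ld(4) by linarith+
        then show ?thesis
          using euler_loop_arith(1)[OF ld(4,5,8) less.hyps[OF _ ld(1)] less.hyps[OF _ ld(2)]] by blast
      next
        case False
        note lc = loop_connected[OF ctx l False]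
        have "card (C - {d, e}) < card C" using lc(2) by linarith
        from less.hyps[OF this lc(1)] show ?thesis by (rule euler_connected_arith(1)[OF lc(2,3,4)])
      qed
    next
      case j: False
      note js = join_step[OF ctx j]
      have "card (C - {d, e}) < card C" using js(2) by linarith
      from less.hyps[OF this js(1)] show ?thesis using euler_join_arith(1)[OF js(2,3,4)] by blast
    qed
  qed
qed

definition plan :: "nat set \<Rightarrow> nat \<Rightarrow> (nat \<Rightarrow> nat) \<Rightarrow> (nat \<Rightarrow> nat) \<Rightarrow> bool" where
  "plan C r a s \<longleftrightarrow> mp C r a s \<and> 2 * (nv s C + nf a s C) = card C + 3"

text \<open>A combinatorial Jordan curve theorem: deleting a nonseparating loop from a planar map
  would give a map violating \<open>euler\<close>. Equality for the whole forces equality on both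
  sides.\<close>

lemma plan_loop:
  assumes "plan C r a s" and ctx: "d = s r" "d \<noteq> r" "e = a d" and l: "e \<in> orbit s r"
  shows "reach (cut_alpha a d e) (cut_sigma s r d e) e \<inter> reach (cut_alpha a d e) (cut_sigma s r d e) r = {}"
    "plan (reach (cut_alpha a d e) (cut_sigma s r d e) e) e (cut_alpha a d e) (cut_sigma s r d e)"
    "plan (reach (cut_alpha a d e) (cut_sigma s r d e) r) r (cut_alpha a d e) (cut_sigma s r d e)"
proof -
  let ?a = "cut_alpha a d e" let ?s = "cut_sigma s r d e"
  have m: "mp C r a s" and eq: "2 * (nv s C + nf a s C) = card C + 3" using assms by (auto simp: plan_def)
  show dis: "reach ?a ?s e \<inter> reach ?a ?s r = {}"
  proof (rule ccontr)
    assume nd: "reach ?a ?s e \<inter> reach ?a ?s r \<noteq> {}"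
    note lc = loop_connected[OF m ctx l nd]
    show False using euler_connected_arith(2)[OF lc(2,3,4) euler[OF lc(1)]] eq by blast
  qed
  note ld = loop_disjoint[OF m ctx l dis]
  show "plan (reach ?a ?s e) e ?a ?s" "plan (reach ?a ?s r) r ?a ?s"
    unfolding plan_def using ld(1,2) euler_loop_arith(2,3)[OF ld(4,5,8) euler[OF ld(1)] euler[OF ld(2)] eq] by blast+
qed

lemma plan_join:
  assumes "plan C r a s" and ctx: "d = s r" "d \<noteq> r" "e = a d" and j: "e \<notin> orbit s r"
  shows "plan (C - {d, e}) r (cut_alpha a d e) (rem e (cut_sigma s r d e))"
proof -
  have m: "mp C r a s" and eq: "2 * (nv s C + nf a s C) = card C + 3" using assms by (auto simp: plan_def)
  note js = join_step[OF m ctx j]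
  show ?thesis unfolding plan_def using js(1) euler_join_arith(2)[OF js(2,3,4)] eq by blast
qed

section \<open>Recursive decomposition of rooted planar maps\<close>

text \<open>\<open>Lp x y\<close> is a map whose root edge is a loop separating \<open>x\<close> from \<open>y\<close>. \<open>Jn x q\<close> is the map obtained from \<open>x\<close> by
  pulling \<open>q\<close> darts of the root vertex away to a new vertex, joined to the root by the new root edge.\<close>

datatype tm = Vx | Lp tm tm | Jn tm nat

fun edges :: "tm \<Rightarrow> nat" where
  "edges Vx = 0" | "edges (Lp x y) = edges x + edges y + 1" | "edges (Jn x q) = edges x + 1"

fun rdeg :: "tm \<Rightarrow> nat" where
  "rdeg Vx = 0" | "rdeg (Lp x y) = rdeg x + rdeg y + 2" | "rdeg (Jn x q) = rdeg x - q + 1"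

fun faces :: "tm \<Rightarrow> nat" where
  "faces Vx = 1" | "faces (Lp x y) = faces x + faces y" | "faces (Jn x q) = faces x"

fun nonroot :: "tm \<Rightarrow> nat" where
  "nonroot Vx = 0" | "nonroot (Lp x y) = nonroot x + nonroot y" | "nonroot (Jn x q) = nonroot x + 1"

fun cnt :: "tm \<Rightarrow> nat \<Rightarrow> nat" where
  "cnt Vx k = 0" | "cnt (Lp x y) k = cnt x k + cnt y k" | "cnt (Jn x q) k = cnt x k + (if k = Suc q then 1 else 0)"

fun valid :: "tm \<Rightarrow> bool" where
  "valid Vx = True" | "valid (Lp x y) = (valid x \<and> valid y)" | "valid (Jn x q) = (valid x \<and> q \<le> rdeg x)"

text \<open>The first argument is fuel, so that the recursion is structural; a map with at most
  \<open>n\<close> edges is decomposed completely.\<close>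

fun dec :: "nat \<Rightarrow> nat \<Rightarrow> (nat \<Rightarrow> nat) \<Rightarrow> (nat \<Rightarrow> nat) \<Rightarrow> tm" where
  "dec 0 r a s = Vx"
| "dec (Suc n) r a s = (let d = s r; e = a d; a' = cut_alpha a d e; s' = cut_sigma s r d e in
     if d = r then Vx
     else if e \<in> orbit s r then Lp (dec n e a' s') (dec n r a' s')
     else Jn (dec n r a' (rem e s')) (card (orbit s e) - 1))"

text \<open>The extra dart accounts for \<open>+ 1\<close> in the number of darts and in the root
  degree; the root vertex accounts for it in the number of vertices.\<close>

definition stats :: "nat set \<Rightarrow> nat \<Rightarrow> (nat \<Rightarrow> nat) \<Rightarrow> (nat \<Rightarrow> nat) \<Rightarrow> tm \<Rightarrow> bool" where
  "stats C r a s t \<longleftrightarrow> valid t \<and> card C = 2 * edges t + 1 \<and> card (orbit s r) = rdeg t + 1 \<and>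
     nf a s C = faces t \<and> nv s C = nonroot t + 1 \<and>
     (\<forall>k. card {W \<in> orbits s C - {orbit s r}. card W = k} = cnt t k)"

lemma plan_single: assumes "plan C r a s" "s r = r" shows "C = {r}" "stats C r a s Vx"
proof -
  show C: "C = {r}" using mp_trivial[of C r a s] assms by (simp add: plan_def)
  have "orbits s {r} = {{r}}" "orbits (s \<circ> a) {r} = {{r}}" "orbit s r = {r}"
    using assms nv_single[of s r] nv_single[of "s \<circ> a" r] by (auto simp: plan_def mp_def pm_def orbits_def)
  then show "stats C r a s Vx" unfolding stats_def C by simp
qed

lemma plan_fin: assumes "plan C r a s" "x \<in> C"
  shows "finite (orbit s x)" "card (orbit s x) \<ge> 1" "finite C" "card C \<ge> 1"
proof -
  show fC: "finite C" using assms by (simp add: plan_def mp_def pm_def)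
  then show f: "finite (orbit s x)" using orbit_sub[of s C x] assms finite_subset by (auto simp: plan_def mp_def pm_def)
  show "card (orbit s x) \<ge> 1" using f orbit_self[of x s] by (metis One_nat_def Suc_leI card_gt_0_iff empty_iff)
  show "card C \<ge> 1" using fC assms(2) by (metis One_nat_def Suc_leI card_gt_0_iff empty_iff)
qed

lemma card_filter_Un: assumes "finite A" "finite B" "A \<inter> B = {}"
  shows "card {W \<in> A \<union> B. P W} = card {W \<in> A. P W} + card {W \<in> B. P W}"
proof -
  have "{W \<in> A \<union> B. P W} = {W \<in> A. P W} \<union> {W \<in> B. P W}" by auto
  then show ?thesis using assms by (simp add: card_Un_disjoint disjoint_iff)
qed

lemma plan_root: "plan C r a s \<Longrightarrow> r \<in> C" by (simp add: plan_def mp_def pm_def)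

lemma join_degree_arith:
  fixes x y k m :: nat
  assumes "x + y = m + 2 \<and> m = k + 1" "y \<ge> 1" "x \<ge> 2"
  shows "y - 1 \<le> k" "x = k - (y - 1) + 1 + 1"
  using assms by auto

lemma dec_stats: "plan C r a s \<Longrightarrow> card C \<le> 2 * n + 1 \<Longrightarrow> stats C r a s (dec n r a s)"
proof (induction n arbitrary: C r a s)
  case 0
  have "C = {r}"
    using plan_fin[OF 0(1) plan_root[OF 0(1)]] plan_root[OF 0(1)] 0(2) by (auto simp: card_le_Suc0_iff_eq)
  moreover have "s r \<in> C" using 0(1) by (auto simp: plan_def mp_def pm_def bij_betw_def)
  ultimately show ?case using plan_single[OF 0(1)] by simp
next
  case (Suc n)
  note pl = Suc.prems(1)
  define d where "d = s r"
  define e where "e = a d"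
  let ?a = "cut_alpha a d e" let ?s = "cut_sigma s r d e"
  show ?case
  proof (cases "d = r")
    case True
    then show ?thesis using plan_single[OF pl] by (simp add: d_def)
  next
    case False
    have m: "mp C r a s" using pl by (simp add: plan_def)
    note ctx = d_def False e_def
    note cb = cbasic[OF m ctx]
    have fo: "finite (orbits s C)" using cb by simp
    show ?thesis
    proof (cases "e \<in> orbit s r")
      case l: True
      note pll = plan_loop[OF pl ctx l] note ld = loop_disjoint[OF m ctx l pll(1)]
      note lo = loop_orbits[OF mp_pm[OF m ctx] ctx l]
      let ?C1 = "reach ?a ?s e" let ?C2 = "reach ?a ?s r"
      have c1: "card ?C1 \<ge> 1" "card ?C2 \<ge> 1" using plan_fin[OF pll(2), of e] plan_fin[OF pll(3), of r] by auto
      then have "card ?C1 \<le> 2 * n + 1" "card ?C2 \<le> 2 * n + 1" using ld(4) Suc.prems(2) by auto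
      then have s1: "stats ?C1 e ?a ?s (dec n e ?a ?s)" and s2: "stats ?C2 r ?a ?s (dec n r ?a ?s)"
        using Suc.IH pll(2,3) by blast+
      have D: "dec (Suc n) r a s = Lp (dec n e ?a ?s) (dec n r ?a ?s)"
        using False l unfolding d_def e_def by (simp add: Let_def)
      have "card {W \<in> orbits s C - {orbit s r}. card W = k} =
        cnt (dec n e ?a ?s) k + cnt (dec n r ?a ?s) k" for k
        unfolding ld(6) using s1 s2 plan_fin(3)[OF pll(2), of e] plan_fin(3)[OF pll(3), of r]
        by (subst card_filter_Un[OF _ _ ld(7)]) (auto simp: stats_def)
      moreover have "nv s C = nonroot (dec n e ?a ?s) + nonroot (dec n r ?a ?s) + 1"
        using ld(8) s1 s2 by (simp add: stats_def)
      moreover have "nf a s C = faces (dec n e ?a ?s) + faces (dec n r ?a ?s)"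
        using ld(5) s1 s2 unfolding stats_def by metis
      ultimately show ?thesis unfolding D
        using s1 s2 ld(4) lo(5) by (simp add: stats_def)
    next
      case j: False
      note plj = plan_join[OF pl ctx j] note js = join_step[OF m ctx j]
      note jo = join_orbits[OF mp_pm[OF m ctx] ctx j]
      let ?C = "C - {d, e}" let ?s2 = "rem e ?s"
      have s2: "stats ?C r ?a ?s2 (dec n r ?a ?s2)" using Suc.IH[OF plj] js(2) Suc.prems(2) by simp
      have D: "dec (Suc n) r a s = Jn (dec n r ?a ?s2) (card (orbit s e) - 1)"
        using False j unfolding d_def e_def by (simp add: Let_def)
      have ce: "card (orbit s e) \<ge> 1" using plan_fin[OF pl] cb by blast
      \<comment> \<open>The degree of the new root vertex is a truncated difference. That this
        vertex contains both \<open>r\<close> and \<open>d\<close> keeps the difference honest, and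
        it gives the validity condition on \<open>Jn\<close>.\<close>
      have "{r, d} \<subseteq> orbit s r" using orbit_step[of r s r] by (auto simp: d_def)
      then have "card {r, d} \<le> card (orbit s r)" using plan_fin[OF pl] cb card_mono by metis
      then have cr: "card (orbit s r) \<ge> 2" using False by simp
      have f2: "finite (orbits ?s2 ?C)" using cb by simp
      have "card {W \<in> orbits s C - {orbit s r}. card W = k} =
        (if k = card (orbit s e) then 1 else 0) + card {W \<in> orbits ?s2 ?C - {orbit ?s2 r}. card W = k}" for k
      proof -
        have "{W \<in> insert (orbit s e) (orbits ?s2 ?C - {orbit ?s2 r}). card W = k} =
          (if k = card (orbit s e) then insert (orbit s e) {W \<in> orbits ?s2 ?C - {orbit ?s2 r}. card W = k}
           else {W \<in> orbits ?s2 ?C - {orbit ?s2 r}. card W = k})" by auto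
        then show ?thesis unfolding js(5) using js(6) f2 by simp
      qed
      moreover have "Suc (card (orbit s e) - 1) = card (orbit s e)" using ce by simp
      moreover have "nf a s C = faces (dec n r ?a ?s2)" using js(4) s2 unfolding stats_def by metis
      moreover have "card (orbit s e) - 1 \<le> rdeg (dec n r ?a ?s2)"
        "card (orbit s r) = rdeg (dec n r ?a ?s2) - (card (orbit s e) - 1) + 1 + 1"
        using join_degree_arith[OF _ ce cr] jo(3) s2 unfolding stats_def by blast+
      ultimately show ?thesis unfolding D
        using s2 js(2,3) by (simp add: stats_def)
    qed
  qed
qed

section \<open>Invariance of the decomposition under relabelling\<close>

definition hom :: "(nat \<Rightarrow> nat) \<Rightarrow> nat set \<Rightarrow> (nat \<Rightarrow> nat) \<Rightarrow> (nat \<Rightarrow> nat) \<Rightarrow> (nat \<Rightarrow> nat) \<Rightarrow> (nat \<Rightarrow> nat) \<Rightarrow> bool" where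
  "hom \<pi> C a s a' s' \<longleftrightarrow> inj_on \<pi> C \<and>
     (\<forall>x\<in>C. a x \<in> C \<and> s x \<in> C \<and> \<pi> (a x) = a' (\<pi> x) \<and> \<pi> (s x) = s' (\<pi> x))"

lemma orbit_image: assumes "\<And>x. x \<in> C \<Longrightarrow> s x \<in> C \<and> \<pi> (s x) = s' (\<pi> x)" "x \<in> C"
  shows "orbit s' (\<pi> x) = \<pi> ` orbit s x"
proof -
  have "(s ^^ k) x \<in> C \<and> (s' ^^ k) (\<pi> x) = \<pi> ((s ^^ k) x)" for k
    using assms by (induction k) auto
  then show ?thesis by (auto simp: orbit_def)
qed

text \<open>The recursion uses only the two permutations and equality of darts. An embedding
  suffices, which also covers the inclusion of a component into a larger map.\<close>

lemma dec_hom: "hom \<pi> C a s a' s' \<Longrightarrow> r \<in> C \<Longrightarrow> dec n (\<pi> r) a' s' = dec n r a s"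
proof (induction n arbitrary: r a s a' s')
  case (Suc n)
  note h = Suc.prems
  define d where "d = s r"
  define e where "e = a d"
  have in_C: "r \<in> C" "d \<in> C" "e \<in> C" using h unfolding d_def e_def hom_def by blast+
  have im: "\<pi> d = s' (\<pi> r)" "\<pi> e = a' (\<pi> d)" using h in_C unfolding d_def e_def hom_def by blast+
  have inj: "\<pi> x = \<pi> y \<longleftrightarrow> x = y" if "x \<in> C" "y \<in> C" for x y
    using h that by (auto simp: hom_def dest: inj_onD)
  have cl: "a x \<in> C" "s x \<in> C" "\<pi> (a x) = a' (\<pi> x)" "\<pi> (s x) = s' (\<pi> x)" if "x \<in> C" for x
    using h that by (auto simp: hom_def)
  have i: "inj_on \<pi> C" using h by (simp add: hom_def)
  have h1: "hom \<pi> C (cut_alpha a d e) (cut_sigma s r d e) (cut_alpha a' (\<pi> d) (\<pi> e)) (cut_sigma s' (\<pi> r) (\<pi> d) (\<pi> e))"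
    unfolding hom_def cut_alpha_def cut_sigma_def using i cl inj in_C by simp
  have h2: "hom \<pi> C (cut_alpha a d e) (rem e (cut_sigma s r d e)) (cut_alpha a' (\<pi> d) (\<pi> e))
    (rem (\<pi> e) (cut_sigma s' (\<pi> r) (\<pi> d) (\<pi> e)))"
  proof -
    have "rem e (cut_sigma s r d e) x \<in> C \<and>
      \<pi> (rem e (cut_sigma s r d e) x) = rem (\<pi> e) (cut_sigma s' (\<pi> r) (\<pi> d) (\<pi> e)) (\<pi> x)" if "x \<in> C" for x
    proof -
      have *: "cut_sigma s r d e y \<in> C" "\<pi> (cut_sigma s r d e y) = cut_sigma s' (\<pi> r) (\<pi> d) (\<pi> e) (\<pi> y)"
        if "y \<in> C" for y using h1 that by (auto simp: hom_def)
      show ?thesis unfolding rem_def using *[OF that] *[OF in_C(3)] inj[OF that in_C(3)] inj[OF *(1)[OF that] in_C(3)]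
        in_C by auto
    qed
    then show ?thesis using h1 by (simp add: hom_def)
  qed
  have orb: "orbit s' (\<pi> x) = \<pi> ` orbit s x" if "x \<in> C" for x
    by (rule orbit_image[OF _ that]) (use cl in auto)
  have osub: "orbit s x \<subseteq> C" if "x \<in> C" for x by (rule orbit_subset) (use that cl in auto)
  have mem: "\<pi> e \<in> orbit s' (\<pi> r) \<longleftrightarrow> e \<in> orbit s r"
    unfolding orb[OF in_C(1)] using inj osub[OF in_C(1)] in_C by blast
  have crd: "card (orbit s' (\<pi> e)) = card (orbit s e)"
    unfolding orb[OF in_C(3)] by (rule card_image) (rule inj_on_subset[OF i osub[OF in_C(3)]])
  show ?case
    using Suc.IH[OF h1 in_C(3)] Suc.IH[OF h1 in_C(1)] Suc.IH[OF h2 in_C(1)] mem crd inj[OF in_C(2,1)]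
    unfolding dec.simps Let_def d_def[symmetric] e_def[symmetric] im(1)[symmetric] im(2)[symmetric] by simp
qed simp

definition iso :: "(nat \<Rightarrow> nat) \<Rightarrow> nat set \<Rightarrow> nat \<Rightarrow> (nat \<Rightarrow> nat) \<Rightarrow> (nat \<Rightarrow> nat) \<Rightarrow>
    nat set \<Rightarrow> nat \<Rightarrow> (nat \<Rightarrow> nat) \<Rightarrow> (nat \<Rightarrow> nat) \<Rightarrow> bool" where
  "iso \<pi> C r a s C' r' a' s' \<longleftrightarrow> bij_betw \<pi> C C' \<and> \<pi> r = r' \<and>
     (\<forall>x\<in>C. \<pi> (a x) = a' (\<pi> x) \<and> \<pi> (s x) = s' (\<pi> x))"

lemma mp_cl: assumes "mp C r a s" "x \<in> C" shows "a x \<in> C" "s x \<in> C"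
  using assms bij_alpha[of C r a s] by (auto simp: mp_def pm_def bij_betw_def)

lemma iso_hom: assumes "mp C r a s" "iso \<pi> C r a s C' r' a' s'" shows "hom \<pi> C a s a' s'"
  using assms mp_cl[OF assms(1)] by (auto simp: iso_def hom_def bij_betw_def)

lemma dec_iso: assumes "mp C r a s" "iso \<pi> C r a s C' r' a' s'" shows "dec n r' a' s' = dec n r a s"
  using dec_hom[OF iso_hom[OF assms], of r n] assms by (simp add: iso_def mp_def pm_def)

lemma plan_iso: assumes "plan C r a s" "iso \<pi> C r a s C' r' a' s'" shows "plan C' r' a' s'"
proof -
  have m: "mp C r a s" using assms by (simp add: plan_def)
  have bij: "bij_betw \<pi> C C'" and r': "r' = \<pi> r" and C': "C' = \<pi> ` C" and inj: "inj_on \<pi> C"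
    and com: "\<And>x. x \<in> C \<Longrightarrow> a' (\<pi> x) = \<pi> (a x)" "\<And>x. x \<in> C \<Longrightarrow> s' (\<pi> x) = \<pi> (s x)"
    using assms(2) by (auto simp: iso_def bij_betw_def)
  have pmC: "finite C" "r \<in> C" "a r = r" "bij_betw s C C"
    "\<And>x. x \<in> C - {r} \<Longrightarrow> a x \<in> C - {r} \<and> a x \<noteq> x \<and> a (a x) = x"
    using m by (auto simp: mp_def pm_def)
  have cl: "\<And>x. x \<in> C \<Longrightarrow> a x \<in> C" "\<And>x. x \<in> C \<Longrightarrow> s x \<in> C" using mp_cl[OF m] by auto
  have inj': "\<pi> x = \<pi> y \<longleftrightarrow> x = y" if "x \<in> C" "y \<in> C" for x y using inj that by (auto dest: inj_onD)
  have "finite C'" "r' \<in> C'" "a' r' = r'" using pmC com C' r' by auto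
  moreover have "\<forall>x\<in>C' - {r'}. a' x \<in> C' - {r'} \<and> a' x \<noteq> x \<and> a' (a' x) = x"
  proof
    fix y assume "y \<in> C' - {r'}"
    then obtain x where x: "x \<in> C - {r}" "y = \<pi> x" using C' r' by auto
    then show "a' y \<in> C' - {r'} \<and> a' y \<noteq> y \<and> a' (a' y) = y"
      using pmC(5)[OF x(1)] inj'[of "a x" r] inj'[of "a x" x] pmC(2) com(1)[of x] com(1)[of "a x"] C' r' by auto
  qed
  moreover have "bij_betw s' C' C'"
  proof (rule bij_endo)
    show "finite C'" using pmC C' by simp
    show "inj_on s' C'" unfolding C'
    proof (rule inj_onI)
      fix x y assume "x \<in> \<pi> ` C" "y \<in> \<pi> ` C" "s' x = s' y"
      then obtain u v where uv: "u \<in> C" "v \<in> C" "x = \<pi> u" "y = \<pi> v" "\<pi> (s u) = \<pi> (s v)" using com by auto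
      then have "s u = s v" using inj' cl by blast
      then show "x = y" using pmC(4) uv by (auto simp: bij_betw_def dest: inj_onD)
    qed
    show "s' x \<in> C'" if "x \<in> C'" for x using that C' com cl by auto
  qed
  moreover have "C' \<subseteq> reach a' s' r'"
  proof
    fix y assume "y \<in> C'"
    then obtain x where x: "x \<in> C" "y = \<pi> x" using C' by auto
    have "x \<in> reach a s r" using mp_reach[OF m] x by simp
    then have "x \<in> C \<and> \<pi> x \<in> reach a' s' r'"
    proof (induction rule: reach_induct)
      case (step z)
      then show ?case using com[of z] cl[of z] reach_step[of "\<pi> z" a' s' r'] by auto
    qed (use pmC r' in auto)
    then show "y \<in> reach a' s' r'" using x by simp
  qed
  ultimately have m': "mp C' r' a' s'" by (simp add: mp_def pm_def)
  have card_img: "card (orbits f' C') = card (orbits f C)"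
    if "\<And>x. x \<in> C \<Longrightarrow> f x \<in> C \<and> \<pi> (f x) = f' (\<pi> x)" for f f'
  proof -
    have eq: "orbits f' C' = (`) \<pi> ` orbits f C"
      unfolding orbits_def C' image_image by (rule image_cong[OF refl]) (rule orbit_image, use that in auto)
    have "orbits f C \<subseteq> Pow C" using orbit_subset[of _ C f] that by (force simp: orbits_def)
    then have "inj_on ((`) \<pi>) (orbits f C)" using inj_on_image_Pow[OF inj] inj_on_subset by blast
    then show ?thesis unfolding eq by (rule card_image)
  qed
  have "nv s' C' = nv s C" by (rule card_img) (use cl com in auto)
  moreover have "nf a' s' C' = nf a s C" by (rule card_img) (use cl com in auto)
  moreover have "card C' = card C" unfolding C' by (rule card_image[OF inj])
  ultimately show ?thesis using assms(1) m' by (simp add: plan_def)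
qed

lemma path_funpow: "path f (x # xs) y \<Longrightarrow> k \<le> length xs \<Longrightarrow> (f ^^ k) x = (x # xs) ! k"
proof (induction xs arbitrary: x k)
  case (Cons z zs)
  then show ?case by (cases k) (auto simp: funpow_swap1)
qed simp

context
  fixes C r a s d e
  assumes pm: "pm C r a s" and d: "d = s r" "d \<noteq> r" and e: "e = a d"
begin

text \<open>In the merged rotation \<open>e\<close> follows the last dart of Q. Counted from
  \<open>r\<close> in the reduced map, that dart stands at the position stored in \<open>Jn\<close>,
  so the stored number determines where \<open>e\<close> was.\<close>

lemma join_pos: assumes j: "e \<notin> orbit s r"
  obtains P Q y where "cut_sigma s r d e y = e" "y = (rem e (cut_sigma s r d e) ^^ (card (orbit s e) - 1)) r"
    "y \<in> C - {d, e}" "cyc (rem e (cut_sigma s r d e)) (r # Q @ P)" "length Q = card (orbit s e) - 1"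
    "y = (r # Q @ P) ! (card (orbit s e) - 1)"
proof -
  let ?s1 = "cut_sigma s r d e" let ?s2 = "rem e (cut_sigma s r d e)"
  obtain P Q where PQ: "cyc s (r # d # P)" "cyc s (e # Q)" "set (r # d # P) \<subseteq> C" "set (e # Q) \<subseteq> C"
    "set (r # d # P) \<inter> set (e # Q) = {}" "cyc ?s1 (r # Q @ e # P)" "cyc ?s2 (r # Q @ P)"
    using join_cyc[OF pm d e j] by blast
  have q: "length Q = card (orbit s e) - 1"
    using cyc_orbit[OF PQ(2), of e] PQ(2) distinct_card[of "e # Q"] by (simp add: cyc_def)
  define y where "y = last (r # Q)"
  have y: "y = (r # Q @ P) ! length Q" unfolding y_def by (cases Q) (auto simp: last_conv_nth nth_append)
  have "path ?s2 (r # Q @ P) r" using PQ(7) by (simp add: cyc_def)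
  then have "(?s2 ^^ length Q) r = (r # Q @ P) ! length Q" by (rule path_funpow) simp
  then have 1: "y = (?s2 ^^ (card (orbit s e) - 1)) r" using y q by simp
  have 2: "?s1 y = e"
  proof (cases Q rule: rev_cases)
    case Nil then show ?thesis using PQ(6) by (simp add: y_def cyc_def)
  next
    case (snoc Q' z) then show ?thesis using PQ(6) by (simp add: y_def cyc_def)
  qed
  have "y \<in> set (r # Q)" unfolding y_def by (rule last_in_set) simp
  moreover have "d \<notin> set (r # Q)" "e \<notin> set (r # Q)" "set (r # Q) \<subseteq> C"
    using PQ(1-5) by (auto simp: cyc_def)
  ultimately have "y \<in> C - {d, e}" by blast
  then show thesis using that 1 2 PQ(7) q y by metis
qed

end

text \<open>Both permutations can be read off from their cut versions and the darts
  \<open>r\<close>, \<open>d\<close>, \<open>e\<close>. An isomorphism of the cut maps that matches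
  these three darts is therefore one of the uncut maps.\<close>

lemma glue_iso:
  assumes pm: "pm C r a s" and ctx: "d = s r" "d \<noteq> r" "e = a d"
    and pm': "pm C' r' a' s'" and ctx': "d' = s' r'" "d' \<noteq> r'" "e' = a' d'"
    and bij: "bij_betw \<pi> (C - {d}) (C' - {d'})" and im: "\<pi> d = d'" "\<pi> e = e'" "\<pi> r = r'"
    and com: "\<And>x. x \<in> C - {d} \<Longrightarrow> \<pi> (cut_alpha a d e x) = cut_alpha a' d' e' (\<pi> x)"
      "\<And>x. x \<in> C - {d} \<Longrightarrow> \<pi> (cut_sigma s r d e x) = cut_sigma s' r' d' e' (\<pi> x)"
  shows "iso \<pi> C r a s C' r' a' s'"
proof -
  note cb = cut_basic[OF pm ctx] note cb' = cut_basic[OF pm' ctx']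
  have "bij_betw \<pi> (insert d (C - {d})) (insert d' (C' - {d'}))"
    using bij notIn_Un_bij_betw[of d "C - {d}" \<pi> "C' - {d'}"] im(1) by simp
  then have b: "bij_betw \<pi> C C'" using cb cb' by (simp add: insert_absorb)
  have inj: "\<pi> x = \<pi> y \<longleftrightarrow> x = y" if "x \<in> C" "y \<in> C" for x y
    using b that by (auto simp: bij_betw_def dest: inj_onD)
  have "\<pi> (a x) = a' (\<pi> x)" if "x \<in> C" for x
  proof -
    consider "x = d" | "x = e" | "x \<noteq> d" "x \<noteq> e" by blast
    then show ?thesis
    proof cases
      case 3
      then have "\<pi> x \<noteq> d'" "\<pi> x \<noteq> e'" using inj[OF that cb(1)] inj[OF that cb(2)] im by auto
      then show ?thesis using com(1)[of x] 3 that by (simp add: cut_alpha_def)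
    qed (use im ctx ctx' cb(6) cb'(6) in auto)
  qed
  moreover have "\<pi> (s x) = s' (\<pi> x)" if "x \<in> C" for x
  proof -
    have er: "e \<in> C - {d}" "r \<in> C - {d}" using cb ctx(2) by auto
    have v: "cut_sigma s r d e r = s e" "cut_sigma s r d e e = s d" using cb ctx by (auto simp: cut_sigma_def)
    have v': "cut_sigma s' r' d' e' r' = s' e'" "cut_sigma s' r' d' e' e' = s' d'"
      using cb' ctx' by (auto simp: cut_sigma_def)
    consider "x = d" | "x = e" | "x = r" | "x \<noteq> d" "x \<noteq> e" "x \<noteq> r" by blast
    then show ?thesis
    proof cases
      case 1 then show ?thesis using com(2)[OF er(1)] v v' im by simp
    next
      case 2 then show ?thesis using com(2)[OF er(2)] v v' im by simp
    next
      case 3 then show ?thesis using im ctx(1) ctx'(1) by simp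
    next
      case 4
      then have "\<pi> x \<noteq> d'" "\<pi> x \<noteq> e'" "\<pi> x \<noteq> r'"
        using inj[OF that cb(1)] inj[OF that cb(2)] inj[OF that cb(3)] im by auto
      then show ?thesis using com(2)[of x] 4 that by (simp add: cut_sigma_def)
    qed
  qed
  ultimately show ?thesis using b im by (simp add: iso_def)
qed

lemma dec_Vx: "dec (Suc n) r a s = Vx \<longleftrightarrow> s r = r"
  by (simp add: Let_def)

text \<open>Equal terms have the same head, so both maps are cut in the same way. The pieces are
  isomorphic by induction, and \<open>glue_iso\<close> extends the isomorphism over the root
  edge.\<close>

lemma dec_inj: "plan C r a s \<Longrightarrow> plan C' r' a' s' \<Longrightarrow> card C \<le> 2 * n + 1 \<Longrightarrow> card C' \<le> 2 * n + 1 \<Longrightarrow>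
   dec n r a s = dec n r' a' s' \<Longrightarrow> \<exists>\<pi>. iso \<pi> C r a s C' r' a' s'"
proof (induction n arbitrary: C r a s C' r' a' s')
  case 0
  have single: "s r = r \<and> C = {r}" if "plan C r a s" "card C \<le> 1" for C r a s
  proof -
    have "C = {r}" using plan_fin[OF that(1) plan_root[OF that(1)]] plan_root[OF that(1)] that(2)
      by (auto simp: card_le_Suc0_iff_eq)
    moreover have "s r \<in> C" using that(1) by (auto simp: plan_def mp_def pm_def bij_betw_def)
    ultimately show ?thesis by simp
  qed
  have "iso (\<lambda>_. r') C r a s C' r' a' s'"
    using single[OF 0(1)] single[OF 0(2)] 0 by (auto simp: iso_def bij_betw_def plan_def mp_def pm_def)
  then show ?case by blast
next
  case (Suc n)
  note pl = Suc.prems(1) note pl' = Suc.prems(2)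
  define d where "d = s r"
  define e where "e = a d"
  define d' where "d' = s' r'"
  define e' where "e' = a' d'"
  let ?a = "cut_alpha a d e" let ?s = "cut_sigma s r d e"
  let ?a' = "cut_alpha a' d' e'" let ?s' = "cut_sigma s' r' d' e'"
  have m: "mp C r a s" "mp C' r' a' s'" using pl pl' by (simp_all add: plan_def)
  show ?case
  proof (cases "d = r")
    case True
    then have "s r = r" "s' r' = r'" using Suc.prems(5) dec_Vx by (metis d_def)+
    then have "iso (\<lambda>_. r') C r a s C' r' a' s'"
      using plan_single(1)[OF pl] plan_single(1)[OF pl'] m by (auto simp: iso_def bij_betw_def mp_def pm_def)
    then show ?thesis by blast
  next
    case False
    then have False': "d' \<noteq> r'" using Suc.prems(5) dec_Vx by (metis d_def d'_def)
    note ctx = d_def False e_def note ctx' = d'_def False' e'_def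
    note cb = cbasic[OF m(1) ctx] note cb' = cbasic[OF m(2) ctx']
    have pm: "pm C r a s" "pm C' r' a' s'" using m by (auto simp: mp_def)
    have D: "dec (Suc n) r a s = (if e \<in> orbit s r then Lp (dec n e ?a ?s) (dec n r ?a ?s)
      else Jn (dec n r ?a (rem e ?s)) (card (orbit s e) - 1))"
      using False unfolding d_def e_def by (simp add: Let_def)
    have D': "dec (Suc n) r' a' s' = (if e' \<in> orbit s' r' then Lp (dec n e' ?a' ?s') (dec n r' ?a' ?s')
      else Jn (dec n r' ?a' (rem e' ?s')) (card (orbit s' e') - 1))"
      using False' unfolding d'_def e'_def by (simp add: Let_def)
    have same: "e \<in> orbit s r \<longleftrightarrow> e' \<in> orbit s' r'" using Suc.prems(5) unfolding D D' by (auto split: if_splits)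
    show ?thesis
    proof (cases "e \<in> orbit s r")
      case l: True
      then have l': "e' \<in> orbit s' r'" using same by simp
      have dd: "dec n e ?a ?s = dec n e' ?a' ?s'" "dec n r ?a ?s = dec n r' ?a' ?s'"
        using Suc.prems(5) l l' unfolding D D' by auto
      note pll = plan_loop[OF pl ctx l] note ld = loop_disjoint[OF m(1) ctx l pll(1)]
      note pll' = plan_loop[OF pl' ctx' l'] note ld' = loop_disjoint[OF m(2) ctx' l' pll'(1)]
      let ?C1 = "reach ?a ?s e" let ?C2 = "reach ?a ?s r"
      let ?D1 = "reach ?a' ?s' e'" let ?D2 = "reach ?a' ?s' r'"
      have c1: "card ?C1 \<ge> 1" "card ?C2 \<ge> 1" "card ?D1 \<ge> 1" "card ?D2 \<ge> 1"
        using plan_fin[OF pll(2), of e] plan_fin[OF pll(3), of r] plan_fin[OF pll'(2), of e'] plan_fin[OF pll'(3), of r'] by auto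
      then have cc: "card ?C1 \<le> 2 * n + 1" "card ?C2 \<le> 2 * n + 1" "card ?D1 \<le> 2 * n + 1" "card ?D2 \<le> 2 * n + 1"
        using ld(4) ld'(4) Suc.prems(3,4) by auto
      obtain \<pi>1 where i1: "iso \<pi>1 ?C1 e ?a ?s ?D1 e' ?a' ?s'"
        using Suc.IH[OF pll(2) pll'(2) cc(1,3) dd(1)] by blast
      obtain \<pi>2 where i2: "iso \<pi>2 ?C2 r ?a ?s ?D2 r' ?a' ?s'"
        using Suc.IH[OF pll(3) pll'(3) cc(2,4) dd(2)] by blast
      define \<pi> where "\<pi> x = (if x = d then d' else if x \<in> ?C1 then \<pi>1 x else \<pi>2 x)" for x
      have dn: "d \<notin> ?C1" "d \<notin> ?C2" using ld(3) by auto
      have p1: "\<pi> x = \<pi>1 x" if "x \<in> ?C1" for x using that dn by (auto simp: \<pi>_def)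
      have p2: "\<pi> x = \<pi>2 x" if "x \<in> ?C2" for x using that dn pll(1) by (auto simp: \<pi>_def)
      have "bij_betw \<pi> ?C1 ?D1" using i1 p1 bij_betw_cong[of ?C1 \<pi> \<pi>1] by (simp add: iso_def)
      moreover have "bij_betw \<pi> ?C2 ?D2" using i2 p2 bij_betw_cong[of ?C2 \<pi> \<pi>2] by (simp add: iso_def)
      ultimately have bij: "bij_betw \<pi> (C - {d}) (C' - {d'})"
        unfolding ld(3) ld'(3) using pll'(1) by (rule bij_betw_combine)
      have "\<pi> e = e'" "\<pi> r = r'" using p1[of e] p2[of r] i1 i2 by (simp_all add: iso_def)
      moreover have "\<pi> (?a x) = ?a' (\<pi> x) \<and> \<pi> (?s x) = ?s' (\<pi> x)" if "x \<in> C - {d}" for x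
      proof (cases "x \<in> ?C1")
        case True
        then show ?thesis using i1 p1 reach_step[OF True] by (simp add: iso_def)
      next
        case False
        then have x: "x \<in> ?C2" using that ld(3) by auto
        then show ?thesis using i2 p2 reach_step[OF x] by (simp add: iso_def)
      qed
      ultimately have "iso \<pi> C r a s C' r' a' s'"
        by (intro glue_iso[OF pm(1) ctx pm(2) ctx' bij]) (auto simp: \<pi>_def)
      then show ?thesis by blast
    next
      case j: False
      then have j': "e' \<notin> orbit s' r'" using same by simp
      let ?s2 = "rem e ?s" let ?s2' = "rem e' ?s'"
      have dd: "dec n r ?a ?s2 = dec n r' ?a' ?s2'" and q: "card (orbit s e) - 1 = card (orbit s' e') - 1"
        using Suc.prems(5) j j' unfolding D D' by auto
      note plj = plan_join[OF pl ctx j] note js = join_step[OF m(1) ctx j]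
      note plj' = plan_join[OF pl' ctx' j'] note js' = join_step[OF m(2) ctx' j']
      have cc: "card (C - {d, e}) \<le> 2 * n + 1" "card (C' - {d', e'}) \<le> 2 * n + 1"
        using js(2) js'(2) Suc.prems(3,4) by simp_all
      obtain \<pi>0 where i0: "iso \<pi>0 (C - {d, e}) r ?a ?s2 (C' - {d', e'}) r' ?a' ?s2'"
        using Suc.IH[OF plj plj' cc dd] by blast
      obtain y where y: "?s y = e" "y = (?s2 ^^ (card (orbit s e) - 1)) r" "y \<in> C - {d, e}"
        using join_pos[OF pm(1) ctx j] by metis
      obtain y' where y': "?s' y' = e'" "y' = (?s2' ^^ (card (orbit s' e') - 1)) r'" "y' \<in> C' - {d', e'}"
        using join_pos[OF pm(2) ctx' j'] by metis
      have cl0: "?a x \<in> C - {d, e}" "?s2 x \<in> C - {d, e}" if "x \<in> C - {d, e}" for x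
        using mp_cl[OF js(1) that] by auto
      \<comment> \<open>The isomorphism preserves positions along the root vertex, hence sends the
        dart in front of \<open>e\<close> to the dart in front of \<open>e'\<close>. This is where
        the number stored in \<open>Jn\<close> is used.\<close>
      have pw: "\<pi>0 ((?s2 ^^ k) r) = (?s2' ^^ k) r' \<and> (?s2 ^^ k) r \<in> C - {d, e}" for k
      proof (induction k)
        case 0 then show ?case using i0 cb ctx(2) by (simp add: iso_def)
      next
        case (Suc k) then show ?case using i0 cl0 by (simp add: iso_def)
      qed
      have py: "\<pi>0 y = y'" using pw y(2) y'(2) q by simp
      define \<pi> where "\<pi> = \<pi>0(d := d', e := e')"
      have p0: "\<pi> x = \<pi>0 x" if "x \<in> C - {d, e}" for x using that by (auto simp: \<pi>_def)
      have im: "\<pi> d = d'" "\<pi> e = e'" using cb by (auto simp: \<pi>_def)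
      have "bij_betw \<pi> (C - {d, e}) (C' - {d', e'})"
        using i0 p0 bij_betw_cong[of "C - {d, e}" \<pi> \<pi>0] by (simp add: iso_def)
      then have "bij_betw \<pi> (insert e (C - {d, e})) (insert e' (C' - {d', e'}))"
        using im(2) notIn_Un_bij_betw[of e "C - {d, e}" \<pi> "C' - {d', e'}"] by simp
      moreover have "insert e (C - {d, e}) = C - {d}" "insert e' (C' - {d', e'}) = C' - {d'}" using cb cb' by auto
      ultimately have bij: "bij_betw \<pi> (C - {d}) (C' - {d'})" by simp
      have inj: "\<pi> u = \<pi> v \<longleftrightarrow> u = v" if "u \<in> C - {d}" "v \<in> C - {d}" for u v
        using bij that by (auto simp: bij_betw_def dest: inj_onD)
      have sinj: "u = v" if "?s u = ?s v" "u \<in> C - {d}" "v \<in> C - {d}" for u v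
        using cut_bij'[OF pm(1) ctx] that by (auto simp: bij_betw_def dest: inj_onD)
      have sinj': "u = v" if "?s' u = ?s' v" "u \<in> C' - {d'}" "v \<in> C' - {d'}" for u v
        using cut_bij'[OF pm(2) ctx'] that by (auto simp: bij_betw_def dest: inj_onD)
      have r: "\<pi> r = r'" using p0[of r] i0 cb ctx(2) by (simp add: iso_def)
      have ca: "\<pi> (?a x) = ?a' (\<pi> x)" if "x \<in> C - {d}" for x
      proof (cases "x = e")
        case True then show ?thesis using im by (simp add: cut_alpha_def)
      next
        case False
        then have x: "x \<in> C - {d, e}" using that by auto
        then show ?thesis using i0 p0[OF x] p0[OF cl0(1)[OF x]] by (simp add: iso_def)
      qed
      have cs: "\<pi> (?s x) = ?s' (\<pi> x)" if "x \<in> C - {d}" for x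
      proof -
        have yy: "\<pi> y = y'" using p0[OF y(3)] py by simp
        have se: "?s2 y = ?s e" "?s2' y' = ?s' e'" using y y' by (auto simp: rem_def)
        consider "x = e" | "x = y" | "x \<noteq> e" "x \<noteq> y" by blast
        then show ?thesis
        proof cases
          case 1
          have "\<pi> (?s2 y) = ?s2' y'" using i0 p0[OF cl0(2)[OF y(3)]] y(3) py by (simp add: iso_def)
          then show ?thesis using 1 se im by simp
        next
          case 2 then show ?thesis using yy y(1) y'(1) im by simp
        next
          case 3
          have x: "x \<in> C - {d, e}" using that 3 by auto
          have "?s x \<noteq> e" using sinj[of x y] y 3 that by auto
          then have s2: "?s2 x = ?s x" using 3 by (simp add: rem_def)
          have px: "\<pi> x \<in> C' - {d'}" using bij that by (auto simp: bij_betw_def)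
          have ne: "\<pi> x \<noteq> y'" "\<pi> x \<noteq> e'" using inj[of x y] inj[of x e] 3 that y(3) yy im cb by auto
          then have "?s' (\<pi> x) \<noteq> e'" using sinj'[of "\<pi> x" y'] y' px by auto
          then have s2': "?s2' (\<pi> x) = ?s' (\<pi> x)" using ne by (simp add: rem_def)
          have "\<pi> (?s2 x) = ?s2' (\<pi> x)" using i0 p0[OF x] p0[OF cl0(2)[OF x]] x by (simp add: iso_def)
          then show ?thesis using s2 s2' by simp
        qed
      qed
      have "iso \<pi> C r a s C' r' a' s'"
        by (rule glue_iso[OF pm(1) ctx pm(2) ctx' bij im r ca cs])
      then show ?thesis by blast
    qed
  qed
qed

section \<open>Realizing every valid term by a planar map\<close>

lemma iso_transport: assumes "inj_on \<pi> C"
  obtains a' s' where "iso \<pi> C r a s (\<pi> ` C) (\<pi> r) a' s'"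
    "\<And>y. y \<notin> \<pi> ` C \<Longrightarrow> a' y = y \<and> s' y = y"
proof -
  define tr where "tr f y = (if y \<in> \<pi> ` C then \<pi> (f (inv_into C \<pi> y)) else y)" for f :: "nat \<Rightarrow> nat" and y
  have "iso \<pi> C r a s (\<pi> ` C) (\<pi> r) (tr a) (tr s)"
    using assms by (auto simp: iso_def tr_def bij_betw_def)
  then show thesis using that by (auto simp: tr_def)
qed

text \<open>The inverse of the cut: \<open>d\<close> and \<open>e\<close> are paired to an edge and
  the rotation is rerouted through \<open>d\<close>. The reachability conclusions say that nothing
  attached to \<open>e\<close> or \<open>r\<close> is lost.\<close>

lemma glue_pm:
  assumes C': "finite C'" "r \<in> C'" "e \<in> C'" "r \<noteq> e" "d \<notin> C'"
    and \<alpha>: "\<alpha> e = e" "\<alpha> r = r" "\<forall>x\<in>C' - {r, e}. \<alpha> x \<in> C' - {r, e} \<and> \<alpha> x \<noteq> x \<and> \<alpha> (\<alpha> x) = x" "\<alpha> d = d"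
    and \<sigma>: "bij_betw \<sigma> C' C'" "\<sigma> d = d"
    and a: "a = \<alpha>(d := e, e := d)" and s: "s = \<sigma>(r := d, d := \<sigma> e, e := \<sigma> r)"
  shows "pm (insert d C') r a s" "d = s r" "d \<noteq> r" "e = a d" "cut_alpha a d e = \<alpha>" "cut_sigma s r d e = \<sigma>"
    "reach \<alpha> \<sigma> e \<subseteq> reach a s r" "reach \<alpha> \<sigma> r \<subseteq> reach a s r" "d \<in> reach a s r" "e \<in> reach a s r"
proof -
  have ne: "d \<noteq> r" "d \<noteq> e" using C' by auto
  show dr: "d = s r" "d \<noteq> r" "e = a d" using ne C'(4) unfolding a s by auto
  show ca: "cut_alpha a d e = \<alpha>" using \<alpha> unfolding cut_alpha_def a by (auto simp: fun_eq_iff)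
  show cs: "cut_sigma s r d e = \<sigma>" using \<sigma> ne C'(4) unfolding cut_sigma_def s by (auto simp: fun_eq_iff)
  have cl: "\<And>x. x \<in> C' \<Longrightarrow> \<sigma> x \<in> C'" and inj: "\<And>x y. x \<in> C' \<Longrightarrow> y \<in> C' \<Longrightarrow> \<sigma> x = \<sigma> y \<Longrightarrow> x = y"
    using \<sigma>(1) by (auto simp: bij_betw_def dest: inj_onD)
  have bs: "bij_betw s (insert d C') (insert d C')"
  proof (rule bij_endo)
    show "finite (insert d C')" using C' by simp
    show "s x \<in> insert d C'" if "x \<in> insert d C'" for x using that cl C' unfolding s by auto
    define \<tau> where "\<tau> x = (if x = d then e else if x = e then r else x)" for x
    have \<tau>: "s x = \<sigma> (\<tau> x)" "\<tau> x \<in> C'" if "x \<in> insert d C'" "x \<noteq> r" for x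
      using that C' ne unfolding s \<tau>_def by auto
    show "inj_on s (insert d C')"
    proof (rule inj_onI)
      fix x y assume xy: "x \<in> insert d C'" "y \<in> insert d C'" "s x = s y"
      show "x = y"
      proof (cases "x = r \<or> y = r")
        case True
        have "z = r" if "z \<in> insert d C'" "s z = d" for z
        proof (rule ccontr)
          assume "z \<noteq> r"
          then have "s z \<in> C'" using \<tau>[OF that(1)] cl by auto
          then show False using that(2) C' by simp
        qed
        then show ?thesis using True xy dr(1) by metis
      next
        case False
        then have "\<tau> x = \<tau> y" using \<tau>[OF xy(1)] \<tau>[OF xy(2)] xy(3) inj by auto
        then show ?thesis using False C' ne by (auto simp: \<tau>_def split: if_splits)
      qed
    qed
  qed
  have "\<forall>x\<in>insert d C' - {r}. a x \<in> insert d C' - {r} \<and> a x \<noteq> x \<and> a (a x) = x"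
  proof
    fix x assume x: "x \<in> insert d C' - {r}"
    consider "x = d" | "x = e" | "x \<in> C' - {r, e}" using x by auto
    then show "a x \<in> insert d C' - {r} \<and> a x \<noteq> x \<and> a (a x) = x"
    proof cases
      case 3
      then have "x \<noteq> d" "\<alpha> x \<noteq> d" using C' bspec[OF \<alpha>(3) 3] by auto
      then show ?thesis using bspec[OF \<alpha>(3) 3] 3 unfolding a by auto
    qed (use C' ne in \<open>auto simp: a\<close>)
  qed
  moreover have "a r = r" using \<alpha> ne C'(4) unfolding a by auto
  ultimately show "pm (insert d C') r a s" using C' bs by (auto simp: pm_def)
  let ?R = "reach a s r"
  show d: "d \<in> ?R" using reach_step(2)[OF reach_self, of s r a] dr by simp
  then show e: "e \<in> ?R" using reach_step(1)[OF d] dr by simp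
  have cl1: "\<alpha> x \<in> ?R \<and> \<sigma> x \<in> ?R" if "x \<in> ?R" for x
  proof -
    have 1: "s e \<in> ?R" "s d \<in> ?R" "s x \<in> ?R" "a x \<in> ?R" using reach_step e d that by blast+
    have 2: "\<sigma> r = s e" "\<sigma> e = s d" using ne C' unfolding s by auto
    have "\<alpha> x = x \<or> \<alpha> x = a x" using \<alpha> unfolding a by auto
    moreover have "\<sigma> x = s e \<or> \<sigma> x = s d \<or> \<sigma> x = x \<or> \<sigma> x = s x" using 2 \<sigma>(2) unfolding s by auto
    ultimately show ?thesis using 1 that by metis
  qed
  show "reach \<alpha> \<sigma> e \<subseteq> ?R" "reach \<alpha> \<sigma> r \<subseteq> ?R"
    by (rule reach_subset; use cl1 e in auto)+
qed

lemma reach_cong: assumes "x \<in> C" "\<And>y. y \<in> C \<Longrightarrow> a y \<in> C \<and> s y \<in> C \<and> a' y = a y \<and> s' y = s y"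
  shows "reach a' s' x = reach a s x"
proof -
  have sub: "reach a s x \<subseteq> C" by (rule reach_subset) (use assms in auto)
  have sub': "reach a' s' x \<subseteq> C" by (rule reach_subset) (use assms in auto)
  show ?thesis
  proof
    show "reach a s x \<subseteq> reach a' s' x"
    proof
      fix y assume "y \<in> reach a s x"
      then show "y \<in> reach a' s' x"
        by (induction rule: reach_induct) (use assms(2) sub in \<open>metis reach_self reach_step subsetD\<close>)+
    qed
    show "reach a' s' x \<subseteq> reach a s x"
    proof
      fix y assume "y \<in> reach a' s' x"
      then show "y \<in> reach a s x"
        by (induction rule: reach_induct) (use assms(2) sub' in \<open>metis reach_self reach_step subsetD\<close>)+
    qed
  qed
qed

lemma dec_Suc: "d = s r \<Longrightarrow> d \<noteq> r \<Longrightarrow> e = a d \<Longrightarrow> dec (Suc n) r a s =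
  (if e \<in> orbit s r then Lp (dec n e (cut_alpha a d e) (cut_sigma s r d e)) (dec n r (cut_alpha a d e) (cut_sigma s r d e))
   else Jn (dec n r (cut_alpha a d e) (rem e (cut_sigma s r d e))) (card (orbit s e) - 1))"
  by (simp add: Let_def)

lemma compose_loop:
  assumes p1: "plan C1 e a1 s1" and p2: "plan C2 r a2 s2" and dis: "C1 \<inter> C2 = {}" and d: "d \<notin> C1 \<union> C2"
  obtains a s where "plan (insert d (C1 \<union> C2)) r a s"
    "\<And>n. dec (Suc n) r a s = Lp (dec n e a1 s1) (dec n r a2 s2)"
proof -
  have m1: "mp C1 e a1 s1" and m2: "mp C2 r a2 s2" using p1 p2 by (simp_all add: plan_def)
  have q1: "finite C1" "e \<in> C1" "a1 e = e" "bij_betw s1 C1 C1"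
      "\<And>x. x \<in> C1 - {e} \<Longrightarrow> a1 x \<in> C1 - {e} \<and> a1 x \<noteq> x \<and> a1 (a1 x) = x"
    and q2: "finite C2" "r \<in> C2" "a2 r = r" "bij_betw s2 C2 C2"
      "\<And>x. x \<in> C2 - {r} \<Longrightarrow> a2 x \<in> C2 - {r} \<and> a2 x \<noteq> x \<and> a2 (a2 x) = x"
    using m1 m2 by (auto simp: mp_def pm_def)
  define \<alpha> where "\<alpha> x = (if x \<in> C1 then a1 x else if x \<in> C2 then a2 x else x)" for x
  define \<sigma> where "\<sigma> x = (if x \<in> C1 then s1 x else if x \<in> C2 then s2 x else x)" for x
  define a where "a = \<alpha>(d := e, e := d)"
  define s where "s = \<sigma>(r := d, d := \<sigma> e, e := \<sigma> r)"
  have v1: "\<alpha> x = a1 x" "\<sigma> x = s1 x" if "x \<in> C1" for x using that by (auto simp: \<alpha>_def \<sigma>_def)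
  have v2: "\<alpha> x = a2 x" "\<sigma> x = s2 x" if "x \<in> C2" for x using that dis by (auto simp: \<alpha>_def \<sigma>_def)
  have cl1: "a1 x \<in> C1" "s1 x \<in> C1" if "x \<in> C1" for x using mp_cl[OF m1 that] by auto
  have cl2: "a2 x \<in> C2" "s2 x \<in> C2" if "x \<in> C2" for x using mp_cl[OF m2 that] by auto
  have re: "r \<noteq> e" using q1 q2 dis by auto
  have A0: "\<alpha> x \<in> C1 \<union> C2 - {r, e} \<and> \<alpha> x \<noteq> x \<and> \<alpha> (\<alpha> x) = x" if "x \<in> C1 \<union> C2 - {r, e}" for x
  proof (cases "x \<in> C1")
    case True
    have "a1 x \<in> C1 - {e} \<and> a1 x \<noteq> x \<and> a1 (a1 x) = x" using q1(5)[of x] True that by auto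
    moreover from this have "a1 x \<noteq> r" using q2 dis by auto
    ultimately show ?thesis using v1 True by auto
  next
    case False
    then have x2: "x \<in> C2 - {r}" using that by auto
    have "a2 x \<in> C2 - {r} \<and> a2 x \<noteq> x \<and> a2 (a2 x) = x" using q2(5)[OF x2] .
    moreover from this have "a2 x \<noteq> e" using q1 dis by auto
    ultimately show ?thesis using v2 x2 by auto
  qed
  then have A: "\<forall>x\<in>C1 \<union> C2 - {r, e}. \<alpha> x \<in> C1 \<union> C2 - {r, e} \<and> \<alpha> x \<noteq> x \<and> \<alpha> (\<alpha> x) = x" by blast
  have B1: "bij_betw \<sigma> C1 C1" using q1(4) v1 bij_betw_cong[of C1 \<sigma> s1] by simp
  have B2: "bij_betw \<sigma> C2 C2" using q2(4) v2 bij_betw_cong[of C2 \<sigma> s2] by simp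
  have B: "bij_betw \<sigma> (C1 \<union> C2) (C1 \<union> C2)" by (rule bij_betw_combine[OF B1 B2 dis])
  have fix1: "\<alpha> e = e" "\<alpha> r = r" "\<alpha> d = d" "\<sigma> d = d"
    using v1[of e] v2[of r] q1 q2 d by (auto simp: \<alpha>_def \<sigma>_def)
  note gp = glue_pm[OF finite_UnI[OF q1(1) q2(1)] _ _ re d fix1(1,2) A fix1(3) B fix1(4) a_def s_def]
  have in_U: "r \<in> C1 \<union> C2" "e \<in> C1 \<union> C2" using q1 q2 by auto
  note gp = gp[OF in_U]
  have R1: "reach \<alpha> \<sigma> e = C1" using reach_cong[OF q1(2), of a1 s1 \<alpha> \<sigma>] cl1 v1 mp_reach[OF m1] by simp
  have R2: "reach \<alpha> \<sigma> r = C2" using reach_cong[OF q2(2), of a2 s2 \<alpha> \<sigma>] cl2 v2 mp_reach[OF m2] by simp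
  let ?C = "insert d (C1 \<union> C2)"
  have m: "mp ?C r a s" using gp(1,7,8,9) R1 R2 by (auto simp: mp_def)
  note ctx = gp(2,3,4)
  \<comment> \<open>Otherwise the cut would have merged two vertices and put \<open>e\<close> in the
    \<sigma>-orbit of \<open>r\<close>, but that orbit stays inside \<open>C2\<close>.\<close>
  have l: "e \<in> orbit s r"
  proof (rule ccontr)
    assume "e \<notin> orbit s r"
    from join_cyc[OF gp(1) ctx this] obtain P Q where "cyc \<sigma> (r # Q @ e # P)" unfolding gp(6) by metis
    then have "e \<in> orbit \<sigma> r" using cyc_orbit[of \<sigma> "r # Q @ e # P" r] by auto
    moreover have "orbit \<sigma> r \<subseteq> C2" by (rule orbit_subset) (use q2 v2 cl2 in auto)
    ultimately show False using q1 dis by auto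
  qed
  have dis': "reach (cut_alpha a d e) (cut_sigma s r d e) e \<inter> reach (cut_alpha a d e) (cut_sigma s r d e) r = {}"
    unfolding gp(5,6) R1 R2 by (rule dis)
  note ld = loop_disjoint[OF m ctx l dis', unfolded gp(5,6) R1 R2]
  have cl1': "\<And>x. x \<in> C1 \<Longrightarrow> s1 x \<in> C1 \<and> s1 x = \<sigma> x" "\<And>x. x \<in> C1 \<Longrightarrow> (s1 \<circ> a1) x \<in> C1 \<and> (s1 \<circ> a1) x = (\<sigma> \<circ> \<alpha>) x"
    and cl2': "\<And>x. x \<in> C2 \<Longrightarrow> s2 x \<in> C2 \<and> s2 x = \<sigma> x" "\<And>x. x \<in> C2 \<Longrightarrow> (s2 \<circ> a2) x \<in> C2 \<and> (s2 \<circ> a2) x = (\<sigma> \<circ> \<alpha>) x"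
    using cl1 cl2 v1 v2 by auto
  have eqs: "orbits \<sigma> C1 = orbits s1 C1" "orbits \<sigma> C2 = orbits s2 C2"
    "orbits (\<sigma> \<circ> \<alpha>) C1 = orbits (s1 \<circ> a1) C1" "orbits (\<sigma> \<circ> \<alpha>) C2 = orbits (s2 \<circ> a2) C2"
    using orbits_cong[of C1 s1 \<sigma>] orbits_cong[of C2 s2 \<sigma>] orbits_cong[of C1 "s1 \<circ> a1" "\<sigma> \<circ> \<alpha>"]
      orbits_cong[of C2 "s2 \<circ> a2" "\<sigma> \<circ> \<alpha>"] cl1' cl2' by blast+
  have eq1: "2 * (nv \<sigma> C1 + nf \<alpha> \<sigma> C1) = card C1 + 3" "2 * (nv \<sigma> C2 + nf \<alpha> \<sigma> C2) = card C2 + 3"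
    unfolding eqs using p1 p2 by (simp_all add: plan_def)
  have arith: "2 * (v + f) = c + 3" if "c = c1 + c2 + 1" "f1 + f2 = f" "v1 + v2 = v + 1"
    "2 * (v1 + f1) = c1 + 3" "2 * (v2 + f2) = c2 + 3" for v f c c1 c2 f1 f2 v1 v2 :: nat
    using that by auto
  have pl: "plan ?C r a s"
    unfolding plan_def using m by (rule conjI) (rule arith[OF ld(4,5,8) eq1])
  have "dec (Suc n) r a s = Lp (dec n e \<alpha> \<sigma>) (dec n r \<alpha> \<sigma>)" for n
    unfolding dec_Suc[of d s r e a, OF ctx] gp(5,6) if_P[OF l] ..
  moreover have "hom id C1 a1 s1 \<alpha> \<sigma>" "hom id C2 a2 s2 \<alpha> \<sigma>"
    using cl1 cl2 v1 v2 by (auto simp: hom_def)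
  then have "dec n e \<alpha> \<sigma> = dec n e a1 s1" "dec n r \<alpha> \<sigma> = dec n r a2 s2" for n
    using dec_hom[of id C1 a1 s1 \<alpha> \<sigma> e n] dec_hom[of id C2 a2 s2 \<alpha> \<sigma> r n] q1 q2 by simp_all
  ultimately show thesis using that pl by metis
qed

lemma compose_join:
  assumes p0: "plan C0 r a0 s0" and q: "q < card (orbit s0 r)" and de: "d \<notin> C0" "e \<notin> C0" "d \<noteq> e"
  obtains a s where "plan (insert d (insert e C0)) r a s"
    "\<And>n. dec (Suc n) r a s = Jn (dec n r a0 s0) q"
proof -
  have m0: "mp C0 r a0 s0" using p0 by (simp add: plan_def)
  have q0: "finite C0" "r \<in> C0" "a0 r = r" "bij_betw s0 C0 C0"
      "\<And>x. x \<in> C0 - {r} \<Longrightarrow> a0 x \<in> C0 - {r} \<and> a0 x \<noteq> x \<and> a0 (a0 x) = x"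
    using m0 by (auto simp: mp_def pm_def)
  \<comment> \<open>\<open>y\<close> is the dart of the root vertex after which \<open>e\<close> is
    inserted: \<open>r\<close> and the \<open>q\<close> darts after it, up to \<open>y\<close>,
    yield \<open>q\<close> darts for the new vertex.\<close>
  define y where "y = (s0 ^^ q) r"
  have cl0: "a0 x \<in> C0" "s0 x \<in> C0" if "x \<in> C0" for x using mp_cl[OF m0 that] by auto
  have yC: "y \<in> C0" unfolding y_def using q0(2) cl0 by (induction q) auto
  define \<alpha> where "\<alpha> x = (if x \<in> C0 then a0 x else x)" for x
  define \<sigma>0 where "\<sigma>0 x = (if x \<in> C0 then s0 x else x)" for x
  define \<sigma> where "\<sigma> = \<sigma>0(y := e, e := s0 y)"
  define a where "a = \<alpha>(d := e, e := d)"
  define s where "s = \<sigma>(r := d, d := \<sigma> e, e := \<sigma> r)"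
  let ?C' = "insert e C0"
  have s0inj: "u = v" if "u \<in> C0" "v \<in> C0" "s0 u = s0 v" for u v
    using q0(4) that by (auto simp: bij_betw_def dest: inj_onD)
  have rem: "rem e \<sigma> = \<sigma>0"
    using de yC cl0 by (auto simp: rem_def \<sigma>_def \<sigma>0_def fun_eq_iff)
  have B: "bij_betw \<sigma> ?C' ?C'"
  proof (rule bij_endo)
    show "finite ?C'" using q0 by simp
    show "\<sigma> x \<in> ?C'" if "x \<in> ?C'" for x using that cl0 yC by (auto simp: \<sigma>_def \<sigma>0_def)
    define \<tau> where "\<tau> x = (if x = e then y else x)" for x
    have \<tau>: "\<sigma> x = s0 (\<tau> x)" "\<tau> x \<in> C0" if "x \<in> ?C'" "x \<noteq> y" for x
      using that yC de by (auto simp: \<sigma>_def \<sigma>0_def \<tau>_def)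
    have "y \<noteq> e" using yC de by auto
    then have sy: "\<sigma> y = e" by (simp add: \<sigma>_def)
    show "inj_on \<sigma> ?C'"
    proof (rule inj_onI)
      fix u v assume uv: "u \<in> ?C'" "v \<in> ?C'" "\<sigma> u = \<sigma> v"
      have z: "z = y" if "z \<in> ?C'" "\<sigma> z = e" for z
      proof (rule ccontr)
        assume "z \<noteq> y"
        then have "\<sigma> z \<in> C0" using \<tau>[OF that(1)] cl0 by simp
        then show False using that(2) de by simp
      qed
      show "u = v"
      proof (cases "u = y \<or> v = y")
        case True then show ?thesis using z uv sy by metis
      next
        case False
        then have "\<tau> u = \<tau> v" using \<tau>[OF uv(1)] \<tau>[OF uv(2)] uv(3) s0inj by auto
        then show ?thesis using False uv yC de by (auto simp: \<tau>_def split: if_splits)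
      qed
    qed
  qed
  have re: "r \<noteq> e" using q0 de by auto
  have A: "\<forall>x\<in>?C' - {r, e}. \<alpha> x \<in> ?C' - {r, e} \<and> \<alpha> x \<noteq> x \<and> \<alpha> (\<alpha> x) = x"
  proof
    fix x assume "x \<in> ?C' - {r, e}"
    then have "x \<in> C0 - {r}" by auto
    from q0(5)[OF this] this de show "\<alpha> x \<in> ?C' - {r, e} \<and> \<alpha> x \<noteq> x \<and> \<alpha> (\<alpha> x) = x"
      by (auto simp: \<alpha>_def)
  qed
  have fix1: "\<alpha> e = e" "\<alpha> r = r" "\<alpha> d = d" "\<sigma> d = d"
    using q0 de yC by (auto simp: \<alpha>_def \<sigma>_def \<sigma>0_def)
  have st: "finite ?C'" "r \<in> ?C'" "e \<in> ?C'" "d \<notin> ?C'" using q0 de by auto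
  note gp = glue_pm[OF st(1-3) re st(4) fix1(1,2) A fix1(3) B fix1(4) a_def s_def]
  note ctx = gp(2,3,4)
  let ?C = "insert d (insert e C0)"
  have sy: "\<sigma> y = e" using yC de by (auto simp: \<sigma>_def)
  let ?R = "reach a s r"
  have "reach a0 s0 r \<subseteq> ?R"
  proof
    fix x assume "x \<in> reach a0 s0 r"
    then have "x \<in> C0 \<and> x \<in> reach \<alpha> \<sigma> e \<union> reach \<alpha> \<sigma> r"
    proof (induction rule: reach_induct)
      case base then show ?case using q0 by auto
    next
      case (step x)
      then have x: "x \<in> C0" by simp
      have 1: "a0 x \<in> C0" "s0 x \<in> C0" using cl0[OF x] by auto
      have 2: "\<alpha> x = a0 x" using x by (simp add: \<alpha>_def)
      have "s0 x = \<sigma> (if x = y then e else x)" using x de yC by (auto simp: \<sigma>_def \<sigma>0_def)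
      moreover have "(if x = y then e else x) \<in> reach \<alpha> \<sigma> e \<union> reach \<alpha> \<sigma> r" using step by auto
      ultimately have "s0 x \<in> reach \<alpha> \<sigma> e \<union> reach \<alpha> \<sigma> r" using reach_step(2) by (metis UnCI UnE)
      moreover have "a0 x \<in> reach \<alpha> \<sigma> e \<union> reach \<alpha> \<sigma> r" using step reach_step(1) 2 by (metis UnCI UnE)
      ultimately show ?case using 1 by auto
    qed
    then show "x \<in> ?R" using gp(7,8) by auto
  qed
  then have m: "mp ?C r a s" using gp(1,9,10) mp_reach[OF m0] by (auto simp: mp_def)
  \<comment> \<open>If the new edge were a loop, the cut would separate \<open>e\<close> from the
    \<sigma>-orbit of \<open>r\<close>. That orbit, however, runs through \<open>y\<close>, whose
    successor is \<open>e\<close>.\<close>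
  have j: "e \<notin> orbit s r"
  proof
    assume l: "e \<in> orbit s r"
    have ns: "e \<notin> orbit \<sigma> r"
      using loop_orbits(2)[OF gp(1) ctx l] orbit_self[of e \<sigma>] unfolding gp(6) by blast
    have sub: "orbit \<sigma> r \<subseteq> ?C'" by (rule orbit_sub[OF B st(2)])
    have "y \<notin> orbit \<sigma> r" using ns orbit_step[of y \<sigma> r] sy by auto
    then have "(s0 ^^ k) r \<in> orbit \<sigma> r" for k
    proof (induction k)
      case (Suc k)
      then have "(s0 ^^ k) r \<in> C0" "(s0 ^^ k) r \<noteq> y" using sub ns by auto
      then have "s0 ((s0 ^^ k) r) = \<sigma> ((s0 ^^ k) r)" using de by (auto simp: \<sigma>_def \<sigma>0_def)
      then show ?case using orbit_step[OF Suc.IH[OF Suc.prems]] by simp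
    qed simp
    then show False using \<open>y \<notin> orbit \<sigma> r\<close> unfolding y_def by blast
  qed
  note js = join_step[OF m ctx j, unfolded gp(5,6) rem]
  have C0: "?C - {d, e} = C0" using de by auto
  have eqs: "orbits \<sigma>0 C0 = orbits s0 C0" "orbits (\<sigma>0 \<circ> \<alpha>) C0 = orbits (s0 \<circ> a0) C0"
    by (rule orbits_cong[symmetric]; use cl0 in \<open>auto simp: \<sigma>0_def \<alpha>_def\<close>)+
  have "2 * (nv \<sigma>0 C0 + nf \<alpha> \<sigma>0 C0) = card C0 + 3" unfolding eqs using p0 by (simp add: plan_def)
  then have pl: "plan ?C r a s"
    unfolding plan_def using m by (intro conjI iffD1[OF euler_join_arith(2)[OF js(2,3,4)]]) (simp_all add: C0)
  \<comment> \<open>\<open>join_pos\<close> finds \<open>y\<close> at the position recorded by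
    \<open>dec\<close>, while by definition \<open>y\<close> is at position \<open>q\<close>;
    positions along a cycle are unique.\<close>
  obtain P Q where PQ: "y = (\<sigma>0 ^^ (card (orbit s e) - 1)) r" "cyc \<sigma>0 (r # Q @ P)" "length Q = card (orbit s e) - 1"
    "y = (r # Q @ P) ! (card (orbit s e) - 1)"
  proof -
    obtain P Q y' where *: "\<sigma> y' = e" "y' = (\<sigma>0 ^^ (card (orbit s e) - 1)) r" "y' \<in> ?C - {d, e}"
      "cyc \<sigma>0 (r # Q @ P)" "length Q = card (orbit s e) - 1" "y' = (r # Q @ P) ! (card (orbit s e) - 1)"
      using join_pos[OF gp(1) ctx j, unfolded gp(6) rem] by metis
    have "y' = y" using *(1,3) sy B yC by (auto simp: bij_betw_def dest: inj_onD)
    then show thesis using that * by metis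
  qed
  have pow0: "(s0 ^^ k) r = (\<sigma>0 ^^ k) r \<and> (s0 ^^ k) r \<in> C0" for k
    using q0 cl0 by (induction k) (auto simp: \<sigma>0_def)
  have "orbit s0 r = orbit \<sigma>0 r" using pow0 by (auto simp: orbit_def)
  also have "\<dots> = set (r # Q @ P)" by (rule cyc_orbit[OF PQ(2)]) simp
  finally have "card (orbit s0 r) = length (r # Q @ P)" using PQ(2) distinct_card[of "r # Q @ P"] by (simp add: cyc_def)
  then have ql: "q < length (r # Q @ P)" using q by simp
  have "path \<sigma>0 (r # Q @ P) r" using PQ(2) by (simp add: cyc_def)
  then have "(\<sigma>0 ^^ q) r = (r # Q @ P) ! q" by (rule path_funpow) (use ql in simp)
  then have "(r # Q @ P) ! q = (r # Q @ P) ! (card (orbit s e) - 1)" using PQ(4) pow0[of q] unfolding y_def by simp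
  moreover have "card (orbit s e) - 1 < length (r # Q @ P)" using PQ(3) by simp
  moreover have "distinct (r # Q @ P)" using PQ(2) by (simp add: cyc_def)
  ultimately have qq: "card (orbit s e) - 1 = q" using ql nth_eq_iff_index_eq by metis
  have "dec (Suc n) r a s = Jn (dec n r \<alpha> \<sigma>0) q" for n
    unfolding dec_Suc[of d s r e a, OF ctx] gp(5,6) if_not_P[OF j] rem qq ..
  moreover have "hom id C0 a0 s0 \<alpha> \<sigma>0"
    using cl0 by (auto simp: hom_def \<alpha>_def \<sigma>0_def)
  then have "dec n r \<alpha> \<sigma>0 = dec n r a0 s0" for n
    using dec_hom[of id C0 a0 s0 \<alpha> \<sigma>0 r n] q0 by simp
  ultimately show thesis using that pl by metis
qed

lemma dec_surj: "valid t \<Longrightarrow> \<exists>C r a s. plan C r a s \<and> (\<forall>n\<ge>edges t. dec n r a s = t)"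
proof (induction t)
  case Vx
  have "dec n 0 id id = Vx" for n by (cases n) simp_all
  moreover have "mp {0} 0 id id" by (simp add: mp_def pm_def)
  then have "plan {0} 0 id id" using nv_single[of id 0] by (simp add: plan_def)
  ultimately show ?case by blast
next
  case (Lp x y)
  obtain C1 e a1 s1 where 1: "plan C1 e a1 s1" "\<And>n. n \<ge> edges x \<Longrightarrow> dec n e a1 s1 = x" using Lp by auto
  obtain C2 r a2 s2 where 2: "plan C2 r a2 s2" "\<And>n. n \<ge> edges y \<Longrightarrow> dec n r a2 s2 = y" using Lp by auto
  \<comment> \<open>Residues modulo 3 make the two dart sets disjoint and leave the dart 2 free for
    the new root edge.\<close>
  define f1 where "f1 x = 3 * x" for x :: nat
  define f2 where "f2 x = 3 * x + 1" for x :: nat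
  have inj: "inj_on f1 C1" "inj_on f2 C2" by (auto simp: inj_on_def f1_def f2_def)
  obtain a1' s1' where i1: "iso f1 C1 e a1 s1 (f1 ` C1) (f1 e) a1' s1'" using iso_transport[OF inj(1)] by metis
  obtain a2' s2' where i2: "iso f2 C2 r a2 s2 (f2 ` C2) (f2 r) a2' s2'" using iso_transport[OF inj(2)] by metis
  have m: "mp C1 e a1 s1" "mp C2 r a2 s2" using 1 2 by (simp_all add: plan_def)
  have "f1 ` C1 \<inter> f2 ` C2 = {}" "2 \<notin> f1 ` C1 \<union> f2 ` C2" unfolding f1_def f2_def by (auto; presburger)+
  from compose_loop[OF plan_iso[OF 1(1) i1] plan_iso[OF 2(1) i2] this]
  obtain a s where as: "plan (insert 2 (f1 ` C1 \<union> f2 ` C2)) (f2 r) a s"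
    "\<And>n. dec (Suc n) (f2 r) a s = Lp (dec n (f1 e) a1' s1') (dec n (f2 r) a2' s2')" by blast
  have "dec n (f2 r) a s = Lp x y" if n: "n \<ge> edges (Lp x y)" for n
  proof -
    obtain k where k: "n = Suc k" using n by (cases n) auto
    then show ?thesis using as(2)[of k] 1(2)[of k] 2(2)[of k] n dec_iso[OF m(1) i1] dec_iso[OF m(2) i2] by auto
  qed
  then show ?case using as(1) by blast
next
  case (Jn x q)
  obtain C0 r a0 s0 where 0: "plan C0 r a0 s0" "\<And>n. n \<ge> edges x \<Longrightarrow> dec n r a0 s0 = x" using Jn by auto
  have f: "finite C0" using plan_fin[OF 0(1) plan_root[OF 0(1)]] by simp
  define d where "d = Suc (Max C0)"
  define e where "e = Suc d"
  have de: "d \<notin> C0" "e \<notin> C0" "d \<noteq> e" using Max_ge[OF f] unfolding e_def d_def by fastforce+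
  have "stats C0 r a0 s0 x" using dec_stats[OF 0(1), of "card C0 + edges x"] 0(2)[of "card C0 + edges x"] by auto
  then have "q < card (orbit s0 r)" using Jn by (auto simp: stats_def)
  from compose_join[OF 0(1) this de] obtain a s where as: "plan (insert d (insert e C0)) r a s"
    "\<And>n. dec (Suc n) r a s = Jn (dec n r a0 s0) q" by blast
  have "dec n r a s = Jn x q" if n: "n \<ge> edges (Jn x q)" for n
  proof -
    obtain k where k: "n = Suc k" using n by (cases n) auto
    then show ?thesis using as(2)[of k] 0(2)[of k] n by auto
  qed
  then show ?case using as(1) by blast
qed

section \<open>Labelled maps and terms\<close>

text \<open>Inserts the extra dart \<open>2 * n\<close> in front of the root dart 0.\<close>

definition tok :: "nat \<Rightarrow> (nat \<Rightarrow> nat) \<Rightarrow> nat \<Rightarrow> nat" where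
  "tok n s = (\<lambda>x. if x = 2 * n then 0 else if s x = 0 then 2 * n else s x)"

definition mdec :: "nat \<Rightarrow> (nat \<Rightarrow> nat) \<times> (nat \<Rightarrow> nat) \<Rightarrow> tm" where
  "mdec n M = (case M of (a, s) \<Rightarrow> dec n (2 * n) a (tok n s))"

lemma darts_eq: "darts n = {..2 * n} - {2 * n}"
  by (auto simp: darts_def)

lemma reach_token:
  assumes t: "t (2 * n) = 0" "n \<ge> 1" and a: "a (2 * n) = 2 * n" "\<And>x. x \<in> darts n \<Longrightarrow> a x \<in> darts n"
    and tc: "\<And>x. x \<in> darts n \<Longrightarrow> t x \<in> {..2 * n}"
  shows "{..2 * n} \<subseteq> reach a t (2 * n) \<longleftrightarrow> darts n \<subseteq> reach a (rem (2 * n) t) 0"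
proof
  have 0: "0 \<in> darts n" using t by (simp add: darts_def)
  assume r: "{..2 * n} \<subseteq> reach a t (2 * n)"
  show "darts n \<subseteq> reach a (rem (2 * n) t) 0"
  proof
    fix y assume y: "y \<in> darts n"
    then have "y \<in> reach a t (2 * n)" using r by (auto simp: darts_def)
    then have "y = 2 * n \<or> y \<in> darts n \<and> y \<in> reach a (rem (2 * n) t) 0"
    proof (induction rule: reach_induct)
      case (step y)
      then consider "y = 2 * n" | "y \<in> darts n" "y \<in> reach a (rem (2 * n) t) 0" by blast
      then show ?case
      proof cases
        case 1
        then show ?thesis using a t 0 by simp
      next
        case 2
        have "rem (2 * n) t y \<in> reach a (rem (2 * n) t) 0" "a y \<in> reach a (rem (2 * n) t) 0" using reach_step 2 by blast+
        moreover have "t y = 2 * n \<or> t y = rem (2 * n) t y \<and> t y \<in> darts n" using 2(1) tc[OF 2(1)] by (auto simp: rem_def darts_def)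
        ultimately show ?thesis using a(2)[OF 2(1)] by auto
      qed
    qed simp
    then show "y \<in> reach a (rem (2 * n) t) 0" using y by (auto simp: darts_def)
  qed
next
  have s0: "0 \<in> reach a t (2 * n)" using reach_step(2)[OF reach_self, of t "2 * n" a] t by simp
  assume r: "darts n \<subseteq> reach a (rem (2 * n) t) 0"
  have "y \<in> reach a t (2 * n)" if "y \<in> reach a (rem (2 * n) t) 0" for y
    using that
  proof (induction rule: reach_induct)
    case (step y)
    then have "t y \<in> reach a t (2 * n)" "a y \<in> reach a t (2 * n)" using reach_step by blast+
    then show ?case using s0 t by (auto simp: rem_def)
  qed (rule s0)
  note key = this
  show "{..2 * n} \<subseteq> reach a t (2 * n)"
  proof
    fix y assume "y \<in> {..2 * n}"
    then consider "y = 2 * n" | "y \<in> darts n" by (force simp: darts_def)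
    then show "y \<in> reach a t (2 * n)" using key r by cases auto
  qed
qed

lemma euler_int: "int v - int n + int f = 2 \<longleftrightarrow> 2 * (v + f) = Suc (2 * n) + 3"
  by presburger

text \<open>Bypassing the extra dart changes neither the number of vertices nor that of faces, and
  it preserves connectedness, so both sides express the same Euler relation.\<close>

lemma lab_iff:
  assumes n: "n \<ge> 1" and t: "t (2 * n) = 0" and id: "\<And>x. x > 2 * n \<Longrightarrow> a x = x \<and> t x = x" "a (2 * n) = 2 * n"
    and bij: "bij_betw t {..2 * n} {..2 * n}" and s: "s = rem (2 * n) t"
  shows "(a, s) \<in> lab_maps n \<longleftrightarrow> plan {..2 * n} (2 * n) a t"
proof -
  have bs: "bij_betw s (darts n) (darts n)" unfolding s darts_eq by (rule bij_rem[OF bij]) auto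
  have sid: "s x = x" if "x \<notin> darts n" for x
    using that id(1)[of x] by (cases "x = 2 * n") (auto simp: s rem_def darts_def)
  have t2: "t (2 * n) \<noteq> 2 * n" using t n by simp
  have V: "card (orbits s (darts n)) = nv t {..2 * n}"
    unfolding s darts_eq by (rule card_orbits_rem(1)[OF bij]) (use t2 in auto)
  have inv: "(\<forall>d\<in>darts n. a d \<noteq> d \<and> a (a d) = d \<and> a d \<in> darts n) \<Longrightarrow> bij_betw a (darts n) (darts n)"
    by (rule bij_betw_byWitness[where f' = a]) auto
  have A: "bij_betw a (darts n) (darts n) \<and> (\<forall>d\<in>darts n. a d \<noteq> d \<and> a (a d) = d) \<longleftrightarrow>
    (\<forall>x\<in>{..2 * n} - {2 * n}. a x \<in> {..2 * n} - {2 * n} \<and> a x \<noteq> x \<and> a (a x) = x)"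
    unfolding darts_eq[symmetric] using inv by (auto simp: bij_betw_def)
  have aid: "\<forall>x. x \<notin> darts n \<longrightarrow> a x = x \<and> s x = x"
    using sid id by (metis darts_def lessThan_iff linorder_neqE_nat)
  have lab: "(a, s) \<in> lab_maps n \<longleftrightarrow> (bij_betw a (darts n) (darts n) \<and> (\<forall>d\<in>darts n. a d \<noteq> d \<and> a (a d) = d)) \<and>
     darts n \<subseteq> reach a s 0 \<and> int (card (orbits s (darts n))) - int n + int (card (orbits (s \<circ> a) (darts n))) = 2"
    unfolding lab_maps_def reach_def using bs aid by auto
  show ?thesis
  proof (cases "bij_betw a (darts n) (darts n) \<and> (\<forall>d\<in>darts n. a d \<noteq> d \<and> a (a d) = d)")
    case False
    then show ?thesis unfolding lab plan_def mp_def pm_def using A by blast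
  next
    case True
    then have acl: "a x \<in> darts n" if "x \<in> darts n" for x using that by (auto simp: bij_betw_def)
    have pm: "pm {..2 * n} (2 * n) a t" using True A bij id by (auto simp: pm_def)
    have tcl: "t x \<in> {..2 * n}" if "x \<in> darts n" for x using bij that by (auto simp: bij_betw_def darts_def)
    have F: "card (orbits (s \<circ> a) (darts n)) = nf a t {..2 * n}"
    proof -
      have bp: "bij_betw (t \<circ> a) {..2 * n} {..2 * n}" using bij_alpha[OF pm] bij by (rule bij_betw_trans)
      have ne: "(t \<circ> a) (2 * n) \<noteq> 2 * n" using id t n by simp
      have "orbits (rem (2 * n) (t \<circ> a)) (darts n) = orbits (s \<circ> a) (darts n)"
      proof (rule orbits_cong)
        fix x assume x: "x \<in> darts n"
        show "rem (2 * n) (t \<circ> a) x \<in> darts n"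
          using bij_rem[OF bp, of "2 * n"] x unfolding darts_eq by (auto simp: bij_betw_def simp del: o_apply)
        have "x \<noteq> 2 * n" "a x \<noteq> 2 * n" using acl[OF x] x by (auto simp: darts_def)
        then show "rem (2 * n) (t \<circ> a) x = (s \<circ> a) x" using id(2) by (simp add: rem_def s)
      qed
      moreover have "card (orbits (rem (2 * n) (t \<circ> a)) (darts n)) = nf a t {..2 * n}"
        unfolding darts_eq by (rule card_orbits_rem(1)[OF bp _ _ ne]) auto
      ultimately show ?thesis by simp
    qed
    have R: "{..2 * n} \<subseteq> reach a t (2 * n) \<longleftrightarrow> darts n \<subseteq> reach a s 0"
      unfolding s by (rule reach_token) (use t n id(2) acl tcl in \<open>blast+\<close>)
    show ?thesis unfolding lab plan_def mp_def V F euler_int R card_atMost using True pm by blast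
  qed
qed

lemma tok_props: assumes "n \<ge> 1" "(a, s) \<in> lab_maps n"
  shows "plan {..2 * n} (2 * n) a (tok n s)" "rem (2 * n) (tok n s) = s" "tok n s (2 * n) = 0"
proof -
  have bs: "bij_betw s (darts n) (darts n)" and id: "\<And>x. x \<notin> darts n \<Longrightarrow> a x = x \<and> s x = x"
    using assms(2) by (auto simp: lab_maps_def)
  have 0: "0 \<in> darts n" using assms by (simp add: darts_def)
  have s2: "s (2 * n) = 2 * n" using id[of "2 * n"] by (simp add: darts_def)
  show t0: "tok n s (2 * n) = 0" by (simp add: tok_def)
  have cl: "s x < 2 * n" if "x < 2 * n" for x using bs that by (auto simp: bij_betw_def darts_def)
  have inj: "x = y" if "s x = s y" "x < 2 * n" "y < 2 * n" for x y
    using bs that by (auto simp: bij_betw_def darts_def dest: inj_onD)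
  have out: "s x \<noteq> 0" if "x \<ge> 2 * n" for x using id[of x] that assms by (simp add: darts_def)
  show r: "rem (2 * n) (tok n s) = s"
  proof
    fix x
    have "s x = 2 * n \<Longrightarrow> x = 2 * n" using cl[of x] id[of x] by (cases "x < 2 * n") (auto simp: darts_def)
    then show "rem (2 * n) (tok n s) x = s x"
      using s2 cl[of x] id[of x] assms by (auto simp: rem_def tok_def darts_def)
  qed
  have b: "bij_betw (tok n s) {..2 * n} {..2 * n}"
  proof (rule bij_endo)
    show "tok n s x \<in> {..2 * n}" if "x \<in> {..2 * n}" for x using that cl[of x] by (auto simp: tok_def)
    show "inj_on (tok n s) {..2 * n}"
    proof (rule inj_onI)
      fix x y assume xy: "x \<in> {..2 * n}" "y \<in> {..2 * n}" "tok n s x = tok n s y"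
      have *: "s z = 0 \<Longrightarrow> z < 2 * n" for z using out[of z] by fastforce
      show "x = y"
        using xy inj[of x y] cl[of x] cl[of y] * assms(1) by (auto simp: tok_def split: if_splits)
    qed
  qed simp
  have "a (2 * n) = 2 * n" using id[of "2 * n"] by (simp add: darts_def)
  moreover have "a x = x \<and> tok n s x = x" if "x > 2 * n" for x
    using id[of x] that out[of x] by (auto simp: darts_def tok_def)
  ultimately show "plan {..2 * n} (2 * n) a (tok n s)"
    using lab_iff[OF assms(1) t0 _ _ b r[symmetric]] assms(2) by blast
qed

lemma mdec_stats: assumes "n \<ge> 1" "(a, s) \<in> lab_maps n"
  defines "t \<equiv> mdec n (a, s)"
  shows "valid t" "edges t = n" "rdeg t = card (orbit s 0)" "faces t = card (orbits (s \<circ> a) (darts n))"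
    "nonroot t = card (orbits s (darts n)) - 1"
    "cnt t k = card {W \<in> orbits s (darts n). W \<noteq> orbit s 0 \<and> card W = k}"
proof -
  note tp = tok_props[OF assms(1,2)]
  let ?t = "tok n s"
  have st: "stats {..2 * n} (2 * n) a ?t t" unfolding t_def mdec_def using dec_stats[OF tp(1)] by simp
  have bij: "bij_betw ?t {..2 * n} {..2 * n}" using tp(1) by (simp add: plan_def mp_def pm_def)
  have t2: "?t (2 * n) \<noteq> 2 * n" using tp(3) assms(1) by simp
  show "valid t" "edges t = n" using st by (auto simp: stats_def)
  have in_C: "(0::nat) \<in> {..2 * n}" "2 * n \<in> {..2 * n}" "0 \<noteq> 2 * n" using assms(1) by auto
  note orr = orbit_rem[OF bij _ in_C(2) t2, unfolded tp(2)]
  note cor = card_orbits_rem[OF bij _ in_C(2) t2, unfolded tp(2), folded darts_eq]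
  have o0: "orbit ?t 0 = orbit ?t (2 * n)"
    using orbit_eq[OF bij _ in_C(2) orbit_step[OF orbit_self]] tp(3) by simp
  then have os: "orbit s 0 = orbit ?t (2 * n) - {2 * n}" using orr[OF _ in_C(1,3)] by simp
  have fin: "finite (orbit ?t (2 * n))" using plan_fin[OF tp(1) in_C(2)] by simp
  have "card (orbit s 0) = card (orbit ?t (2 * n)) - 1" using os fin by simp
  moreover have "card (orbit ?t (2 * n)) = rdeg t + 1" using st unfolding stats_def by blast
  ultimately show "rdeg t = card (orbit s 0)" by simp
  have Veq: "card (orbits s (darts n)) = nv ?t {..2 * n}" using cor(1) by simp
  moreover have "nv ?t {..2 * n} = nonroot t + 1" using st unfolding stats_def by blast
  ultimately show "nonroot t = card (orbits s (darts n)) - 1" by simp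
  \<comment> \<open>The faces are compared through Euler's formula on both sides, since the vertex
    counts are already known to agree.\<close>
  have lab: "int (card (orbits s (darts n))) - int n + int (card (orbits (s \<circ> a) (darts n))) = 2"
    using assms(2) by (auto simp: lab_maps_def)
  have "2 * (nv ?t {..2 * n} + nf a ?t {..2 * n}) = Suc (2 * n) + 3" using tp(1) unfolding plan_def card_atMost by blast
  moreover have "2 * (card (orbits s (darts n)) + card (orbits (s \<circ> a) (darts n))) = Suc (2 * n) + 3"
    using lab unfolding euler_int .
  ultimately have "card (orbits (s \<circ> a) (darts n)) = nf a ?t {..2 * n}" unfolding Veq by simp
  moreover have "nf a ?t {..2 * n} = faces t" using st unfolding stats_def by blast
  ultimately show "faces t = card (orbits (s \<circ> a) (darts n))" by simp
  \<comment> \<open>Only the root vertex contains the extra dart, so bypassing that dart leaves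
    every other vertex as it is.\<close>
  have sets: "{W \<in> orbits s (darts n). W \<noteq> orbit s 0} = orbits ?t {..2 * n} - {orbit ?t (2 * n)}"
  proof -
    have W: "(2 * n \<in> W \<longrightarrow> W = orbit ?t (2 * n)) \<and> W \<noteq> {}" if "W \<in> orbits ?t {..2 * n}" for W
    proof -
      from that obtain x where x: "x \<in> {..2 * n}" "W = orbit ?t x" unfolding orbits_def by blast
      show ?thesis using orbit_eq[OF bij finite_atMost x(1), of "2 * n"] orbit_self[of x ?t] unfolding x(2) by blast
    qed
    have "orbit s 0 \<noteq> {}" using orbit_self by blast
    have dis: "W \<inter> orbit ?t (2 * n) = {}" if "W \<in> orbits ?t {..2 * n}" "W \<noteq> orbit ?t (2 * n)" for W
    proof -
      from that(1) obtain x where x: "x \<in> {..2 * n}" "W = orbit ?t x" unfolding orbits_def by blast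
      show ?thesis using orbit_disj[OF bij finite_atMost x(1) in_C(2)] that(2) unfolding x(2) by blast
    qed
    have me: "orbit ?t (2 * n) \<in> orbits ?t {..2 * n}" by (auto simp: orbits_def)
    show ?thesis
    proof (intro equalityI subsetI)
      fix Z assume "Z \<in> {W \<in> orbits s (darts n). W \<noteq> orbit s 0}"
      then obtain W where ZW: "W \<in> orbits ?t {..2 * n}" "Z = W - {2 * n}" "Z \<noteq> orbit s 0" using cor(2) by auto
      then have "W \<noteq> orbit ?t (2 * n)" using os by auto
      then show "Z \<in> orbits ?t {..2 * n} - {orbit ?t (2 * n)}" using ZW W[OF ZW(1)] by auto
    next
      fix Z assume Z: "Z \<in> orbits ?t {..2 * n} - {orbit ?t (2 * n)}"
      then have "2 * n \<notin> Z" using W by auto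
      then have "Z = Z - {2 * n}" by auto
      then have 1: "Z \<in> orbits s (darts n)" using cor(2) Z by auto
      have "Z \<noteq> orbit s 0" using dis[of Z] Z os W[of Z] by auto
      then show "Z \<in> {W \<in> orbits s (darts n). W \<noteq> orbit s 0}" using 1 by simp
    qed
  qed
  have "{W \<in> orbits s (darts n). W \<noteq> orbit s 0 \<and> card W = k} =
    {W \<in> {W \<in> orbits s (darts n). W \<noteq> orbit s 0}. card W = k}" by auto
  moreover have "card {W \<in> orbits ?t {..2 * n} - {orbit ?t (2 * n)}. card W = k} = cnt t k"
    using st unfolding stats_def by blast
  ultimately show "cnt t k = card {W \<in> orbits s (darts n). W \<noteq> orbit s 0 \<and> card W = k}"
    unfolding sets by simp
qed

text \<open>The dart 0 follows the extra dart, so a relabelling that fixes 0 extends to one fixing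
  the extra dart, and conversely. Then \<open>dec_iso\<close> and \<open>dec_inj\<close>
  apply.\<close>

lemma map_iso_iff: assumes n: "n \<ge> 1" and l: "(a, s) \<in> lab_maps n" "(a', s') \<in> lab_maps n"
  shows "((a, s), (a', s')) \<in> map_iso n \<longleftrightarrow> mdec n (a, s) = mdec n (a', s')"
proof
  note tp = tok_props[OF n l(1)] tok_props[OF n l(2)]
  have id: "s x = x" "a x = x" "s' x = x" "a' x = x" if "x \<notin> darts n" for x
    using l that by (auto simp: lab_maps_def)
  have 0: "0 \<in> darts n" using n by (simp add: darts_def)
  { assume "((a, s), (a', s')) \<in> map_iso n"
    then obtain \<pi> where \<pi>: "bij_betw \<pi> (darts n) (darts n)" "\<pi> 0 = 0"
      "\<And>d. d \<in> darts n \<Longrightarrow> \<pi> (a d) = a' (\<pi> d) \<and> \<pi> (s d) = s' (\<pi> d)"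
      by (auto simp: map_iso_def)
    define \<rho> where "\<rho> = \<pi>(2 * n := 2 * n)"
    have dn: "2 * n \<notin> darts n" by (simp add: darts_def)
    have ins: "insert (2 * n) (darts n) = {..2 * n}" by (auto simp: darts_def)
    have \<rho>: "\<rho> x = \<pi> x" if "x \<in> darts n" for x using that dn by (auto simp: \<rho>_def)
    have "bij_betw \<rho> (darts n) (darts n)" using \<pi>(1) \<rho> bij_betw_cong[of "darts n" \<rho> \<pi>] by simp
    then have b: "bij_betw \<rho> {..2 * n} {..2 * n}"
      using notIn_Un_bij_betw[of "2 * n" "darts n" \<rho> "darts n"] dn ins by (simp add: \<rho>_def)
    have acl: "a x \<in> darts n" "s x \<in> darts n" if "x \<in> darts n" for x using l(1) that by (auto simp: lab_maps_def bij_betw_def)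
    have "\<rho> (a x) = a' (\<rho> x) \<and> \<rho> (tok n s x) = tok n s' (\<rho> x)" if "x \<in> {..2 * n}" for x
    proof (cases "x = 2 * n")
      case True
      then show ?thesis using id[OF dn] \<rho>[OF 0] \<pi>(2) by (simp add: \<rho>_def tok_def)
    next
      case False
      then have x: "x \<in> darts n" using that by (simp add: darts_def)
      have px: "\<pi> x \<in> darts n" using \<pi>(1) x by (auto simp: bij_betw_def)
      have "\<pi> (s x) = 0 \<longleftrightarrow> s x = 0"
        using \<pi>(1,2) inj_on_eq_iff[of \<pi> "darts n" "s x" 0] acl(2)[OF x] 0 by (simp add: bij_betw_def)
      then show ?thesis using \<rho>[OF x] \<rho>[OF acl(1)[OF x]] \<rho>[OF acl(2)[OF x]] \<pi>(3)[OF x] False px dn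
        by (auto simp: tok_def \<rho>_def)
    qed
    then have i: "iso \<rho> {..2 * n} (2 * n) a (tok n s) {..2 * n} (2 * n) a' (tok n s')"
      using b by (simp add: iso_def \<rho>_def)
    have "mp {..2 * n} (2 * n) a (tok n s)" using tp(1) by (simp add: plan_def)
    from dec_iso[OF this i] show "mdec n (a, s) = mdec n (a', s')" by (simp add: mdec_def) }
  { assume "mdec n (a, s) = mdec n (a', s')"
    then have "dec n (2 * n) a (tok n s) = dec n (2 * n) a' (tok n s')" by (simp add: mdec_def)
    from dec_inj[OF tp(1,4) _ _ this] obtain \<pi>
      where \<pi>: "iso \<pi> {..2 * n} (2 * n) a (tok n s) {..2 * n} (2 * n) a' (tok n s')" by auto
    have im: "\<pi> (2 * n) = 2 * n" and b: "bij_betw \<pi> {..2 * n} {..2 * n}"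
      and com: "\<And>x. x \<le> 2 * n \<Longrightarrow> \<pi> (a x) = a' (\<pi> x) \<and> \<pi> (tok n s x) = tok n s' (\<pi> x)"
      using \<pi> by (auto simp: iso_def)
    have p0: "\<pi> 0 = 0" using com[of "2 * n"] im tp(3,6) by simp
    have "{..2 * n} = darts n \<union> {2 * n}" by (auto simp: darts_def)
    then have b': "bij_betw \<pi> (darts n) (darts n)"
      using b notIn_Un_bij_betw3[of "2 * n" "darts n" \<pi> "darts n"] im by (simp add: darts_def)
    have "\<pi> (s x) = s' (\<pi> x)" if x: "x \<in> darts n" for x
    proof -
      have px: "\<pi> x \<in> darts n" using b' x by (auto simp: bij_betw_def)
      then have ne: "x \<noteq> 2 * n" "\<pi> x \<noteq> 2 * n" using x by (auto simp: darts_def)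
      have tc: "tok n s x \<le> 2 * n" using tp(1) x by (auto simp: plan_def mp_def pm_def bij_betw_def darts_def)
      have "\<pi> (tok n s x) = 2 * n \<longleftrightarrow> tok n s x = 2 * n"
        using b im tc inj_on_eq_iff[of \<pi> "{..2 * n}" "tok n s x" "2 * n"] by (simp add: bij_betw_def)
      moreover have "s x = (if tok n s x = 2 * n then 0 else tok n s x)"
        "s' (\<pi> x) = (if tok n s' (\<pi> x) = 2 * n then 0 else tok n s' (\<pi> x))"
        using tp(2,5) tp(3,6) ne unfolding rem_def fun_eq_iff by metis+
      ultimately show ?thesis using com[of x] x p0 by (auto simp: darts_def)
    qed
    then show "((a, s), (a', s')) \<in> map_iso n"
      using b' p0 com l by (auto simp: map_iso_def darts_def) }
qed

lemma mdec_surj: assumes "valid t" "edges t = n" "n \<ge> 1"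
  obtains M where "M \<in> lab_maps n" "mdec n M = t"
proof -
  obtain C r a s where pl: "plan C r a s" and dt: "\<And>k. k \<ge> n \<Longrightarrow> dec k r a s = t" using dec_surj[OF assms(1)] assms(2) by auto
  have "stats C r a s t" using dec_stats[OF pl, of "card C + n"] dt[of "card C + n"] by auto
  then have cC: "card C = 2 * n + 1" using assms(2) by (simp add: stats_def)
  have fC: "finite C" "r \<in> C" using plan_fin[OF pl plan_root[OF pl]] plan_root[OF pl] by auto
  have sr: "s r \<noteq> r" using plan_single(1)[OF pl] cC assms(3) by auto
  have sC: "s r \<in> C" using pl fC by (auto simp: plan_def mp_def pm_def bij_betw_def)
  have "card (C - {r, s r}) = 2 * n - 1" using cC fC sC sr by (simp add: card_Diff_subset)
  moreover have "card {1..<2 * n} = 2 * n - 1" by simp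
  ultimately obtain f where f: "bij_betw f (C - {r, s r}) {1..<2 * n}"
    using finite_same_card_bij[of "C - {r, s r}" "{1..<2 * n}"] fC by auto
  \<comment> \<open>The extra dart must become \<open>2 * n\<close> and its successor the root dart
    0; the other darts are numbered arbitrarily.\<close>
  define \<pi> where "\<pi> = f(r := 2 * n, s r := 0)"
  have b1: "bij_betw \<pi> (C - {r, s r}) {1..<2 * n}"
    using f bij_betw_cong[of "C - {r, s r}" \<pi> f] by (simp add: \<pi>_def)
  have b2: "bij_betw \<pi> (insert r (C - {r, s r})) (insert (2 * n) {1..<2 * n})"
    using b1 sr notIn_Un_bij_betw[of r "C - {r, s r}" \<pi> "{1..<2 * n}"] by (simp add: \<pi>_def)
  have b3: "bij_betw \<pi> (insert (s r) (insert r (C - {r, s r}))) (insert 0 (insert (2 * n) {1..<2 * n}))"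
    using b2 sr assms(3) notIn_Un_bij_betw[of "s r" "insert r (C - {r, s r})" \<pi> "insert (2 * n) {1..<2 * n}"]
    by (simp add: \<pi>_def)
  have "insert (s r) (insert r (C - {r, s r})) = C" "insert 0 (insert (2 * n) {1..<2 * n}) = {..2 * n}"
    using fC sC assms(3) by auto
  then have b: "bij_betw \<pi> C {..2 * n}" using b3 by simp
  have \<pi>r: "\<pi> r = 2 * n" "\<pi> (s r) = 0" using sr by (auto simp: \<pi>_def)
  have img: "\<pi> ` C = {..2 * n}" using b by (simp add: bij_betw_def)
  obtain a' t' where i: "iso \<pi> C r a s (\<pi> ` C) (\<pi> r) a' t'" and out: "\<And>y. y \<notin> \<pi> ` C \<Longrightarrow> a' y = y \<and> t' y = y"
    using iso_transport[of \<pi> C r a s] b by (auto simp: bij_betw_def)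
  have pl': "plan {..2 * n} (2 * n) a' t'" using plan_iso[OF pl i] img \<pi>r by simp
  have t0: "t' (2 * n) = 0" using i fC \<pi>r by (auto simp: iso_def)
  have a2: "a' (2 * n) = 2 * n" and bt: "bij_betw t' {..2 * n} {..2 * n}" using pl' by (auto simp: plan_def mp_def pm_def)
  have id: "a' x = x \<and> t' x = x" if "x > 2 * n" for x using out[of x] img that by auto
  have lab: "(a', rem (2 * n) t') \<in> lab_maps n"
    using lab_iff[OF assms(3) t0 id a2 bt refl] pl' by blast
  have inj: "x = y" if "t' x = t' y" "x \<le> 2 * n" "y \<le> 2 * n" for x y
    using bt that by (auto simp: bij_betw_def dest: inj_onD)
  have "tok n (rem (2 * n) t') = t'"
  proof
    fix x
    show "tok n (rem (2 * n) t') x = t' x"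
    proof (cases "x > 2 * n")
      case True
      then have "t' x = x" using id by blast
      then show ?thesis using True by (simp add: tok_def rem_def)
    next
      case False
      then have x: "x \<le> 2 * n" by simp
      show ?thesis
      proof (cases "x = 2 * n")
        case True
        then show ?thesis using t0 by (simp add: tok_def)
      next
        case ne: False
        then have "t' x \<noteq> 0" using inj[of x "2 * n"] t0 x by auto
        then show ?thesis using ne t0 by (simp add: tok_def rem_def)
      qed
    qed
  qed
  moreover have "mp C r a s" using pl by (simp add: plan_def)
  ultimately have "mdec n (a', rem (2 * n) t') = t"
    using dec_iso[OF _ i, of n] dt[of n] \<pi>r by (simp add: mdec_def)
  then show thesis using that lab by blast
qed

definition tw :: "(nat \<Rightarrow> mser) \<Rightarrow> (nat \<Rightarrow> mser) \<Rightarrow> nat \<Rightarrow> tm \<Rightarrow> mser" where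
  "tw g h n t = mmul (mpow (mvar 0) (faces t)) (mmul (mpow (mvar 1) (nonroot t))
     (mmul (mpow (mvar 2) n) (mmul (mprod_upto (2 * n + 1) (\<lambda>k. mpow (g k) (cnt t k))) (h (rdeg t)))))"

text \<open>By \<open>map_iso_iff\<close> and \<open>mdec_surj\<close>, \<open>mdec\<close> induces
  a bijection from classes to valid terms, and the weight of a map is a function of its term. The
  choice of representatives is therefore harmless.\<close>

lemma sum_classes: assumes n: "n \<ge> 1"
  shows "(\<Sum>X\<in>lab_maps n // map_iso n. map_weight g h n (SOME M. M \<in> X) \<gamma>) =
    (\<Sum>t\<in>{t. valid t \<and> edges t = n}. tw g h n t \<gamma>)"
proof -
  let ?Q = "lab_maps n // map_iso n"
  have iff: "(M, M') \<in> map_iso n \<longleftrightarrow> M \<in> lab_maps n \<and> M' \<in> lab_maps n \<and> mdec n M = mdec n M'" for M M'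
  proof (cases "M \<in> lab_maps n \<and> M' \<in> lab_maps n")
    case True
    then show ?thesis using map_iso_iff[OF n, of "fst M" "snd M" "fst M'" "snd M'"] by simp
  next
    case False
    then show ?thesis by (auto simp: map_iso_def)
  qed
  have cls: "\<exists>M\<in>lab_maps n. X = {M'\<in>lab_maps n. mdec n M' = mdec n M}" if "X \<in> ?Q" for X
    using that iff by (fastforce simp: quotient_def Image_def)
  have cls': "{M'\<in>lab_maps n. mdec n M' = mdec n M} \<in> ?Q" if "M \<in> lab_maps n" for M
    using that iff by (fastforce simp: quotient_def Image_def)
  define c where "c X = (SOME M. M \<in> X)" for X :: "((nat \<Rightarrow> nat) \<times> (nat \<Rightarrow> nat)) set"
  have c: "c X \<in> X" if "X \<in> ?Q" for X
    unfolding c_def using cls[OF that] by (metis (mono_tags, lifting) mem_Collect_eq someI)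
  have cX: "c X \<in> lab_maps n \<and> X = {M'\<in>lab_maps n. mdec n M' = mdec n (c X)}" if XQ: "X \<in> ?Q" for X
  proof -
    obtain M where M: "X = {M'\<in>lab_maps n. mdec n M' = mdec n M}" using cls[OF XQ] by blast
    have cm: "c X \<in> lab_maps n" "mdec n (c X) = mdec n M" using c[OF XQ] M by blast+
    show ?thesis unfolding cm(2) using cm(1) M by blast
  qed
  have bij: "bij_betw (\<lambda>X. mdec n (c X)) ?Q {t. valid t \<and> edges t = n}"
  proof (rule bij_betw_imageI, rule inj_onI)
    fix X Y assume XY: "X \<in> ?Q" "Y \<in> ?Q" "mdec n (c X) = mdec n (c Y)"
    have "X = {M'\<in>lab_maps n. mdec n M' = mdec n (c X)}" using cX[OF XY(1)] by (rule conjunct2)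
    also have "\<dots> = {M'\<in>lab_maps n. mdec n M' = mdec n (c Y)}" unfolding XY(3) ..
    also have "\<dots> = Y" by (rule conjunct2[OF cX[OF XY(2)], symmetric])
    finally show "X = Y" .
  next
    show "(\<lambda>X. mdec n (c X)) ` ?Q = {t. valid t \<and> edges t = n}"
    proof (intro equalityI subsetI)
    fix t assume "t \<in> (\<lambda>X. mdec n (c X)) ` ?Q"
    then obtain X where "X \<in> ?Q" "t = mdec n (c X)" by blast
    then show "t \<in> {t. valid t \<and> edges t = n}"
      using mdec_stats(1,2)[OF n, of "fst (c X)" "snd (c X)"] cX[of X] by simp
  next
    fix t assume "t \<in> {t. valid t \<and> edges t = n}"
    then obtain M where M: "M \<in> lab_maps n" "mdec n M = t" using mdec_surj[of t n] n by blast
    let ?X = "{M'\<in>lab_maps n. mdec n M' = mdec n M}"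
    have "mdec n (c ?X) = t" using c[OF cls'[OF M(1)]] M(2) by simp
    then show "t \<in> (\<lambda>X. mdec n (c X)) ` ?Q" using cls'[OF M(1)] by (intro image_eqI[where x = ?X]) simp_all
    qed
  qed
  have w: "map_weight g h n (c X) = tw g h n (mdec n (c X))" if "X \<in> ?Q" for X
  proof -
    obtain a s where as: "c X = (a, s)" by (cases "c X")
    have "(a, s) \<in> lab_maps n" using cX[OF that] as by simp
    note ms = mdec_stats[OF n this]
    show ?thesis unfolding as map_weight_def tw_def Let_def prod.case ms(3,4,5) ms(6) ..
  qed
  have "(\<Sum>X\<in>?Q. map_weight g h n (SOME M. M \<in> X) \<gamma>) = (\<Sum>X\<in>?Q. tw g h n (mdec n (c X)) \<gamma>)"
    by (rule sum.cong[OF refl], subst w[symmetric], assumption, simp add: c_def)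
  also have "\<dots> = (\<Sum>t\<in>{t. valid t \<and> edges t = n}. tw g h n t \<gamma>)"
    by (rule sum.reindex_bij_betw[OF bij])
  finally show ?thesis .
qed

section \<open>The one-cut parametrization of Tutte's equation\<close>

text \<open>Convergence to 0 in the X-adic topology.\<close>

definition nul :: "(nat \<Rightarrow> 'a::zero fps) \<Rightarrow> bool" where
  "nul f \<longleftrightarrow> (\<forall>m. \<exists>J. \<forall>j\<ge>J. \<forall>l\<le>m. f j $ l = 0)"

text \<open>Sum of a series of formal power series converging in the \<open>fps_X\<close>-adic topology. It is junk unless \<open>nul f\<close>.\<close>

definition Sa :: "(nat \<Rightarrow> 'a::comm_monoid_add fps) \<Rightarrow> 'a fps" where
  "Sa f = Abs_fps (\<lambda>m. \<Sum>j | f j $ m \<noteq> 0. f j $ m)"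

lemma Sa_nth: assumes "\<And>j. j \<ge> J \<Longrightarrow> f j $ m = 0" shows "Sa f $ m = (\<Sum>j<J. f j $ m)"
  unfolding Sa_def fps_nth_Abs_fps
  by (rule sum.mono_neutral_left) (use assms in \<open>auto simp: not_less[symmetric]\<close>)

lemma Sa_cong_nth: "(\<And>j. f j $ m = g j $ m) \<Longrightarrow> Sa f $ m = Sa g $ m"
  by (simp add: Sa_def)

lemma Sa_nth0: "(\<And>j. f j $ m = 0) \<Longrightarrow> Sa f $ m = 0"
  by (simp add: Sa_def)

lemma nulI: assumes "\<And>m j l. j \<ge> J m \<Longrightarrow> l \<le> m \<Longrightarrow> f j $ l = 0" shows "nul f"
  unfolding nul_def using assms by blast

lemma nulE: assumes "nul f" obtains J where "\<And>j l. j \<ge> J \<Longrightarrow> l \<le> m \<Longrightarrow> f j $ l = 0"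
  using assms unfolding nul_def by blast

lemma nul_add: fixes f :: "nat \<Rightarrow> 'a::monoid_add fps" assumes "nul f" "nul g" shows "nul (\<lambda>j. f j + g j)"
  unfolding nul_def
proof
  fix m
  obtain J where J: "\<And>j l. j \<ge> J \<Longrightarrow> l \<le> m \<Longrightarrow> f j $ l = 0" using nulE[OF assms(1)] by metis
  obtain J' where J': "\<And>j l. j \<ge> J' \<Longrightarrow> l \<le> m \<Longrightarrow> g j $ l = 0" using nulE[OF assms(2)] by metis
  show "\<exists>J. \<forall>j\<ge>J. \<forall>l\<le>m. (f j + g j) $ l = 0" using J J' by (intro exI[of _ "max J J'"]) auto
qed

lemma nul_mult: fixes f :: "nat \<Rightarrow> 'a::comm_ring_1 fps" assumes "nul f" shows "nul (\<lambda>j. c j * f j)"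
  unfolding nul_def
proof
  fix m
  obtain J where J: "\<And>j l. j \<ge> J \<Longrightarrow> l \<le> m \<Longrightarrow> f j $ l = 0" using nulE[OF assms(1)] by metis
  then show "\<exists>J. \<forall>j\<ge>J. \<forall>l\<le>m. (c j * f j) $ l = 0"
    by (intro exI[of _ J]) (auto simp: fps_mult_nth intro!: sum.neutral)
qed

lemma nul_uminus: fixes f :: "nat \<Rightarrow> 'a::comm_ring_1 fps" shows "nul f \<Longrightarrow> nul (\<lambda>j. - f j)"
  by (auto simp: nul_def)

lemma nul_diff: fixes f :: "nat \<Rightarrow> 'a::comm_ring_1 fps" shows "nul f \<Longrightarrow> nul g \<Longrightarrow> nul (\<lambda>j. f j - g j)"
  using nul_add[OF _ nul_uminus[of g], of f] by simp

lemma nul_fin: "(\<And>j. j \<ge> J \<Longrightarrow> f j = 0) \<Longrightarrow> nul f"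
  unfolding nul_def by (metis fps_zero_nth)

lemma Sa_finite: assumes "\<And>j. j \<ge> J \<Longrightarrow> f j = 0" shows "Sa f = (\<Sum>j<J. f j)"
proof (rule fps_ext)
  fix m
  show "Sa f $ m = (\<Sum>j<J. f j) $ m" using Sa_nth[of J f m] assms by (simp add: fps_sum_nth)
qed

lemma Sa_zero [simp]: "Sa (\<lambda>j. 0) = 0"
  by (simp add: Sa_def fps_eq_iff)

lemma Sa_add: fixes f :: "nat \<Rightarrow> 'a::comm_ring_1 fps" assumes "nul f" "nul g" shows "Sa (\<lambda>j. f j + g j) = Sa f + Sa g"
proof (rule fps_ext)
  fix m
  obtain J where J: "\<And>j l. j \<ge> J \<Longrightarrow> l \<le> m \<Longrightarrow> f j $ l = 0" using nulE[OF assms(1)] by metis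
  obtain J' where J': "\<And>j l. j \<ge> J' \<Longrightarrow> l \<le> m \<Longrightarrow> g j $ l = 0" using nulE[OF assms(2)] by metis
  show "Sa (\<lambda>j. f j + g j) $ m = (Sa f + Sa g) $ m"
    using Sa_nth[of "max J J'" f m] Sa_nth[of "max J J'" g m] Sa_nth[of "max J J'" "\<lambda>j. f j + g j" m] J J'
    by (simp add: sum.distrib)
qed

lemma Sa_cmult: fixes f :: "nat \<Rightarrow> 'a::comm_ring_1 fps" assumes "nul f" shows "Sa (\<lambda>j. c * f j) = c * Sa f"
proof (rule fps_ext)
  fix m
  obtain J where J: "\<And>j l. j \<ge> J \<Longrightarrow> l \<le> m \<Longrightarrow> f j $ l = 0" using nulE[OF assms(1)] by metis
  have "Sa (\<lambda>j. c * f j) $ m = (\<Sum>j<J. (c * f j) $ m)"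
    by (rule Sa_nth) (auto simp: fps_mult_nth J intro!: sum.neutral)
  also have "\<dots> = (\<Sum>i=0..m. c $ i * (\<Sum>j<J. f j $ (m - i)))"
    unfolding fps_mult_nth sum_distrib_left by (rule sum.swap)
  also have "\<dots> = (\<Sum>i=0..m. c $ i * Sa f $ (m - i))"
    by (intro sum.cong refl arg_cong2[where f = "(*)"] Sa_nth[symmetric]) (use J in auto)
  finally show "Sa (\<lambda>j. c * f j) $ m = (c * Sa f) $ m" by (simp add: fps_mult_nth)
qed

lemma Sa_mult2: fixes f :: "nat \<Rightarrow> 'a::comm_ring_1 fps" shows "nul f \<Longrightarrow> Sa (\<lambda>j. f j * c) = Sa f * c"
  using Sa_cmult[of f c] by (simp add: mult.commute)

lemma Sa_uminus: fixes f :: "nat \<Rightarrow> 'a::comm_ring_1 fps" shows "nul f \<Longrightarrow> Sa (\<lambda>j. - f j) = - Sa f"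
  using Sa_cmult[of f "-1"] by simp

lemma Sa_diff: fixes f :: "nat \<Rightarrow> 'a::comm_ring_1 fps" shows "nul f \<Longrightarrow> nul g \<Longrightarrow> Sa (\<lambda>j. f j - g j) = Sa f - Sa g"
  using Sa_add[OF _ nul_uminus[of g], of f] Sa_uminus[of g] by simp

lemma Sa_split: fixes f :: "nat \<Rightarrow> 'a::comm_ring_1 fps" assumes "nul f" shows "Sa f = (\<Sum>j<c. f j) + Sa (\<lambda>j. f (j + c))"
proof (rule fps_ext)
  fix m
  obtain J where J: "\<And>j l. j \<ge> J \<Longrightarrow> l \<le> m \<Longrightarrow> f j $ l = 0" using nulE[OF assms(1)] by metis
  have "Sa f $ m = (\<Sum>j<c + J. f j $ m)" by (rule Sa_nth) (use J in auto)
  also have "\<dots> = (\<Sum>j<c. f j $ m) + (\<Sum>j<J. f (j + c) $ m)"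
    by (induction J) (simp_all add: ac_simps)
  also have "(\<Sum>j<J. f (j + c) $ m) = Sa (\<lambda>j. f (j + c)) $ m" by (rule Sa_nth[symmetric]) (use J in auto)
  finally show "Sa f $ m = ((\<Sum>j<c. f j) + Sa (\<lambda>j. f (j + c))) $ m" by (simp add: fps_sum_nth)
qed

lemma Sa_sum: fixes f :: "'b \<Rightarrow> nat \<Rightarrow> 'a::comm_ring_1 fps" assumes "finite I" "\<And>i. i \<in> I \<Longrightarrow> nul (f i)"
  shows "Sa (\<lambda>j. \<Sum>i\<in>I. f i j) = (\<Sum>i\<in>I. Sa (f i)) \<and> nul (\<lambda>j. \<Sum>i\<in>I. f i j)"
  using assms
proof (induction I rule: finite_induct)
  case empty
  then show ?case by (auto simp: nul_def)
next
  case (insert i I)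
  then show ?case using Sa_add[of "f i" "\<lambda>j. \<Sum>i\<in>I. f i j"] nul_add[of "f i" "\<lambda>j. \<Sum>i\<in>I. f i j"] by simp
qed

text \<open>Smallness as soon as one of the two indices is large. This makes both iterated sums
  converge and allows exchanging them.\<close>

definition nul2 :: "(nat \<Rightarrow> nat \<Rightarrow> 'a::zero fps) \<Rightarrow> bool" where
  "nul2 f \<longleftrightarrow> (\<forall>m. \<exists>J. \<forall>i j. i \<ge> J \<or> j \<ge> J \<longrightarrow> (\<forall>l\<le>m. f i j $ l = 0))"

lemma nul2_Sa: fixes f :: "nat \<Rightarrow> nat \<Rightarrow> 'a::comm_ring_1 fps" assumes "nul2 f"
  shows "nul (\<lambda>i. Sa (f i))" "nul (\<lambda>j. Sa (\<lambda>i. f i j))"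
proof -
  show "nul (\<lambda>i. Sa (f i))" unfolding nul_def
  proof
    fix m
    obtain J where "\<And>i j l. i \<ge> J \<or> j \<ge> J \<Longrightarrow> l \<le> m \<Longrightarrow> f i j $ l = 0" using assms unfolding nul2_def by meson
    then show "\<exists>J. \<forall>j\<ge>J. \<forall>l\<le>m. Sa (f j) $ l = 0" by (intro exI[of _ J]) (auto intro!: Sa_nth0)
  qed
  show "nul (\<lambda>j. Sa (\<lambda>i. f i j))" unfolding nul_def
  proof
    fix m
    obtain J where "\<And>i j l. i \<ge> J \<or> j \<ge> J \<Longrightarrow> l \<le> m \<Longrightarrow> f i j $ l = 0" using assms unfolding nul2_def by meson
    then show "\<exists>J. \<forall>j\<ge>J. \<forall>l\<le>m. Sa (\<lambda>i. f i j) $ l = 0" by (intro exI[of _ J]) (auto intro!: Sa_nth0)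
  qed
qed

lemma Sa_swap: fixes f :: "nat \<Rightarrow> nat \<Rightarrow> 'a::comm_ring_1 fps" assumes "nul2 f"
  shows "Sa (\<lambda>i. Sa (f i)) = Sa (\<lambda>j. Sa (\<lambda>i. f i j))"
proof (rule fps_ext)
  fix m
  obtain J where J: "\<And>i j. i \<ge> J \<or> j \<ge> J \<Longrightarrow> f i j $ m = 0" using assms unfolding nul2_def by (meson order_refl)
  have 1: "Sa (f i) $ m = (\<Sum>j<J. f i j $ m)" for i by (rule Sa_nth) (use J in auto)
  have 2: "Sa (\<lambda>i. f i j) $ m = (\<Sum>i<J. f i j $ m)" for j by (rule Sa_nth) (use J in auto)
  have "Sa (\<lambda>i. Sa (f i)) $ m = (\<Sum>i<J. Sa (f i) $ m)" by (rule Sa_nth) (simp add: 1 J)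
  also have "\<dots> = (\<Sum>j<J. Sa (\<lambda>i. f i j) $ m)" unfolding 1 2 by (rule sum.swap)
  also have "\<dots> = Sa (\<lambda>j. Sa (\<lambda>i. f i j)) $ m" by (rule Sa_nth[symmetric]) (simp add: 2 J)
  finally show "Sa (\<lambda>i. Sa (f i)) $ m = Sa (\<lambda>j. Sa (\<lambda>i. f i j)) $ m" .
qed

text \<open>Modulo a power of X only finitely many terms matter, and for these additivity is enough.
  The shift by one in the locality assumption leaves room for d/dt, which lowers the order by
  one.\<close>

lemma Sa_additive:
  fixes f :: "nat \<Rightarrow> 'a::comm_ring_1 fps"
  assumes D: "\<And>x y. D (x + y) = D x + (D y :: 'a fps)" "D 0 = 0"
    and loc: "\<And>x m. (\<And>l. l \<le> m + 1 \<Longrightarrow> x $ l = 0) \<Longrightarrow> D x $ m = 0" and "nul f"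
  shows "D (Sa f) = Sa (\<lambda>j. D (f j))" "nul (\<lambda>j. D (f j))"
proof -
  show n: "nul (\<lambda>j. D (f j))" unfolding nul_def
  proof
    fix m
    obtain J where "\<And>j l. j \<ge> J \<Longrightarrow> l \<le> m + 1 \<Longrightarrow> f j $ l = 0" using nulE[OF \<open>nul f\<close>] by metis
    then show "\<exists>J. \<forall>j\<ge>J. \<forall>l\<le>m. D (f j) $ l = 0" using loc by (intro exI[of _ J]) auto
  qed
  show "D (Sa f) = Sa (\<lambda>j. D (f j))"
  proof (rule fps_ext)
    fix m
    obtain J where J: "\<And>j l. j \<ge> J \<Longrightarrow> l \<le> m + 1 \<Longrightarrow> f j $ l = 0" using nulE[OF \<open>nul f\<close>] by metis
    have "D (\<Sum>j<n. f j) = (\<Sum>j<n. D (f j))" for n by (induction n) (simp_all add: D)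
    then have "D (Sa f) = (\<Sum>j<J. D (f j)) + D (Sa (\<lambda>j. f (j + J)))"
      using Sa_split[OF \<open>nul f\<close>, of J] D(1) by metis
    moreover have "D (Sa (\<lambda>j. f (j + J))) $ m = 0"
      by (rule loc) (use J Sa_nth[of 0 "\<lambda>j. f (j + J)"] in auto)
    moreover have "Sa (\<lambda>j. D (f j)) $ m = (\<Sum>j<J. D (f j) $ m)"
      by (rule Sa_nth) (use J loc in auto)
    ultimately show "D (Sa f) $ m = Sa (\<lambda>j. D (f j)) $ m" by (simp add: fps_sum_nth)
  qed
qed

text \<open>\<open>Tc R S n k\<close> is the coefficient of \<open>v\<close> to the power \<open>k\<close> in \<open>(v + S + R/v) ^ n\<close>, i.e. the weighted count
  of Motzkin paths of length \<open>n\<close> from height 0 to height \<open>k\<close>.\<close>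

fun Tc :: "'b::comm_ring_1 \<Rightarrow> 'b \<Rightarrow> nat \<Rightarrow> int \<Rightarrow> 'b" where
  "Tc R S 0 k = (if k = 0 then 1 else 0)"
| "Tc R S (Suc n) k = Tc R S n (k - 1) + S * Tc R S n k + R * Tc R S n (k + 1)"

lemma Tc_zero: "\<bar>k\<bar> > int n \<Longrightarrow> Tc R S n k = 0"
  by (induction n arbitrary: k) auto

text \<open>The exchange of v and R/v fixes v + S + R/v.\<close>

lemma Tc_neg: "Tc R S n (- int k) = R ^ k * Tc R S n (int k)"
proof (induction n arbitrary: k)
  case (Suc n)
  show ?case
  proof (cases k)
    case (Suc k')
    have e: "- int k - 1 = - int (k + 1)" "int k + 1 = int (k + 1)" "- int k + 1 = - int k'" "int k - 1 = int k'"
      using Suc by simp_all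
    have 1: "Tc R S n (- int k - 1) = R ^ (k + 1) * Tc R S n (int k + 1)" unfolding e by (rule Suc.IH)
    have 2: "Tc R S n (- int k + 1) = R ^ k' * Tc R S n (int k - 1)" unfolding e by (rule Suc.IH)
    have 3: "R ^ k = R * R ^ k'" using Suc by simp
    show ?thesis unfolding Tc.simps 1 2 Suc.IH unfolding 3 using Suc by (simp add: algebra_simps)
  qed simp
qed simp

text \<open>Coefficients of v d/dv X^(n+1) = (n+1) X^n (v - R/v), where X = v + S + R/v.\<close>

lemma Tc_euler: "of_int k * Tc R S (Suc n) k = of_nat (Suc n) * (Tc R S n (k - 1) - R * Tc R S n (k + 1))"
proof (induction n arbitrary: k)
  case 0
  show ?case by (cases "k = 0"; cases "k = 1"; cases "k = -1") auto
next
  case (Suc n)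
  have *: "of_int k * x = of_int (k - 1) * x + x" "of_int k * x = of_int (k + 1) * x - x" for x :: 'a
    by (simp_all add: algebra_simps)
  have "of_int k * Tc R S (Suc (Suc n)) k =
    of_int k * Tc R S (Suc n) (k - 1) + S * (of_int k * Tc R S (Suc n) k) + R * (of_int k * Tc R S (Suc n) (k + 1))"
    unfolding Tc.simps(2)[of R S "Suc n"] by (simp add: algebra_simps)
  also have "\<dots> = (of_int (k - 1) * Tc R S (Suc n) (k - 1) + Tc R S (Suc n) (k - 1)) + S * (of_int k * Tc R S (Suc n) k)
    + R * (of_int (k + 1) * Tc R S (Suc n) (k + 1) - Tc R S (Suc n) (k + 1))"
    using *(1)[of "Tc R S (Suc n) (k - 1)"] *(2)[of "Tc R S (Suc n) (k + 1)"] by simp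
  also have "\<dots> = of_nat (Suc (Suc n)) * (Tc R S (Suc n) (k - 1) - R * Tc R S (Suc n) (k + 1))"
    unfolding Suc.IH unfolding Tc.simps(2) by (simp add: algebra_simps)
  finally show ?case .
qed

text \<open>The power rule for X^(n+1), as a derivation that kills v maps X to D S + D R /
  v.\<close>

lemma Tc_deriv:
  assumes D: "\<And>x y. D (x + y) = D x + (D y :: 'b::comm_ring_1)" "\<And>x y. D (x * y) = D x * y + x * D y" "D 0 = 0" "D 1 = 0"
  shows "D (Tc R S (Suc n) k) = of_nat (Suc n) * (D S * Tc R S n k + D R * Tc R S n (k + 1))"
proof (induction n arbitrary: k)
  case 0
  have "D (if P then 1 else 0) = 0" for P using D by simp
  then show ?case by (simp add: D)
next
  case (Suc n)
  show ?case unfolding Tc.simps(2)[of R S "Suc n"] D Suc.IH unfolding Tc.simps(2) by (simp add: algebra_simps)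
qed

text \<open>A path of length n ending at height k has n - k equal to its level steps plus twice its
  down steps. Each such step contributes a factor S or R without constant term, so there are at
  least (n - k)/2 such factors.\<close>

lemma Tc_order:
  fixes R S :: "'a::comm_ring_1 fps"
  assumes "R $ 0 = 0" "S $ 0 = 0" "int n > 2 * int m + k"
  shows "Tc R S n k $ m = 0"
  using assms(3)
proof (induction n arbitrary: k m)
  case 0
  then show ?case by (auto split: if_splits)
next
  case (Suc n)
  have 1: "(S * Tc R S n k) $ m = 0" unfolding fps_mult_nth
  proof (rule sum.neutral, rule ballI)
    fix i assume "i \<in> {0..m}"
    then show "S $ i * Tc R S n k $ (m - i) = 0"
      using Suc.IH[of "m - i" k] Suc.prems assms(2) by (cases "i = 0") (auto simp: of_nat_diff)
  qed
  have 2: "(R * Tc R S n (k + 1)) $ m = 0" unfolding fps_mult_nth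
  proof (rule sum.neutral, rule ballI)
    fix i assume "i \<in> {0..m}"
    then show "R $ i * Tc R S n (k + 1) $ (m - i) = 0"
      using Suc.IH[of "m - i" "k + 1"] Suc.prems assms(1) by (cases "i = 0") (auto simp: of_nat_diff)
  qed
  show ?case using Suc.IH[of m "k - 1"] Suc.prems 1 2 by simp
qed

lemma fps_mult_cong_nth: "(\<And>i. i \<le> m \<Longrightarrow> x $ i = x' $ i) \<Longrightarrow> (\<And>i. i \<le> m \<Longrightarrow> y $ i = y' $ i) \<Longrightarrow> (x * y) $ m = (x' * y') $ m"
  by (auto simp: fps_mult_nth intro!: sum.cong)

lemma Tc_cong:
  fixes R S :: "'a::comm_ring_1 fps"
  assumes "\<And>i. i \<le> m \<Longrightarrow> R $ i = R' $ i" "\<And>i. i \<le> m \<Longrightarrow> S $ i = S' $ i"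
  shows "i \<le> m \<Longrightarrow> Tc R S n k $ i = Tc R' S' n k $ i"
proof (induction n arbitrary: k i)
  case (Suc n)
  have "(S * Tc R S n k) $ i = (S' * Tc R' S' n k) $ i" "(R * Tc R S n (k + 1)) $ i = (R' * Tc R' S' n (k + 1)) $ i"
    by (rule fps_mult_cong_nth; use Suc assms in auto)+
  then show ?case using Suc by simp
qed simp

text \<open>Motzkin paths from height \<open>l\<close> to height \<open>m\<close> that stay nonnegative, by the reflection principle.\<close>

definition Pc :: "'b::comm_ring_1 \<Rightarrow> 'b \<Rightarrow> nat \<Rightarrow> nat \<Rightarrow> nat \<Rightarrow> 'b" where
  "Pc R S j l m = Tc R S j (int m - int l) - R ^ (l + 1) * Tc R S j (int m + int l + 2)"

lemma Pc_0: "Pc R S 0 l m = (if l = m then 1 else 0)"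
  by (auto simp: Pc_def)

text \<open>The contributions from height -1, the mirror of the reflection, cancel by
  \<open>Tc_neg\<close>.\<close>

lemma Pc_Suc_0: "Pc R S (Suc j) l 0 = S * Pc R S j l 0 + R * Pc R S j l 1"
proof -
  have e: "- int l - 1 = - int (l + 1)" "int l + 1 = int (l + 1)" by simp_all
  have 1: "Tc R S j (- int l - 1) = R ^ (l + 1) * Tc R S j (int l + 1)" unfolding e by (rule Tc_neg)
  have e: "int 0 - int l = - int l" "- int l + 1 = int 1 - int l" "int 0 + int l + 2 - 1 = int l + 1"
    "int 0 + int l + 2 + 1 = int 1 + int l + 2" by simp_all
  have ring: "Q * y1 + S * x2 + R * x3 - Q * (y1 + S * y2 + R * y3) = S * (x2 - Q * y2) + R * (x3 - Q * y3)"
    for x2 x3 y1 y2 y3 Q :: 'a by (simp add: algebra_simps)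
  show ?thesis unfolding Pc_def Tc.simps(2) e 1 by (rule ring)
qed

lemma Pc_Suc_Suc: "Pc R S (Suc j) l (Suc m) = Pc R S j l m + S * Pc R S j l (Suc m) + R * Pc R S j l (Suc (Suc m))"
proof -
  have "int (Suc m) - int l - 1 = int m - int l" "int (Suc m) - int l + 1 = int (Suc (Suc m)) - int l"
    "int (Suc m) + int l + 2 - 1 = int m + int l + 2" "int (Suc m) + int l + 2 + 1 = int (Suc (Suc m)) + int l + 2" by auto
  note e = this
  have ring: "x1 + S * x2 + R * x3 - Q * (y1 + S * y2 + R * y3) = (x1 - Q * y1) + S * (x2 - Q * y2) + R * (x3 - Q * y3)"
    for x1 x2 x3 y1 y2 y3 Q :: 'a by (simp add: algebra_simps)
  show ?thesis unfolding Pc_def Tc.simps(2) e by (rule ring)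
qed

lemma Pc_zero: "m > l + j \<Longrightarrow> Pc R S j l m = 0"
  unfolding Pc_def by (simp add: Tc_zero)

text \<open>Cut the path at time \<open>i\<close> and sum over the height \<open>l\<close> reached
  there.\<close>

lemma Pc_chapman: "Pc R S (i + j) 0 m = (\<Sum>l\<le>i. Pc R S i 0 l * Pc R S j l m)"
proof (induction j arbitrary: m)
  case 0
  show ?case
  proof (cases "m \<le> i")
    case True
    then show ?thesis by (simp add: Pc_0 if_distrib[of "\<lambda>x. _ * x"] cong: if_cong)
  next
    case False
    then show ?thesis by (auto simp: Pc_0 Pc_zero intro!: sum.neutral[symmetric])
  qed
next
  case (Suc j)
  show ?case
  proof (cases m)
    case 0
    then show ?thesis using Suc by (simp add: Pc_Suc_0 sum_distrib_left sum.distrib algebra_simps del: One_nat_def)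
  next
    case (Suc m')
    then show ?thesis using Suc.IH by (simp add: Pc_Suc_Suc sum_distrib_left sum.distrib algebra_simps)
  qed
qed

text \<open>Cut the path after its last visit to height \<open>a\<close>: an up step follows, and
  the remainder, seen from height a + 1, is a nonnegative path to height \<open>b\<close>.\<close>

lemma Pc_first_passage: "Pc R S (Suc n) 0 (a + b + 1) = (\<Sum>i\<le>n. Pc R S i 0 a * Pc R S (n - i) 0 b)"
proof (induction n arbitrary: b)
  case 0
  show ?case by (simp add: Pc_Suc_Suc Pc_0)
next
  case (Suc n)
  have "(\<Sum>i\<le>Suc n. Pc R S i 0 a * Pc R S (Suc n - i) 0 b) =
    Pc R S (Suc n) 0 a * (if b = 0 then 1 else 0) + (\<Sum>i\<le>n. Pc R S i 0 a * Pc R S (Suc (n - i)) 0 b)"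
    by (simp add: Pc_0 Suc_diff_le)
  also have "\<dots> = Pc R S (Suc (Suc n)) 0 (a + b + 1)"
  proof (cases b)
    case 0
    have "(\<Sum>i\<le>n. Pc R S i 0 a * Pc R S (Suc (n - i)) 0 b) =
      S * (\<Sum>i\<le>n. Pc R S i 0 a * Pc R S (n - i) 0 0) + R * (\<Sum>i\<le>n. Pc R S i 0 a * Pc R S (n - i) 0 1)"
      unfolding 0 Pc_Suc_0 by (simp add: sum_distrib_left sum.distrib algebra_simps del: One_nat_def)
    then show ?thesis unfolding Suc.IH[symmetric] 0 using Pc_Suc_Suc[of R S "Suc n" 0 a] by simp
  next
    case (Suc b')
    have "(\<Sum>i\<le>n. Pc R S i 0 a * Pc R S (Suc (n - i)) 0 b) = (\<Sum>i\<le>n. Pc R S i 0 a * Pc R S (n - i) 0 b') +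
      S * (\<Sum>i\<le>n. Pc R S i 0 a * Pc R S (n - i) 0 (Suc b')) + R * (\<Sum>i\<le>n. Pc R S i 0 a * Pc R S (n - i) 0 (Suc (Suc b')))"
      unfolding Suc Pc_Suc_Suc by (simp add: sum_distrib_left sum.distrib algebra_simps)
    then show ?thesis unfolding Suc.IH[symmetric] unfolding Suc using Pc_Suc_Suc[of R S "Suc n" 0 "a + b' + 1"] by simp
  qed
  finally show ?case by simp
qed

lemma Pc_one: "Pc R S 1 l m = (if m = Suc l then 1 else 0) + (if m = l then S else 0) + (if Suc m = l then R else 0)"
  unfolding One_nat_def by (cases m) (auto simp: Pc_Suc_0 Pc_Suc_Suc Pc_0)

text \<open>The coefficient of v to the power \<open>k\<close> in the sum of \<open>g j\<close> X^j,
  where X = v + S + R/v.\<close>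

definition bc :: "'a::comm_ring_1 fps \<Rightarrow> 'a fps \<Rightarrow> (nat \<Rightarrow> 'a fps) \<Rightarrow> int \<Rightarrow> 'a fps" where
  "bc R S g k = Sa (\<lambda>j. g j * Tc R S j k)"

lemma fps_mult_nth_zero: fixes x :: "'a::comm_ring_1 fps"
  shows "(\<And>i. i \<le> m \<Longrightarrow> y $ i = 0) \<Longrightarrow> (x * y) $ m = 0"
  by (auto simp: fps_mult_nth intro!: sum.neutral)

lemma Tc_nul: fixes R S :: "'a::comm_ring_1 fps"
  assumes "R $ 0 = 0" "S $ 0 = 0" shows "nul (\<lambda>j. g j * Tc R S j k)"
  by (rule nul_mult, rule nulI[where J = "\<lambda>m. nat (2 * int m + k + 1)"])
    (use Tc_order[OF assms] in \<open>auto simp: nat_le_iff\<close>)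

lemma bc_neg: fixes R S :: "'a::comm_ring_1 fps"
  assumes "R $ 0 = 0" "S $ 0 = 0" shows "bc R S g (- int k) = R ^ k * bc R S g (int k)"
  unfolding bc_def Tc_neg using Sa_cmult[OF Tc_nul[OF assms], of "R ^ k" g "int k"] by (simp add: ac_simps)

lemma bc_order: fixes R S :: "'a::comm_ring_1 fps"
  assumes "R $ 0 = 0" "S $ 0 = 0" "int m + k < 0" shows "bc R S g k $ m = 0"
  unfolding bc_def
proof (rule Sa_nth0, rule fps_mult_nth_zero)
  fix j i assume "i \<le> m"
  then show "Tc R S j k $ i = 0"
    using Tc_order[OF assms(1,2), of i k j] Tc_zero[of j k R S] assms(3) by (cases "int j > 2 * int i + k") auto
qed

text \<open>The candidate for the generating function of root degree \<open>n\<close>: nonnegative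
  Motzkin paths of length \<open>n\<close>, weighted at their final height \<open>m\<close> by
  \<open>B (m + 1)\<close>.\<close>

definition Wc :: "'a::comm_ring_1 fps \<Rightarrow> 'a fps \<Rightarrow> (nat \<Rightarrow> 'a fps) \<Rightarrow> nat \<Rightarrow> 'a fps" where
  "Wc R S B n = (\<Sum>m\<le>n. Pc R S n 0 m * B (m + 1))"

text \<open>The coefficient of 1/v is R times that of v by \<open>bc_neg\<close>, so a factor t can
  be taken out of the equation for R; \<open>Q\<close> is R/t. Here \<open>g j\<close> is the weight
  of a vertex of degree j + 1.\<close>

locale one_cut =
  fixes z u Q R S :: "'a::comm_ring_1 fps" and g :: "nat \<Rightarrow> 'a fps"
  assumes R: "R = fps_X * Q" and S: "S = fps_X * u * bc R S g 0" and Q: "Q = z + u * R * bc R S g 1"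
begin

lemma R0: "R $ 0 = 0" and S0: "S $ 0 = 0"
proof -
  show "R $ 0 = 0" unfolding R by simp
  have "S = fps_X * (u * bc R S g 0)" using S by (simp add: mult.assoc)
  then show "S $ 0 = 0" by (metis fps_X_mult_nth)
qed

text \<open>For positive \<open>k\<close>, \<open>bet k\<close> is the coefficient of v to the power
  \<open>k\<close> in v - t u Y, with Y as in the overview. \<open>Bc k\<close> is R^k
  \<open>bet k\<close> / t, written with \<open>Q\<close> to avoid dividing; by the symmetry of v
  and R/v it is, up to this t, the coefficient of v to the power -k in R/v - t u Y.\<close>

definition "bet k = (if k = 1 then 1 else 0) - fps_X * u * bc R S g (int k)"
definition "Bc k = Q * R ^ (k - 1) * bet k"

lemma R_pow_order: "m < k \<Longrightarrow> (R ^ k * y) $ m = 0"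
proof -
  assume "m < k"
  have "R ^ k * y = fps_X ^ k * (Q ^ k * y)" unfolding R by (simp add: power_mult_distrib mult.assoc)
  then show ?thesis using \<open>m < k\<close> by (metis fps_X_power_mult_nth)
qed

lemma Bc_order: "m + 1 < k \<Longrightarrow> Bc k $ m = 0"
  using R_pow_order[of m "k - 1" "Q * bet k"] unfolding Bc_def by (simp add: ac_simps)

lemma Bc_1: "Bc 1 = z"
proof -
  have "Q = z + fps_X * Q * u * bc R S g 1" using Q unfolding R by (simp add: ac_simps)
  then show ?thesis unfolding Bc_def bet_def by (simp add: algebra_simps)
qed

lemma X_Bc: "k \<ge> 1 \<Longrightarrow> fps_X * Bc k = R ^ k * bet k"
  unfolding Bc_def by (cases k) (simp_all add: R ac_simps)

lemma nul_Bc: "nul (\<lambda>m. c m * Bc (m + d))"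
  by (rule nul_mult, rule nulI[where J = "\<lambda>m. m + 2"], rule Bc_order) simp

text \<open>The sum is split at \<open>m = l\<close>. The diagonal term is the equation for
  \<open>S\<close>. The terms above it produce \<open>Bc (l + 2)\<close> and cancel the reflected
  terms. The terms below it are turned by \<open>bc_neg\<close> into the convolution that represents
  loops.\<close>

lemma key_sum:
  "Sa (\<lambda>m. fps_X * u * (bc R S g (int m - int l) - R ^ (l + 1) * bc R S g (int m + int l + 2)) * Bc (m + 1)) =
    S * Bc (l + 1) + Bc (l + 2) + (if l \<ge> 1 then R * Bc l else 0) - fps_X * (\<Sum>m<l. Bc (l - m) * Bc (m + 1))"
proof -
  define y where "y m = fps_X * u * bc R S g (int m - int l) * Bc (m + 1)" for m
  have ny: "nul y" unfolding y_def using nul_Bc[of "\<lambda>m. fps_X * u * bc R S g (int m - int l)" 1] by (simp add: ac_simps)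
  have np: "nul (\<lambda>m. bet (m + 1) * Bc (m + l + 2))" using nul_Bc[of "\<lambda>m. bet (m + 1)" "l + 2"] by (simp add: add.assoc)
  \<comment> \<open>In the reflected term \<open>bc\<close> has index at least 2, where
    \<open>bet\<close> has no extra 1; the powers of R regroup with \<open>Bc (m + 1)\<close> so
    that \<open>bet\<close> and \<open>Bc\<close> change places.\<close>
  have "fps_X * u * (bc R S g (int m - int l) - R ^ (l + 1) * bc R S g (int m + int l + 2)) * Bc (m + 1) =
    y m + bet (m + 1) * Bc (m + l + 2)" for m
  proof -
    have "int (m + l + 2) = int m + int l + 2" by simp
    then have "bet (m + l + 2) = (if m + l + 2 = 1 then 1 else 0) - fps_X * u * bc R S g (int m + int l + 2)"
      unfolding bet_def by metis
    then have "bet (m + l + 2) = - (fps_X * u * bc R S g (int m + int l + 2))" by simp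
    then have "bet (m + 1) * Bc (m + l + 2) = - (bet (m + 1) * Q * R ^ (m + l + 1) * (fps_X * u * bc R S g (int m + int l + 2)))"
      unfolding Bc_def by (simp add: ac_simps)
    also have "\<dots> = - (R ^ (l + 1) * (fps_X * u * bc R S g (int m + int l + 2)) * Bc (m + 1))"
      unfolding Bc_def by (simp add: power_add ac_simps)
    finally show ?thesis unfolding y_def by (simp add: algebra_simps)
  qed
  then have "Sa (\<lambda>m. fps_X * u * (bc R S g (int m - int l) - R ^ (l + 1) * bc R S g (int m + int l + 2)) * Bc (m + 1)) =
    Sa y + Sa (\<lambda>m. bet (m + 1) * Bc (m + l + 2))" using Sa_add[OF ny np] by simp
  moreover have "Sa y = (\<Sum>m<l. y m) + y l + Sa (\<lambda>i. y (i + (l + 1)))"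
    using Sa_split[OF ny, of "l + 1"] by simp
  moreover have "y l = S * Bc (l + 1)" unfolding y_def by (simp add: S[symmetric])
  moreover have "Sa (\<lambda>i. y (i + (l + 1))) = Bc (l + 2) - Sa (\<lambda>m. bet (m + 1) * Bc (m + l + 2))"
  proof -
    have "y (i + (l + 1)) = (if i = 0 then Bc (l + 2) else 0) - bet (i + 1) * Bc (i + l + 2)" for i
    proof -
      have e: "int (i + (l + 1)) - int l = int (i + 1)" "i + (l + 1) + 1 = i + l + 2" by simp_all
      have "fps_X * u * bc R S g (int (i + 1)) = (if i = 0 then 1 else 0) - bet (i + 1)" unfolding bet_def by simp
      then show ?thesis unfolding y_def e by (auto simp: left_diff_distrib)
    qed
    moreover have "Sa (\<lambda>i. if i = 0 then Bc (l + 2) else 0) = Bc (l + 2)"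
      using Sa_finite[of 1 "\<lambda>i. if i = 0 then Bc (l + 2) else 0"] by simp
    moreover have "nul (\<lambda>i. if i = 0 then Bc (l + 2) else 0)" by (rule nul_fin[of 1]) simp
    ultimately show ?thesis using Sa_diff[OF _ np] by simp
  qed
  moreover have "(\<Sum>m<l. y m) = (if l \<ge> 1 then R * Bc l else 0) - fps_X * (\<Sum>m<l. Bc (l - m) * Bc (m + 1))"
  proof -
    have "y m = (if Suc m = l then R * Bc l else 0) - fps_X * (Bc (l - m) * Bc (m + 1))" if "m < l" for m
    proof -
      have "int m - int l = - int (l - m)" using that by simp
      then have b: "bc R S g (int m - int l) = R ^ (l - m) * bc R S g (int (l - m))" using bc_neg[OF R0 S0] by metis
      have "(l - m = 1) = (Suc m = l)" using that by auto
      then have c: "fps_X * u * bc R S g (int (l - m)) = (if Suc m = l then 1 else 0) - bet (l - m)"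
        unfolding bet_def by simp
      have "y m = R ^ (l - m) * (fps_X * u * bc R S g (int (l - m))) * Bc (m + 1)"
        unfolding y_def b by (simp only: ac_simps)
      then have "y m = R ^ (l - m) * ((if Suc m = l then 1 else 0) - bet (l - m)) * Bc (m + 1)"
        unfolding c .
      also have "\<dots> = (if Suc m = l then R ^ (l - m) * Bc (m + 1) else 0) - (R ^ (l - m) * bet (l - m)) * Bc (m + 1)"
        by (simp add: algebra_simps)
      finally have y: "y m = (if Suc m = l then R ^ (l - m) * Bc (m + 1) else 0) - (R ^ (l - m) * bet (l - m)) * Bc (m + 1)" .
      have 1: "R ^ (l - m) * bet (l - m) = fps_X * Bc (l - m)" using X_Bc[of "l - m"] that by simp
      have 2: "(if Suc m = l then R ^ (l - m) * Bc (m + 1) else 0) = (if Suc m = l then R * Bc l else 0)"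
        by (auto simp: Suc_diff_le)
      show ?thesis unfolding y 1 2 by (simp only: mult.assoc)
    qed
    then have "(\<Sum>m<l. y m) = (\<Sum>m<l. if Suc m = l then R * Bc l else 0) - fps_X * (\<Sum>m<l. Bc (l - m) * Bc (m + 1))"
      by (simp add: sum_subtractf sum_distrib_left)
    moreover have "(\<Sum>m<l. if Suc m = l then R * Bc l else 0) = (if l \<ge> 1 then R * Bc l else 0)"
      by (cases l) auto
    ultimately show ?thesis by simp
  qed
  ultimately show ?thesis by simp
qed

lemma nul2_PB: "nul2 (\<lambda>j m. c j * Pc R S j l m * Bc (m + 1))"
  unfolding nul2_def
proof
  fix M
  \<comment> \<open>For \<open>m > M\<close> the order of \<open>Bc\<close> suffices. For
    \<open>m \<le> M\<close> the bound of \<open>Tc_order\<close> is at most 2M + (M + l + 2),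
    whence the constant.\<close>
  have "(c j * Pc R S j l m * Bc (m + 1)) $ i = 0" if "j \<ge> 3 * M + l + 3 \<or> m \<ge> 3 * M + l + 3" "i \<le> M" for j m i
  proof (cases "m > M")
    case True
    then show ?thesis by (intro fps_mult_nth_zero Bc_order) (use that in auto)
  next
    case False
    have o: "Tc R S j k $ i' = 0" if "i' \<le> i" "k \<le> int m + int l + 2" for k i'
      by (rule Tc_order[OF R0 S0]) (use that False \<open>j \<ge> _ \<or> m \<ge> _\<close> \<open>i \<le> M\<close> in linarith)
    have "Pc R S j l m $ i' = 0" if "i' \<le> i" for i'
    proof -
      have "(R ^ (l + 1) * Tc R S j (int m + int l + 2)) $ i' = 0"
        by (rule fps_mult_nth_zero, rule o) (use that in auto)
      moreover have "Tc R S j (int m - int l) $ i' = 0" by (rule o) (use that in auto)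
      ultimately show ?thesis unfolding Pc_def by (simp only: fps_sub_nth diff_0_right)
    qed
    then have "(c j * Bc (m + 1) * Pc R S j l m) $ i = 0" by (intro fps_mult_nth_zero) auto
    then show ?thesis by (simp add: ac_simps)
  qed
  then show "\<exists>J. \<forall>i j. i \<ge> J \<or> j \<ge> J \<longrightarrow> (\<forall>la\<le>M. (c i * Pc R S i l j * Bc (j + 1)) $ la = 0)" by blast
qed

lemma Wc_Sa: "Wc R S Bc n = Sa (\<lambda>m. Pc R S n 0 m * Bc (m + 1))"
  unfolding Wc_def by (subst Sa_finite[of "Suc n"]) (auto simp: Pc_zero lessThan_Suc_atMost)

lemma Wc_0: "Wc R S Bc 0 = z"
  unfolding Wc_def using Bc_1 by (simp add: Pc_0)

text \<open>\<open>Pc_first_passage\<close> merges a path ending at \<open>a\<close> and one ending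
  at \<open>b\<close> into a path ending at \<open>l = a + b + 1\<close>; summing over the split of
  \<open>l\<close> gives the inner convolution.\<close>

lemma Wc_conv: "(\<Sum>l\<le>n. Pc R S n 0 l * (\<Sum>m<l. Bc (l - m) * Bc (m + 1))) = (\<Sum>i<n. Wc R S Bc i * Wc R S Bc (n - 1 - i))"
proof (cases n)
  case (Suc n')
  have w: "Wc R S Bc i = (\<Sum>a\<le>n'. Pc R S i 0 a * Bc (a + 1))" if "i \<le> n'" for i
    unfolding Wc_def by (rule sum.mono_neutral_left) (use that in \<open>auto simp: Pc_zero\<close>)
  have "(\<Sum>i<n. Wc R S Bc i * Wc R S Bc (n - 1 - i)) =
    (\<Sum>i\<le>n'. \<Sum>a\<le>n'. \<Sum>b\<le>n'. (Pc R S i 0 a * Pc R S (n' - i) 0 b) * (Bc (a + 1) * Bc (b + 1)))"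
    unfolding Suc lessThan_Suc_atMost by (rule sum.cong) (auto simp: w sum_product ac_simps)
  also have "\<dots> = (\<Sum>a\<le>n'. \<Sum>i\<le>n'. \<Sum>b\<le>n'. (Pc R S i 0 a * Pc R S (n' - i) 0 b) * (Bc (a + 1) * Bc (b + 1)))"
    by (rule sum.swap)
  also have "\<dots> = (\<Sum>a\<le>n'. \<Sum>b\<le>n'. \<Sum>i\<le>n'. (Pc R S i 0 a * Pc R S (n' - i) 0 b) * (Bc (a + 1) * Bc (b + 1)))"
    by (rule sum.cong[OF refl], rule sum.swap)
  also have "\<dots> = (\<Sum>a\<le>n'. \<Sum>b\<le>n'. Pc R S n 0 (a + b + 1) * (Bc (a + 1) * Bc (b + 1)))"
    unfolding Suc Pc_first_passage sum_distrib_right ..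
  also have "\<dots> = (\<Sum>(a, b)\<in>{..n'} \<times> {..n'}. Pc R S n 0 (a + b + 1) * (Bc (a + 1) * Bc (b + 1)))"
    by (simp add: sum.cartesian_product)
  also have "\<dots> = (\<Sum>(a, b)\<in>{(a, b). a + b \<le> n'}. Pc R S n 0 (a + b + 1) * (Bc (a + 1) * Bc (b + 1)))"
  proof (rule sum.mono_neutral_right)
    have z: "Pc R S n 0 (a + b + 1) = 0" if "\<not> a + b \<le> n'" for a b by (rule Pc_zero) (use that Suc in simp)
    show "\<forall>x\<in>{..n'} \<times> {..n'} - {(a, b). a + b \<le> n'}. (case x of (a, b) \<Rightarrow> Pc R S n 0 (a + b + 1) * (Bc (a + 1) * Bc (b + 1))) = 0"
    proof
      fix x assume x: "x \<in> {..n'} \<times> {..n'} - {(a, b). a + b \<le> n'}"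
      obtain a b where xe: "x = (a, b)" by (cases x)
      have "\<not> a + b \<le> n'" using x xe by auto
      then have "Pc R S n 0 (a + b + 1) = 0" by (rule z)
      then show "(case x of (a, b) \<Rightarrow> Pc R S n 0 (a + b + 1) * (Bc (a + 1) * Bc (b + 1))) = 0"
        unfolding xe prod.case by (simp only: mult_zero_left)
    qed
  qed auto
  also have "\<dots> = (\<Sum>(l, m)\<in>(SIGMA l:{..n}. {..<l}). Pc R S n 0 l * (Bc (l - m) * Bc (m + 1)))"
    by (rule sum.reindex_bij_witness[of _ "\<lambda>(l, m). (l - m - 1, m)" "\<lambda>(a, b). (a + b + 1, b)"]) (auto simp: Suc)
  also have "\<dots> = (\<Sum>l\<le>n. Pc R S n 0 l * (\<Sum>m<l. Bc (l - m) * Bc (m + 1)))"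
    by (subst sum.Sigma[symmetric]) (auto simp: sum_distrib_left)
  finally show ?thesis ..
qed simp

text \<open>A path of length n + j is cut at time \<open>n\<close> and height \<open>l\<close>.
  Summed over \<open>j\<close>, the second piece is evaluated by \<open>key_sum\<close>: its first
  terms describe one more step, giving index n + 1, and its convolution gives the loop term by
  \<open>Wc_conv\<close>.\<close>

theorem Wc_tutte: "Wc R S Bc (Suc n) = fps_X * (\<Sum>i<n. Wc R S Bc i * Wc R S Bc (n - 1 - i))
    + fps_X * u * Sa (\<lambda>j. g j * Wc R S Bc (n + j))"
proof -
  have Wnj: "g j * Wc R S Bc (n + j) = (\<Sum>l\<le>n. Pc R S n 0 l * Sa (\<lambda>m. g j * Pc R S j l m * Bc (m + 1)))" for j
  proof -
    have "g j * Wc R S Bc (n + j) = g j * Sa (\<lambda>m. (\<Sum>l\<le>n. Pc R S n 0 l * Pc R S j l m) * Bc (m + 1))"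
      unfolding Wc_Sa Pc_chapman ..
    also have "\<dots> = Sa (\<lambda>m. g j * ((\<Sum>l\<le>n. Pc R S n 0 l * Pc R S j l m) * Bc (m + 1)))"
      by (rule Sa_cmult[symmetric, OF nul_Bc[of _ 1]])
    also have "\<dots> = Sa (\<lambda>m. \<Sum>l\<le>n. Pc R S n 0 l * (g j * Pc R S j l m * Bc (m + 1)))"
      by (simp only: sum_distrib_left sum_distrib_right ac_simps)
    also have "\<dots> = (\<Sum>l\<le>n. Sa (\<lambda>m. Pc R S n 0 l * (g j * Pc R S j l m * Bc (m + 1))))"
      by (rule conjunct1[OF Sa_sum], simp, rule nul_mult[OF nul_Bc[of _ 1]])
    also have "\<dots> = (\<Sum>l\<le>n. Pc R S n 0 l * Sa (\<lambda>m. g j * Pc R S j l m * Bc (m + 1)))"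
      by (rule sum.cong[OF refl], rule Sa_cmult[OF nul_Bc[of _ 1]])
    finally show ?thesis .
  qed
  have inner: "fps_X * u * Sa (\<lambda>j. Sa (\<lambda>m. g j * Pc R S j l m * Bc (m + 1))) =
     S * Bc (l + 1) + Bc (l + 2) + (if l \<ge> 1 then R * Bc l else 0) - fps_X * (\<Sum>m<l. Bc (l - m) * Bc (m + 1))" for l
  proof -
    have "Sa (\<lambda>j. Sa (\<lambda>m. g j * Pc R S j l m * Bc (m + 1))) = Sa (\<lambda>m. Sa (\<lambda>j. g j * Pc R S j l m * Bc (m + 1)))"
      by (rule Sa_swap[OF nul2_PB])
    also have "\<dots> = Sa (\<lambda>m. (bc R S g (int m - int l) - R ^ (l + 1) * bc R S g (int m + int l + 2)) * Bc (m + 1))"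
    proof (intro arg_cong[where f = Sa] ext)
      fix m
      have n1: "nul (\<lambda>j. g j * Tc R S j k)" for k by (rule Tc_nul[OF R0 S0])
      have "Sa (\<lambda>j. g j * Pc R S j l m) = Sa (\<lambda>j. g j * Tc R S j (int m - int l) - R ^ (l + 1) * (g j * Tc R S j (int m + int l + 2)))"
        unfolding Pc_def by (simp add: algebra_simps)
      also have "\<dots> = bc R S g (int m - int l) - R ^ (l + 1) * bc R S g (int m + int l + 2)"
        unfolding bc_def by (subst Sa_diff[OF n1 nul_mult[OF n1]]) (simp only: Sa_cmult[OF n1])
      finally have e: "Sa (\<lambda>j. g j * Pc R S j l m) = bc R S g (int m - int l) - R ^ (l + 1) * bc R S g (int m + int l + 2)" .
      have "nul (\<lambda>j. g j * Pc R S j l m)"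
      proof -
        have "(\<lambda>j. g j * Pc R S j l m) = (\<lambda>j. g j * Tc R S j (int m - int l) - R ^ (l + 1) * (g j * Tc R S j (int m + int l + 2)))"
          unfolding Pc_def by (simp add: algebra_simps)
        then show ?thesis using nul_diff[OF n1 nul_mult[OF n1, of "\<lambda>_. R ^ (l + 1)"]] by simp
      qed
      then show "Sa (\<lambda>j. g j * Pc R S j l m * Bc (m + 1)) =
        (bc R S g (int m - int l) - R ^ (l + 1) * bc R S g (int m + int l + 2)) * Bc (m + 1)"
        by (simp only: Sa_mult2 e)
    qed
    finally have sw: "Sa (\<lambda>j. Sa (\<lambda>m. g j * Pc R S j l m * Bc (m + 1))) =
      Sa (\<lambda>m. (bc R S g (int m - int l) - R ^ (l + 1) * bc R S g (int m + int l + 2)) * Bc (m + 1))" .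
    have "fps_X * u * Sa (\<lambda>j. Sa (\<lambda>m. g j * Pc R S j l m * Bc (m + 1))) = Sa (\<lambda>m. (fps_X * u) * ((bc R S g (int m - int l) - R ^ (l + 1) * bc R S g (int m + int l + 2)) * Bc (m + 1)))"
      unfolding sw using Sa_cmult[OF nul_Bc[of "\<lambda>m. bc R S g (int m - int l) - R ^ (l + 1) * bc R S g (int m + int l + 2)" 1], of "fps_X * u"]
      by (rule sym)
    also have "\<dots> = Sa (\<lambda>m. fps_X * u * (bc R S g (int m - int l) - R ^ (l + 1) * bc R S g (int m + int l + 2)) * Bc (m + 1))"
      by (rule arg_cong[where f = Sa], rule ext, rule mult.assoc[symmetric])
    also have "\<dots> = S * Bc (l + 1) + Bc (l + 2) + (if l \<ge> 1 then R * Bc l else 0) - fps_X * (\<Sum>m<l. Bc (l - m) * Bc (m + 1))"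
      by (rule key_sum)
    finally show ?thesis .
  qed
  have n2: "nul (\<lambda>j. Sa (\<lambda>m. g j * Pc R S j l m * Bc (m + 1)))" for l
    using nul2_Sa(1)[OF nul2_PB[of g l]] .
  have "fps_X * u * Sa (\<lambda>j. g j * Wc R S Bc (n + j)) =
    fps_X * u * (\<Sum>l\<le>n. Pc R S n 0 l * Sa (\<lambda>j. Sa (\<lambda>m. g j * Pc R S j l m * Bc (m + 1))))"
  proof -
    have "Sa (\<lambda>j. g j * Wc R S Bc (n + j)) = (\<Sum>l\<le>n. Sa (\<lambda>j. Pc R S n 0 l * Sa (\<lambda>m. g j * Pc R S j l m * Bc (m + 1))))"
      unfolding Wnj by (rule conjunct1[OF Sa_sum], simp, rule nul_mult[OF n2])
    also have "\<dots> = (\<Sum>l\<le>n. Pc R S n 0 l * Sa (\<lambda>j. Sa (\<lambda>m. g j * Pc R S j l m * Bc (m + 1))))"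
      by (rule sum.cong[OF refl], rule Sa_cmult[OF n2])
    finally show ?thesis by simp
  qed
  also have "\<dots> = (\<Sum>l\<le>n. Pc R S n 0 l * (fps_X * u * Sa (\<lambda>j. Sa (\<lambda>m. g j * Pc R S j l m * Bc (m + 1)))))"
    by (simp add: sum_distrib_left ac_simps)
  also have "\<dots> = (\<Sum>l\<le>n. Pc R S n 0 l * (S * Bc (l + 1) + Bc (l + 2) + (if l \<ge> 1 then R * Bc l else 0)))
     - fps_X * (\<Sum>l\<le>n. Pc R S n 0 l * (\<Sum>m<l. Bc (l - m) * Bc (m + 1)))"
    unfolding inner by (simp only: right_diff_distrib sum_subtractf sum_distrib_left) (simp only: ac_simps)
  finally have main: "fps_X * u * Sa (\<lambda>j. g j * Wc R S Bc (n + j)) =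
    (\<Sum>l\<le>n. Pc R S n 0 l * (S * Bc (l + 1) + Bc (l + 2) + (if l \<ge> 1 then R * Bc l else 0)))
     - fps_X * (\<Sum>l\<le>n. Pc R S n 0 l * (\<Sum>m<l. Bc (l - m) * Bc (m + 1)))" .
  \<comment> \<open>The bracket is the sum of \<open>Pc R S 1 l m * Bc (m + 1)\<close> over
    \<open>m\<close>: one step up, level or down from height \<open>l\<close>.\<close>
  have JB: "(\<Sum>l\<le>n. Pc R S n 0 l * (S * Bc (l + 1) + Bc (l + 2) + (if l \<ge> 1 then R * Bc l else 0))) = Wc R S Bc (Suc n)"
  proof -
    have "Wc R S Bc (n + 1) = (\<Sum>m\<le>n + 1. \<Sum>l\<le>n. Pc R S n 0 l * (Pc R S 1 l m * Bc (m + 1)))"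
      unfolding Wc_def Pc_chapman by (simp only: sum_distrib_right mult.assoc)
    also have "\<dots> = (\<Sum>l\<le>n. Pc R S n 0 l * (\<Sum>m\<le>n + 1. Pc R S 1 l m * Bc (m + 1)))"
      unfolding sum_distrib_left by (rule sum.swap)
    also have "\<dots> = (\<Sum>l\<le>n. Pc R S n 0 l * (S * Bc (l + 1) + Bc (l + 2) + (if l \<ge> 1 then R * Bc l else 0)))"
    proof (intro sum.cong refl arg_cong2[where f = "(*)"])
      fix l assume "l \<in> {..n}"
      then have l: "l \<le> n" by simp
      have "(\<Sum>m\<le>n + 1. Pc R S 1 l m * Bc (m + 1)) = (\<Sum>m\<le>n + 1. if m = Suc l then Bc (m + 1) else 0)
        + (\<Sum>m\<le>n + 1. if m = l then S * Bc (m + 1) else 0) + (\<Sum>m\<le>n + 1. if m = l - 1 then (if l \<ge> 1 then R * Bc (m + 1) else 0) else 0)"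
        unfolding Pc_one sum.distrib[symmetric] by (rule sum.cong) (auto simp: algebra_simps)
      also have "\<dots> = S * Bc (l + 1) + Bc (l + 2) + (if l \<ge> 1 then R * Bc l else 0)"
        using l by (cases l; cases "n = l") (auto simp: ac_simps)
      finally show "(\<Sum>m\<le>n + 1. Pc R S 1 l m * Bc (m + 1)) = S * Bc (l + 1) + Bc (l + 2) + (if l \<ge> 1 then R * Bc l else 0)" .
    qed
    finally show ?thesis by simp
  qed
  show ?thesis unfolding main JB Wc_conv by (rule diff_add_cancel[symmetric, THEN trans]) (rule add.commute)
qed

lemma Sa_h_Wc: "Sa (\<lambda>n. h n * Wc R S Bc n) = Sa (\<lambda>m. (bc R S h (int m) - R * bc R S h (int m + 2)) * Bc (m + 1))"
proof -
  have n1: "nul (\<lambda>j. h j * Tc R S j k)" for k by (rule Tc_nul[OF R0 S0])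
  have "Sa (\<lambda>n. h n * Wc R S Bc n) = Sa (\<lambda>n. Sa (\<lambda>m. h n * Pc R S n 0 m * Bc (m + 1)))"
    unfolding Wc_Sa Sa_cmult[OF nul_Bc[of _ 1], symmetric] mult.assoc ..
  also have "\<dots> = Sa (\<lambda>m. Sa (\<lambda>n. h n * Pc R S n 0 m * Bc (m + 1)))" by (rule Sa_swap[OF nul2_PB])
  also have "\<dots> = Sa (\<lambda>m. (bc R S h (int m) - R * bc R S h (int m + 2)) * Bc (m + 1))"
  proof (intro arg_cong[where f = Sa] ext)
    fix m
    have e: "(\<lambda>j. h j * Pc R S j 0 m) = (\<lambda>j. h j * Tc R S j (int m) - R * (h j * Tc R S j (int m + 2)))"
      unfolding Pc_def by (simp add: algebra_simps)
    have "nul (\<lambda>j. h j * Pc R S j 0 m)" unfolding e by (rule nul_diff[OF n1 nul_mult[OF n1]])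
    moreover have "Sa (\<lambda>j. h j * Pc R S j 0 m) = bc R S h (int m) - R * bc R S h (int m + 2)"
      unfolding e bc_def by (subst Sa_diff[OF n1 nul_mult[OF n1]]) (simp only: Sa_cmult[OF n1])
    ultimately show "Sa (\<lambda>n. h n * Pc R S n 0 m * Bc (m + 1)) = (bc R S h (int m) - R * bc R S h (int m + 2)) * Bc (m + 1)"
      by (simp only: Sa_mult2)
  qed
  finally show ?thesis .
qed

end

text \<open>Entry \<open>n\<close> of the iterates of F is stable after n + 1 iterations, whatever
  the start; the stable values form the fixed point.\<close>

lemma causal_fixpoint:
  fixes F :: "(nat \<Rightarrow> 'b) \<Rightarrow> nat \<Rightarrow> 'b"
  assumes "\<And>f g n. (\<And>i. i < n \<Longrightarrow> f i = g i) \<Longrightarrow> F f n = F g n"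
  shows "\<exists>f. F f = f"
proof -
  define a :: "nat \<Rightarrow> 'b" where "a = (\<lambda>_. undefined)"
  have st: "(F ^^ k) a n = (F ^^ Suc n) a n" if "n < k" for n k
    using that
  proof (induction n arbitrary: k rule: less_induct)
    case (less n)
    obtain k' where k: "k = Suc k'" using less.prems by (cases k) auto
    have "F ((F ^^ k') a) n = F ((F ^^ n) a) n"
    proof (rule assms)
      fix i assume i: "i < n"
      then have "i < k'" using less.prems k by simp
      then show "(F ^^ k') a i = (F ^^ n) a i" using less.IH[OF i \<open>i < k'\<close>] less.IH[OF i i] by simp
    qed
    then show ?case using k by simp
  qed
  define f where "f n = (F ^^ Suc n) a n" for n
  have "F f n = f n" for n
  proof -
    have "F f n = F ((F ^^ n) a) n" by (rule assms) (unfold f_def, rule st[symmetric])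
    then show ?thesis by (simp add: f_def)
  qed
  then have "F f = f" by (rule ext)
  then show ?thesis by (rule exI[of _ f])
qed

lemma ex_one_cut: fixes z u :: "'a::comm_ring_1 fps" shows "\<exists>Q R S. one_cut z u Q R S g"
proof -
  define \<Phi> where "\<Phi> R S = (z + u * R * bc R S g 1, fps_X * (u * bc R S g 0))" for R S
  \<comment> \<open>The unknown sequence lists the coefficients of \<open>Q\<close> and
    \<open>S\<close>. The equations are causal because each \<open>bc\<close> comes with a factor X,
    explicit or contained in R.\<close>
  define Rf where "Rf f = fps_X * Abs_fps (\<lambda>n. fst (f n))" for f :: "nat \<Rightarrow> 'a \<times> 'a"
  define Sf where "Sf f = Abs_fps (\<lambda>n. snd (f n))" for f :: "nat \<Rightarrow> 'a \<times> 'a"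
  define F where "F f n = (fst (\<Phi> (Rf f) (Sf f)) $ n, snd (\<Phi> (Rf f) (Sf f)) $ n)" for f n
  have "F f n = F f' n" if eq: "\<And>i. i < n \<Longrightarrow> f i = f' i" for f f' n
  proof -
    have R: "Rf f $ i = Rf f' $ i" if "i \<le> n" for i using eq[of "i - 1"] that by (cases i) (auto simp: Rf_def)
    have S: "Sf f $ i = Sf f' $ i" if "i < n" for i using eq that by (simp add: Sf_def)
    have b: "bc (Rf f) (Sf f) g k $ i = bc (Rf f') (Sf f') g k $ i" if "i < n" for i k
      unfolding bc_def
      by (rule Sa_cong_nth, rule fps_mult_cong_nth, simp, rule Tc_cong[of i]) (use R S that in auto)
    have "fst (\<Phi> (Rf f) (Sf f)) $ n = fst (\<Phi> (Rf f') (Sf f')) $ n"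
    proof -
      have e: "u * Rf h * y = fps_X * (u * Abs_fps (\<lambda>n. fst (h n)) * y)" for h y by (simp add: Rf_def ac_simps)
      have "(u * Abs_fps (\<lambda>n. fst (f n)) * bc (Rf f) (Sf f) g 1) $ (n - 1) = (u * Abs_fps (\<lambda>n. fst (f' n)) * bc (Rf f') (Sf f') g 1) $ (n - 1)"
        if "n \<noteq> 0" by (rule fps_mult_cong_nth, rule fps_mult_cong_nth) (use b eq that in auto)
      then show ?thesis unfolding \<Phi>_def fst_conv e by simp
    qed
    moreover have "snd (\<Phi> (Rf f) (Sf f)) $ n = snd (\<Phi> (Rf f') (Sf f')) $ n"
    proof -
      have "(u * bc (Rf f) (Sf f) g 0) $ (n - 1) = (u * bc (Rf f') (Sf f') g 0) $ (n - 1)" if "n \<noteq> 0"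
        by (rule fps_mult_cong_nth) (use b that in auto)
      then show ?thesis unfolding \<Phi>_def by simp
    qed
    ultimately show ?thesis by (simp add: F_def)
  qed
  then obtain f where f: "F f = f" using causal_fixpoint[of F] by blast
  define Q where "Q = Abs_fps (\<lambda>n. fst (f n))"
  have f1: "fst (f n) = fst (\<Phi> (Rf f) (Sf f)) $ n" and f2: "snd (f n) = snd (\<Phi> (Rf f) (Sf f)) $ n" for n
    using arg_cong[OF f, of "\<lambda>h. h n"] by (metis F_def fst_conv, metis F_def snd_conv)
  have "Q = fst (\<Phi> (Rf f) (Sf f))" unfolding Q_def by (rule fps_ext) (simp add: f1)
  moreover have "Sf f = snd (\<Phi> (Rf f) (Sf f))" 
  proof (rule fps_ext)
    fix n
    have "Sf f $ n = snd (f n)" by (simp add: Sf_def)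
    then show "Sf f $ n = snd (\<Phi> (Rf f) (Sf f)) $ n" unfolding f2 .
  qed
  moreover have "Rf f = fps_X * Q" by (simp add: Rf_def Q_def)
  ultimately have "one_cut z u Q (Rf f) (Sf f) g"
    by unfold_locales (simp_all add: \<Phi>_def mult.assoc)
  then show ?thesis by blast
qed

text \<open>Both terms on the right carry a factor X, so coefficient m of every \<open>W k\<close>
  with positive \<open>k\<close> is determined by lower coefficients of all the \<open>W j\<close>.
  The induction is on m, for all indices at once.\<close>

lemma tutte_unique:
  fixes W W' :: "nat \<Rightarrow> 'a::comm_ring_1 fps"
  assumes "W 0 = W' 0"
    and W: "\<And>n. W (Suc n) = fps_X * (\<Sum>i<n. W i * W (n - 1 - i)) + fps_X * u * Sa (\<lambda>j. g j * W (n + j))"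
    and W': "\<And>n. W' (Suc n) = fps_X * (\<Sum>i<n. W' i * W' (n - 1 - i)) + fps_X * u * Sa (\<lambda>j. g j * W' (n + j))"
  shows "W = W'"
proof -
  have "W k $ m = W' k $ m" for k m
  proof (induction m arbitrary: k rule: less_induct)
    case (less m)
    show ?case
    proof (cases k)
      case (Suc n)
      have "((\<Sum>i<n. W i * W (n - 1 - i)) + u * Sa (\<lambda>j. g j * W (n + j))) $ (m - 1) =
        ((\<Sum>i<n. W' i * W' (n - 1 - i)) + u * Sa (\<lambda>j. g j * W' (n + j))) $ (m - 1)" if "m \<noteq> 0"
      proof -
        have 1: "(W i * W i') $ (m - 1) = (W' i * W' i') $ (m - 1)" for i i'
          by (rule fps_mult_cong_nth) (use less that in auto)
        have 2: "(u * Sa (\<lambda>j. g j * W (n + j))) $ (m - 1) = (u * Sa (\<lambda>j. g j * W' (n + j))) $ (m - 1)"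
          by (rule fps_mult_cong_nth[OF refl], rule Sa_cong_nth, rule fps_mult_cong_nth) (use less that in auto)
        show ?thesis using 1 2 by (simp add: fps_sum_nth)
      qed
      moreover have "x * y + x * u * v = x * (y + u * v)" for x y v :: "'a fps" by (simp add: algebra_simps)
      ultimately show ?thesis unfolding Suc W W' by (simp only:) (auto simp: fps_X_mult_nth)
    qed (use assms in simp)
  qed
  then show ?thesis by (intro ext fps_ext)
qed

section \<open>The generating function of the terms\<close>

fun wt :: "'b::comm_ring_1 \<Rightarrow> 'b \<Rightarrow> (nat \<Rightarrow> 'b) \<Rightarrow> tm \<Rightarrow> 'b" where
  "wt z u G Vx = z"
| "wt z u G (Lp x y) = wt z u G x * wt z u G y"
| "wt z u G (Jn x q) = u * G (Suc q) * wt z u G x"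

definition Tm :: "nat \<Rightarrow> tm set" where "Tm n = {t. valid t \<and> edges t = n}"

lemma rdeg_le: "valid t \<Longrightarrow> rdeg t \<le> 2 * edges t"
  by (induction t) auto

lemma Tm_0: "Tm 0 = {Vx}"
proof -
  have "edges t = 0 \<Longrightarrow> t = Vx" for t by (cases t) auto
  then show ?thesis by (auto simp: Tm_def)
qed

lemma Tm_Suc: "Tm (Suc n) = (\<lambda>(i, x, y). Lp x y) ` (SIGMA i:{..n}. Tm i \<times> Tm (n - i)) \<union> (\<lambda>(x, q). Jn x q) ` (SIGMA x:Tm n. {..rdeg x})"
proof (intro equalityI subsetI)
  fix t assume t: "t \<in> Tm (Suc n)"
  show "t \<in> (\<lambda>(i, x, y). Lp x y) ` (SIGMA i:{..n}. Tm i \<times> Tm (n - i)) \<union> (\<lambda>(x, q). Jn x q) ` (SIGMA x:Tm n. {..rdeg x})"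
  proof (cases t)
    case Vx then show ?thesis using t by (simp add: Tm_def)
  next
    case (Lp x y)
    then have "(edges x, x, y) \<in> (SIGMA i:{..n}. Tm i \<times> Tm (n - i))" using t by (auto simp: Tm_def)
    then show ?thesis using Lp by force
  next
    case (Jn x q)
    then have "(x, q) \<in> (SIGMA x:Tm n. {..rdeg x})" using t by (auto simp: Tm_def)
    then show ?thesis using Jn by force
  qed
qed (auto simp: Tm_def)

lemma finite_Tm: "finite (Tm n)"
proof (induction n rule: less_induct)
  case (less n)
  show ?case
  proof (cases n)
    case (Suc m)
    then have f: "finite (Tm i)" if "i \<le> m" for i using less that by simp
    show ?thesis unfolding Suc Tm_Suc by (intro finite_UnI finite_imageI finite_SigmaI finite_cartesian_product) (auto intro: f)
  qed (simp add: Tm_0)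
qed

lemma sum_Tm_Suc: fixes f :: "tm \<Rightarrow> 'b::comm_ring_1"
  shows "(\<Sum>t\<in>Tm (Suc n). f t) = (\<Sum>i\<le>n. \<Sum>x\<in>Tm i. \<Sum>y\<in>Tm (n - i). f (Lp x y)) + (\<Sum>x\<in>Tm n. \<Sum>q\<le>rdeg x. f (Jn x q))"
proof -
  let ?A = "(\<lambda>(i, x, y). Lp x y) ` (SIGMA i:{..n}. Tm i \<times> Tm (n - i))"
  let ?B = "(\<lambda>(x, q). Jn x q) ` (SIGMA x:Tm n. {..rdeg x})"
  have "(\<Sum>t\<in>Tm (Suc n). f t) = (\<Sum>t\<in>?A \<union> ?B. f t)" unfolding Tm_Suc by simp
  also have "\<dots> = (\<Sum>t\<in>?A. f t) + (\<Sum>t\<in>?B. f t)"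
    by (rule sum.union_disjoint) (auto simp: finite_Tm)
  also have "(\<Sum>t\<in>?A. f t) = (\<Sum>(i, x, y)\<in>(SIGMA i:{..n}. Tm i \<times> Tm (n - i)). f (Lp x y))"
    by (subst sum.reindex) (auto simp: inj_on_def Tm_def case_prod_unfold intro!: sum.cong)
  also have "\<dots> = (\<Sum>i\<le>n. \<Sum>x\<in>Tm i. \<Sum>y\<in>Tm (n - i). f (Lp x y))"
    by (simp add: sum.Sigma[symmetric] sum.cartesian_product[symmetric] finite_Tm)
  also have "(\<Sum>t\<in>?B. f t) = (\<Sum>(x, q)\<in>(SIGMA x:Tm n. {..rdeg x}). f (Jn x q))"
    by (subst sum.reindex) (auto simp: inj_on_def case_prod_unfold)
  also have "\<dots> = (\<Sum>x\<in>Tm n. \<Sum>q\<le>rdeg x. f (Jn x q))"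
    by (simp add: sum.Sigma[symmetric] finite_Tm)
  finally show ?thesis .
qed

definition wn :: "'b::comm_ring_1 \<Rightarrow> 'b \<Rightarrow> (nat \<Rightarrow> 'b) \<Rightarrow> nat \<Rightarrow> nat \<Rightarrow> 'b" where
  "wn z u G n k = (\<Sum>t\<in>Tm n. if rdeg t = k then wt z u G t else 0)"

lemma wn_zero: "k > 2 * n \<Longrightarrow> wn z u G n k = 0"
  unfolding wn_def by (rule sum.neutral) (use rdeg_le in \<open>auto simp: Tm_def dest!: rdeg_le\<close>)

lemma wn_0: "wn z u G 0 k = (if k = 0 then z else 0)"
  by (auto simp: wn_def Tm_0)

lemma wn_Suc_0: "wn z u G (Suc n) 0 = 0"
  unfolding wn_def
proof (rule sum.neutral, rule ballI)
  fix t assume "t \<in> Tm (Suc n)"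
  then show "(if rdeg t = 0 then wt z u G t else 0) = 0" by (cases t) (auto simp: Tm_def)
qed

text \<open>Tutte's recursion. The root loop contributes 2 to the degree, so the degrees of the two
  sides add up to k - 1; a nonloop root edge of total degree k + 1 comes from a root of degree k + q
  with \<open>q\<close> darts pulled away.\<close>

lemma wn_Suc_Suc: "wn z u G (Suc n) (Suc k) = (\<Sum>i\<le>n. \<Sum>a<k. wn z u G i a * wn z u G (n - i) (k - 1 - a))
   + u * (\<Sum>q\<le>2 * n. G (Suc q) * wn z u G n (k + q))"
proof -
  let ?w = "wt z u G"
  have 1: "(\<Sum>x\<in>Tm i. \<Sum>y\<in>Tm j. if rdeg (Lp x y) = Suc k then ?w (Lp x y) else 0) =
     (\<Sum>a<k. wn z u G i a * wn z u G j (k - 1 - a))" for i j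
  proof -
    have "(if rdeg (Lp x y) = Suc k then ?w (Lp x y) else 0) =
      (\<Sum>a<k. (if rdeg x = a then ?w x else 0) * (if rdeg y = k - 1 - a then ?w y else 0))" for x y
    proof -
      have "(\<Sum>a<k. (if rdeg x = a then ?w x else 0) * (if rdeg y = k - 1 - a then ?w y else 0)) =
        (\<Sum>a<k. if a = rdeg x then ?w x * (if rdeg y = k - 1 - rdeg x then ?w y else 0) else 0)"
        by (rule sum.cong) auto
      also have "\<dots> = (if rdeg x < k then ?w x * (if rdeg y = k - 1 - rdeg x then ?w y else 0) else 0)"
        by (subst sum.delta) auto
      also have "\<dots> = (if rdeg (Lp x y) = Suc k then ?w (Lp x y) else 0)" by auto
      finally show ?thesis ..
    qed
    then have "(\<Sum>x\<in>Tm i. \<Sum>y\<in>Tm j. if rdeg (Lp x y) = Suc k then ?w (Lp x y) else 0) =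
      (\<Sum>x\<in>Tm i. \<Sum>y\<in>Tm j. \<Sum>a<k. (if rdeg x = a then ?w x else 0) * (if rdeg y = k - 1 - a then ?w y else 0))"
      by simp
    also have "\<dots> = (\<Sum>x\<in>Tm i. \<Sum>a<k. \<Sum>y\<in>Tm j. (if rdeg x = a then ?w x else 0) * (if rdeg y = k - 1 - a then ?w y else 0))"
      by (rule sum.cong[OF refl], rule sum.swap)
    also have "\<dots> = (\<Sum>a<k. \<Sum>x\<in>Tm i. \<Sum>y\<in>Tm j. (if rdeg x = a then ?w x else 0) * (if rdeg y = k - 1 - a then ?w y else 0))"
      by (rule sum.swap)
    also have "\<dots> = (\<Sum>a<k. wn z u G i a * wn z u G j (k - 1 - a))"
      unfolding wn_def sum_product ..
    finally show ?thesis .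
  qed
  have 2: "(\<Sum>x\<in>Tm n. \<Sum>q\<le>rdeg x. if rdeg (Jn x q) = Suc k then ?w (Jn x q) else 0) =
    u * (\<Sum>q\<le>2 * n. G (Suc q) * wn z u G n (k + q))"
  proof -
    have "(\<Sum>q\<le>rdeg x. if rdeg (Jn x q) = Suc k then ?w (Jn x q) else 0) =
      (\<Sum>q\<le>2 * n. u * (G (Suc q) * (if rdeg x = k + q then ?w x else 0)))" if "x \<in> Tm n" for x
    proof -
      have "rdeg x \<le> 2 * n" using that rdeg_le[of x] by (auto simp: Tm_def)
      then show ?thesis
        by (intro sum.mono_neutral_cong_left) (auto simp: ac_simps)
    qed
    then have "(\<Sum>x\<in>Tm n. \<Sum>q\<le>rdeg x. if rdeg (Jn x q) = Suc k then ?w (Jn x q) else 0) =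
      (\<Sum>x\<in>Tm n. \<Sum>q\<le>2 * n. u * (G (Suc q) * (if rdeg x = k + q then ?w x else 0)))" by simp
    also have "\<dots> = (\<Sum>q\<le>2 * n. \<Sum>x\<in>Tm n. u * (G (Suc q) * (if rdeg x = k + q then ?w x else 0)))"
      by (rule sum.swap)
    also have "\<dots> = u * (\<Sum>q\<le>2 * n. G (Suc q) * wn z u G n (k + q))"
      unfolding wn_def sum_distrib_left ..
    finally show ?thesis .
  qed
  show ?thesis unfolding wn_def[of z u G "Suc n"] sum_Tm_Suc 1 2 ..
qed

lemma nul_X: fixes f :: "nat \<Rightarrow> 'a::comm_ring_1 fps" shows "nul (\<lambda>n. fps_X ^ n * f n)"
  by (rule nulI[where J = Suc]) (simp add: fps_X_power_mult_nth)

lemma Sa_delay: fixes f :: "nat \<Rightarrow> 'a::comm_ring_1 fps" assumes "nul f"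
  shows "Sa (\<lambda>n. if n < c then 0 else f (n - c)) = Sa f"
proof -
  have "nul (\<lambda>n. if n < c then 0 else f (n - c))" unfolding nul_def
  proof
    fix m
    obtain J where "\<And>j l. j \<ge> J \<Longrightarrow> l \<le> m \<Longrightarrow> f j $ l = 0" using nulE[OF assms] by metis
    then show "\<exists>J. \<forall>j\<ge>J. \<forall>l\<le>m. (if j < c then 0 else f (j - c)) $ l = 0" by (intro exI[of _ "J + c"]) auto
  qed
  from Sa_split[OF this, of c] show ?thesis by simp
qed

lemma Sa_conv: fixes a b :: "nat \<Rightarrow> 'a::comm_ring_1 fps"
  shows "Sa (\<lambda>n. fps_X ^ n * (\<Sum>i\<le>n. a i * b (n - i))) = Sa (\<lambda>i. fps_X ^ i * a i) * Sa (\<lambda>j. fps_X ^ j * b j)"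
proof -
  define F where "F i n = (if n < i then 0 else fps_X ^ n * (a i * b (n - i)))" for i n
  have n2: "nul2 F" unfolding nul2_def
  proof
    fix m
    show "\<exists>J. \<forall>i j. i \<ge> J \<or> j \<ge> J \<longrightarrow> (\<forall>l\<le>m. F i j $ l = 0)"
      by (rule exI[of _ "Suc m"]) (auto simp: F_def fps_X_power_mult_nth)
  qed
  have "Sa (\<lambda>i. fps_X ^ i * a i) * Sa (\<lambda>j. fps_X ^ j * b j) = Sa (\<lambda>i. (fps_X ^ i * a i) * Sa (\<lambda>j. fps_X ^ j * b j))"
    by (rule Sa_mult2[OF nul_X, symmetric])
  also have "\<dots> = Sa (\<lambda>i. Sa (F i))"
  proof (intro arg_cong[where f = Sa] ext)
    fix i
    have "(fps_X ^ i * a i) * Sa (\<lambda>j. fps_X ^ j * b j) = Sa (\<lambda>j. (fps_X ^ i * a i) * (fps_X ^ j * b j))"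
      by (rule Sa_cmult[OF nul_X, symmetric])
    also have "\<dots> = Sa (\<lambda>n. if n < i then 0 else (fps_X ^ i * a i) * (fps_X ^ (n - i) * b (n - i)))"
      by (rule Sa_delay[OF nul_mult[OF nul_X], symmetric])
    also have "\<dots> = Sa (F i)"
    proof (intro arg_cong[where f = Sa] ext)
      fix n
      show "(if n < i then 0 else (fps_X ^ i * a i) * (fps_X ^ (n - i) * b (n - i))) = F i n"
      proof (cases "n < i")
        case False
        then have pw: "(fps_X :: 'a fps) ^ n = fps_X ^ i * fps_X ^ (n - i)"
          using power_add[of "fps_X :: 'a fps" i "n - i"] by simp
        show ?thesis unfolding F_def if_not_P[OF False] pw by (simp only: ac_simps)
      qed (simp add: F_def)
    qed
    finally show "(fps_X ^ i * a i) * Sa (\<lambda>j. fps_X ^ j * b j) = Sa (F i)" .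
  qed
  also have "\<dots> = Sa (\<lambda>n. Sa (\<lambda>i. F i n))" by (rule Sa_swap[OF n2])
  also have "\<dots> = Sa (\<lambda>n. fps_X ^ n * (\<Sum>i\<le>n. a i * b (n - i)))"
  proof (intro arg_cong[where f = Sa] ext)
    fix n
    have "Sa (\<lambda>i. F i n) = (\<Sum>i<Suc n. F i n)" by (rule Sa_finite) (simp add: F_def)
    also have "\<dots> = fps_X ^ n * (\<Sum>i\<le>n. a i * b (n - i))"
      unfolding lessThan_Suc_atMost sum_distrib_left by (rule sum.cong) (auto simp: F_def)
    finally show "Sa (\<lambda>i. F i n) = fps_X ^ n * (\<Sum>i\<le>n. a i * b (n - i))" .
  qed
  finally show ?thesis ..
qed

definition Wt :: "'a::comm_ring_1 fps \<Rightarrow> 'a fps \<Rightarrow> (nat \<Rightarrow> 'a fps) \<Rightarrow> nat \<Rightarrow> 'a fps" where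
  "Wt z u G k = Sa (\<lambda>n. fps_X ^ n * wn z u G n k)"

lemma nul2_wn: fixes z u :: "'a::comm_ring_1 fps" shows "nul2 (\<lambda>q n. c q * (fps_X ^ n * wn z u G n (k + q)))"
  unfolding nul2_def
proof
  fix m
  \<comment> \<open>With at most m edges the root degree is at most 2m, so \<open>q\<close> is
    bounded as well.\<close>
  have "(c q * (fps_X ^ n * wn z u G n (k + q))) $ l = 0" if "q \<ge> 2 * m + 1 \<or> n \<ge> 2 * m + 1" "l \<le> m" for q n l
  proof (cases "n > m")
    case True
    then show ?thesis using that by (subst fps_mult_nth_zero) (simp_all add: fps_X_power_mult_nth)
  next
    case False
    then show ?thesis using that wn_zero[of n "k + q" z u G] by simp
  qed
  then show "\<exists>J. \<forall>i j. i \<ge> J \<or> j \<ge> J \<longrightarrow> (\<forall>l\<le>m. (c i * (fps_X ^ j * wn z u G j (k + i))) $ l = 0)" by blast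
qed

lemma Wt_0: "Wt z u G 0 = z"
proof -
  have "Wt z u G 0 = (\<Sum>n<1. fps_X ^ n * wn z u G n 0)"
    unfolding Wt_def
  proof (rule Sa_finite)
    fix n :: nat assume "1 \<le> n"
    then show "fps_X ^ n * wn z u G n 0 = 0" by (cases n) (simp_all add: wn_Suc_0)
  qed
  then show ?thesis by (simp add: wn_0)
qed

lemma Wt_tutte: "Wt z u G (Suc k) = fps_X * (\<Sum>a<k. Wt z u G a * Wt z u G (k - 1 - a))
    + fps_X * u * Sa (\<lambda>q. G (Suc q) * Wt z u G (k + q))"
proof -
  let ?w = "wn z u G"
  have "Wt z u G (Suc k) = Sa (\<lambda>n. fps_X ^ (n + 1) * ?w (n + 1) (Suc k))"
    unfolding Wt_def by (subst Sa_split[OF nul_X, where c = 1]) (simp add: wn_0)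
  also have "\<dots> = Sa (\<lambda>n. fps_X * ((\<Sum>a<k. fps_X ^ n * (\<Sum>i\<le>n. ?w i a * ?w (n - i) (k - 1 - a)))
      + u * Sa (\<lambda>q. G (Suc q) * (fps_X ^ n * ?w n (k + q)))))"
  proof (intro arg_cong[where f = Sa] ext)
    fix n
    have s: "Sa (\<lambda>q. G (Suc q) * (fps_X ^ n * ?w n (k + q))) = (\<Sum>q<Suc (2 * n). G (Suc q) * (fps_X ^ n * ?w n (k + q)))"
      by (rule Sa_finite) (simp add: wn_zero)
    have e: "n + 1 = Suc n" by (rule Suc_eq_plus1[symmetric])
    have "(\<Sum>i\<le>n. \<Sum>a<k. ?w i a * ?w (n - i) (k - 1 - a)) = (\<Sum>a<k. \<Sum>i\<le>n. ?w i a * ?w (n - i) (k - 1 - a))" by (rule sum.swap)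
    note sw = this
    have 1: "(\<Sum>a<k. (fps_X :: 'a fps) ^ n * (\<Sum>i\<le>n. ?w i a * ?w (n - i) (k - 1 - a))) =
      fps_X ^ n * (\<Sum>a<k. \<Sum>i\<le>n. ?w i a * ?w (n - i) (k - 1 - a))" by (rule sum_distrib_left[symmetric])
    have 2: "(\<Sum>q\<le>2 * n. G (Suc q) * (fps_X ^ n * ?w n (k + q))) = fps_X ^ n * (\<Sum>q\<le>2 * n. G (Suc q) * ?w n (k + q))"
      unfolding sum_distrib_left by (simp only: mult.left_commute)
    have ring: "x ^ Suc n * (y + v * y') = x * (x ^ n * y + v * (x ^ n * y'))" for x y v y' :: "'a fps"
      by (simp add: algebra_simps)
    show "fps_X ^ (n + 1) * ?w (n + 1) (Suc k) = fps_X * ((\<Sum>a<k. fps_X ^ n * (\<Sum>i\<le>n. ?w i a * ?w (n - i) (k - 1 - a)))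
      + u * Sa (\<lambda>q. G (Suc q) * (fps_X ^ n * ?w n (k + q))))"
      unfolding e wn_Suc_Suc s lessThan_Suc_atMost 1 2 sw by (rule ring)
  qed
  also have "\<dots> = fps_X * (Sa (\<lambda>n. \<Sum>a<k. fps_X ^ n * (\<Sum>i\<le>n. ?w i a * ?w (n - i) (k - 1 - a)))
      + u * Sa (\<lambda>n. Sa (\<lambda>q. G (Suc q) * (fps_X ^ n * ?w n (k + q)))))"
  proof -
    have n1: "nul (\<lambda>n. \<Sum>a<k. fps_X ^ n * (\<Sum>i\<le>n. ?w i a * ?w (n - i) (k - 1 - a)))"
      by (rule conjunct2[OF Sa_sum], simp, rule nul_X)
    have n2: "nul (\<lambda>n. Sa (\<lambda>q. G (Suc q) * (fps_X ^ n * ?w n (k + q))))"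
      by (rule nul2_Sa(2)[OF nul2_wn])
    show ?thesis
      unfolding Sa_cmult[OF nul_add[OF n1 nul_mult[OF n2, of "\<lambda>_. u"]]] Sa_add[OF n1 nul_mult[OF n2, of "\<lambda>_. u"]] Sa_cmult[OF n2] ..
  qed
  also have "Sa (\<lambda>n. \<Sum>a<k. fps_X ^ n * (\<Sum>i\<le>n. ?w i a * ?w (n - i) (k - 1 - a))) = (\<Sum>a<k. Wt z u G a * Wt z u G (k - 1 - a))"
    unfolding Wt_def Sa_conv[symmetric] by (rule conjunct1[OF Sa_sum], simp, rule nul_X)
  also have "Sa (\<lambda>n. Sa (\<lambda>q. G (Suc q) * (fps_X ^ n * ?w n (k + q)))) = Sa (\<lambda>q. G (Suc q) * Wt z u G (k + q))"
    unfolding Sa_swap[OF nul2_wn, symmetric] Wt_def by (intro arg_cong[where f = Sa] ext Sa_cmult[OF nul_X])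
  finally show ?thesis by (simp add: algebra_simps)
qed

lemma Sa_terms: fixes z u :: "'a::comm_ring_1 fps"
  shows "Sa (\<lambda>n. fps_X ^ n * (\<Sum>t\<in>Tm n. wt z u G t * h (rdeg t))) = Sa (\<lambda>k. h k * Wt z u G k)"
proof -
  have "(\<Sum>t\<in>Tm n. wt z u G t * h (rdeg t)) = Sa (\<lambda>k. h k * wn z u G n k)" for n
  proof -
    have "Sa (\<lambda>k. h k * wn z u G n k) = (\<Sum>k<Suc (2 * n). h k * wn z u G n k)"
      by (rule Sa_finite) (simp add: wn_zero)
    also have "\<dots> = (\<Sum>t\<in>Tm n. \<Sum>k<Suc (2 * n). if k = rdeg t then wt z u G t * h (rdeg t) else 0)"
      unfolding wn_def sum_distrib_left by (subst sum.swap) (intro sum.cong refl; auto)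
    also have "\<dots> = (\<Sum>t\<in>Tm n. wt z u G t * h (rdeg t))"
    proof (rule sum.cong[OF refl])
      fix t assume "t \<in> Tm n"
      then have "rdeg t < Suc (2 * n)" using rdeg_le[of t] by (auto simp: Tm_def)
      then show "(\<Sum>k<Suc (2 * n). if k = rdeg t then wt z u G t * h (rdeg t) else 0) = wt z u G t * h (rdeg t)"
        by (subst sum.delta) auto
    qed
    finally show ?thesis ..
  qed
  then have "Sa (\<lambda>n. fps_X ^ n * (\<Sum>t\<in>Tm n. wt z u G t * h (rdeg t))) = Sa (\<lambda>n. Sa (\<lambda>k. h k * (fps_X ^ n * wn z u G n (0 + k))))"
  proof -
    have "fps_X ^ n * Sa (\<lambda>k. h k * wn z u G n k) = Sa (\<lambda>k. h k * (fps_X ^ n * wn z u G n (0 + k)))" for n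
    proof -
      have "nul (\<lambda>k. h k * wn z u G n k)" by (rule nul_fin[of "Suc (2 * n)"]) (simp add: wn_zero)
      from Sa_cmult[OF this, of "fps_X ^ n"] show ?thesis by (simp add: ac_simps)
    qed
    then show ?thesis using \<open>\<And>n. (\<Sum>t\<in>Tm n. wt z u G t * h (rdeg t)) = _ n\<close> by simp
  qed
  also have "\<dots> = Sa (\<lambda>k. Sa (\<lambda>n. h k * (fps_X ^ n * wn z u G n (0 + k))))" by (rule Sa_swap[OF nul2_wn, symmetric])
  also have "\<dots> = Sa (\<lambda>k. h k * Wt z u G k)"
    unfolding Wt_def add_0 by (intro arg_cong[where f = Sa] ext Sa_cmult[OF nul_X])
  finally show ?thesis .
qed

text \<open>Terms and weighted paths satisfy the same Tutte equation with the same initial value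
  \<open>z\<close>, so \<open>tutte_unique\<close> identifies them for each root degree; the root
  weights are then summed.\<close>

theorem terms_one_cut: fixes z u :: "'a::comm_ring_1 fps"
  assumes "one_cut z u Q R S (\<lambda>j. G (Suc j))"
  shows "Sa (\<lambda>n. fps_X ^ n * (\<Sum>t\<in>Tm n. wt z u G t * h (rdeg t))) =
    Sa (\<lambda>m. (bc R S h (int m) - R * bc R S h (int m + 2)) * one_cut.Bc u Q R S (\<lambda>j. G (Suc j)) (m + 1))"
proof -
  interpret one_cut z u Q R S "\<lambda>j. G (Suc j)" by (rule assms)
  have "Wt z u G = Wc R S Bc"
  proof (rule tutte_unique)
    show "Wt z u G 0 = Wc R S Bc 0" using Wt_0 Wc_0 by metis
    show "Wt z u G (Suc n) = fps_X * (\<Sum>i<n. Wt z u G i * Wt z u G (n - 1 - i)) + fps_X * u * Sa (\<lambda>j. G (Suc j) * Wt z u G (n + j))" for n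
      by (rule Wt_tutte)
    show "Wc R S Bc (Suc n) = fps_X * (\<Sum>i<n. Wc R S Bc i * Wc R S Bc (n - 1 - i)) + fps_X * u * Sa (\<lambda>j. G (Suc j) * Wc R S Bc (n + j))" for n
      by (rule Wc_tutte)
  qed
  then show ?thesis unfolding Sa_terms using Sa_h_Wc by metis
qed

lemma wt_prod: "valid t \<Longrightarrow> N > 2 * edges t \<Longrightarrow> wt z u G t = z ^ faces t * (u ^ nonroot t * (\<Prod>k<N. G k ^ cnt t k))"
proof (induction t)
  case (Jn x q)
  have "Suc q < N" using rdeg_le[of x] Jn.prems by auto
  then have "(\<Prod>k<N. G k ^ (if k = Suc q then 1 else 0)) = G (Suc q)"
    by (simp add: if_distrib[of "\<lambda>e. _ ^ e"] prod.delta cong: if_cong)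
  then show ?case using Jn by (simp add: power_add prod.distrib ac_simps)
qed (auto simp: power_add prod.distrib ac_simps)

section \<open>Finitely generated fields\<close>

definition subfld :: "'a::field set \<Rightarrow> bool" where
  "subfld L \<longleftrightarrow> 0 \<in> L \<and> 1 \<in> L \<and> (\<forall>x\<in>L. \<forall>y\<in>L. x + y \<in> L \<and> x * y \<in> L) \<and> (\<forall>x\<in>L. - x \<in> L \<and> inverse x \<in> L)"

lemma subfldD: assumes "subfld L"
  shows "0 \<in> L" "1 \<in> L" "x \<in> L \<Longrightarrow> y \<in> L \<Longrightarrow> x + y \<in> L" "x \<in> L \<Longrightarrow> y \<in> L \<Longrightarrow> x * y \<in> L"
    "x \<in> L \<Longrightarrow> - x \<in> L" "x \<in> L \<Longrightarrow> inverse x \<in> L" "x \<in> L \<Longrightarrow> y \<in> L \<Longrightarrow> x - y \<in> L"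
    "x \<in> L \<Longrightarrow> y \<in> L \<Longrightarrow> x / y \<in> L" "x \<in> L \<Longrightarrow> x ^ n \<in> L" "of_nat n \<in> L" "of_int k \<in> L"
    "(\<And>i. i \<in> A \<Longrightarrow> f i \<in> L) \<Longrightarrow> sum f A \<in> L" "(\<And>i. i \<in> A \<Longrightarrow> f i \<in> L) \<Longrightarrow> prod f A \<in> L"
proof -
  show b: "0 \<in> L" "1 \<in> L" and add: "\<And>x y. x \<in> L \<Longrightarrow> y \<in> L \<Longrightarrow> x + y \<in> L" and mult: "\<And>x y. x \<in> L \<Longrightarrow> y \<in> L \<Longrightarrow> x * y \<in> L"
    and um: "\<And>x. x \<in> L \<Longrightarrow> - x \<in> L" and iv: "\<And>x. x \<in> L \<Longrightarrow> inverse x \<in> L"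
    using assms by (auto simp: subfld_def)
  show "x - y \<in> L" if "x \<in> L" "y \<in> L" for x y using add[OF that(1) um[OF that(2)]] by simp
  show "x / y \<in> L" if "x \<in> L" "y \<in> L" for x y using mult[OF that(1) iv[OF that(2)]] by (simp add: divide_inverse)
  show "x ^ n \<in> L" if "x \<in> L" for x n using that b mult by (induction n) auto
  have nat: "of_nat n \<in> L" for n using b add by (induction n) auto
  then show "of_nat n \<in> L" .
  show "of_int k \<in> L" using nat um by (cases k rule: int_cases2) auto
  show "sum f A \<in> L" if "\<And>i. i \<in> A \<Longrightarrow> f i \<in> L" for f :: "'b \<Rightarrow> 'a" and A
    using that b add by (induction A rule: infinite_finite_induct) auto
  show "prod f A \<in> L" if "\<And>i. i \<in> A \<Longrightarrow> f i \<in> L" for f :: "'c \<Rightarrow> 'a" and A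
    using that b mult by (induction A rule: infinite_finite_induct) auto
qed

definition fld :: "'a::field set \<Rightarrow> 'a set" where
  "fld E = \<Inter>{L. subfld L \<and> E \<subseteq> L}"

lemma subfld_fld: "subfld (fld E)"
  unfolding fld_def subfld_def by auto

lemma fld_incl: "x \<in> E \<Longrightarrow> x \<in> fld E"
  by (auto simp: fld_def)

lemma fld_least: "subfld L \<Longrightarrow> E \<subseteq> L \<Longrightarrow> fld E \<subseteq> L"
  by (auto simp: fld_def)

lemma fld_mono: "E \<subseteq> E' \<Longrightarrow> fld E \<subseteq> fld E'"
  by (auto simp: fld_def)

text \<open>Gaussian elimination over the subfield \<open>L\<close>: one equation with a nonzero
  coefficient eliminates one unknown.\<close>

lemma hom_system:
  assumes L: "subfld L"
  shows "finite J \<Longrightarrow> finite I \<Longrightarrow> card J < card I \<Longrightarrow> (\<And>i j. i \<in> I \<Longrightarrow> j \<in> J \<Longrightarrow> c i j \<in> L) \<Longrightarrow>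
    \<exists>b. (\<forall>i\<in>I. b i \<in> L) \<and> (\<exists>i\<in>I. b i \<noteq> 0) \<and> (\<forall>j\<in>J. (\<Sum>i\<in>I. b i * c i j) = 0)"
proof (induction J arbitrary: I c rule: finite_induct)
  case empty
  then obtain i where "i \<in> I" by fastforce
  then show ?case using subfldD(2)[OF L] by (intro exI[of _ "\<lambda>_. 1"]) auto
next
  case (insert j0 J)
  show ?case
  proof (cases "\<forall>i\<in>I. c i j0 = 0")
    case True
    have "card J < card I" using insert by simp
    moreover have "c i j \<in> L" if "i \<in> I" "j \<in> J" for i j using insert.prems(3) that by simp
    ultimately obtain b
      where "\<forall>i\<in>I. b i \<in> L" "\<exists>i\<in>I. b i \<noteq> 0" "\<forall>j\<in>J. (\<Sum>i\<in>I. b i * c i j) = 0"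
      using insert.IH[OF insert.prems(1), of c] by auto
    then show ?thesis using True by (intro exI[of _ b]) auto
  next
    case False
    then obtain i0 where i0: "i0 \<in> I" "c i0 j0 \<noteq> 0" by blast
    define I' where "I' = I - {i0}"
    have I: "I = insert i0 I'" "i0 \<notin> I'" "finite I'" using i0 insert.prems by (auto simp: I'_def)
    have crd: "card J < card I'" using insert I by simp
    define c' where "c' i j = c i j - c i j0 / c i0 j0 * c i0 j" for i j
    have c'L: "c' i j \<in> L" if "i \<in> I'" "j \<in> J" for i j
      unfolding c'_def using insert.prems(3) that i0 I(1) by (intro subfldD[OF L]) auto
    obtain b where b: "\<forall>i\<in>I'. b i \<in> L" "\<exists>i\<in>I'. b i \<noteq> 0"
      "\<forall>j\<in>J. (\<Sum>i\<in>I'. b i * c' i j) = 0" using insert.IH[OF I(3) crd, of c'] c'L by auto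
    define s where "s = - (\<Sum>i\<in>I'. b i * (c i j0 / c i0 j0))"
    define b' where "b' = b(i0 := s)"
    have sL: "s \<in> L" unfolding s_def using b(1) insert.prems(3) i0 I(1) by (intro subfldD[OF L]) auto
    have b': "b' i = b i" if "i \<in> I'" for i using that I(2) by (auto simp: b'_def)
    have sm: "(\<Sum>i\<in>I. b' i * c i j) = s * c i0 j + (\<Sum>i\<in>I'. b i * c i j)" for j
      unfolding I(1) using I(2,3) b' by (simp add: b'_def)
    have "(\<Sum>i\<in>I. b' i * c i j) = 0" if "j \<in> insert j0 J" for j
    proof (cases "j = j0")
      case True
      have "(\<Sum>i\<in>I'. b i * c i j0) = (\<Sum>i\<in>I'. b i * (c i j0 / c i0 j0)) * c i0 j0"
        unfolding sum_distrib_right using i0(2) by simp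
      then show ?thesis unfolding True sm s_def by simp
    next
      case False
      then have "(\<Sum>i\<in>I'. b i * c' i j) = 0" using b(3) that by simp
      moreover have "(\<Sum>i\<in>I'. b i * c' i j) = (\<Sum>i\<in>I'. b i * c i j) - (\<Sum>i\<in>I'. b i * (c i j0 / c i0 j0)) * c i0 j"
        unfolding c'_def sum_distrib_right sum_subtractf[symmetric] by (rule sum.cong) (auto simp: algebra_simps)
      ultimately show ?thesis unfolding sm s_def by simp
    qed
    then show ?thesis using b(1,2) b' sL I(1) by (intro exI[of _ b']) (auto simp: b'_def)
  qed
qed

definition lspan :: "'a::field set \<Rightarrow> 'a set \<Rightarrow> 'a set" where
  "lspan L A = {x. \<exists>c. (\<forall>a\<in>A. c a \<in> L) \<and> x = (\<Sum>a\<in>A. c a * a)}"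

text \<open>Independent subsets of \<open>U\<close> have fewer than \<open>n\<close> elements, so
  one of maximal size exists, and it spans. Working with tuples, the assumption can be supplied by a
  dimension count.\<close>

lemma fin_dim_span:
  fixes U :: "'a::field set" and n :: nat
  assumes L: "subfld L" and dep: "\<And>x. (\<And>i. i < n \<Longrightarrow> x i \<in> U) \<Longrightarrow>
     \<exists>b. (\<forall>i<n. b i \<in> L) \<and> (\<exists>i<n. b i \<noteq> 0) \<and> (\<Sum>i<n. b i * x i) = 0"
  shows "\<exists>A. finite A \<and> A \<subseteq> U \<and> U \<subseteq> lspan L A"
proof -
  define indep where "indep A \<longleftrightarrow> finite A \<and> A \<subseteq> U \<and>
    (\<forall>c. (\<forall>a\<in>A. c a \<in> L) \<longrightarrow> (\<Sum>a\<in>A. c a * a) = 0 \<longrightarrow> (\<forall>a\<in>A. c a = 0))" for A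
  have bound: "card A < n" if A: "indep A" for A
  proof (rule ccontr)
    assume "\<not> card A < n"
    then obtain B where B: "B \<subseteq> A" "card B = n" using obtain_subset_with_card_n by (metis not_less)
    have fB: "finite B" using A B finite_subset by (auto simp: indep_def)
    obtain x where x: "bij_betw x {..<n} B" using ex_bij_betw_nat_finite[OF fB] B(2) by (auto simp: atLeast0LessThan)
    have xU: "x i \<in> U" if "i < n" for i using x that A B by (auto simp: bij_betw_def indep_def)
    obtain b where b: "\<forall>i<n. b i \<in> L" "\<exists>i<n. b i \<noteq> 0" "(\<Sum>i<n. b i * x i) = 0" using dep[of x] xU by blast
    define c where "c a = (if a \<in> B then b (inv_into {..<n} x a) else 0)" for a
    have cx: "c (x i) = b i" if "i < n" for i
      using x that by (auto simp: c_def bij_betw_def)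
    have "(\<Sum>a\<in>A. c a * a) = (\<Sum>a\<in>B. c a * a)"
      by (rule sum.mono_neutral_right) (use A B in \<open>auto simp: indep_def c_def\<close>)
    also have "\<dots> = (\<Sum>i<n. c (x i) * x i)" by (rule sum.reindex_bij_betw[OF x, symmetric])
    also have "\<dots> = 0" using b(3) cx by simp
    finally have 0: "(\<Sum>a\<in>A. c a * a) = 0" .
    have "\<forall>a\<in>A. c a \<in> L"
    proof
      fix a
      show "c a \<in> L"
      proof (cases "a \<in> B")
        case True
        then have "inv_into {..<n} x a < n" using x bij_betw_imp_surj_on inv_into_into by (metis lessThan_iff)
        then show ?thesis using b(1) True by (simp add: c_def)
      qed (simp add: c_def subfldD(1)[OF L])
    qed
    then have "\<forall>a\<in>A. c a = 0" using A 0 unfolding indep_def by blast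
    moreover have "x i \<in> A" if "i < n" for i using x that B by (auto simp: bij_betw_def)
    ultimately show False using b(2) cx by metis
  qed
  have "indep {}" by (simp add: indep_def)
  then have "\<exists>A. indep A \<and> (\<forall>B. indep B \<longrightarrow> card B \<le> card A)"
    using ex_has_greatest_nat[of indep "{}" card n] bound less_imp_le by metis
  then obtain A where A: "indep A" and mx: "\<And>B. indep B \<Longrightarrow> card B \<le> card A" by blast
  have fA: "finite A" using A by (simp add: indep_def)
  have "u \<in> lspan L A" if u: "u \<in> U" for u
  proof (cases "u \<in> A")
    case True
    have "u = (\<Sum>a\<in>A. (if a = u then 1 else 0) * a)"
      using fA True by (simp add: if_distrib[of "\<lambda>x. x * _"] cong: if_cong)
    then show ?thesis unfolding lspan_def using subfldD(1,2)[OF L] by (auto intro!: exI[of _ "\<lambda>a. if a = u then 1 else 0"])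
  next
    case False
    have "\<not> indep (insert u A)" using mx[of "insert u A"] False fA by auto
    then obtain c where c: "\<forall>a\<in>insert u A. c a \<in> L" "(\<Sum>a\<in>insert u A. c a * a) = 0" "\<exists>a\<in>insert u A. c a \<noteq> 0"
      using A u by (auto simp: indep_def)
    have eq: "c u * u + (\<Sum>a\<in>A. c a * a) = 0" using c(2) False fA by simp
    have "c u \<noteq> 0"
    proof
      assume z: "c u = 0"
      then have "(\<Sum>a\<in>A. c a * a) = 0" using eq by simp
      then have "\<forall>a\<in>A. c a = 0" using A c(1) unfolding indep_def by blast
      then show False using z c(3) by auto
    qed
    then have "u = (\<Sum>a\<in>A. (- c a / c u) * a)"
    proof -
      have "(\<Sum>a\<in>A. (- c a / c u) * a) = - (\<Sum>a\<in>A. c a * a) / c u"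
        by (simp add: sum_negf[symmetric] sum_divide_distrib)
      also have "- (\<Sum>a\<in>A. c a * a) = c u * u" using eq by (simp add: add_eq_0_iff2 neg_eq_iff_add_eq_0)
      finally show ?thesis using \<open>c u \<noteq> 0\<close> by simp
    qed
    moreover have "\<forall>a\<in>A. - c a / c u \<in> L" using c(1) by (auto intro!: subfldD[OF L])
    ultimately show ?thesis unfolding lspan_def by (auto intro!: exI[of _ "\<lambda>a. - c a / c u"])
  qed
  then show ?thesis using A by (auto simp: indep_def)
qed

lemma lspan_sub: "subfld L' \<Longrightarrow> L \<subseteq> L' \<Longrightarrow> A \<subseteq> L' \<Longrightarrow> lspan L A \<subseteq> L'"
  unfolding lspan_def by (auto intro!: subfldD)

text \<open>Monomials are collected as elements of the field, not as exponents. Coincidences can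
  only lower their number, and only an upper bound for it is needed.\<close>

definition mon :: "'a::field_char_0 set \<Rightarrow> nat \<Rightarrow> 'a set" where
  "mon E d = (\<lambda>\<mu>. \<Prod>e\<in>E. e ^ \<mu> e) ` (PiE E (\<lambda>_. {..d}))"

definition qs :: "'a::field_char_0 set \<Rightarrow> nat \<Rightarrow> 'a set" where
  "qs E d = {x. \<exists>c. x = (\<Sum>m\<in>mon E d. of_rat (c m) * m)}"

context fixes E :: "'a::field_char_0 set" assumes fE: "finite E"
begin

lemma finite_mon: "finite (mon E d)" unfolding mon_def using fE by (auto intro!: finite_PiE)

lemma card_mon: "card (mon E d) \<le> (d + 1) ^ card E"
proof -
  have "card (mon E d) \<le> card (PiE E (\<lambda>_. {..d}))" unfolding mon_def by (rule card_image_le) (auto intro!: finite_PiE fE)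
  then show ?thesis using fE by (simp add: card_PiE)
qed

lemma qs_add: "x \<in> qs E d \<Longrightarrow> y \<in> qs E d \<Longrightarrow> x + y \<in> qs E d"
proof -
  assume "x \<in> qs E d" "y \<in> qs E d"
  then obtain c c' where "x = (\<Sum>m\<in>mon E d. of_rat (c m) * m)" "y = (\<Sum>m\<in>mon E d. of_rat (c' m) * m)" by (auto simp: qs_def)
  then have "x + y = (\<Sum>m\<in>mon E d. of_rat (c m + c' m) * m)" by (simp add: of_rat_add distrib_right sum.distrib)
  then show ?thesis unfolding qs_def mem_Collect_eq by (rule exI[of _ "\<lambda>m. c m + c' m"])
qed

lemma qs_scale: "x \<in> qs E d \<Longrightarrow> of_rat r * x \<in> qs E d"
proof -
  assume "x \<in> qs E d"
  then obtain c where "x = (\<Sum>m\<in>mon E d. of_rat (c m) * m)" by (auto simp: qs_def)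
  then have "of_rat r * x = (\<Sum>m\<in>mon E d. of_rat (r * c m) * m)" by (simp add: of_rat_mult sum_distrib_left ac_simps)
  then show ?thesis unfolding qs_def mem_Collect_eq by (rule exI[of _ "\<lambda>m. r * c m"])
qed

lemma qs_0: "0 \<in> qs E d"
  unfolding qs_def by (auto intro!: exI[of _ "\<lambda>_. 0"])

lemma qs_sum: "(\<And>i. i \<in> A \<Longrightarrow> f i \<in> qs E d) \<Longrightarrow> sum f A \<in> qs E d"
  by (induction A rule: infinite_finite_induct) (auto simp: qs_0 qs_add)

lemma qs_mon: assumes "m \<in> mon E d" shows "m \<in> qs E d"
proof -
  have "m = (\<Sum>m'\<in>mon E d. of_rat (if m' = m then 1 else 0) * m')"
    using assms finite_mon by (simp add: if_distrib[of of_rat] if_distrib[of "\<lambda>x. x * _"] cong: if_cong)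
  then show ?thesis unfolding qs_def mem_Collect_eq by (rule exI[of _ "\<lambda>m'. if m' = m then 1 else 0"])
qed

lemma mon_mult: assumes "m \<in> mon E d" "m' \<in> mon E d'" shows "m * m' \<in> mon E (d + d')"
proof -
  obtain \<mu> where \<mu>: "\<mu> \<in> PiE E (\<lambda>_. {..d})" "m = (\<Prod>e\<in>E. e ^ \<mu> e)" using assms(1) by (auto simp: mon_def)
  obtain \<nu> where \<nu>: "\<nu> \<in> PiE E (\<lambda>_. {..d'})" "m' = (\<Prod>e\<in>E. e ^ \<nu> e)" using assms(2) by (auto simp: mon_def)
  let ?s = "restrict (\<lambda>e. \<mu> e + \<nu> e) E"
  have "m * m' = (\<Prod>e\<in>E. e ^ ?s e)" unfolding \<mu>(2) \<nu>(2) by (simp add: prod.distrib power_add)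
  moreover have "?s \<in> PiE E (\<lambda>_. {..d + d'})" using \<mu>(1) \<nu>(1) by (auto simp: PiE_def Pi_def intro!: add_mono)
  ultimately show ?thesis unfolding mon_def by blast
qed

lemma qs_mult: assumes "x \<in> qs E d" "y \<in> qs E d'" shows "x * y \<in> qs E (d + d')"
proof -
  obtain c where c: "x = (\<Sum>m\<in>mon E d. of_rat (c m) * m)" using assms(1) by (auto simp: qs_def)
  obtain c' where c': "y = (\<Sum>m\<in>mon E d'. of_rat (c' m) * m)" using assms(2) by (auto simp: qs_def)
  have "x * y = (\<Sum>m\<in>mon E d. \<Sum>m'\<in>mon E d'. of_rat (c m * c' m') * (m * m'))"
    unfolding c c' sum_product by (simp add: of_rat_mult ac_simps)
  also have "\<dots> \<in> qs E (d + d')" by (intro qs_sum qs_scale qs_mon mon_mult)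
  finally show ?thesis .
qed

lemma mon_mono: "d \<le> d' \<Longrightarrow> mon E d \<subseteq> mon E d'"
  unfolding mon_def by (intro image_mono PiE_mono) auto

lemma qs_mono: assumes "d \<le> d'" "x \<in> qs E d" shows "x \<in> qs E d'"
proof -
  obtain c where c: "x = (\<Sum>m\<in>mon E d. of_rat (c m) * m)" using assms(2) by (auto simp: qs_def)
  show ?thesis unfolding c using mon_mono[OF assms(1)] by (intro qs_sum qs_scale qs_mon) auto
qed

lemma qs_1: "1 \<in> qs E d"
proof -
  have "1 = (\<Prod>e\<in>E. e ^ restrict (\<lambda>_. 0) E e)" by simp
  moreover have "restrict (\<lambda>_. 0) E \<in> PiE E (\<lambda>_. {..d})" by auto
  ultimately have "1 \<in> mon E d" unfolding mon_def by blast
  then show ?thesis by (rule qs_mon)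
qed

lemma qs_gen: assumes "e \<in> E" shows "e \<in> qs E 1"
proof -
  let ?\<mu> = "restrict (\<lambda>x. if x = e then 1 else (0::nat)) E"
  have "(\<Prod>x\<in>E. x ^ ?\<mu> x) = (\<Prod>x\<in>E. if x = e then x else 1)" by (rule prod.cong) auto
  also have "\<dots> = e" using assms fE by simp
  finally have "e = (\<Prod>x\<in>E. x ^ ?\<mu> x)" by simp
  moreover have "?\<mu> \<in> PiE E (\<lambda>_. {..1})" by auto
  ultimately have "e \<in> mon E 1" unfolding mon_def by blast
  then show ?thesis by (rule qs_mon)
qed

lemma qs_power: "x \<in> qs E d \<Longrightarrow> x ^ k \<in> qs E (k * d)"
  by (induction k) (auto simp: qs_1 qs_mult)

lemma qs_prod: "finite A \<Longrightarrow> (\<And>i. i \<in> A \<Longrightarrow> f i \<in> qs E d) \<Longrightarrow> prod f A \<in> qs E (card A * d)"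
  by (induction A rule: finite_induct) (auto simp: qs_1 qs_mult)

lemma fld_rep: assumes "x \<in> fld E" shows "\<exists>d p q. p \<in> qs E d \<and> q \<in> qs E d \<and> q \<noteq> 0 \<and> x = p / q"
proof -
  define F where "F = {x. \<exists>d p q. p \<in> qs E d \<and> q \<in> qs E d \<and> q \<noteq> 0 \<and> x = p / q}"
  have FI: "x \<in> F" if "p \<in> qs E d" "q \<in> qs E d'" "q \<noteq> 0" "x = p / q" for x p q d d'
    unfolding F_def using that qs_mono[of d "max d d'" p] qs_mono[of d' "max d d'" q] by auto
  have "subfld F"
    unfolding subfld_def
  proof (intro conjI ballI)
    show "0 \<in> F" by (rule FI[OF qs_0 qs_1]) auto
    show "1 \<in> F" by (rule FI[OF qs_1 qs_1]) auto
    fix x y assume "x \<in> F" "y \<in> F"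
    then obtain d p q d' p' q' where x: "p \<in> qs E d" "q \<in> qs E d" "q \<noteq> 0" "x = p / q"
      and y: "p' \<in> qs E d'" "q' \<in> qs E d'" "q' \<noteq> 0" "y = p' / q'" by (auto simp: F_def)
    have 1: "p * q' + p' * q \<in> qs E (d + d')"
      using qs_mult[OF x(1) y(2)] qs_mult[OF y(1) x(2)] by (intro qs_add) (auto simp: add.commute)
    show "x + y \<in> F" by (rule FI[OF 1 qs_mult[OF x(2) y(2)]]) (use x y in \<open>auto simp: add_frac_eq\<close>)
    show "x * y \<in> F" by (rule FI[OF qs_mult[OF x(1) y(1)] qs_mult[OF x(2) y(2)]]) (use x y in auto)
  next
    fix x assume "x \<in> F"
    then obtain d p q where x: "p \<in> qs E d" "q \<in> qs E d" "q \<noteq> 0" "x = p / q" by (auto simp: F_def)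
    show "- x \<in> F" by (rule FI[OF qs_scale[OF x(1), of "-1"] x(2)]) (use x in auto)
    show "inverse x \<in> F"
    proof (cases "p = 0")
      case True then show ?thesis using x FI[OF qs_0 qs_1] by auto
    next
      case False then show ?thesis by (intro FI[OF x(2,1)]) (use x in auto)
    qed
  qed
  moreover have "E \<subseteq> F" by (auto intro!: FI[OF qs_gen qs_1])
  ultimately show ?thesis using fld_least[of F E] assms by (auto simp: F_def)
qed

text \<open>A counting argument: after clearing a common denominator, the monomials of degree at
  most D in each of the N elements lie in a rational space of dimension O(D^card E), while there are
  (D+1)^N of them.\<close>

theorem alg_dependent:
  fixes y :: "nat \<Rightarrow> 'a"
  assumes y: "\<And>i. i < N \<Longrightarrow> y i \<in> fld E" and N: "card E < N"
  shows "\<exists>P :: (nat \<Rightarrow>\<^sub>0 nat) \<Rightarrow>\<^sub>0 rat. P \<noteq> 0 \<and> (\<forall>\<mu>\<in>Poly_Mapping.keys P. Poly_Mapping.keys \<mu> \<subseteq> {..<N}) \<and>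
    (\<Sum>\<mu>\<in>Poly_Mapping.keys P. of_rat (Poly_Mapping.lookup P \<mu>) * (\<Prod>i<N. y i ^ Poly_Mapping.lookup \<mu> i)) = 0"
proof -
  have "\<forall>i. \<exists>d p q. i < N \<longrightarrow> p \<in> qs E d \<and> q \<in> qs E d \<and> q \<noteq> 0 \<and> y i = p / q" using fld_rep y by blast
  then obtain dd p q where r: "\<And>i. i < N \<Longrightarrow> p i \<in> qs E (dd i) \<and> q i \<in> qs E (dd i) \<and> q i \<noteq> 0 \<and> y i = p i / q i" by metis
  define d where "d = (\<Sum>i<N. dd i)"
  have dle: "dd i \<le> d" if "i < N" for i unfolding d_def using that by (intro member_le_sum) auto
  have pq: "p i \<in> qs E d" "q i \<in> qs E d" "q i \<noteq> 0" "y i = p i / q i" if "i < N" for i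
    using r[OF that] qs_mono[OF dle[OF that]] by auto
  \<comment> \<open>With this choice (N D d + 1)^card E is at most (N d + 1)^card E (D + 1)^card E =
    D (D + 1)^card E, which is less than (D + 1)^N.\<close>
  define D where "D = (N * d + 1) ^ card E"
  define \<psi> where "\<psi> \<nu> = Abs_poly_mapping (\<lambda>i. if i < N then \<nu> i else (0::nat))" for \<nu>
  have look: "Poly_Mapping.lookup (\<psi> \<nu>) i = (if i < N then \<nu> i else 0)" for \<nu> i
    unfolding \<psi>_def by (subst Abs_poly_mapping_inverse) auto
  define M where "M = \<psi> ` (PiE {..<N} (\<lambda>_. {..D}))"
  have fP: "finite (PiE {..<N} (\<lambda>_. {..D}))" by (auto intro!: finite_PiE)
  then have fM: "finite M" by (simp add: M_def)
  have "inj_on \<psi> (PiE {..<N} (\<lambda>_. {..D}))"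
  proof (rule inj_onI)
    fix \<nu> \<nu>' assume a: "\<nu> \<in> PiE {..<N} (\<lambda>_. {..D})" "\<nu>' \<in> PiE {..<N} (\<lambda>_. {..D})" "\<psi> \<nu> = \<psi> \<nu>'"
    have "\<nu> i = \<nu>' i" if "i < N" for i using look[of \<nu> i] look[of \<nu>' i] a(3) that by simp
    then show "\<nu> = \<nu>'" using a(1,2) by (intro PiE_ext[OF a(1,2)]) auto
  qed
  then have "card M = (D + 1) ^ N" unfolding M_def by (subst card_image) (auto simp: card_PiE)
  have big: "card (mon E (N * D * d)) < card M"
  proof -
    have "card (mon E (N * D * d)) \<le> (N * D * d + 1) ^ card E" by (rule card_mon)
    also have "\<dots> \<le> ((N * d + 1) * (D + 1)) ^ card E" by (intro power_mono) (auto simp: algebra_simps)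
    also have "\<dots> = D * (D + 1) ^ card E" unfolding power_mult_distrib D_def ..
    also have "\<dots> < (D + 1) * (D + 1) ^ card E" by simp
    also have "\<dots> = (D + 1) ^ (Suc (card E))" by simp
    also have "\<dots> \<le> (D + 1) ^ N" using N by (intro power_increasing) auto
    finally show ?thesis using \<open>card M = (D + 1) ^ N\<close> by simp
  qed
  define QD where "QD = (\<Prod>i<N. q i ^ D)"
  have QD0: "QD \<noteq> 0" unfolding QD_def by (simp add: pq(3))
  have mem: "QD * (\<Prod>i<N. y i ^ Poly_Mapping.lookup \<mu> i) \<in> qs E (N * D * d)" if "\<mu> \<in> M" for \<mu>
  proof -
    have le: "Poly_Mapping.lookup \<mu> i \<le> D" if "i < N" for i
    proof -
      obtain \<nu> where \<nu>: "\<nu> \<in> PiE {..<N} (\<lambda>_. {..D})" "\<mu> = \<psi> \<nu>" using \<open>\<mu> \<in> M\<close> unfolding M_def by blast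
      have "\<nu> i \<in> {..D}" using PiE_mem[OF \<nu>(1), of i] that by simp
      then show ?thesis unfolding \<nu>(2) look using that by simp
    qed
    have "QD * (\<Prod>i<N. y i ^ Poly_Mapping.lookup \<mu> i) = (\<Prod>i<N. p i ^ Poly_Mapping.lookup \<mu> i * q i ^ (D - Poly_Mapping.lookup \<mu> i))"
      unfolding QD_def prod.distrib[symmetric]
    proof (rule prod.cong[OF refl])
      fix i assume "i \<in> {..<N}"
      then have i: "i < N" by simp
      have "q i ^ D = q i ^ Poly_Mapping.lookup \<mu> i * q i ^ (D - Poly_Mapping.lookup \<mu> i)"
        unfolding power_add[symmetric] using le[OF i] by simp
      then show "q i ^ D * y i ^ Poly_Mapping.lookup \<mu> i = p i ^ Poly_Mapping.lookup \<mu> i * q i ^ (D - Poly_Mapping.lookup \<mu> i)"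
        unfolding pq(4)[OF i] power_divide using pq(3)[OF i] by simp
    qed
    also have "\<dots> \<in> qs E (card {..<N} * (D * d))"
    proof (rule qs_prod)
      fix i assume "i \<in> {..<N}"
      then have i: "i < N" by simp
      have "p i ^ Poly_Mapping.lookup \<mu> i * q i ^ (D - Poly_Mapping.lookup \<mu> i) \<in>
        qs E (Poly_Mapping.lookup \<mu> i * d + (D - Poly_Mapping.lookup \<mu> i) * d)"
        using pq(1,2)[OF i] by (intro qs_mult qs_power)
      also have "Poly_Mapping.lookup \<mu> i * d + (D - Poly_Mapping.lookup \<mu> i) * d = D * d"
        using le[OF i] by (simp flip: distrib_right)
      finally show "p i ^ Poly_Mapping.lookup \<mu> i * q i ^ (D - Poly_Mapping.lookup \<mu> i) \<in> qs E (D * d)" .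
    qed simp
    finally show ?thesis by (simp add: mult.assoc)
  qed
  then have "\<forall>\<mu>. \<exists>c. \<mu> \<in> M \<longrightarrow> QD * (\<Prod>i<N. y i ^ Poly_Mapping.lookup \<mu> i) = (\<Sum>m\<in>mon E (N * D * d). of_rat (c m) * m)"
    by (auto simp: qs_def)
  then obtain c where c: "\<And>\<mu>. \<mu> \<in> M \<Longrightarrow> QD * (\<Prod>i<N. y i ^ Poly_Mapping.lookup \<mu> i) = (\<Sum>m\<in>mon E (N * D * d). of_rat (c \<mu> m) * m)" by metis
  \<comment> \<open>The linear system is solved over the copy of the rationals inside the big field,
    so that the coefficients found can be read back as rationals.\<close>
  have Q: "subfld (\<rat> :: 'a set)" unfolding subfld_def by auto
  have "\<exists>b :: (nat \<Rightarrow>\<^sub>0 nat) \<Rightarrow> 'a. (\<forall>\<mu>\<in>M. b \<mu> \<in> \<rat>) \<and> (\<exists>\<mu>\<in>M. b \<mu> \<noteq> 0) \<and>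
    (\<forall>m\<in>mon E (N * D * d). (\<Sum>\<mu>\<in>M. b \<mu> * of_rat (c \<mu> m)) = 0)"
    by (rule hom_system[OF Q finite_mon fM big]) simp
  then obtain b :: "(nat \<Rightarrow>\<^sub>0 nat) \<Rightarrow> 'a" where b: "\<forall>\<mu>\<in>M. b \<mu> \<in> \<rat>" "\<exists>\<mu>\<in>M. b \<mu> \<noteq> 0"
    "\<forall>m\<in>mon E (N * D * d). (\<Sum>\<mu>\<in>M. b \<mu> * of_rat (c \<mu> m)) = 0"
    by blast
  have "QD * (\<Sum>\<mu>\<in>M. b \<mu> * (\<Prod>i<N. y i ^ Poly_Mapping.lookup \<mu> i)) = (\<Sum>\<mu>\<in>M. b \<mu> * (QD * (\<Prod>i<N. y i ^ Poly_Mapping.lookup \<mu> i)))"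
    by (simp add: sum_distrib_left ac_simps)
  also have "\<dots> = (\<Sum>\<mu>\<in>M. \<Sum>m\<in>mon E (N * D * d). b \<mu> * of_rat (c \<mu> m) * m)"
    by (rule sum.cong) (simp_all add: c sum_distrib_left ac_simps)
  also have "\<dots> = (\<Sum>m\<in>mon E (N * D * d). (\<Sum>\<mu>\<in>M. b \<mu> * of_rat (c \<mu> m)) * m)"
    unfolding sum_distrib_right by (rule sum.swap)
  also have "\<dots> = 0" using b(3) by simp
  finally have zero: "(\<Sum>\<mu>\<in>M. b \<mu> * (\<Prod>i<N. y i ^ Poly_Mapping.lookup \<mu> i)) = 0" using QD0 by simp
  have "\<forall>\<mu>. \<exists>r. \<mu> \<in> M \<longrightarrow> b \<mu> = of_rat r" using b(1) by (auto elim!: Rats_cases)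
  then obtain r where r: "\<And>\<mu>. \<mu> \<in> M \<Longrightarrow> b \<mu> = of_rat (r \<mu>)" by metis
  define P where "P = Abs_poly_mapping (\<lambda>\<mu>. if \<mu> \<in> M then r \<mu> else 0)"
  have lP: "Poly_Mapping.lookup P \<mu> = (if \<mu> \<in> M then r \<mu> else 0)" for \<mu>
    unfolding P_def by (subst Abs_poly_mapping_inverse) (auto intro: finite_subset[OF _ fM])
  have kP: "Poly_Mapping.keys P \<subseteq> M" by (auto simp: in_keys_iff lP split: if_splits)
  have "P \<noteq> 0"
  proof
    assume "P = 0"
    then have "r \<mu> = 0" if "\<mu> \<in> M" for \<mu> using lP[of \<mu>] that by simp
    then show False using b(2) r by auto
  qed
  moreover have "Poly_Mapping.keys \<mu> \<subseteq> {..<N}" if mk: "\<mu> \<in> Poly_Mapping.keys P" for \<mu>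
  proof
    fix i assume i: "i \<in> Poly_Mapping.keys \<mu>"
    obtain \<nu> where "\<mu> = \<psi> \<nu>" using kP mk unfolding M_def by blast
    then show "i \<in> {..<N}" using i look[of \<nu> i] by (auto simp: in_keys_iff split: if_splits)
  qed
  moreover have "(\<Sum>\<mu>\<in>Poly_Mapping.keys P. of_rat (Poly_Mapping.lookup P \<mu>) * (\<Prod>i<N. y i ^ Poly_Mapping.lookup \<mu> i)) =
    (\<Sum>\<mu>\<in>M. b \<mu> * (\<Prod>i<N. y i ^ Poly_Mapping.lookup \<mu> i))"
    by (rule sum.mono_neutral_cong_left[OF fM kP]) (auto simp: in_keys_iff lP r split: if_splits)
  ultimately show ?thesis using zero by auto
qed

end

section \<open>Residues of D-finite Laurent series\<close>

unbundle fps_syntax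

definition flmap :: "('a::zero \<Rightarrow> 'b::zero) \<Rightarrow> 'a fls \<Rightarrow> 'b fls" where
  "flmap f F = Abs_fls (\<lambda>n. f (F $$ n))"

lemma flmap_nth: assumes "f 0 = 0" shows "flmap f F $$ n = f (F $$ n)"
  unfolding flmap_def by (rule nth_Abs_fls_lower_bound[of "fls_subdegree F"]) (use assms in auto)

lemma fls_mult_nth_bound:
  fixes f g :: "'a::comm_ring_1 fls"
  assumes "\<And>i. i < a \<Longrightarrow> f $$ i = 0" "\<And>i. i < b \<Longrightarrow> g $$ i = 0"
  shows "(f * g) $$ n = (\<Sum>i=a..n - b. f $$ i * g $$ (n - i))"
proof (cases "f = 0 \<or> g = 0")
  case False
  then have "a \<le> fls_subdegree f" "b \<le> fls_subdegree g"
    using assms fls_subdegree_geI by metis+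
  then show ?thesis unfolding fls_times_nth(2)[of f g n]
    by (intro sum.mono_neutral_left) (auto simp: not_le)
qed auto

lemma additive_sum: assumes "\<And>x y. F (x + y) = F x + (F y :: 'b::comm_monoid_add)" "F 0 = 0"
  shows "F (sum f A) = (\<Sum>i\<in>A. F (f i))"
  by (induction A rule: infinite_finite_induct) (simp_all add: assms)

lemma flmap_add: assumes "\<And>x y. F (x + y) = F x + (F y :: 'b::comm_monoid_add)" "F 0 = 0"
  shows "flmap F (f + g) = flmap F f + flmap F g"
  by (rule fls_eqI) (simp add: flmap_nth assms)

definition is_der :: "('a::comm_ring_1 \<Rightarrow> 'a) \<Rightarrow> bool" where
  "is_der D \<longleftrightarrow> (\<forall>x y. D (x + y) = D x + D y) \<and> (\<forall>x y. D (x * y) = D x * y + x * D y)"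

lemma is_derD: assumes "is_der D"
  shows "D (x + y) = D x + D y" "D (x * y) = D x * y + x * D y" "D 0 = 0" "D 1 = 0" "D (- x) = - D x"
    "D (x - y) = D x - D y" "D (sum f A) = (\<Sum>i\<in>A. D (f i))" "D (x ^ n) = of_nat n * x ^ (n - 1) * D x"
proof -
  show a: "\<And>x y. D (x + y) = D x + D y" and m: "\<And>x y. D (x * y) = D x * y + x * D y" using assms by (auto simp: is_der_def)
  show z: "D 0 = 0" using a[of 0 0] by simp
  show "D 1 = 0" using m[of 1 1] by simp
  then show "D (x ^ n) = of_nat n * x ^ (n - 1) * D x"
  proof (induction n)
    case (Suc n) then show ?case by (cases n) (simp_all add: m algebra_simps)
  qed simp
  show u: "D (- x) = - D x" for x using a[of x "- x"] z by (simp add: add_eq_0_iff)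
  show "D (x - y) = D x - D y" using a[of x "- y"] u by simp
  show "D (sum f A) = (\<Sum>i\<in>A. D (f i))" by (rule additive_sum[of D, OF a z])
qed

lemma is_der_inverse: fixes D :: "'a::field \<Rightarrow> 'a" assumes "is_der D" shows "D (inverse x) = - D x * inverse x * inverse x"
proof (cases "x = 0")
  case True then show ?thesis using is_derD[OF assms] by simp
next
  case False
  have "0 = D (x * inverse x)" using False is_derD(4)[OF assms] by simp
  also have "\<dots> = D x * inverse x + x * D (inverse x)" by (rule is_derD(2)[OF assms])
  finally have "x * D (inverse x) = - (D x * inverse x)" by (simp add: add_eq_0_iff)
  then have "inverse x * (x * D (inverse x)) = - (D x * inverse x) * inverse x" by simp
  then show ?thesis using False by (simp add: mult.assoc[symmetric])
qed

lemma flmap_der: assumes "is_der D" shows "is_der (flmap D)"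
  unfolding is_der_def
proof (intro conjI allI)
  note D = is_derD[OF assms]
  show "flmap D (f + g) = flmap D f + flmap D g" for f g by (rule flmap_add) (use D in auto)
  show "flmap D (f * g) = flmap D f * g + f * flmap D g" for f g
  proof (rule fls_eqI)
    fix n
    let ?a = "fls_subdegree f" let ?b = "fls_subdegree g"
    have "flmap D (f * g) $$ n = D (\<Sum>i=?a..n - ?b. f $$ i * g $$ (n - i))"
      unfolding flmap_nth[of D, OF D(3)] by (subst fls_mult_nth_bound[of ?a f ?b g]) auto
    also have "\<dots> = (\<Sum>i=?a..n - ?b. flmap D f $$ i * g $$ (n - i)) + (\<Sum>i=?a..n - ?b. f $$ i * flmap D g $$ (n - i))"
      unfolding D(7) D(2) flmap_nth[of D, OF D(3)] by (rule sum.distrib)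
    also have "(\<Sum>i=?a..n - ?b. flmap D f $$ i * g $$ (n - i)) = (flmap D f * g) $$ n"
      by (rule fls_mult_nth_bound[symmetric]) (simp_all add: flmap_nth D(3))
    also have "(\<Sum>i=?a..n - ?b. f $$ i * flmap D g $$ (n - i)) = (f * flmap D g) $$ n"
      by (rule fls_mult_nth_bound[symmetric]) (simp_all add: flmap_nth D(3))
    finally show "flmap D (f * g) $$ n = (flmap D f * g + f * flmap D g) $$ n" by simp
  qed
qed

lemma fls_deriv_der: "is_der (fls_deriv :: 'a::comm_ring_1 fls \<Rightarrow> 'a fls)"
  by (auto simp: is_der_def fls_deriv_add)

text \<open>In \<open>'k fls fls\<close> the outer variable is \<open>t\<close> and the inner one is \<open>v\<close>: \<open>em\<close> embeds the series free of \<open>v\<close>,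
  \<open>cf k\<close> extracts the coefficient of \<open>v\<close> to the power \<open>k\<close>, \<open>vp k\<close> is that power and \<open>dv\<close> is \<open>d/dv\<close>.\<close>

definition em :: "'k::field_char_0 fls \<Rightarrow> 'k fls fls" where "em = flmap fls_const"
definition cf :: "int \<Rightarrow> 'k::field_char_0 fls fls \<Rightarrow> 'k fls" where "cf k = flmap (\<lambda>x. x $$ k)"
definition vp :: "int \<Rightarrow> 'k::field_char_0 fls fls" where "vp k = fls_const (fls_X_intpow k)"
definition dv :: "'k::field_char_0 fls fls \<Rightarrow> 'k fls fls" where "dv = flmap fls_deriv"
definition Ng :: "'k::field_char_0 fls fls \<Rightarrow> 'k fls fls" where "Ng = flmap fls_prpart_as_fls"

lemma em_nth: "em c $$ n = fls_const (c $$ n)" unfolding em_def by (rule flmap_nth) simp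
lemma cf_nth: "cf k f $$ n = f $$ n $$ k" unfolding cf_def by (rule flmap_nth) simp
lemma dv_nth: "dv f $$ n = fls_deriv (f $$ n)" unfolding dv_def by (rule flmap_nth) simp
lemma Ng_nth: "Ng f $$ n $$ k = (if k < 0 then f $$ n $$ k else 0)"
  unfolding Ng_def by (subst flmap_nth) (simp_all only: fls_prpart_as_fls_nth fls_zero_nth fls_prpart0 fls_subdegree_fls_X_intpow, simp_all)

lemma cf_ext: "(\<And>k. cf k f = cf k g) \<Longrightarrow> f = g"
  by (rule fls_eqI, rule fls_eqI) (metis cf_nth)

lemma cf_add [simp]: "cf k (f + g) = cf k f + cf k g" by (rule fls_eqI) (simp add: cf_nth)
lemma cf_0 [simp]: "cf k 0 = 0" by (rule fls_eqI) (simp add: cf_nth)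
lemma cf_uminus [simp]: "cf k (- f) = - cf k f" by (rule fls_eqI) (simp add: cf_nth)
lemma cf_diff [simp]: "cf k (f - g) = cf k f - cf k g" by (rule fls_eqI) (simp add: cf_nth)
lemma cf_sum: "cf k (sum f A) = (\<Sum>i\<in>A. cf k (f i))" by (rule additive_sum) simp_all

lemma em_0 [simp]: "em 0 = 0" by (rule fls_eqI) (simp add: em_nth)
lemma em_1 [simp]: "em 1 = 1" by (rule fls_eqI) (simp add: em_nth)
lemma em_add: "em (x + y) = em x + em y" by (rule fls_eqI) (simp add: em_nth fls_plus_const)
lemma em_uminus: "em (- x) = - em x" by (rule fls_eqI) (simp add: em_nth)
lemma cf_em_mult: "cf k (em c * f) = c * cf k f"
proof (rule fls_eqI)
  fix n
  let ?a = "fls_subdegree c" let ?b = "fls_subdegree f"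
  have "(em c * f) $$ n = (\<Sum>i=?a..n - ?b. em c $$ i * f $$ (n - i))"
    by (rule fls_mult_nth_bound) (simp_all add: em_nth)
  moreover have "(c * cf k f) $$ n = (\<Sum>i=?a..n - ?b. c $$ i * cf k f $$ (n - i))"
    by (rule fls_mult_nth_bound) (simp_all add: cf_nth)
  ultimately show "cf k (em c * f) $$ n = (c * cf k f) $$ n"
    by (simp add: cf_nth fls_nth_sum em_nth)
qed

lemma cf_vp_mult: "cf k (vp j * f) = cf (k - j) f"
  by (rule fls_eqI) (simp add: cf_nth vp_def fls_X_intpow_times_conv_shift)

lemma cf_1: "cf k 1 = (if k = 0 then 1 else 0)"
  by (rule fls_eqI) (simp add: cf_nth)

lemma cf_em: "cf k (em c) = (if k = 0 then c else 0)"
  using cf_em_mult[of k c 1] by (simp add: cf_1)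

lemma cf_vp: "cf k (vp j) = (if k = j then 1 else 0)"
  using cf_vp_mult[of k j 1] by (simp add: cf_1)

lemma vp_0 [simp]: "vp 0 = 1" by (rule cf_ext) (simp add: cf_vp cf_1)
lemma vp_nz [simp]: "vp k \<noteq> 0"
proof
  assume "vp k = (0 :: 'a fls fls)"
  then have "cf k (vp k) = (0 :: 'a fls)" by simp
  then show False by (simp add: cf_vp)
qed

lemma em_eq_0 [simp]: "em c = 0 \<longleftrightarrow> c = 0" using cf_em[of 0 c] by auto

lemma em_of_nat: "em (of_nat n) = of_nat n" by (induction n) (simp_all add: em_add)

lemma dv_der: "is_der dv" unfolding dv_def by (rule flmap_der[OF fls_deriv_der])

lemma cf_dv: "cf k (dv f) = of_int (k + 1) * cf (k + 1) f"
  by (rule fls_eqI) (simp add: cf_nth dv_nth del: of_int_add)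

lemma cf_Ng: "cf k (Ng f) = (if k < 0 then cf k f else 0)"
  by (rule fls_eqI) (simp add: cf_nth Ng_nth)

lemma dv_em_mult: "dv (em c * f) = em c * dv f"
  by (rule cf_ext) (simp only: cf_dv cf_em_mult mult.left_commute)

text \<open>A derivation in z, u or t acts on the coefficients of the powers of v. Hence it kills v
  and commutes with taking residues and negative parts.\<close>

definition compat :: "('k::field_char_0 fls \<Rightarrow> 'k fls) \<Rightarrow> ('k fls fls \<Rightarrow> 'k fls fls) \<Rightarrow> bool" where
  "compat D DD \<longleftrightarrow> is_der D \<and> is_der DD \<and> (\<forall>k f. cf k (DD f) = D (cf k f))"

lemma compat_em: "compat D DD \<Longrightarrow> DD (em c) = em (D c)"
  by (rule cf_ext) (auto simp: compat_def cf_em is_derD)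

lemma compat_vp: "compat D DD \<Longrightarrow> DD (vp k) = 0"
  by (rule cf_ext) (auto simp: compat_def cf_vp is_derD)

lemma compat_Ng: "compat D DD \<Longrightarrow> DD (Ng f) = Ng (DD f)"
  by (rule cf_ext) (auto simp: compat_def cf_Ng is_derD)

lemma dv_Ng: "dv (Ng f) = Ng (dv f)"
proof (rule cf_ext)
  show "cf k (dv (Ng f)) = cf k (Ng (dv f))" for k by (cases "k = -1") (auto simp: cf_dv cf_Ng)
qed

section \<open>Finite modules over localized Laurent polynomials\<close>

text \<open>\<open>LPu L\<close> is the ring of Laurent polynomials in \<open>v\<close> over \<open>L\<close>, and \<open>Md L p I f\<close> below is the module generated
  by the \<open>f i\<close> over its localization at \<open>p\<close>.\<close>

definition LP :: "'k::field_char_0 fls set \<Rightarrow> nat \<Rightarrow> 'k fls fls set" where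
  "LP L B = {q. (\<forall>k. cf k q \<in> L) \<and> (\<forall>k. \<bar>k\<bar> > int B \<longrightarrow> cf k q = 0)}"

definition LPu :: "'k::field_char_0 fls set \<Rightarrow> 'k fls fls set" where
  "LPu L = (\<Union>B. LP L B)"

lemma LP_mono: "B \<le> B' \<Longrightarrow> LP L B \<subseteq> LP L B'" "L \<subseteq> L' \<Longrightarrow> LP L B \<subseteq> LP L' B"
  by (auto simp: LP_def)

lemma LPu_mono: "L \<subseteq> L' \<Longrightarrow> LPu L \<subseteq> LPu L'"
  unfolding LPu_def using LP_mono(2) by blast

lemma LP_expand: assumes "q \<in> LP L B" shows "q = (\<Sum>i\<in>{- int B..int B}. em (cf i q) * vp i)"
proof (rule cf_ext)
  fix k
  have "cf k (\<Sum>i\<in>{- int B..int B}. em (cf i q) * vp i) = (\<Sum>i\<in>{- int B..int B}. if i = k then cf i q else 0)"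
    unfolding cf_sum by (rule sum.cong) (auto simp: cf_em_mult cf_vp)
  also have "\<dots> = cf k q" using assms by (auto simp: LP_def)
  finally show "cf k q = cf k (\<Sum>i\<in>{- int B..int B}. em (cf i q) * vp i)" by simp
qed

lemma cf_LP_mult: assumes "q \<in> LP L B" shows "cf k (q * f) = (\<Sum>i\<in>{- int B..int B}. cf i q * cf (k - i) f)"
  by (subst LP_expand[OF assms]) (simp add: sum_distrib_right cf_sum mult.assoc cf_em_mult cf_vp_mult)

context fixes L :: "'k::field_char_0 fls set" assumes L: "subfld L"
begin

lemma LP_add: "p \<in> LP L B \<Longrightarrow> q \<in> LP L B \<Longrightarrow> p + q \<in> LP L B"
  by (auto simp: LP_def subfldD[OF L])

lemma LP_uminus: "p \<in> LP L B \<Longrightarrow> - p \<in> LP L B"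
  by (auto simp: LP_def subfldD[OF L])

lemma LP_0: "0 \<in> LP L B" by (auto simp: LP_def subfldD[OF L])

lemma LP_sum: "(\<And>i. i \<in> A \<Longrightarrow> f i \<in> LP L B) \<Longrightarrow> sum f A \<in> LP L B"
  by (induction A rule: infinite_finite_induct) (auto simp: LP_0 LP_add)

lemma LP_em: "c \<in> L \<Longrightarrow> em c \<in> LP L B"
  by (auto simp: LP_def cf_em subfldD[OF L])

lemma LP_vp: "vp k \<in> LP L (nat \<bar>k\<bar>)"
  by (auto simp: LP_def cf_vp subfldD[OF L])

lemma LP_1: "1 \<in> LP L B" using LP_em[of 1 B] subfldD(2)[OF L] by simp

lemma LP_mult: assumes "p \<in> LP L B" "q \<in> LP L B'" shows "p * q \<in> LP L (B + B')"
  unfolding LP_def mem_Collect_eq cf_LP_mult[OF assms(1)]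
proof (intro conjI allI impI)
  show "(\<Sum>i = - int B..int B. cf i p * cf (k - i) q) \<in> L" for k
    using assms by (intro subfldD[OF L]) (auto simp: LP_def)
  show "(\<Sum>i = - int B..int B. cf i p * cf (k - i) q) = 0" if "int (B + B') < \<bar>k\<bar>" for k
  proof (rule sum.neutral, rule ballI)
    fix i assume "i \<in> {- int B..int B}"
    then have "\<bar>k - i\<bar> > int B'" using that by auto
    then show "cf i p * cf (k - i) q = 0" using assms by (simp add: LP_def)
  qed
qed

lemma LP_power: "p \<in> LP L B \<Longrightarrow> p ^ n \<in> LP L (n * B)"
  by (induction n) (auto simp: LP_1 LP_mult)

lemma LP_dv: "p \<in> LP L B \<Longrightarrow> dv p \<in> LP L (B + 1)"
  by (auto simp: LP_def cf_dv subfldD[OF L] simp del: of_int_add)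

lemma LPuI: "p \<in> LP L B \<Longrightarrow> p \<in> LPu L" by (auto simp: LPu_def)

lemma LPuE: assumes "p \<in> LPu L" obtains B where "p \<in> LP L B" using assms by (auto simp: LPu_def)

lemma LPu_add: assumes "p \<in> LPu L" "q \<in> LPu L" shows "p + q \<in> LPu L"
proof -
  obtain B B' where "p \<in> LP L B" "q \<in> LP L B'" using assms LPuE by metis
  then have "p \<in> LP L (max B B')" "q \<in> LP L (max B B')"
    using LP_mono(1)[of B "max B B'" L] LP_mono(1)[of B' "max B B'" L] by auto
  then show ?thesis using LP_add LPuI by blast
qed

lemma LPu_mult: "p \<in> LPu L \<Longrightarrow> q \<in> LPu L \<Longrightarrow> p * q \<in> LPu L"
  using LP_mult LPuI LPuE by metis

lemma LPu_uminus: "p \<in> LPu L \<Longrightarrow> - p \<in> LPu L"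
  using LP_uminus LPuI LPuE by metis

lemma LPu_diff: "p \<in> LPu L \<Longrightarrow> q \<in> LPu L \<Longrightarrow> p - q \<in> LPu L"
  using LPu_add[OF _ LPu_uminus[of q], of p] by simp

lemma LPu_em: "c \<in> L \<Longrightarrow> em c \<in> LPu L" using LP_em LPuI by blast
lemma LPu_vp: "vp k \<in> LPu L" using LP_vp LPuI by blast
lemma LPu_0: "0 \<in> LPu L" using LP_0 LPuI by blast
lemma LPu_1: "1 \<in> LPu L" using LP_1 LPuI by blast
lemma LPu_power: "p \<in> LPu L \<Longrightarrow> p ^ n \<in> LPu L" by (induction n) (auto simp: LPu_1 LPu_mult)
lemma LPu_sum: "(\<And>i. i \<in> A \<Longrightarrow> f i \<in> LPu L) \<Longrightarrow> sum f A \<in> LPu L"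
  by (induction A rule: infinite_finite_induct) (auto simp: LPu_0 LPu_add)
lemma LPu_uniform: assumes "finite A" "\<forall>i\<in>A. f i \<in> LPu L" shows "\<exists>B. \<forall>i\<in>A. f i \<in> LP L B"
proof -
  have "\<forall>i. \<exists>B. i \<in> A \<longrightarrow> f i \<in> LP L B" using assms(2) LPuE by metis
  then obtain b where b: "\<And>i. i \<in> A \<Longrightarrow> f i \<in> LP L (b i)" by metis
  have "f i \<in> LP L (\<Sum>i\<in>A. b i)" if "i \<in> A" for i
    using b[OF that] LP_mono(1)[of "b i" "\<Sum>i\<in>A. b i" L] member_le_sum[of i A b] that assms(1) by auto
  then show ?thesis by blast
qed

end

definition Md :: "'k::field_char_0 fls set \<Rightarrow> 'k fls fls \<Rightarrow> 'i set \<Rightarrow> ('i \<Rightarrow> 'k fls fls) \<Rightarrow> 'k fls fls set" where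
  "Md L p I f = {x. \<exists>N q. (\<forall>i\<in>I. q i \<in> LPu L) \<and> p ^ N * x = (\<Sum>i\<in>I. q i * f i)}"

lemma Md_mono: "L \<subseteq> L' \<Longrightarrow> Md L p I f \<subseteq> Md L' p I f"
  unfolding Md_def using LPu_mono by blast

context
  fixes L :: "'k::field_char_0 fls set" and p :: "'k fls fls" and I :: "'i set" and f :: "'i \<Rightarrow> 'k fls fls"
  assumes L: "subfld L" and p: "p \<in> LPu L" "p \<noteq> 0" and I: "finite I"
begin

lemma MdI: "(\<And>i. i \<in> I \<Longrightarrow> q i \<in> LPu L) \<Longrightarrow> p ^ N * x = (\<Sum>i\<in>I. q i * f i) \<Longrightarrow> x \<in> Md L p I f"
  unfolding Md_def by blast

lemma Md_raise: assumes "x \<in> Md L p I f"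
  shows "\<exists>N. \<forall>M\<ge>N. \<exists>q. (\<forall>i\<in>I. q i \<in> LPu L) \<and> p ^ M * x = (\<Sum>i\<in>I. q i * f i)"
proof -
  obtain N q where q: "\<forall>i\<in>I. q i \<in> LPu L" "p ^ N * x = (\<Sum>i\<in>I. q i * f i)" using assms by (auto simp: Md_def)
  have "\<exists>q'. (\<forall>i\<in>I. q' i \<in> LPu L) \<and> p ^ M * x = (\<Sum>i\<in>I. q' i * f i)" if "M \<ge> N" for M
  proof (intro exI conjI)
    show "\<forall>i\<in>I. p ^ (M - N) * q i \<in> LPu L" using q by (auto intro!: LPu_mult[OF L] LPu_power[OF L] p)
    have "p ^ M = p ^ (M - N) * p ^ N" using that by (simp flip: power_add)
    then have "p ^ M * x = p ^ (M - N) * (p ^ N * x)" by (simp only: mult.assoc)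
    then show "p ^ M * x = (\<Sum>i\<in>I. p ^ (M - N) * q i * f i)" unfolding q(2) by (simp add: sum_distrib_left mult.assoc)
  qed
  then show ?thesis by blast
qed

lemma Md_add: assumes "x \<in> Md L p I f" "y \<in> Md L p I f" shows "x + y \<in> Md L p I f"
proof -
  obtain N where N: "\<And>M. M \<ge> N \<Longrightarrow> \<exists>q. (\<forall>i\<in>I. q i \<in> LPu L) \<and> p ^ M * x = (\<Sum>i\<in>I. q i * f i)" using Md_raise[OF assms(1)] by blast
  obtain N' where N': "\<And>M. M \<ge> N' \<Longrightarrow> \<exists>q. (\<forall>i\<in>I. q i \<in> LPu L) \<and> p ^ M * y = (\<Sum>i\<in>I. q i * f i)" using Md_raise[OF assms(2)] by blast
  obtain q where q: "\<forall>i\<in>I. q i \<in> LPu L" "p ^ max N N' * x = (\<Sum>i\<in>I. q i * f i)" using N[of "max N N'"] by auto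
  obtain q' where q': "\<forall>i\<in>I. q' i \<in> LPu L" "p ^ max N N' * y = (\<Sum>i\<in>I. q' i * f i)" using N'[of "max N N'"] by auto
  show ?thesis
    by (rule MdI[of "\<lambda>i. q i + q' i" "max N N'"]) (use q q' LPu_add[OF L] in \<open>auto simp: distrib_left distrib_right sum.distrib\<close>)
qed

lemma Md_mult: assumes "a \<in> LPu L" "x \<in> Md L p I f" shows "a * x \<in> Md L p I f"
proof -
  obtain N q where q: "\<forall>i\<in>I. q i \<in> LPu L" "p ^ N * x = (\<Sum>i\<in>I. q i * f i)" using assms by (auto simp: Md_def)
  have "p ^ N * (a * x) = a * (p ^ N * x)" by (simp add: ac_simps)
  then show ?thesis
    by (intro MdI[of "\<lambda>i. a * q i" N]) (use q assms in \<open>auto simp: sum_distrib_left mult.assoc intro!: LPu_mult[OF L]\<close>)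
qed

lemma Md_0: "0 \<in> Md L p I f"
  by (rule MdI[of "\<lambda>_. 0" 0]) (auto simp: LPu_0[OF L])

lemma Md_uminus: "x \<in> Md L p I f \<Longrightarrow> - x \<in> Md L p I f"
  using Md_mult[OF LPu_uminus[OF L LPu_1[OF L]]] by simp

lemma Md_diff: "x \<in> Md L p I f \<Longrightarrow> y \<in> Md L p I f \<Longrightarrow> x - y \<in> Md L p I f"
  using Md_add[OF _ Md_uminus[of y], of x] by simp

lemma Md_sum: "(\<And>i. i \<in> A \<Longrightarrow> g i \<in> Md L p I f) \<Longrightarrow> sum g A \<in> Md L p I f"
  by (induction A rule: infinite_finite_induct) (auto simp: Md_0 Md_add)

lemma Md_gen: "i \<in> I \<Longrightarrow> f i \<in> Md L p I f"
  by (rule MdI[of "\<lambda>j. if j = i then 1 else 0" 0])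
    (auto simp: LPu_0[OF L] LPu_1[OF L] I if_distrib[of "\<lambda>x. x * _"] cong: if_cong)

lemma Md_div: assumes "p ^ n * x \<in> Md L p I f" shows "x \<in> Md L p I f"
proof -
  obtain N q where q: "\<forall>i\<in>I. q i \<in> LPu L" "p ^ N * (p ^ n * x) = (\<Sum>i\<in>I. q i * f i)" using assms by (auto simp: Md_def)
  then show ?thesis by (intro MdI[of q "N + n"]) (auto simp: power_add mult.assoc)
qed

text \<open>The denominator is handled by the product rule applied to \<open>p ^ N * x\<close>. Two
  fields occur because a derivation may take coefficients in \<open>L'\<close> out of it; the
  closure argument for R and S needs this form.\<close>

lemma Md_der:
  assumes L': "subfld L'" "L' \<subseteq> L" "p \<in> LPu L'"
    and DD: "is_der DD" "\<And>q. q \<in> LPu L' \<Longrightarrow> DD q \<in> LPu L" "\<And>i. i \<in> I \<Longrightarrow> DD (f i) \<in> Md L p I f" and x: "x \<in> Md L' p I f"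
  shows "DD x \<in> Md L p I f"
proof -
  obtain N q where q: "\<forall>i\<in>I. q i \<in> LPu L'" "p ^ N * x = (\<Sum>i\<in>I. q i * f i)" using x by (auto simp: Md_def)
  have qL: "q i \<in> LPu L" if "i \<in> I" for i using q(1) that LPu_mono[OF L'(2)] by blast
  have "DD (p ^ N * x) = DD (p ^ N) * x + p ^ N * DD x" by (rule is_derD(2)[OF DD(1)])
  then have "p ^ N * DD x = (\<Sum>i\<in>I. DD (q i) * f i + q i * DD (f i)) - DD (p ^ N) * x"
    unfolding q(2) is_derD(7)[OF DD(1)] is_derD(2)[OF DD(1)] by (simp add: algebra_simps)
  also have "\<dots> \<in> Md L p I f"
    by (intro Md_diff Md_sum Md_add Md_mult DD subsetD[OF Md_mono[OF L'(2)] x] Md_gen LPu_power[OF L'(1)] L'(3)) (use q qL in auto)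
  finally show ?thesis by (rule Md_div)
qed

text \<open>A dimension count requires one exponent of \<open>p\<close> and one degree bound for
  finitely many elements.\<close>

lemma Md_uniform: assumes "finite X" "\<forall>x\<in>X. g x \<in> Md L p I f"
  shows "\<exists>N B q. \<forall>x\<in>X. (\<forall>i\<in>I. q x i \<in> LP L B) \<and> p ^ N * g x = (\<Sum>i\<in>I. q x i * f i)"
proof -
  define W where "W M x q \<longleftrightarrow> (\<forall>i\<in>I. q i \<in> LPu L) \<and> p ^ M * g x = (\<Sum>i\<in>I. q i * f i)" for M x q
  have "\<forall>x. \<exists>N. x \<in> X \<longrightarrow> (\<forall>M\<ge>N. \<exists>q. W M x q)"
    using Md_raise[OF bspec[OF assms(2)]] unfolding W_def[abs_def] by blast
  then obtain n where n: "\<And>x M. x \<in> X \<Longrightarrow> M \<ge> n x \<Longrightarrow> \<exists>q. W M x q" by metis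
  define N where "N = (\<Sum>x\<in>X. n x)"
  have nN: "n x \<le> N" if "x \<in> X" for x unfolding N_def using that assms(1) by (intro member_le_sum) auto
  have "\<forall>x\<in>X. \<exists>q. W N x q" using n nN by blast
  then obtain q where "\<forall>x\<in>X. W N x (q x)" by (rule bchoice[THEN exE])
  then have q: "(\<forall>i\<in>I. q x i \<in> LPu L) \<and> p ^ N * g x = (\<Sum>i\<in>I. q x i * f i)" if "x \<in> X" for x
    using that unfolding W_def[abs_def] by blast
  have "\<forall>xi\<in>X \<times> I. q (fst xi) (snd xi) \<in> LPu L" using q by auto
  from LPu_uniform[OF L finite_cartesian_product[OF assms(1) I] this]
  obtain B where B: "\<forall>xi\<in>X \<times> I. q (fst xi) (snd xi) \<in> LP L B" by blast
  have "\<forall>x\<in>X. (\<forall>i\<in>I. q x i \<in> LP L B) \<and> p ^ N * g x = (\<Sum>i\<in>I. q x i * f i)"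
  proof (intro ballI conjI)
    show "q x i \<in> LP L B" if "x \<in> X" "i \<in> I" for x i using B that by force
    show "p ^ N * g x = (\<Sum>i\<in>I. q x i * f i)" if "x \<in> X" for x using q[OF that] by blast
  qed
  then show ?thesis by (intro exI)
qed

text \<open>Given \<open>\<rho>\<close> elements \<open>x i\<close>, counting dimensions yields a relation between the iterated derivatives \<open>(dv ^^ n) (x i)\<close>
  for \<open>n < N\<close>, with coefficients in \<open>L\<close>. Since \<open>dv\<close> has no residue and kills no negative power of \<open>v\<close>,
  it can be peeled off one derivative at a time, and some step gives a relation between the residues.\<close>

theorem residue_finite:
  assumes dvf: "\<forall>i\<in>I. dv (f i) \<in> Md L p I f"
  shows "\<exists>A. finite A \<and> A \<subseteq> cf (-1) ` Md L p I f \<and> cf (-1) ` Md L p I f \<subseteq> lspan L A"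
proof -
  obtain M0 B0 A0 where "\<forall>i\<in>I. (\<forall>j\<in>I. A0 i j \<in> LP L B0) \<and> p ^ M0 * dv (f i) = (\<Sum>j\<in>I. A0 i j * f j)"
    using Md_uniform[of I "\<lambda>i. dv (f i)", OF I dvf] by (elim exE)
  then have A0: "(\<forall>j\<in>I. A0 i j \<in> LP L B0) \<and> p ^ M0 * dv (f i) = (\<Sum>j\<in>I. A0 i j * f j)" if "i \<in> I" for i
    using that by (rule bspec)
  \<comment> \<open>The exponent is \<open>Suc M0\<close>, not \<open>M0\<close>, so that
    \<open>P ^ N0\<close> is also a multiple of \<open>p ^ N0\<close>.\<close>
  define P where "P = p ^ Suc M0"
  obtain bp where bp: "p \<in> LP L bp" using p LPuE[OF L] by metis
  define A1 where "A1 i j = p * A0 i j" for i j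
  define e where "e = bp * Suc M0 + (bp + B0)"
  have PL: "P \<in> LP L e" unfolding P_def e_def using LP_power[OF L bp, of "Suc M0"] LP_mono(1) by (metis le_add1 mult.commute subsetD)
  have AL: "A1 i j \<in> LP L e" if "i \<in> I" "j \<in> I" for i j
    unfolding A1_def e_def using LP_mult[OF L bp, of "A0 i j" B0] A0 that LP_mono(1)[of "bp + B0" "bp * Suc M0 + (bp + B0)"] by auto
  have Pf: "P * dv (f i) = (\<Sum>j\<in>I. A1 i j * f j)" if "i \<in> I" for i
  proof -
    have "P * dv (f i) = p * (p ^ M0 * dv (f i))" by (simp add: P_def mult.assoc)
    also have "\<dots> = (\<Sum>j\<in>I. A1 i j * f j)" using A0[OF that] by (simp add: A1_def sum_distrib_left mult.assoc)
    finally show ?thesis .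
  qed
  have P0: "P \<noteq> 0" using p by (simp add: P_def)
  \<comment> \<open>Each derivative widens the coefficients by e + 1 on either side, hence adds 2
    \<open>card I\<close> (e + 1) scalar equations, whereas it adds \<rho> unknowns. This \<rho>
    does not depend on the chosen elements.\<close>
  define \<rho> where "\<rho> = 2 * card I * (e + 1) + 1"
  show ?thesis
  proof (rule fin_dim_span[OF L, where n = \<rho>])
    fix y assume y: "\<And>i. i < \<rho> \<Longrightarrow> y i \<in> cf (-1) ` Md L p I f"
    show "\<exists>b. (\<forall>i<\<rho>. b i \<in> L) \<and> (\<exists>i<\<rho>. b i \<noteq> 0) \<and> (\<Sum>i<\<rho>. b i * y i) = 0"
    proof (rule ccontr)
      assume "\<not> ?thesis"
      then have ind: "b i = 0" if "\<And>i. i < \<rho> \<Longrightarrow> b i \<in> L" "(\<Sum>i<\<rho>. b i * y i) = 0" "i < \<rho>" for b i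
        using that by blast
      have "\<forall>i. \<exists>x. i < \<rho> \<longrightarrow> x \<in> Md L p I f \<and> y i = cf (-1) x" using y by blast
      then obtain x where x: "\<And>i. i < \<rho> \<Longrightarrow> x i \<in> Md L p I f \<and> y i = cf (-1) (x i)" by metis
      have "\<forall>i\<in>{..<\<rho>}. x i \<in> Md L p I f" using x by simp
      from Md_uniform[OF finite_lessThan this] obtain N0 E0 q0 where "\<forall>i\<in>{..<\<rho>}. (\<forall>j\<in>I. q0 i j \<in> LP L E0) \<and> p ^ N0 * x i = (\<Sum>j\<in>I. q0 i j * f j)"
        by (elim exE)
      then have q0: "(\<forall>j\<in>I. q0 i j \<in> LP L E0) \<and> p ^ N0 * x i = (\<Sum>j\<in>I. q0 i j * f j)" if "i < \<rho>" for i
        using that by blast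
      define E where "E = M0 * N0 * bp + E0"
      have base: "\<exists>q. (\<forall>j\<in>I. q j \<in> LP L E) \<and> P ^ N0 * x i = (\<Sum>j\<in>I. q j * f j)" if i: "i < \<rho>" for i
      proof (intro exI conjI)
        show "\<forall>j\<in>I. p ^ (M0 * N0) * q0 i j \<in> LP L E"
          unfolding E_def using q0[OF i] LP_mult[OF L LP_power[OF L bp]] by blast
        have "P ^ N0 = p ^ (M0 * N0) * p ^ N0" unfolding P_def by (simp add: power_mult power_mult_distrib mult.commute)
        then have "P ^ N0 * x i = p ^ (M0 * N0) * (p ^ N0 * x i)" by (simp only: mult.assoc)
        then show "P ^ N0 * x i = (\<Sum>j\<in>I. p ^ (M0 * N0) * q0 i j * f j)" using q0[OF i] by (simp add: sum_distrib_left mult.assoc)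
      qed
      \<comment> \<open>One derivative costs one factor \<open>P\<close> and widens the coefficients
        by at most e + 1.\<close>
      have step: "\<exists>q. (\<forall>j\<in>I. q j \<in> LP L (E + n * (e + 1))) \<and> P ^ (N0 + n) * (dv ^^ n) (x i) = (\<Sum>j\<in>I. q j * f j)"
        if i: "i < \<rho>" for i n
      proof (induction n)
        case 0 then show ?case using base[OF i] by simp
      next
        case (Suc n)
        then obtain q where q: "\<forall>j\<in>I. q j \<in> LP L (E + n * (e + 1))" "P ^ (N0 + n) * (dv ^^ n) (x i) = (\<Sum>j\<in>I. q j * f j)" by blast
        let ?y = "(dv ^^ n) (x i)" let ?m = "N0 + n"
        have "dv (P ^ ?m * ?y) = (of_nat ?m * P ^ (?m - 1) * dv P) * ?y + P ^ ?m * dv ?y"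
          unfolding is_derD(2)[OF dv_der, of "P ^ ?m"] is_derD(8)[OF dv_der] ..
        then have "P * (P ^ ?m * dv ?y) = P * dv (\<Sum>j\<in>I. q j * f j) - P * (of_nat ?m * P ^ (?m - 1) * dv P) * ?y"
          unfolding q(2)[symmetric] by (simp add: algebra_simps)
        also have "P * (of_nat ?m * P ^ (?m - 1) * dv P) * ?y = of_nat ?m * dv P * (P ^ ?m * ?y)"
          by (cases ?m) (simp_all add: ac_simps)
        also have "\<dots> = (\<Sum>j\<in>I. of_nat ?m * dv P * q j * f j)" unfolding q(2) by (simp add: sum_distrib_left mult.assoc)
        also have "P * dv (\<Sum>j\<in>I. q j * f j) = (\<Sum>j\<in>I. P * dv (q j) * f j) + (\<Sum>j\<in>I. q j * (P * dv (f j)))"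
          unfolding is_derD(7)[OF dv_der] is_derD(2)[OF dv_der] by (simp add: sum_distrib_left distrib_left sum.distrib ac_simps)
        also have "(\<Sum>j\<in>I. q j * (P * dv (f j))) = (\<Sum>j\<in>I. \<Sum>l\<in>I. q j * A1 j l * f l)"
          by (rule sum.cong) (simp_all add: Pf sum_distrib_left mult.assoc)
        also have "\<dots> = (\<Sum>l\<in>I. (\<Sum>j\<in>I. q j * A1 j l) * f l)" unfolding sum_distrib_right by (rule sum.swap)
        finally have eq: "P ^ (N0 + Suc n) * (dv ^^ Suc n) (x i) =
           (\<Sum>j\<in>I. (P * dv (q j) + (\<Sum>l\<in>I. q l * A1 l j) - of_nat ?m * dv P * q j) * f j)"
          by (simp add: sum.distrib sum_subtractf left_diff_distrib distrib_right mult.assoc)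
        have "P * dv (q j) + (\<Sum>l\<in>I. q l * A1 l j) - of_nat ?m * dv P * q j \<in> LP L (E + Suc n * (e + 1))" if j: "j \<in> I" for j
        proof -
          let ?E = "E + n * (e + 1)"
          have s: "E + Suc n * (e + 1) = e + (?E + 1)" by simp
          have 1: "P * dv (q j) \<in> LP L (e + (?E + 1))" using LP_mult[OF L PL LP_dv[OF L]] q(1) j by blast
          have "q l * A1 l j \<in> LP L (?E + e)" if "l \<in> I" for l using LP_mult[OF L _ AL[OF that j]] q(1) that by blast
          then have 2: "(\<Sum>l\<in>I. q l * A1 l j) \<in> LP L (e + (?E + 1))"
            using LP_mono(1)[of "?E + e" "e + (?E + 1)" L] by (intro LP_sum[OF L]) auto
          have "(of_nat ?m :: 'k fls fls) \<in> LP L 0" unfolding em_of_nat[symmetric] by (rule LP_em[OF L subfldD(10)[OF L]])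
          from LP_mult[OF L LP_mult[OF L this LP_dv[OF L PL]], of "q j" ?E] q(1) j
          have "of_nat ?m * dv P * q j \<in> LP L (0 + (e + 1) + ?E)" by blast
          also have "0 + (e + 1) + ?E = e + (?E + 1)" by simp
          finally have 3: "of_nat ?m * dv P * q j \<in> LP L (e + (?E + 1))" .
          show ?thesis unfolding s diff_conv_add_uminus by (rule LP_add[OF L LP_add[OF L 1 2] LP_uminus[OF L 3]])
        qed
        then have "\<forall>j\<in>I. P * dv (q j) + (\<Sum>l\<in>I. q l * A1 l j) - of_nat ?m * dv P * q j \<in> LP L (E + Suc n * (e + 1))" by (rule ballI)
        then show ?case using eq by (intro exI conjI)
      qed
      \<comment> \<open>The initial width \<open>E\<close> does depend on the elements. It costs a
        fixed number of equations, and \<open>N\<close> derivatives supply one spare unknown each to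
        pay for it.\<close>
      define N where "N = card I * (2 * E + 1) + 1"
      define E' where "E' = E + N * (e + 1)"
      have full: "\<exists>q. (\<forall>j\<in>I. q j \<in> LP L E') \<and> P ^ (N0 + N) * (dv ^^ n) (x i) = (\<Sum>j\<in>I. q j * f j)"
        if i: "i < \<rho>" "n < N" for i n
      proof -
        obtain q where q: "\<forall>j\<in>I. q j \<in> LP L (E + n * (e + 1))" "P ^ (N0 + n) * (dv ^^ n) (x i) = (\<Sum>j\<in>I. q j * f j)"
          using step[OF i(1)] by blast
        have le: "(N - n) * e + (E + n * (e + 1)) \<le> E'"
        proof -
          have "(N - n) * e + n * e = N * e" using i(2) by (simp flip: distrib_right)
          then show ?thesis unfolding E'_def using i(2) by (simp add: algebra_simps)
        qed
        have "P ^ (N - n) * q j \<in> LP L E'" if "j \<in> I" for j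
          using LP_mult[OF L LP_power[OF L PL] bspec[OF q(1) that], of "N - n"] LP_mono(1)[OF le] by (rule rev_subsetD)
        then have 1: "\<forall>j\<in>I. P ^ (N - n) * q j \<in> LP L E'" by (rule ballI)
        have "P ^ (N0 + N) * (dv ^^ n) (x i) = (\<Sum>j\<in>I. P ^ (N - n) * q j * f j)"
        proof -
          have "N0 + N = (N - n) + (N0 + n)" using i(2) by simp
          then have "P ^ (N0 + N) = P ^ (N - n) * P ^ (N0 + n)" by (simp only: power_add)
          then have "P ^ (N0 + N) * (dv ^^ n) (x i) = P ^ (N - n) * (P ^ (N0 + n) * (dv ^^ n) (x i))" by (simp only: mult.assoc)
          then show ?thesis unfolding q(2) by (simp add: sum_distrib_left mult.assoc)
        qed
        then show ?thesis using 1 by (intro exI conjI)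
      qed
      define W where "W ni q \<longleftrightarrow> (\<forall>j\<in>I. q j \<in> LP L E') \<and> P ^ (N0 + N) * (dv ^^ fst ni) (x (snd ni)) = (\<Sum>j\<in>I. q j * f j)" for ni q
      have "\<exists>q. W ni q" if "ni \<in> {..<N} \<times> {..<\<rho>}" for ni
      proof -
        have "snd ni < \<rho>" "fst ni < N" using that by auto
        from full[OF this] show ?thesis unfolding W_def .
      qed
      then have "\<forall>ni\<in>{..<N} \<times> {..<\<rho>}. \<exists>q. W ni q" by (rule ballI)
      then obtain qt where "\<forall>ni\<in>{..<N} \<times> {..<\<rho>}. W ni (qt ni)" by (rule bchoice[THEN exE])
      then have qt: "W ni (qt ni)" if "ni \<in> {..<N} \<times> {..<\<rho>}" for ni
        using that by (rule bspec)
      have qtL: "qt ni j \<in> LP L E'" if "ni \<in> {..<N} \<times> {..<\<rho>}" "j \<in> I" for ni j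
        using qt[OF that(1)] that(2) unfolding W_def by blast
      have qte: "P ^ (N0 + N) * (dv ^^ fst ni) (x (snd ni)) = (\<Sum>j\<in>I. qt ni j * f j)" if "ni \<in> {..<N} \<times> {..<\<rho>}" for ni
        using qt[OF that] unfolding W_def by blast
      have cardJ: "card ({- int E'..int E'} \<times> I) = (2 * E' + 1) * card I"
      proof -
        have "nat (2 * int E' + 1) = 2 * E' + 1" by simp
        then show ?thesis by (simp only: card_cartesian_product card_atLeastAtMost_int) simp
      qed
      have cardlt: "card ({- int E'..int E'} \<times> I) < card ({..<N} \<times> {..<\<rho>})"
      proof -
        have "(2 * E' + 1) * card I = card I * (2 * E + 1) + N * (2 * card I * (e + 1))"
          unfolding E'_def by (simp add: algebra_simps)
        also have "\<dots> < N + N * (2 * card I * (e + 1))" unfolding N_def by simp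
        also have "\<dots> = N * \<rho>" unfolding \<rho>_def by (simp add: algebra_simps)
        finally show ?thesis unfolding cardJ by (simp add: card_cartesian_product)
      qed
      have "\<exists>b. (\<forall>ni\<in>{..<N} \<times> {..<\<rho>}. b ni \<in> L) \<and> (\<exists>ni\<in>{..<N} \<times> {..<\<rho>}. b ni \<noteq> 0) \<and>
        (\<forall>kj\<in>{- int E'..int E'} \<times> I. (\<Sum>ni\<in>{..<N} \<times> {..<\<rho>}. b ni * cf (fst kj) (qt ni (snd kj))) = 0)"
        by (rule hom_system[OF L _ _ cardlt]) (use qtL I in \<open>auto simp: LP_def\<close>)
      then obtain b where b0: "(\<forall>ni\<in>{..<N} \<times> {..<\<rho>}. b ni \<in> L) \<and> (\<exists>ni\<in>{..<N} \<times> {..<\<rho>}. b ni \<noteq> 0) \<and>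
        (\<forall>kj\<in>{- int E'..int E'} \<times> I. (\<Sum>ni\<in>{..<N} \<times> {..<\<rho>}. b ni * cf (fst kj) (qt ni (snd kj))) = 0)"
        by (elim exE)
      have b: "\<And>ni. ni \<in> {..<N} \<times> {..<\<rho>} \<Longrightarrow> b ni \<in> L" "\<exists>ni\<in>{..<N} \<times> {..<\<rho>}. b ni \<noteq> 0"
        using b0 by blast+
      have bz: "(\<Sum>ni\<in>{..<N} \<times> {..<\<rho>}. b ni * cf k (qt ni j)) = 0" if "k \<in> {- int E'..int E'}" "j \<in> I" for k j
        using b0[THEN conjunct2, THEN conjunct2, THEN bspec, of "(k, j)"] that by simp
      have zz: "(\<Sum>ni\<in>{..<N} \<times> {..<\<rho>}. em (b ni) * qt ni j) = 0" if j: "j \<in> I" for j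
      proof (rule cf_ext)
        fix k
        show "cf k (\<Sum>ni\<in>{..<N} \<times> {..<\<rho>}. em (b ni) * qt ni j) = cf k 0"
        proof (cases "\<bar>k\<bar> > int E'")
          case True
          then have "cf k (qt ni j) = 0" if "ni \<in> {..<N} \<times> {..<\<rho>}" for ni using qtL[OF that j] True by (auto simp: LP_def)
          then show ?thesis by (simp add: cf_sum cf_em_mult)
        next
          case False
          then have "k \<in> {- int E'..int E'}" by auto
          then show ?thesis using bz[OF _ j] by (simp add: cf_sum cf_em_mult)
        qed
      qed
      have "P ^ (N0 + N) * (\<Sum>ni\<in>{..<N} \<times> {..<\<rho>}. em (b ni) * (dv ^^ fst ni) (x (snd ni))) =
        (\<Sum>ni\<in>{..<N} \<times> {..<\<rho>}. em (b ni) * (P ^ (N0 + N) * (dv ^^ fst ni) (x (snd ni))))"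
        by (simp add: sum_distrib_left ac_simps)
      also have "\<dots> = (\<Sum>ni\<in>{..<N} \<times> {..<\<rho>}. \<Sum>j\<in>I. em (b ni) * qt ni j * f j)"
        by (rule sum.cong[OF refl]) (simp only: qte sum_distrib_left mult.assoc)
      also have "\<dots> = (\<Sum>j\<in>I. (\<Sum>ni\<in>{..<N} \<times> {..<\<rho>}. em (b ni) * qt ni j) * f j)"
        unfolding sum_distrib_right by (rule sum.swap)
      also have "\<dots> = 0" by (simp add: zz)
      finally have rel: "(\<Sum>ni\<in>{..<N} \<times> {..<\<rho>}. em (b ni) * (dv ^^ fst ni) (x (snd ni))) = 0" using P0 by simp
      \<comment> \<open>\<open>z m\<close> collects the relation from order \<open>m\<close> on with
        \<open>m\<close> derivatives stripped off; \<open>z 0\<close> is the relation itself, and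
        \<open>z m\<close> is a combination of the \<open>x i\<close> plus the derivative of
        \<open>z (Suc m)\<close>.\<close>
      define z where "z m = (\<Sum>n\<in>{m..<N}. \<Sum>i<\<rho>. em (b (n, i)) * (dv ^^ (n - m)) (x i))" for m
      have z0: "z 0 = 0" unfolding z_def using rel by (simp add: sum.cartesian_product case_prod_unfold atLeast0LessThan)
      have zS: "z m = (\<Sum>i<\<rho>. em (b (m, i)) * x i) + dv (z (Suc m))" if "m < N" for m
      proof -
        have "dv (z (Suc m)) = (\<Sum>n\<in>{Suc m..<N}. \<Sum>i<\<rho>. em (b (n, i)) * (dv ^^ (n - m)) (x i))"
          unfolding z_def is_derD(7)[OF dv_der] dv_em_mult
        proof (intro sum.cong refl arg_cong2[where f = "(*)"])
          fix n i assume "n \<in> {Suc m..<N}"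
          then have "n - m = Suc (n - Suc m)" by auto
          then show "dv ((dv ^^ (n - Suc m)) (x i)) = (dv ^^ (n - m)) (x i)" by simp
        qed
        moreover have "{m..<N} = insert m {Suc m..<N}" using that by auto
        ultimately show ?thesis unfolding z_def[of m] by simp
      qed
      \<comment> \<open>If \<open>z m\<close> has no negative powers, its residue is a relation
        between the \<open>y i\<close>, since \<open>dv\<close> contributes no residue. By the
        assumed independence the coefficients of order \<open>m\<close> vanish, so
        \<open>z m\<close> is the derivative of \<open>z (Suc m)\<close>, which then has no negative
        powers either.\<close>
      have inv: "m \<le> N \<Longrightarrow> (\<forall>k<0. cf k (z m) = 0) \<and> (\<forall>n<m. \<forall>i<\<rho>. b (n, i) = 0)" for m
      proof (induction m)
        case 0 then show ?case using z0 by simp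
      next
        case (Suc m)
        then have IH: "\<forall>k<0. cf k (z m) = 0" "\<forall>n<m. \<forall>i<\<rho>. b (n, i) = 0" and mN: "m < N" by auto
        have "cf (-1) (z m) = (\<Sum>i<\<rho>. b (m, i) * y i)"
          unfolding zS[OF mN] using x by (simp add: cf_dv cf_sum cf_em_mult)
        then have "(\<Sum>i<\<rho>. b (m, i) * y i) = 0" using IH(1) by simp
        then have bm: "b (m, i) = 0" if "i < \<rho>" for i using ind[of "\<lambda>i. b (m, i)" i] b(1) mN that by auto
        then have zd: "z m = dv (z (Suc m))" using zS[OF mN] by simp
        have "cf k (z (Suc m)) = 0" if "k < 0" for k
        proof -
          have "of_int k * cf k (z (Suc m)) = cf (k - 1) (z m)" unfolding zd cf_dv by simp
          then show ?thesis using IH(1) that by simp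
        qed
        then show ?case using IH(2) bm by (auto simp: less_Suc_eq)
      qed
      then show False using b(2) by auto
    qed
  qed
qed

end

section \<open>Generating series along the one-cut curve\<close>

abbreviation ft :: "'k::field_char_0 fps \<Rightarrow> 'k fls" where "ft \<equiv> fps_to_fls"

lemma ft_mult: "ft (x * y) = ft x * ft y" by (rule fls_times_fps_to_fls)

text \<open>\<open>Psi R S g\<close> is the sum of \<open>g j * X ^ j\<close> over all \<open>j\<close>, where \<open>X = Xv R S\<close>.\<close>

definition Psi :: "'k::field_char_0 fps \<Rightarrow> 'k fps \<Rightarrow> (nat \<Rightarrow> 'k fps) \<Rightarrow> 'k fls fls" where
  "Psi R S g = fps_to_fls (Abs_fps (\<lambda>n. Abs_fls (\<lambda>k. bc R S g k $ n)))"

definition Xv :: "'k::field_char_0 fps \<Rightarrow> 'k fps \<Rightarrow> 'k fls fls" where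
  "Xv R S = vp 1 + em (ft S) + em (ft R) * vp (-1)"

lemma cf_Xv_mult: "cf k (Xv R S * f) = cf (k - 1) f + ft S * cf k f + ft R * cf (k + 1) f"
  by (simp add: Xv_def distrib_right cf_vp_mult cf_em_mult mult.assoc)

lemma cf_Xv_pow: "cf k (Xv R S ^ n) = ft (Tc R S n k)"
  by (induction n arbitrary: k) (simp_all add: cf_1 cf_Xv_mult ft_mult)

lemma Tc_top: "Tc R S n (int n) = 1"
  by (induction n) (simp_all add: Tc_zero)

text \<open>The top coefficient in v of X^m is 1, so a nonzero polynomial in X has a nonzero leading
  coefficient.\<close>

lemma Xv_pow_sum_nz:
  assumes "finite J" "j \<in> J" "p j \<noteq> 0"
  shows "(\<Sum>j\<in>J. em (ft (p j)) * Xv R S ^ j) \<noteq> 0"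
proof -
  define J' where "J' = {j \<in> J. p j \<noteq> 0}"
  have J': "finite J'" "J' \<noteq> {}" using assms by (auto simp: J'_def)
  define m where "m = Max J'"
  have m: "m \<in> J'" using J' by (simp add: m_def)
  have "cf (int m) (\<Sum>j\<in>J. em (ft (p j)) * Xv R S ^ j) = (\<Sum>j\<in>J. ft (p j) * ft (Tc R S j (int m)))"
    by (simp add: cf_sum cf_em_mult cf_Xv_pow)
  also have "\<dots> = (\<Sum>j\<in>J. if j = m then ft (p m) else 0)"
  proof (rule sum.cong[OF refl])
    fix j assume j: "j \<in> J"
    show "ft (p j) * ft (Tc R S j (int m)) = (if j = m then ft (p m) else 0)"
    proof (cases "j \<in> J'")
      case True
      then have "j \<le> m" using J'(1) by (simp add: m_def)
      then show ?thesis using Tc_zero[of j "int m" R S] by (cases "j = m") (auto simp: Tc_top)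
    next
      case False
      then have "p j = 0" "j \<noteq> m" using j m by (auto simp: J'_def)
      then show ?thesis by simp
    qed
  qed
  also have "\<dots> = ft (p m)" using m assms(1) by (simp add: J'_def)
  finally have "cf (int m) (\<Sum>j\<in>J. em (ft (p j)) * Xv R S ^ j) = ft (p m)" .
  moreover have "p m \<noteq> 0" using m by (simp add: J'_def)
  ultimately show ?thesis by force
qed

lemma Xv_nz: "Xv R S \<noteq> 0"
proof
  assume "Xv R S = 0"
  then have "cf 1 (Xv R S ^ 1) = 0" by simp
  then show False unfolding cf_Xv_pow using Tc_top[of R S 1] by simp
qed

text \<open>A sequence stands for a power series in a variable x, later replaced by X:
  \<open>conv\<close> is the product, \<open>vd\<close> is d/dx, and \<open>shl\<close> drops the
  constant term and divides by x.\<close>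

definition conv :: "(nat \<Rightarrow> 'a::comm_ring_1) \<Rightarrow> (nat \<Rightarrow> 'a) \<Rightarrow> nat \<Rightarrow> 'a" where
  "conv p g n = (\<Sum>i\<le>n. p i * g (n - i))"

definition vd :: "(nat \<Rightarrow> 'a::comm_ring_1) \<Rightarrow> nat \<Rightarrow> 'a" where
  "vd g j = of_nat (Suc j) * g (Suc j)"

definition shl :: "(nat \<Rightarrow> 'a) \<Rightarrow> nat \<Rightarrow> 'a" where
  "shl g j = g (Suc j)"

context
  fixes R S :: "'k::field_char_0 fps"
  assumes RS: "R $ 0 = 0" "S $ 0 = 0"
begin

lemma cf_Psi: "cf k (Psi R S g) = ft (bc R S g k)"
proof (rule fls_eqI)
  fix n
  show "cf k (Psi R S g) $$ n = ft (bc R S g k) $$ n"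
  proof (cases "n < 0")
    case False
    have "Abs_fls (\<lambda>k. bc R S g k $ nat n) $$ k = bc R S g k $ nat n"
      by (rule nth_Abs_fls_lower_bound[of "- n"]) (use False bc_order[OF RS] in auto)
    then show ?thesis using False by (simp add: cf_nth Psi_def)
  qed (simp add: cf_nth Psi_def)
qed

lemma Psi_add: "Psi R S (\<lambda>j. g j + h j) = Psi R S g + Psi R S h"
  by (rule cf_ext) (simp add: cf_Psi bc_def distrib_right Sa_add[OF Tc_nul[OF RS] Tc_nul[OF RS]])

lemma Psi_cmult: "Psi R S (\<lambda>j. c * g j) = em (ft c) * Psi R S g"
  by (rule cf_ext) (simp add: cf_Psi cf_em_mult bc_def mult.assoc Sa_cmult[OF Tc_nul[OF RS]] flip: ft_mult)

lemma Psi_0: "Psi R S (\<lambda>j. 0) = 0"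
  by (rule cf_ext) (simp add: cf_Psi bc_def)

lemma Psi_sum: "finite I \<Longrightarrow> Psi R S (\<lambda>j. \<Sum>i\<in>I. f i j) = (\<Sum>i\<in>I. Psi R S (f i))"
  by (induction I rule: finite_induct) (simp_all add: Psi_0 Psi_add)

lemma Psi_Suc: assumes "g 0 = 0" shows "Psi R S g = Xv R S * Psi R S (shl g)"
proof (rule cf_ext)
  fix k
  have n: "nul (\<lambda>j. g (Suc j) * Tc R S j k')" for k'
    using Tc_nul[OF RS, of "\<lambda>j. g (Suc j)"] by simp
  have "bc R S g k = (\<Sum>j<1. g j * Tc R S j k) + Sa (\<lambda>j. g (j + 1) * Tc R S (j + 1) k)"
    unfolding bc_def by (rule Sa_split[OF Tc_nul[OF RS]])
  also have "\<dots> = Sa (\<lambda>j. g (Suc j) * Tc R S j (k - 1) + S * (g (Suc j) * Tc R S j k) + R * (g (Suc j) * Tc R S j (k + 1)))"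
    using assms by (simp add: algebra_simps)
  also have "\<dots> = bc R S (shl g) (k - 1) + S * bc R S (shl g) k + R * bc R S (shl g) (k + 1)"
    by (simp add: bc_def shl_def Sa_add Sa_cmult nul_add nul_mult n)
  finally show "cf k (Psi R S g) = cf k (Xv R S * Psi R S (shl g))"
    by (simp add: cf_Psi cf_Xv_mult ft_mult)
qed

text \<open>Chain rule, with dX/dv = 1 - R/v^2; coefficientwise it is
  \<open>Tc_euler\<close>.\<close>

lemma Psi_dv: "dv (Psi R S g) = Psi R S (vd g) * (1 - em (ft R) * vp (-2))"
proof (rule cf_ext)
  fix k :: int
  let ?k = "k + 1"
  have n: "nul (\<lambda>j. vd g j * Tc R S j k')" for k' by (rule Tc_nul[OF RS])
  have "of_int ?k * bc R S g ?k = Sa (\<lambda>j. of_int ?k * (g j * Tc R S j ?k))"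
    unfolding bc_def by (rule Sa_cmult[OF Tc_nul[OF RS], symmetric])
  also have "\<dots> = (\<Sum>j<1. of_int ?k * (g j * Tc R S j ?k)) + Sa (\<lambda>j. of_int ?k * (g (j + 1) * Tc R S (j + 1) ?k))"
    by (rule Sa_split[OF nul_mult[OF Tc_nul[OF RS]]])
  also have "(\<Sum>j<1. of_int ?k * (g j * Tc R S j ?k)) = 0" by (cases "?k = 0") simp_all
  also have "(\<lambda>j. of_int ?k * (g (j + 1) * Tc R S (j + 1) ?k)) = (\<lambda>j. vd g j * Tc R S j k - R * (vd g j * Tc R S j (k + 2)))"
  proof
    fix j
    have "of_int ?k * (g (j + 1) * Tc R S (j + 1) ?k) = g (Suc j) * (of_int ?k * Tc R S (Suc j) ?k)"
      by (simp add: ac_simps)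
    also have "\<dots> = g (Suc j) * (of_nat (Suc j) * (Tc R S j (?k - 1) - R * Tc R S j (?k + 1)))" unfolding Tc_euler ..
    also have "\<dots> = vd g j * Tc R S j k - R * (vd g j * Tc R S j (k + 2))"
      by (simp add: vd_def right_diff_distrib add.commute[of _ 2] add.assoc[symmetric])
    finally show "of_int ?k * (g (j + 1) * Tc R S (j + 1) ?k) = vd g j * Tc R S j k - R * (vd g j * Tc R S j (k + 2))" .
  qed
  also have "Sa (\<lambda>j. vd g j * Tc R S j k - R * (vd g j * Tc R S j (k + 2))) = bc R S (vd g) k - R * bc R S (vd g) (k + 2)"
    by (simp add: bc_def Sa_diff Sa_cmult nul_mult n)
  finally have "of_int ?k * bc R S g ?k = bc R S (vd g) k - R * bc R S (vd g) (k + 2)" by simp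
  then have "ft (of_int ?k) * ft (bc R S g ?k) = ft (bc R S (vd g) k) - ft R * ft (bc R S (vd g) (k + 2))"
    by (simp only: fps_to_fls_minus flip: ft_mult)
  moreover have "cf k (Psi R S (vd g) * (1 - em (ft R) * vp (-2))) = ft (bc R S (vd g) k) - ft R * ft (bc R S (vd g) (k + 2))"
  proof -
    have "Psi R S (vd g) * (1 - em (ft R) * vp (-2)) = Psi R S (vd g) - em (ft R) * (vp (-2) * Psi R S (vd g))"
      by (simp add: algebra_simps)
    then show ?thesis by (simp only: cf_diff cf_em_mult cf_vp_mult cf_Psi) simp
  qed
  ultimately show "cf k (dv (Psi R S g)) = cf k (Psi R S (vd g) * (1 - em (ft R) * vp (-2)))"
    unfolding cf_dv cf_Psi fps_to_fls_of_int by (simp only:)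
qed

text \<open>Chain rule in z, u or t: the coefficients of the series are differentiated as well as X.
  The locality of \<open>d\<close> allows differentiating the infinite sum term by term.\<close>

lemma Psi_DD:
  assumes c: "compat D DD" and d: "\<And>x. D (ft x) = ft (d x)"
    and loc: "\<And>x m. (\<And>l. l \<le> m + 1 \<Longrightarrow> x $ l = 0) \<Longrightarrow> d x $ m = 0"
  shows "DD (Psi R S g) = Psi R S (\<lambda>j. d (g j)) + Psi R S (vd g) * DD (Xv R S)"
proof (rule cf_ext)
  fix k
  have isd: "is_der D" "is_der DD" and cc: "cf k (DD f) = D (cf k f)" for f using c by (auto simp: compat_def)
  have d': "d (x + y) = d x + d y" "d (x * y) = d x * y + x * d y" "d 0 = 0" "d 1 = 0" for x y
    using is_derD(1)[OF isd(1), of "ft x" "ft y"] is_derD(2)[OF isd(1), of "ft x" "ft y"] is_derD(3,4)[OF isd(1)]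
    by (simp_all add: d flip: ft_mult fps_to_fls_plus fps_zero_to_fls fps_one_to_fls)
  have n: "nul (\<lambda>j. vd g j * Tc R S j k')" "nul (\<lambda>j. d (g j) * Tc R S j k')" for k' by (rule Tc_nul[OF RS])+
  have nd: "nul (\<lambda>j. d (g j * Tc R S j k))"
    by (rule Sa_additive(2)[OF d'(1) d'(3) loc Tc_nul[OF RS]])
  have nsh: "nul (\<lambda>j. g j * d (Tc R S j k))"
  proof -
    have "(\<lambda>j. g j * d (Tc R S j k)) = (\<lambda>j. d (g j * Tc R S j k) - d (g j) * Tc R S j k)" by (simp add: d')
    then show ?thesis using nul_diff[OF nd n(2)[of k]] by simp
  qed
  have "d (bc R S g k) = Sa (\<lambda>j. d (g j * Tc R S j k))"
    unfolding bc_def by (rule Sa_additive(1)[OF d'(1) d'(3) loc Tc_nul[OF RS]])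
  also have "\<dots> = bc R S (\<lambda>j. d (g j)) k + Sa (\<lambda>j. g j * d (Tc R S j k))"
    unfolding d' bc_def by (rule Sa_add[OF n(2) nsh])
  also have "Sa (\<lambda>j. g j * d (Tc R S j k)) = (\<Sum>j<1. g j * d (Tc R S j k)) + Sa (\<lambda>j. g (j + 1) * d (Tc R S (j + 1) k))"
    by (rule Sa_split[OF nsh])
  also have "(\<Sum>j<1. g j * d (Tc R S j k)) = 0" by (simp add: d')
  also have "(\<lambda>j. g (j + 1) * d (Tc R S (j + 1) k)) = (\<lambda>j. d S * (vd g j * Tc R S j k) + d R * (vd g j * Tc R S j (k + 1)))"
  proof
    fix j
    have "g (j + 1) * d (Tc R S (Suc j) k) = g (j + 1) * (of_nat (Suc j) * (d S * Tc R S j k + d R * Tc R S j (k + 1)))"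
      by (subst Tc_deriv[of d, OF d']) (rule refl)
    also have "\<dots> = d S * (vd g j * Tc R S j k) + d R * (vd g j * Tc R S j (k + 1))"
      unfolding vd_def distrib_left by (simp only: Suc_eq_plus1 ac_simps)
    finally show "g (j + 1) * d (Tc R S (j + 1) k) = d S * (vd g j * Tc R S j k) + d R * (vd g j * Tc R S j (k + 1))"
      by simp
  qed
  also have "Sa (\<lambda>j. d S * (vd g j * Tc R S j k) + d R * (vd g j * Tc R S j (k + 1))) = d S * bc R S (vd g) k + d R * bc R S (vd g) (k + 1)"
    by (simp add: bc_def Sa_add Sa_cmult nul_mult n)
  finally have 1: "d (bc R S g k) = bc R S (\<lambda>j. d (g j)) k + (d S * bc R S (vd g) k + d R * bc R S (vd g) (k + 1))" by simp
  have X: "DD (Xv R S) = em (ft (d S)) + em (ft (d R)) * vp (-1)"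
    by (simp add: Xv_def is_derD[OF isd(2)] compat_em[OF c] compat_vp[OF c] d)
  have "Psi R S (vd g) * DD (Xv R S) = em (ft (d S)) * Psi R S (vd g) + em (ft (d R)) * (vp (-1) * Psi R S (vd g))"
    unfolding X by (simp add: algebra_simps)
  then have "cf k (Psi R S (vd g) * DD (Xv R S)) = ft (d S) * ft (bc R S (vd g) k) + ft (d R) * ft (bc R S (vd g) (k + 1))"
    by (simp add: cf_em_mult cf_vp_mult cf_Psi)
  then show "cf k (DD (Psi R S g)) = cf k (Psi R S (\<lambda>j. d (g j)) + Psi R S (vd g) * DD (Xv R S))"
    by (simp add: cc cf_Psi d 1 ft_mult)
qed

lemma Psi_shift: "Psi R S (\<lambda>n. if i \<le> n then g (n - i) else 0) = Xv R S ^ i * Psi R S g"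
proof (induction i)
  case (Suc i)
  have "Psi R S (\<lambda>n. if Suc i \<le> n then g (n - Suc i) else 0) = Xv R S * Psi R S (shl (\<lambda>n. if Suc i \<le> n then g (n - Suc i) else 0))"
    by (rule Psi_Suc) simp
  also have "shl (\<lambda>n. if Suc i \<le> n then g (n - Suc i) else 0) = (\<lambda>n. if i \<le> n then g (n - i) else 0)"
    by (auto simp: shl_def fun_eq_iff)
  finally show ?case by (simp add: Suc.IH mult.assoc)
qed simp

lemma Psi_conv: assumes "finite J" "\<And>j. j \<notin> J \<Longrightarrow> p j = 0"
  shows "Psi R S (conv p g) = (\<Sum>j\<in>J. em (ft (p j)) * Xv R S ^ j) * Psi R S g"
proof -
  have "conv p g = (\<lambda>n. \<Sum>j\<in>J. p j * (if j \<le> n then g (n - j) else 0))"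
  proof
    fix n
    have "conv p g n = (\<Sum>j\<in>J \<inter> {..n}. p j * g (n - j))"
      unfolding conv_def by (rule sum.mono_neutral_right) (use assms(2) in auto)
    also have "\<dots> = (\<Sum>j\<in>J. p j * (if j \<le> n then g (n - j) else 0))"
      by (rule sum.mono_neutral_cong_left) (use assms(1) in auto)
    finally show "conv p g n = \<dots>" .
  qed
  then show ?thesis using assms(1)
    by (simp add: Psi_sum Psi_cmult Psi_shift sum_distrib_right mult.assoc)
qed

text \<open>The product rule for g = x times \<open>shl g\<close>, with x replaced by X.\<close>

lemma Psi_vd_shl: assumes "g 0 = 0" shows "Xv R S * Psi R S (vd (shl g)) = Psi R S (vd g) - Psi R S (shl g)"
proof -
  have "Xv R S * Psi R S (vd (shl g)) = Psi R S (\<lambda>n. if 1 \<le> n then vd (shl g) (n - 1) else 0)"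
    using Psi_shift[of 1 "vd (shl g)"] by simp
  also have "(\<lambda>n. if 1 \<le> n then vd (shl g) (n - 1) else 0) = (\<lambda>n. vd g n + (- 1) * shl g n)"
    by (auto simp: fun_eq_iff vd_def shl_def algebra_simps)
  also have "Psi R S \<dots> = Psi R S (vd g) + em (ft (-1)) * Psi R S (shl g)"
    by (simp only: Psi_add Psi_cmult)
  finally show ?thesis by (simp add: em_uminus)
qed

end

text \<open>As \<open>G\<close> has only negative powers of v, the residue pairs coefficient m of
  \<open>F\<close> with coefficient -1 - m of \<open>G\<close>. The order condition makes the sum
  over m converge.\<close>

lemma cf_prod_Sa:
  fixes F G :: "'k::field_char_0 fls fls" and a b :: "int \<Rightarrow> 'k fps"
  assumes F: "\<And>k. cf k F = ft (a k)" and G: "\<And>k. cf k G = ft (b k)"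
    and ord: "\<And>k m. int m + k < 0 \<Longrightarrow> b k $ m = 0" and neg: "\<And>k. k \<ge> 0 \<Longrightarrow> b k = 0"
  shows "cf (-1) (F * G) = ft (Sa (\<lambda>m. a (int m) * b (- 1 - int m)))"
proof -
  have Fn: "F $$ i $$ k = ft (a k) $$ i" and Gn: "G $$ i $$ k = ft (b k) $$ i" for i k
    unfolding cf_nth[symmetric] F G by simp_all
  have F0: "F $$ i = 0" and G0: "G $$ i = 0" if "i < 0" for i
    by (rule fls_eqI, use that in \<open>simp add: Fn Gn\<close>)+
  show ?thesis
  proof (rule fls_eqI)
    fix n
    have prod: "(F * G) $$ n = (\<Sum>i=0..n. F $$ i * G $$ (n - i))"
      by (subst fls_mult_nth_bound[of 0 F 0 G]) (auto simp: F0 G0)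
    show "cf (-1) (F * G) $$ n = ft (Sa (\<lambda>m. a (int m) * b (- 1 - int m))) $$ n"
    proof (cases "n < 0")
      case True then show ?thesis by (simp add: cf_nth prod)
    next
      case False
      define N where "N = nat n"
      have n: "n = int N" using False by (simp add: N_def)
      have one: "(F $$ int i * G $$ (n - int i)) $$ (-1) = (\<Sum>m<N. a (int m) $ i * b (- 1 - int m) $ (N - i))" if i: "i \<le> N" for i
      proof -
        define A where "A = fls_subdegree (F $$ int i)"
        define Bd where "Bd = - (n - int i)"
        have ni: "n - int i = int (N - i)" using i n by simp
        have "(F $$ int i * G $$ (n - int i)) $$ (-1) = (\<Sum>k=A..-1 - Bd. F $$ int i $$ k * G $$ (n - int i) $$ (- 1 - k))"
          by (rule fls_mult_nth_bound) (use i in \<open>auto simp: A_def Bd_def Gn ni ord\<close>)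
        also have "\<dots> = (\<Sum>k\<in>int ` {..<N}. F $$ int i $$ k * G $$ (n - int i) $$ (- 1 - k))"
        proof (rule sum.mono_neutral_cong)
          show "F $$ int i $$ k * G $$ (n - int i) $$ (- 1 - k) = 0" if "k \<in> int ` {..<N} - {A..-1 - Bd}" for k
          proof -
            from that consider "k < A" | "k > - 1 - Bd" by force
            then show ?thesis
            proof cases
              case 1 then show ?thesis by (simp add: A_def)
            next
              case 2 then show ?thesis unfolding Gn ni using ni i n by (simp add: Bd_def ord)
            qed
          qed
          show "F $$ int i $$ k * G $$ (n - int i) $$ (- 1 - k) = 0" if "k \<in> {A..-1 - Bd} - int ` {..<N}" for k
          proof -
            have "k < 0"
            proof (rule ccontr)
              assume "\<not> k < 0"
              then have "k = int (nat k)" "nat k < N" using that n i by (auto simp: Bd_def)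
              then show False using that by blast
            qed
            then show ?thesis unfolding Gn by (simp add: neg)
          qed
        qed auto
        also have "\<dots> = (\<Sum>m<N. F $$ int i $$ int m * G $$ (n - int i) $$ (- 1 - int m))"
          by (subst sum.reindex) simp_all
        also have "\<dots> = (\<Sum>m<N. a (int m) $ i * b (- 1 - int m) $ (N - i))"
          unfolding Fn Gn ni by simp
        finally show ?thesis .
      qed
      have "cf (-1) (F * G) $$ n = (\<Sum>i=0..n. (F $$ i * G $$ (n - i)) $$ (-1))"
        unfolding cf_nth prod fls_nth_sum ..
      also have "\<dots> = (\<Sum>i\<in>int ` {..N}. (F $$ i * G $$ (n - i)) $$ (-1))"
        by (rule sum.cong) (auto simp: n image_iff intro!: bexI[of _ "nat _"])
      also have "\<dots> = (\<Sum>i\<le>N. (F $$ int i * G $$ (n - int i)) $$ (-1))"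
        by (subst sum.reindex) simp_all
      also have "\<dots> = (\<Sum>i\<le>N. \<Sum>m<N. a (int m) $ i * b (- 1 - int m) $ (N - i))"
        by (rule sum.cong) (simp_all add: one)
      also have "\<dots> = (\<Sum>m<N. \<Sum>i\<le>N. a (int m) $ i * b (- 1 - int m) $ (N - i))" by (rule sum.swap)
      also have "\<dots> = (\<Sum>m<N. (a (int m) * b (- 1 - int m)) $ N)"
        by (simp add: fps_mult_nth atLeast0AtMost)
      also have "\<dots> = Sa (\<lambda>m. a (int m) * b (- 1 - int m)) $ N"
      proof (rule Sa_nth[symmetric])
        show "(a (int j) * b (- 1 - int j)) $ N = 0" if "N \<le> j" for j
          by (rule fps_mult_nth_zero) (use that in \<open>simp add: ord\<close>)
      qed
      finally show ?thesis using False by (simp add: N_def)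
    qed
  qed
qed

text \<open>Multiplying by t turns \<open>Bc k\<close> into R^k \<open>bet k\<close>, and by
  \<open>bc_neg\<close> these are the coefficients of the negative part of R/v - t u Y. The
  differences of coefficients of \<open>Psi R S h\<close> are those of its product with 1 -
  R/v^2.\<close>

theorem one_cut_residue:
  fixes z u Q R S :: "'k::field_char_0 fps"
  assumes "one_cut z u Q R S g"
  shows "ft fps_X * ft (Sa (\<lambda>m. (bc R S h (int m) - R * bc R S h (int m + 2)) * one_cut.Bc u Q R S g (m + 1))) =
    cf (-1) (Psi R S h * (1 - em (ft R) * vp (-2)) * (em (ft R) * vp (-1) - em (ft (fps_X * u)) * Ng (Psi R S g)))"
proof -
  interpret one_cut z u Q R S g by (rule assms)
  note RS = R0 S0
  define H where "H = Psi R S h * (1 - em (ft R) * vp (-2))"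
  define a where "a k = bc R S h k - R * bc R S h (k + 2)" for k
  have cH: "cf k H = ft (a k)" for k
  proof -
    have "H = Psi R S h - em (ft R) * (vp (-2) * Psi R S h)" by (simp add: H_def algebra_simps)
    then show ?thesis by (simp add: cf_em_mult cf_vp_mult cf_Psi[OF RS] a_def ft_mult)
  qed
  define b where "b k = (if k < 0 then fps_X * u * bc R S g k else 0)" for k
  have b: "cf k (em (ft (fps_X * u)) * Ng (Psi R S g)) = ft (b k)" for k
    by (simp add: cf_em_mult cf_Ng cf_Psi[OF RS] b_def ft_mult)
  have "fps_X * Bc (m + 1) = (if m = 0 then R else 0) - b (- 1 - int m)" for m
  proof -
    have "R ^ Suc m * bc R S g (int (Suc m)) = bc R S g (- int (Suc m))" using bc_neg[OF RS, of g "Suc m"] by simp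
    then have "R ^ Suc m * (fps_X * u * bc R S g (int (Suc m))) = b (- 1 - int m)"
      by (simp add: b_def ac_simps)
    then show ?thesis using X_Bc[of "m + 1"] by (simp add: bet_def right_diff_distrib)
  qed
  moreover have "fps_X * Sa (\<lambda>m. a (int m) * Bc (m + 1)) = Sa (\<lambda>m. fps_X * (a (int m) * Bc (m + 1)))"
    by (rule Sa_cmult[OF nul_Bc, symmetric])
  moreover have "fps_X * (a (int m) * Bc (m + 1)) = a (int m) * (fps_X * Bc (m + 1))" for m by (rule mult.left_commute)
  ultimately have "fps_X * Sa (\<lambda>m. a (int m) * Bc (m + 1)) = Sa (\<lambda>m. a (int m) * ((if m = 0 then R else 0) - b (- 1 - int m)))"
    by (simp only:)
  also have "\<dots> = Sa (\<lambda>m. a (int m) * (if m = 0 then R else 0)) - Sa (\<lambda>m. a (int m) * b (- 1 - int m))"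
    unfolding right_diff_distrib
  proof (rule Sa_diff)
    show "nul (\<lambda>m. a (int m) * (if m = 0 then R else 0))" by (rule nul_fin[of 1]) simp
    show "nul (\<lambda>m. a (int m) * b (- 1 - int m))"
      by (rule nul_mult, rule nulI[where J = "\<lambda>m. m + 1"]) (simp add: b_def fps_mult_nth_zero bc_order[OF RS])
  qed
  also have "Sa (\<lambda>m. a (int m) * (if m = 0 then R else 0)) = a 0 * R"
    by (subst Sa_finite[of 1]) simp_all
  finally have "ft fps_X * ft (Sa (\<lambda>m. a (int m) * Bc (m + 1))) = ft (a 0) * ft R - ft (Sa (\<lambda>m. a (int m) * b (- 1 - int m)))"
    by (simp only: fps_to_fls_minus flip: ft_mult)
  also have "ft (Sa (\<lambda>m. a (int m) * b (- 1 - int m))) = cf (-1) (H * (em (ft (fps_X * u)) * Ng (Psi R S g)))"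
    by (rule cf_prod_Sa[OF cH b, symmetric]) (simp_all add: b_def fps_mult_nth_zero bc_order[OF RS])
  also have "ft (a 0) * ft R = cf (-1) (em (ft R) * (vp (-1) * H))"
    by (simp add: cf_em_mult cf_vp_mult cH)
  also have "em (ft R) * (vp (-1) * H) = H * (em (ft R) * vp (-1))" by (simp add: ac_simps)
  finally show ?thesis unfolding H_def[symmetric] a_def[symmetric] right_diff_distrib[of H] cf_diff .
qed

text \<open>By the sum, product and quotient rules it is enough to look at the generators.\<close>

lemma fld_D:
  assumes D: "is_der D" and L: "subfld L" "fld E \<subseteq> L" and E: "\<And>e. e \<in> E \<Longrightarrow> D e \<in> L" and x: "x \<in> fld E"
  shows "D x \<in> L"
proof -
  have "fld E \<subseteq> {x \<in> fld E. D x \<in> L}"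
  proof (rule fld_least)
    show "E \<subseteq> {x \<in> fld E. D x \<in> L}" using E fld_incl by blast
    have in_L: "y \<in> L" if "y \<in> fld E" for y using that L(2) by blast
    show "subfld {x \<in> fld E. D x \<in> L}"
      unfolding subfld_def
      by (auto simp: is_derD(1-5)[OF D] is_der_inverse[OF D] subfldD[OF subfld_fld] in_L subfldD[OF L(1)])
  qed
  then show ?thesis using x by blast
qed

lemma LPu_DD:
  assumes "compat D DD" "\<And>x. x \<in> L \<Longrightarrow> D x \<in> L'" "q \<in> LPu L"
  shows "DD q \<in> LPu L'"
  using assms is_derD(3)[of D] by (fastforce simp: LPu_def LP_def compat_def)

lemma Md_dvd:
  assumes L: "subfld L" and p: "p \<in> LPu L" "r \<in> LPu L" "r * p \<noteq> 0" and I: "finite I" and "r * y \<in> Md L (r * p) I f"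
  shows "y \<in> Md L (r * p) I f"
proof -
  have rp: "r * p \<in> LPu L" using LPu_mult[OF L] p by blast
  have "p * (r * y) \<in> Md L (r * p) I f" by (rule Md_mult[OF L rp p(3) I p(1) assms(6)])
  then have "(r * p) ^ 1 * y \<in> Md L (r * p) I f" by (simp add: ac_simps)
  then show ?thesis by (rule Md_div[OF L rp p(3) I])
qed

text \<open>Any coefficient is the residue after multiplication by a power of v, under which the
  module is stable. Thus the residues over \<open>L\<close> already control all coefficients over
  \<open>L'\<close>.\<close>

lemma Md_cf:
  assumes L: "subfld L" and p: "p \<in> LPu L" "p \<noteq> 0" and I: "finite I"
    and L': "subfld L'" "L \<subseteq> L'" and res: "cf (-1) ` Md L p I f \<subseteq> L'" and x: "x \<in> Md L' p I f"
  shows "cf k x \<in> L'"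
proof -
  obtain N q where q: "\<forall>i\<in>I. q i \<in> LPu L'" "p ^ N * x = (\<Sum>i\<in>I. q i * f i)" using x by (auto simp: Md_def)
  from LPu_uniform[OF L'(1) I q(1)] obtain B where B: "\<forall>i\<in>I. q i \<in> LP L' B" by blast
  \<comment> \<open>\<open>x\<close> is a combination of these elements with scalars in
    \<open>L'\<close>, and they lie in the module over the smaller field \<open>L\<close>, whose
    residues are known.\<close>
  define e where "e i l = vp l * f i / p ^ N" for i l
  have eM: "vp m * e i l \<in> Md L p I f" if "i \<in> I" for i l m
  proof -
    have "vp m * (vp l * f i) \<in> Md L p I f"
      by (intro Md_mult[OF L p I] LPu_vp[OF L] Md_gen[OF L p I] that)
    moreover have "vp m * (vp l * f i) = p ^ N * (vp m * e i l)" using p(2) by (simp add: e_def)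
    ultimately show ?thesis using Md_div[OF L p I] by metis
  qed
  have "cf k (e i l) \<in> L'" if "i \<in> I" for i l
  proof -
    have "cf (-1) (vp (-1 - k) * e i l) \<in> L'" using res eM[OF that] by blast
    then show ?thesis by (simp add: cf_vp_mult)
  qed
  moreover have "cf l (q i) \<in> L'" if "i \<in> I" for i l using B that by (auto simp: LP_def)
  moreover have "x = (\<Sum>i\<in>I. \<Sum>l\<in>{- int B..int B}. em (cf l (q i)) * e i l)"
  proof -
    have "p ^ N * x = (\<Sum>i\<in>I. (\<Sum>l\<in>{- int B..int B}. em (cf l (q i)) * vp l) * f i)"
      unfolding q(2) by (rule sum.cong[OF refl]) (use B LP_expand in metis)
    also have "\<dots> = p ^ N * (\<Sum>i\<in>I. \<Sum>l\<in>{- int B..int B}. em (cf l (q i)) * e i l)"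
      using p(2) by (simp add: e_def sum_distrib_left sum_distrib_right mult.assoc mult.left_commute[of "p ^ N"])
    finally show ?thesis using p(2) by simp
  qed
  ultimately show ?thesis
    by (simp only: cf_sum cf_em_mult) (intro subfldD(12,4)[OF L'(1)], auto)
qed

lemma Md_prod:
  assumes L: "subfld L" and p: "p \<in> LPu L" "p \<noteq> 0" and I: "finite I"
    and p': "p' \<in> LPu L" "p' \<noteq> 0" and J: "finite J"
    and x: "x \<in> Md L p I f" and y: "y \<in> Md L p' J k"
  shows "x * y \<in> Md L (p * p') (I \<times> J) (\<lambda>ij. f (fst ij) * k (snd ij))"
proof -
  obtain N where N: "\<forall>M\<ge>N. \<exists>q. (\<forall>i\<in>I. q i \<in> LPu L) \<and> p ^ M * x = (\<Sum>i\<in>I. q i * f i)"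
    using Md_raise[OF L p I x] by blast
  obtain N' where N': "\<forall>M\<ge>N'. \<exists>q. (\<forall>i\<in>J. q i \<in> LPu L) \<and> p' ^ M * y = (\<Sum>i\<in>J. q i * k i)"
    using Md_raise[OF L p' J y] by blast
  let ?M = "max N N'"
  obtain q where q: "\<forall>i\<in>I. q i \<in> LPu L" "p ^ ?M * x = (\<Sum>i\<in>I. q i * f i)" using N[rule_format, of ?M] by auto
  obtain r where r: "\<forall>i\<in>J. r i \<in> LPu L" "p' ^ ?M * y = (\<Sum>i\<in>J. r i * k i)" using N'[rule_format, of ?M] by auto
  have "(p * p') ^ ?M * (x * y) = (p ^ ?M * x) * (p' ^ ?M * y)" by (simp add: power_mult_distrib ac_simps)
  also have "\<dots> = (\<Sum>i\<in>I. \<Sum>j\<in>J. (q i * f i) * (r j * k j))" unfolding q(2) r(2) by (rule sum_product)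
  also have "\<dots> = (\<Sum>ij\<in>I \<times> J. (q (fst ij) * r (snd ij)) * (f (fst ij) * k (snd ij)))"
    by (simp add: sum.cartesian_product case_prod_unfold ac_simps)
  finally have e: "(p * p') ^ ?M * (x * y) = (\<Sum>ij\<in>I \<times> J. (q (fst ij) * r (snd ij)) * (f (fst ij) * k (snd ij)))" .
  have "\<forall>ij\<in>I \<times> J. q (fst ij) * r (snd ij) \<in> LPu L" using q(1) r(1) LPu_mult[OF L] by auto
  then show ?thesis unfolding Md_def using e by (intro CollectI exI conjI)
qed

lemma Ng_add: "Ng (x + y) = Ng x + Ng y" by (rule cf_ext) (simp add: cf_Ng)
lemma Ng_sum: "Ng (sum f A) = (\<Sum>i\<in>A. Ng (f i))"
  by (rule additive_sum) (rule Ng_add, rule cf_ext, simp add: cf_Ng)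

text \<open>Shifting by v^i and discarding nonnegative powers commute except for the at most |i|
  coefficients that cross degree 0.\<close>

lemma Ng_LPu:
  assumes L: "subfld L" and q: "q \<in> LPu L" and f: "\<And>k. cf k f \<in> L"
  shows "q * Ng f - Ng (q * f) \<in> LPu L"
proof -
  obtain B where B: "q \<in> LP L B" using q LPuE[OF L] by metis
  have cfk: "cf k (q * Ng f - Ng (q * f)) = (\<Sum>i\<in>{- int B..int B}. cf i q * (if k - i < 0 then if k < 0 then 0 else cf (k - i) f else if k < 0 then - cf (k - i) f else 0))" for k
    by (auto simp: cf_Ng cf_LP_mult[OF B] simp flip: sum_subtractf sum_negf intro!: sum.cong)
  have "q * Ng f - Ng (q * f) \<in> LP L B"
    unfolding LP_def mem_Collect_eq cfk
  proof (intro conjI allI impI)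
    show "(\<Sum>i\<in>{- int B..int B}. cf i q * (if k - i < 0 then if k < 0 then 0 else cf (k - i) f else if k < 0 then - cf (k - i) f else 0)) \<in> L" for k
      using B f by (intro subfldD(12,4)[OF L]) (auto simp: LP_def subfldD[OF L])
    show "(\<Sum>i\<in>{- int B..int B}. cf i q * (if k - i < 0 then if k < 0 then 0 else cf (k - i) f else if k < 0 then - cf (k - i) f else 0)) = 0"
      if "int B < \<bar>k\<bar>" for k
      by (rule sum.neutral) (use that in auto)
  qed
  then show ?thesis by (rule LPuI[OF L])
qed

definition with_one :: "('i \<Rightarrow> 'k::field_char_0 fls fls) \<Rightarrow> 'i option \<Rightarrow> 'k fls fls" where
  "with_one f j = (case j of None \<Rightarrow> 1 | Some i \<Rightarrow> Ng (f i))"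

text \<open>By \<open>Ng_LPu\<close> the commutation defects are Laurent polynomials. The generator
  1 of \<open>with_one\<close> absorbs them.\<close>

lemma Md_Ng:
  assumes L: "subfld L" and p: "p \<in> LPu L" "p \<noteq> 0" and I: "finite I"
    and f: "\<And>x k. x \<in> Md L p I f \<Longrightarrow> cf k x \<in> L" and y: "y \<in> Md L p I f"
  shows "Ng y \<in> Md L p (insert None (Some ` I)) (with_one f)"
proof -
  let ?J = "insert None (Some ` I)"
  have J: "finite ?J" using I by simp
  note MM = Md_add[OF L p J] Md_sum[OF L p J] Md_mult[OF L p J] Md_gen[OF L p J]
  have lp: "a \<in> Md L p ?J (with_one f)" if "a \<in> LPu L" for a
    using MM(3)[OF that MM(4)[of None "with_one f"]] by (simp add: with_one_def)
  obtain N q where q: "\<forall>i\<in>I. q i \<in> LPu L" "p ^ N * y = (\<Sum>i\<in>I. q i * f i)" using y by (auto simp: Md_def)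
  have "p ^ N * Ng y = (p ^ N * Ng y - Ng (p ^ N * y)) + (\<Sum>i\<in>I. Ng (q i * f i))"
    unfolding q(2) Ng_sum by simp
  also have "(\<Sum>i\<in>I. Ng (q i * f i)) = (\<Sum>i\<in>I. q i * with_one f (Some i) + - (q i * Ng (f i) - Ng (q i * f i)))"
    by (rule sum.cong) (simp_all add: with_one_def)
  also have "(p ^ N * Ng y - Ng (p ^ N * y)) + \<dots> \<in> Md L p ?J (with_one f)"
    by (intro MM lp LPu_uminus[OF L] Ng_LPu[OF L] LPu_power[OF L] p f y Md_gen[OF L p I]) (use q in auto)
  finally show ?thesis by (rule Md_div[OF L p J])
qed

definition Pol :: "'a::zero set \<Rightarrow> (nat \<Rightarrow> 'a) set" where
  "Pol Z = {p. finite {j. p j \<noteq> 0} \<and> (\<forall>j. p j \<in> Z)}"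

text \<open>Sequences stand for power series in the fourth variable; \<open>Z\<close> is the set of coefficients of the polynomials allowed.\<close>

definition pspan :: "'a::comm_ring_1 set \<Rightarrow> 'i set \<Rightarrow> ('i \<Rightarrow> nat \<Rightarrow> 'a) \<Rightarrow> (nat \<Rightarrow> 'a) \<Rightarrow> bool" where
  "pspan Z F \<phi> x \<longleftrightarrow> (\<exists>p q. p \<in> Pol Z \<and> p \<noteq> (\<lambda>_. 0) \<and> (\<forall>i\<in>F. q i \<in> Pol Z) \<and>
     conv p x = (\<lambda>n. \<Sum>i\<in>F. conv (q i) (\<phi> i) n))"

text \<open>The holonomicity data that is used: \<open>x\<close>, its first derivatives, and the
  first derivatives of all generators lie in the span. The index \<open>s\<close> runs over z, u,
  t.\<close>

definition dfin :: "'a::comm_ring_1 set \<Rightarrow> (nat \<Rightarrow> 'a \<Rightarrow> 'a) \<Rightarrow> 'i set \<Rightarrow> ('i \<Rightarrow> nat \<Rightarrow> 'a) \<Rightarrow> (nat \<Rightarrow> 'a) \<Rightarrow> bool" where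
  "dfin Z d F \<phi> x \<longleftrightarrow> finite F \<and> pspan Z F \<phi> x \<and> pspan Z F \<phi> (vd x) \<and> (\<forall>s<3. pspan Z F \<phi> (\<lambda>j. d s (x j))) \<and>
     (\<forall>i\<in>F. pspan Z F \<phi> (vd (\<phi> i)) \<and> (\<forall>s<3. pspan Z F \<phi> (\<lambda>j. d s (\<phi> i j))))"

text \<open>Replacing the fourth variable by X turns the polynomial denominators into nonzero
  Laurent polynomials, and their product serves all of \<open>X\<close>. The additional factor X in
  the localization makes division by X possible later.\<close>

lemma pspan_Md:
  assumes L: "subfld L" and RSL: "ft R \<in> L" "ft S \<in> L" and Z: "ft ` Z \<subseteq> L" and RS: "R $ 0 = 0" "S $ 0 = 0"
    and F: "finite F" and X: "finite X" "\<forall>x\<in>X. pspan Z F \<phi> x"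
  shows "\<exists>p. p \<in> LPu L \<and> p \<noteq> 0 \<and> (\<forall>x\<in>X. Psi R S x \<in> Md L (Xv R S * p) F (\<lambda>i. Psi R S (\<phi> i)))"
proof -
  let ?f = "\<lambda>i. Psi R S (\<phi> i)"
  have XvL: "Xv R S \<in> LPu L"
    unfolding Xv_def by (intro LPu_add[OF L] LPu_mult[OF L] LPu_em[OF L] LPu_vp[OF L] RSL)
  define EV where "EV p = (\<Sum>j\<in>{j. p j \<noteq> 0}. em (ft (p j)) * Xv R S ^ j)" for p :: "nat \<Rightarrow> 'a fps"
  have EV: "EV p \<in> LPu L" "Psi R S (conv p g) = EV p * Psi R S g" if "p \<in> Pol Z" for p g
  proof -
    show "EV p \<in> LPu L" unfolding EV_def
      by (intro LPu_sum[OF L] LPu_mult[OF L] LPu_em[OF L] LPu_power[OF L] XvL) (use that Z in \<open>auto simp: Pol_def\<close>)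
    show "Psi R S (conv p g) = EV p * Psi R S g" unfolding EV_def
      by (rule Psi_conv[OF RS]) (use that in \<open>auto simp: Pol_def\<close>)
  qed
  have "\<exists>P. P \<in> LPu L \<and> P \<noteq> 0 \<and> (\<exists>Q. (\<forall>i\<in>F. Q i \<in> LPu L) \<and> P * Psi R S x = (\<Sum>i\<in>F. Q i * ?f i))" if x: "x \<in> X" for x
  proof -
    obtain p q where pq: "p \<in> Pol Z" "p \<noteq> (\<lambda>_. 0)" "\<forall>i\<in>F. q i \<in> Pol Z" "conv p x = (\<lambda>n. \<Sum>i\<in>F. conv (q i) (\<phi> i) n)"
      using X(2) x unfolding pspan_def by blast
    obtain j where "p j \<noteq> 0" using pq(2) by auto
    then have nz: "EV p \<noteq> 0" unfolding EV_def using pq(1) by (intro Xv_pow_sum_nz[of _ j]) (auto simp: Pol_def)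
    have "EV p * Psi R S x = (\<Sum>i\<in>F. Psi R S (conv (q i) (\<phi> i)))"
      unfolding EV(2)[OF pq(1), symmetric] pq(4) by (rule Psi_sum[OF RS F])
    also have "\<dots> = (\<Sum>i\<in>F. EV (q i) * ?f i)" by (rule sum.cong[OF refl], rule EV(2)) (use pq(3) in blast)
    finally have e: "EV p * Psi R S x = (\<Sum>i\<in>F. EV (q i) * ?f i)" .
    have "\<forall>i\<in>F. EV (q i) \<in> LPu L" using EV(1) pq(3) by blast
    then show ?thesis using EV(1)[OF pq(1)] nz e by (intro exI conjI)
  qed
  then have "\<forall>x\<in>X. \<exists>P. P \<in> LPu L \<and> P \<noteq> 0 \<and> (\<exists>Q. (\<forall>i\<in>F. Q i \<in> LPu L) \<and> P * Psi R S x = (\<Sum>i\<in>F. Q i * ?f i))" by (rule ballI)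
  then obtain P where "\<forall>x\<in>X. P x \<in> LPu L \<and> P x \<noteq> 0 \<and> (\<exists>Q. (\<forall>i\<in>F. Q i \<in> LPu L) \<and> P x * Psi R S x = (\<Sum>i\<in>F. Q i * ?f i))"
    by (rule bchoice[THEN exE])
  then have P: "P x \<in> LPu L" "P x \<noteq> 0" "\<exists>Q. (\<forall>i\<in>F. Q i \<in> LPu L) \<and> P x * Psi R S x = (\<Sum>i\<in>F. Q i * ?f i)" if "x \<in> X" for x
    using that by blast+
  have prodL: "prod P A \<in> LPu L" if "A \<subseteq> X" for A
    using finite_subset[OF that X(1)] that by (induction A rule: finite_induct) (auto simp: LPu_1[OF L] P intro!: LPu_mult[OF L])
  define p where "p = prod P X"
  have p: "p \<in> LPu L" "p \<noteq> 0" using prodL[of X] P(2) X(1) by (auto simp: p_def)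
  have Xp: "Xv R S * p \<in> LPu L" "Xv R S * p \<noteq> 0" using LPu_mult[OF L XvL p(1)] p(2) Xv_nz by auto
  have "Psi R S x \<in> Md L (Xv R S * p) F ?f" if x: "x \<in> X" for x
  proof -
    obtain Q where Q: "\<forall>i\<in>F. Q i \<in> LPu L" "P x * Psi R S x = (\<Sum>i\<in>F. Q i * ?f i)" using P(3)[OF x] by (elim exE conjE)
    have m: "P x * Psi R S x \<in> Md L (Xv R S * p) F ?f"
      unfolding Q(2) by (intro Md_sum[OF L Xp F] Md_mult[OF L Xp F] Md_gen[OF L Xp F]) (use Q(1) in auto)
    have "(Xv R S * prod P (X - {x})) * (P x * Psi R S x) \<in> Md L (Xv R S * p) F ?f"
      by (rule Md_mult[OF L Xp F LPu_mult[OF L XvL prodL] m]) auto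
    also have "(Xv R S * prod P (X - {x})) * (P x * Psi R S x) = (Xv R S * p) ^ 1 * Psi R S x"
      unfolding p_def using prod.remove[OF X(1) x, of P] by (simp add: ac_simps)
    finally show ?thesis by (rule Md_div[OF L Xp F])
  qed
  then show ?thesis using p by blast
qed

section \<open>Closure of the field of coefficients\<close>

theorem one_cut_finite:
  fixes z u Q R S :: "'k::field_char_0 fps" and G h :: "nat \<Rightarrow> 'k fps"
    and \<phi> :: "'i \<Rightarrow> nat \<Rightarrow> 'k fps" and \<chi> :: "'j \<Rightarrow> nat \<Rightarrow> 'k fps"
  assumes oc: "one_cut z u Q R S (shl G)" and G0: "G 0 = 0"
    and c: "\<And>s. s < 3 \<Longrightarrow> compat (D s) (DD s)" and d: "\<And>s x. s < 3 \<Longrightarrow> D s (ft x) = ft (d s x)"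
    and loc: "\<And>s x m. s < 3 \<Longrightarrow> (\<And>l. l \<le> m + 1 \<Longrightarrow> x $ l = 0) \<Longrightarrow> d s x $ m = 0"
    and E0: "finite E0" "ft ` Z \<subseteq> fld E0" "\<And>s e. s < 3 \<Longrightarrow> e \<in> E0 \<Longrightarrow> D s e \<in> fld E0"
    and zut: "ft z \<in> fld E0" "ft u \<in> fld E0" "fls_X \<in> fld E0"
    and FG: "dfin Z d F \<phi> G" and FH: "dfin Z d H \<chi> h"
  shows "\<exists>E. finite E \<and> E0 \<subseteq> E \<and> (\<forall>s<3. \<forall>x\<in>fld E. D s x \<in> fld E) \<and>
    ft (Sa (\<lambda>m. (bc R S h (int m) - R * bc R S h (int m + 2)) * one_cut.Bc u Q R S (shl G) (m + 1))) \<in> fld E"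
proof -
  interpret one_cut z u Q R S "shl G" by (rule oc)
  note RS = R0 S0
  have F: "finite F" and spG: "pspan Z F \<phi> G" "pspan Z F \<phi> (vd G)" "\<And>s. s < 3 \<Longrightarrow> pspan Z F \<phi> (\<lambda>j. d s (G j))"
    and spF: "\<And>i. i \<in> F \<Longrightarrow> pspan Z F \<phi> (vd (\<phi> i))" "\<And>i s. i \<in> F \<Longrightarrow> s < 3 \<Longrightarrow> pspan Z F \<phi> (\<lambda>j. d s (\<phi> i j))"
    using FG unfolding dfin_def by blast+
  have H: "finite H" and spH: "pspan Z H \<chi> h"
    and spK: "\<And>i. i \<in> H \<Longrightarrow> pspan Z H \<chi> (vd (\<chi> i))" "\<And>i s. i \<in> H \<Longrightarrow> s < 3 \<Longrightarrow> pspan Z H \<chi> (\<lambda>j. d s (\<chi> i j))"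
    using FH unfolding dfin_def by blast+
  have isd: "is_der (D s)" "is_der (DD s)" and cfD: "cf k (DD s f) = D s (cf k f)" if "s < 3" for s k f
    using c[OF that] by (auto simp: compat_def)
  define E1 where "E1 = insert (ft R) (insert (ft S) E0)"
  define L0 where "L0 = fld E1"
  have L0: "subfld L0" unfolding L0_def by (rule subfld_fld)
  have E0L0: "fld E0 \<subseteq> L0" unfolding L0_def E1_def by (rule fld_mono) auto
  have RSL0: "ft R \<in> L0" "ft S \<in> L0" unfolding L0_def E1_def by (auto intro: fld_incl)
  let ?P = "Psi R S"
  define f where "f i = ?P (\<phi> i)" for i
  define X where "X = {G, vd G} \<union> (\<lambda>s j. d s (G j)) ` {..<3} \<union> (\<lambda>i. vd (\<phi> i)) ` F \<union> (\<lambda>(i, s) j. d s (\<phi> i j)) ` (F \<times> {..<3})"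
  have X: "finite X" "\<forall>x\<in>X. pspan Z F \<phi> x" using F spG spF by (auto simp: X_def)
  obtain p' where p': "p' \<in> LPu L0" "p' \<noteq> 0" "\<forall>x\<in>X. ?P x \<in> Md L0 (Xv R S * p') F f"
    using pspan_Md[OF L0 RSL0 order_trans[OF E0(2) E0L0] RS F X] unfolding f_def by blast
  define p where "p = Xv R S * p'"
  have XvL0: "Xv R S \<in> LPu L0"
    unfolding Xv_def by (intro LPu_add[OF L0] LPu_mult[OF L0] LPu_em[OF L0] LPu_vp[OF L0] RSL0)
  have p: "p \<in> LPu L0" "p \<noteq> 0" unfolding p_def using LPu_mult[OF L0 XvL0 p'(1)] p'(2) Xv_nz[of R S] by auto
  define M where "M = Md L0 p F f"
  have PG: "?P G \<in> M" "?P (vd G) \<in> M" "s < 3 \<Longrightarrow> ?P (\<lambda>j. d s (G j)) \<in> M" for s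
    using p'(3) unfolding M_def p_def X_def by auto
  have PF: "i \<in> F \<Longrightarrow> ?P (vd (\<phi> i)) \<in> M" "i \<in> F \<Longrightarrow> s < 3 \<Longrightarrow> ?P (\<lambda>j. d s (\<phi> i j)) \<in> M" for i s
  proof -
    show "?P (vd (\<phi> i)) \<in> M" if "i \<in> F" using p'(3) that unfolding M_def p_def X_def by auto
    have "(\<lambda>j. d s (\<phi> i j)) \<in> X" if "i \<in> F" "s < 3" unfolding X_def using that by force
    then show "?P (\<lambda>j. d s (\<phi> i j)) \<in> M" if "i \<in> F" "s < 3" using p'(3) that unfolding M_def p_def by blast
  qed
  have Mdvd: "y \<in> M" if "Xv R S * y \<in> M" for y
    using Md_dvd[OF L0 p'(1) XvL0 _ F, of y f] p(2) that unfolding M_def p_def by blast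
  \<comment> \<open>\<open>Y\<close> is \<open>Psi\<close> of G divided by X, its shift;
    \<open>V\<close> is its derivative in X and \<open>U s\<close> the contribution of
    differentiating the weights. All three lie in \<open>M\<close> because X is invertible
    there.\<close>
  define Y where "Y = ?P (shl G)"
  define V where "V = ?P (vd (shl G))"
  define U where "U s = ?P (\<lambda>j. d s (G j)) / Xv R S" for s
  have XY: "Xv R S * Y = ?P G" unfolding Y_def by (rule Psi_Suc[OF RS, of G, OF G0, symmetric])
  have XV: "Xv R S * V = ?P (vd G) - Y" unfolding Y_def V_def by (rule Psi_vd_shl[OF RS, of G, OF G0])
  have XU: "Xv R S * U s = ?P (\<lambda>j. d s (G j))" for s unfolding U_def by (simp add: Xv_nz)
  have Y: "Y \<in> M" by (rule Mdvd) (simp only: XY PG)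
  have V: "V \<in> M" by (rule Mdvd) (use PG Y Md_diff[OF L0 p F] in \<open>simp only: XV M_def\<close>)
  have U: "U s \<in> M" if "s < 3" for s by (rule Mdvd) (simp only: XU PG that)
  have dvf: "\<forall>i\<in>F. dv (f i) \<in> Md L0 p F f"
  proof
    fix i assume i: "i \<in> F"
    have "dv (f i) = (1 - em (ft R) * vp (-2)) * ?P (vd (\<phi> i))" unfolding f_def Psi_dv[OF RS] by (rule mult.commute)
    then show "dv (f i) \<in> Md L0 p F f"
      using Md_mult[OF L0 p F _ PF(1)[OF i, unfolded M_def], of "1 - em (ft R) * vp (-2)"]
        LPu_diff[OF L0 LPu_1[OF L0] LPu_mult[OF L0 LPu_em[OF L0 RSL0(1)] LPu_vp[OF L0]], of "-2"] by simp
  qed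
  from residue_finite[OF L0 p F dvf] obtain A0 where A0: "finite A0" "A0 \<subseteq> cf (-1) ` M" "cf (-1) ` M \<subseteq> lspan L0 A0"
    unfolding M_def by blast
  \<comment> \<open>One finite set of residues is adjoined; by \<open>Md_cf\<close> every
    coefficient in v of every element of the module then lies in \<open>L1\<close>.\<close>
  define L1 where "L1 = fld (E1 \<union> A0)"
  have L1: "subfld L1" unfolding L1_def by (rule subfld_fld)
  have L01: "L0 \<subseteq> L1" unfolding L0_def L1_def by (rule fld_mono) auto
  have E0L1: "fld E0 \<subseteq> L1" using E0L0 L01 by blast
  have RSL1: "ft R \<in> L1" "ft S \<in> L1" using RSL0 L01 by auto
  have "A0 \<subseteq> L1" unfolding L1_def by (auto intro: fld_incl)
  then have res1: "cf (-1) ` Md L0 p F f \<subseteq> L1" using A0(3) lspan_sub[OF L1 L01] unfolding M_def by blast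
  define M1 where "M1 = Md L1 p F f"
  have MM1: "M \<subseteq> M1" unfolding M_def M1_def by (rule Md_mono[OF L01])
  have cf1: "cf k x \<in> L1" if "x \<in> M1" for k x
    by (rule Md_cf[OF L0 p F L1 L01 res1 that[unfolded M1_def]])
  have p1: "p \<in> LPu L1" using p(1) LPu_mono[OF L01] by blast
  note sf1 = subfldD[OF L1]
  define T where "T = fls_X * ft u"
  have T: "T \<in> L1" unfolding T_def using zut(2,3) E0L1 by (intro sf1) auto
  have DE0: "D s x \<in> fld E0" if "s < 3" "x \<in> fld E0" for s x
    using fld_D[OF isd(1)[OF that(1)] subfld_fld order_refl E0(3)[OF that(1)] that(2)] .
  have eqS: "ft S = T * cf 0 Y"
    unfolding Y_def cf_Psi[OF RS] T_def by (subst S) (simp only: ft_mult fps_X_to_fls)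
  have eqR: "ft R = fls_X * ft z + T * cf (-1) Y"
  proof -
    have "R = fps_X * z + fps_X * u * (R * bc R S (shl G) 1)" using R Q by (simp add: algebra_simps)
    also have "R * bc R S (shl G) 1 = bc R S (shl G) (-1)" using bc_neg[OF RS, of "shl G" 1] by simp
    finally have "ft R = ft (fps_X * z + fps_X * u * bc R S (shl G) (-1))" by (rule arg_cong)
    then show ?thesis unfolding Y_def cf_Psi[OF RS] T_def by (simp only: ft_mult fps_X_to_fls fps_to_fls_plus)
  qed
  have DXv: "DD s (Xv R S) = em (D s (ft S)) + em (D s (ft R)) * vp (-1)" if s: "s < 3" for s
    by (simp add: Xv_def is_derD[OF isd(2)[OF s]] compat_em[OF c[OF s]] compat_vp[OF c[OF s]])
  have DY: "DD s Y = U s + V * DD s (Xv R S)" if s: "s < 3" for s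
  proof -
    have "DD s (Xv R S) * Y + Xv R S * DD s Y = DD s (?P G)"
      unfolding XY[symmetric] by (rule is_derD(2)[OF isd(2)[OF s], symmetric])
    also have "\<dots> = ?P (\<lambda>j. d s (G j)) + ?P (vd G) * DD s (Xv R S)"
      by (rule Psi_DD[OF RS c[OF s] d[OF s] loc[OF s]])
    also have "\<dots> = Xv R S * U s + (Xv R S * V + Y) * DD s (Xv R S)" unfolding XU XV by simp
    finally have "Xv R S * DD s Y = Xv R S * (U s + V * DD s (Xv R S))" by (simp add: algebra_simps)
    then show ?thesis by (simp add: Xv_nz)
  qed
  \<comment> \<open>Differentiating the equations for S and R gives two linear equations for their
    derivatives, because \<open>DD s Y\<close> is affine in them. The other quantities are
    coefficients of \<open>Y\<close>, \<open>V\<close>, \<open>U s\<close> and derivatives of z, u,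
    t.\<close>
  have DRS: "D s (ft S) \<in> L1" "D s (ft R) \<in> L1" if s: "s < 3" for s
  proof -
    define a where "a = T * cf 0 V"
    define b where "b = T * cf 1 V"
    define e where "e = T * cf (-1) V"
    define \<alpha> where "\<alpha> = D s T * cf 0 Y + T * cf 0 (U s)"
    define \<beta> where "\<beta> = D s (fls_X * ft z) + D s T * cf (-1) Y + T * cf (-1) (U s)"
    note der = is_derD[OF isd(1)[OF s]]
    have cV: "cf k (DD s Y) = cf k (U s) + (D s (ft S) * cf k V + D s (ft R) * cf (k + 1) V)" for k
    proof -
      have "DD s Y = U s + (em (D s (ft S)) * V + em (D s (ft R)) * (vp (-1) * V))"
        unfolding DY[OF s] DXv[OF s] by (simp add: algebra_simps)
      then show ?thesis by (simp add: cf_em_mult cf_vp_mult)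
    qed
    have "D s (ft S) = D s (T * cf 0 Y)" using eqS by simp
    also have "\<dots> = D s T * cf 0 Y + T * cf 0 (DD s Y)" by (simp add: der(2) cfD[OF s])
    also have "\<dots> = \<alpha> + a * D s (ft S) + b * D s (ft R)" unfolding cV by (simp add: \<alpha>_def a_def b_def algebra_simps)
    finally have 1: "D s (ft S) = \<alpha> + a * D s (ft S) + b * D s (ft R)" .
    have "D s (ft R) = D s (fls_X * ft z + T * cf (-1) Y)" using eqR by simp
    also have "\<dots> = D s (fls_X * ft z) + D s T * cf (-1) Y + T * cf (-1) (DD s Y)" unfolding der(1) der(2)[of T] cfD[OF s] by (simp add: add.assoc)
    also have "\<dots> = \<beta> + e * D s (ft S) + a * D s (ft R)" unfolding cV by (simp add: \<beta>_def a_def e_def algebra_simps)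
    finally have 2: "D s (ft R) = \<beta> + e * D s (ft S) + a * D s (ft R)" .
    define dt where "dt = (1 - a) * (1 - a) - b * e"
    \<comment> \<open>The entries a, b, e carry the factor t of \<open>T\<close> and are power
      series in t, so the determinant has constant term 1.\<close>
    have dt0: "dt \<noteq> 0"
    proof
      assume "dt = 0"
      define w where "w k = fps_X * (u * bc R S (vd (shl G)) k)" for k
      have "T * cf k V = ft (w k)" for k unfolding w_def T_def V_def cf_Psi[OF RS] by (simp add: ft_mult mult.assoc)
      then have "dt = ft ((1 - w 0) * (1 - w 0) - w 1 * w (-1))"
        by (simp add: dt_def a_def b_def e_def ft_mult)
      then have "(1 - w 0) * (1 - w 0) - w 1 * w (-1) = 0" using \<open>dt = 0\<close> by simp
      then have "((1 - w 0) * (1 - w 0) - w 1 * w (-1)) $ 0 = 0" by simp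
      then show False by (simp add: w_def)
    qed
    have S1: "(1 - a) * D s (ft S) - b * D s (ft R) = \<alpha>" using 1 by (simp add: algebra_simps)
    have R1: "(1 - a) * D s (ft R) - e * D s (ft S) = \<beta>" using 2 by (simp add: algebra_simps)
    have "dt * D s (ft S) = (1 - a) * \<alpha> + b * \<beta>"
      unfolding S1[symmetric] R1[symmetric] by (simp add: dt_def algebra_simps)
    then have DS: "D s (ft S) = ((1 - a) * \<alpha> + b * \<beta>) / dt"
      using dt0 by (metis nonzero_mult_div_cancel_left)
    have "dt * D s (ft R) = (1 - a) * \<beta> + e * \<alpha>"
      unfolding S1[symmetric] R1[symmetric] by (simp add: dt_def algebra_simps)
    then have DR: "D s (ft R) = ((1 - a) * \<beta> + e * \<alpha>) / dt"
      using dt0 by (metis nonzero_mult_div_cancel_left)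
    have cfs: "cf k Y \<in> L1" "cf k V \<in> L1" "cf k (U s) \<in> L1" for k using Y V U[OF s] MM1 cf1 by blast+
    have "D s x \<in> L1" if "x \<in> fld E0" for x using DE0[OF s that] E0L1 by blast
    moreover have "T \<in> fld E0" "fls_X * ft z \<in> fld E0" unfolding T_def using zut by (auto intro!: subfldD[OF subfld_fld])
    ultimately have DT: "D s T \<in> L1" "D s (fls_X * ft z) \<in> L1" by blast+
    have abe: "a \<in> L1" "b \<in> L1" "e \<in> L1" unfolding a_def b_def e_def by (intro sf1(4) T cfs)+
    have ab: "\<alpha> \<in> L1" "\<beta> \<in> L1" unfolding \<alpha>_def \<beta>_def by (intro sf1(3,4) T cfs DT)+
    have dtL: "dt \<in> L1" unfolding dt_def by (intro sf1(2,4,7) abe)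
    show "D s (ft S) \<in> L1" unfolding DS by (intro sf1(2,3,4,7,8) abe ab dtL)
    show "D s (ft R) \<in> L1" unfolding DR by (intro sf1(2,3,4,7,8) abe ab dtL)
  qed
  have DL0: "D s x \<in> L1" if s: "s < 3" and x: "x \<in> L0" for s x
    by (rule fld_D[OF isd(1)[OF s] L1 L01[unfolded L0_def] _ x[unfolded L0_def]])
      (use DRS[OF s] E0(3)[OF s] E0L1 in \<open>auto simp: E1_def\<close>)
  have DXL: "DD s (Xv R S) \<in> LPu L1" if s: "s < 3" for s
    unfolding DXv[OF s] by (intro LPu_add[OF L1] LPu_mult[OF L1] LPu_em[OF L1] LPu_vp[OF L1] DRS s)
  have PDD: "DD s (?P g) = ?P (\<lambda>j. d s (g j)) + DD s (Xv R S) * ?P (vd g)" if s: "s < 3" for s g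
    unfolding mult.commute[of "DD s (Xv R S)"] by (rule Psi_DD[OF RS c[OF s] d[OF s] loc[OF s]])
  have DDf: "DD s (f i) \<in> M1" if s: "s < 3" and i: "i \<in> F" for s i
  proof -
    have "DD s (f i) = ?P (\<lambda>j. d s (\<phi> i j)) + DD s (Xv R S) * ?P (vd (\<phi> i))"
      unfolding f_def by (rule PDD[OF s])
    moreover have "?P (vd (\<phi> i)) \<in> M1" "?P (\<lambda>j. d s (\<phi> i j)) \<in> M1" using PF(1)[OF i] PF(2)[OF i s] MM1 by blast+
    ultimately show ?thesis unfolding M1_def
      by (simp only: Md_add[OF L1 p1 p(2) F] Md_mult[OF L1 p1 p(2) F DXL[OF s]])
  qed
  have DDM: "DD s x \<in> M1" if s: "s < 3" and x: "x \<in> M" for s x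
    unfolding M1_def
    by (rule Md_der[OF L1 p1 p(2) F L0 L01 p(1) isd(2)[OF s] _ _ x[unfolded M_def]])
      (use LPu_DD[OF c[OF s] DL0[OF s]] DDf[OF s] in \<open>auto simp: M1_def\<close>)
  \<comment> \<open>A derivation sends an adjoined residue to the residue of the derived element,
    which belongs to \<open>M1\<close>; so no further generators are needed.\<close>
  have DL1: "D s x \<in> L1" if s: "s < 3" and x: "x \<in> L1" for s x
  proof (rule fld_D[OF isd(1)[OF s] L1 _ _ x[unfolded L1_def]])
    show "D s y \<in> L1" if yE: "y \<in> E1 \<union> A0" for y
    proof (cases "y \<in> E1")
      case True
      then have "y \<in> L0" unfolding L0_def by (rule fld_incl)
      then show ?thesis by (rule DL0[OF s])
    next
      case False
      then obtain x where "x \<in> M" "y = cf (-1) x" using yE A0(2) by blast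
      then show ?thesis using cf1[OF DDM[OF s]] by (simp add: cfD[OF s])
    qed
  qed (simp add: L1_def)
  have DDL1: "q \<in> LPu L1 \<Longrightarrow> DD s q \<in> LPu L1" if "s < 3" for s q using LPu_DD[OF c[OF that] DL1[OF that]] .
  have DDM1: "DD s x \<in> M1" if s: "s < 3" and x: "x \<in> M1" for s x
    unfolding M1_def
    by (rule Md_der[OF L1 p1 p(2) F L1 order_refl p1 isd(2)[OF s] DDL1[OF s] _ x[unfolded M1_def]])
      (use DDf[OF s] in \<open>auto simp: M1_def\<close>)
  \<comment> \<open>Second round: the root weights are expanded over \<open>L1\<close>, which is
    already closed under the derivations.\<close>
  define k where "k i = ?P (\<chi> i)" for i
  define X' where "X' = {h} \<union> (\<lambda>i. vd (\<chi> i)) ` H \<union> (\<lambda>(i, s) j. d s (\<chi> i j)) ` (H \<times> {..<3})"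
  have X': "finite X'" "\<forall>x\<in>X'. pspan Z H \<chi> x" using H spH spK by (auto simp: X'_def)
  obtain r' where r': "r' \<in> LPu L1" "r' \<noteq> 0" "\<forall>x\<in>X'. ?P x \<in> Md L1 (Xv R S * r') H k"
    using pspan_Md[OF L1 RSL1 order_trans[OF E0(2) E0L1] RS H X'] unfolding k_def by blast
  define r where "r = Xv R S * r'"
  have XvL1: "Xv R S \<in> LPu L1" using XvL0 LPu_mono[OF L01] by blast
  have r: "r \<in> LPu L1" "r \<noteq> 0" unfolding r_def using LPu_mult[OF L1 XvL1 r'(1)] r'(2) Xv_nz[of R S] by auto
  define K where "K = Md L1 r H k"
  have Kh: "?P h \<in> K" using r'(3) unfolding K_def r_def X'_def by auto
  have PK: "i \<in> H \<Longrightarrow> ?P (vd (\<chi> i)) \<in> K" "i \<in> H \<Longrightarrow> s < 3 \<Longrightarrow> ?P (\<lambda>j. d s (\<chi> i j)) \<in> K" for i s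
  proof -
    show "?P (vd (\<chi> i)) \<in> K" if "i \<in> H" using r'(3) that unfolding K_def r_def X'_def by auto
    have "(\<lambda>j. d s (\<chi> i j)) \<in> X'" if "i \<in> H" "s < 3" unfolding X'_def using that by force
    then show "?P (\<lambda>j. d s (\<chi> i j)) \<in> K" if "i \<in> H" "s < 3" using r'(3) that unfolding K_def r_def by blast
  qed
  define W2 where "W2 = 1 - em (ft R) * vp (-2)"
  have W2: "W2 \<in> LPu L1" unfolding W2_def
    by (intro LPu_diff[OF L1] LPu_1[OF L1] LPu_mult[OF L1] LPu_em[OF L1] LPu_vp[OF L1] RSL1)
  have kmul: "q * x \<in> K" if "q \<in> LPu L1" "x \<in> K" for q x
    using Md_mult[OF L1 r H that(1)] that(2) unfolding K_def by blast
  have dvk: "dv (k i) \<in> K" if "i \<in> H" for i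
  proof -
    have "dv (k i) = W2 * ?P (vd (\<chi> i))" unfolding k_def W2_def Psi_dv[OF RS] by (rule mult.commute)
    then show ?thesis using kmul[OF W2 PK(1)[OF that]] by simp
  qed
  have DDk: "DD s (k i) \<in> K" if s: "s < 3" and i: "i \<in> H" for s i
  proof -
    have "DD s (k i) = ?P (\<lambda>j. d s (\<chi> i j)) + DD s (Xv R S) * ?P (vd (\<chi> i))"
      unfolding k_def by (rule PDD[OF s])
    moreover have "DD s (Xv R S) * ?P (vd (\<chi> i)) \<in> K" by (rule kmul[OF DXL[OF s] PK(1)[OF i]])
    ultimately show ?thesis using PK(2)[OF i s] unfolding K_def by (simp only: Md_add[OF L1 r H])
  qed
  define I where "I = insert None (Some ` F)"
  have I: "finite I" using F by (simp add: I_def)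
  define n where "n = with_one f"
  define N where "N = Md L1 p I n"
  have NgM: "Ng y \<in> N" if "y \<in> M1" for y
    unfolding N_def I_def n_def by (rule Md_Ng[OF L1 p1 p(2) F cf1[unfolded M1_def] that[unfolded M1_def]])
  have nN: "i \<in> I \<Longrightarrow> n i \<in> N" for i unfolding N_def by (rule Md_gen[OF L1 p1 p(2) I])
  have N0: "0 \<in> N" unfolding N_def by (rule Md_0[OF L1 p1 p(2) I])
  have dvn: "dv (n i) \<in> N" if "i \<in> I" for i
  proof (cases i)
    case None then show ?thesis using N0 by (simp add: n_def with_one_def is_derD(4)[OF dv_der])
  next
    case (Some j)
    then have "dv (f j) \<in> M1" using that dvf MM1 by (auto simp: I_def M_def)
    then show ?thesis using Some NgM by (simp add: n_def with_one_def dv_Ng)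
  qed
  have DDn: "DD s (n i) \<in> N" if s: "s < 3" and "i \<in> I" for s i
  proof (cases i)
    case None then show ?thesis using N0 by (simp add: n_def with_one_def is_derD(4)[OF isd(2)[OF s]])
  next
    case (Some j)
    then have "DD s (f j) \<in> M1" using that DDf by (auto simp: I_def)
    then show ?thesis using Some NgM by (simp add: n_def with_one_def compat_Ng[OF c[OF s]])
  qed
  \<comment> \<open>Products of generators generate a module containing the integrand of the residue
    formula; by the product rule it is closed under all derivations, so its residues can be adjoined
    as before.\<close>
  define g where "g ij = n (fst ij) * k (snd ij)" for ij
  define P where "P = Md L1 (p * r) (I \<times> H) g"
  have pr: "p * r \<in> LPu L1" "p * r \<noteq> 0" using LPu_mult[OF L1 p1 r(1)] p(2) r(2) by auto
  have IH: "finite (I \<times> H)" using I H by simp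
  have NK: "x * y \<in> P" if "x \<in> N" "y \<in> K" for x y
    using Md_prod[OF L1 p1 p(2) I r H, of x n y k] that unfolding N_def K_def P_def g_def by blast
  have gd: "DD' (g ij) \<in> P" if "is_der DD'" "\<And>i. i \<in> I \<Longrightarrow> DD' (n i) \<in> N" "\<And>i. i \<in> H \<Longrightarrow> DD' (k i) \<in> K" "ij \<in> I \<times> H" for DD' ij
  proof -
    have ij: "fst ij \<in> I" "snd ij \<in> H" using that(4) by auto
    have kK: "k (snd ij) \<in> K" unfolding K_def by (rule Md_gen[OF L1 r H ij(2)])
    have "DD' (g ij) = DD' (n (fst ij)) * k (snd ij) + n (fst ij) * DD' (k (snd ij))"
      unfolding g_def by (rule is_derD(2)[OF that(1)])
    then show ?thesis unfolding P_def
      by (simp only:) (rule Md_add[OF L1 pr IH NK[OF that(2)[OF ij(1)] kK, unfolded P_def] NK[OF nN[OF ij(1)] that(3)[OF ij(2)], unfolded P_def]])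
  qed
  have dvg: "\<forall>ij\<in>I \<times> H. dv (g ij) \<in> Md L1 (p * r) (I \<times> H) g"
    using gd[OF dv_der dvn dvk] unfolding P_def by blast
  from residue_finite[OF L1 pr IH dvg] obtain A1 where A1: "finite A1" "A1 \<subseteq> cf (-1) ` P" "cf (-1) ` P \<subseteq> lspan L1 A1"
    unfolding P_def by blast
  define E where "E = E1 \<union> A0 \<union> A1"
  have L2: "subfld (fld E)" by (rule subfld_fld)
  have L12: "L1 \<subseteq> fld E" unfolding L1_def E_def by (rule fld_mono) auto
  have A1E: "A1 \<subseteq> fld E" unfolding E_def by (auto intro: fld_incl)
  have resP: "cf (-1) x \<in> fld E" if "x \<in> P" for x
    using A1(3) lspan_sub[OF L2 L12 A1E] that by blast
  have DDP: "DD s x \<in> P" if s: "s < 3" and x: "x \<in> P" for s x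
    unfolding P_def
  proof (rule Md_der[OF L1 pr IH L1 order_refl pr(1) isd(2)[OF s] DDL1[OF s] _ x[unfolded P_def]])
    show "DD s (g i) \<in> Md L1 (p * r) (I \<times> H) g" if "i \<in> I \<times> H" for i
      using gd[OF isd(2)[OF s] DDn[OF s] DDk[OF s] that] unfolding P_def .
  qed
  have DE: "D s x \<in> fld E" if s: "s < 3" and x: "x \<in> fld E" for s x
  proof (rule fld_D[OF isd(1)[OF s] L2 order_refl _ x])
    show "D s y \<in> fld E" if yE: "y \<in> E" for y
    proof (cases "y \<in> E1 \<union> A0")
      case True
      then have "y \<in> L1" unfolding L1_def by (rule fld_incl)
      then show ?thesis using DL1[OF s] L12 by blast
    next
      case False
      then obtain x where "x \<in> P" "y = cf (-1) x" using yE A1(2) unfolding E_def by blast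
      then show ?thesis using resP[OF DDP[OF s]] by (simp add: cfD[OF s])
    qed
  qed
  \<comment> \<open>The last factor of \<open>one_cut_residue\<close>: its first summand needs the
    generator 1, its second the negative part of \<open>Y\<close>.\<close>
  define w where "w = em (ft R) * vp (-1) - em (ft (fps_X * u)) * Ng Y"
  have w: "w \<in> N"
  proof -
    have oneN: "1 \<in> N" using nN[of None] by (simp add: n_def with_one_def I_def)
    have "em (ft R) * vp (-1) \<in> LPu L1" by (intro LPu_mult[OF L1] LPu_em[OF L1] LPu_vp[OF L1] RSL1)
    then have 1: "em (ft R) * vp (-1) * 1 \<in> N" using Md_mult[OF L1 p1 p(2) I] oneN unfolding N_def by blast
    have "em (ft (fps_X * u)) \<in> LPu L1" using LPu_em[OF L1 T] by (simp add: T_def ft_mult)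
    moreover have "Ng Y \<in> N" using NgM Y MM1 by blast
    ultimately have "em (ft (fps_X * u)) * Ng Y \<in> N" using Md_mult[OF L1 p1 p(2) I] unfolding N_def by blast
    then show ?thesis using 1 Md_diff[OF L1 p1 p(2) I] unfolding w_def N_def by simp
  qed
  have "W2 * ?P h \<in> K" by (rule kmul[OF W2 Kh])
  then have "cf (-1) (w * (W2 * ?P h)) \<in> fld E" by (intro resP NK w)
  moreover have "fls_X * ft (Sa (\<lambda>m. (bc R S h (int m) - R * bc R S h (int m + 2)) * Bc (m + 1))) = cf (-1) (w * (W2 * ?P h))"
    using one_cut_residue[OF oc, of h] unfolding w_def W2_def Y_def by (simp only: fps_X_to_fls ac_simps)
  moreover have "fls_X \<in> fld E" using zut(3) E0L1 L12 by blast
  ultimately have q: "(fls_X * ft (Sa (\<lambda>m. (bc R S h (int m) - R * bc R S h (int m + 2)) * Bc (m + 1)))) / fls_X \<in> fld E"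
    using subfldD(8)[OF L2] by metis
  have "(fls_X * ft (Sa (\<lambda>m. (bc R S h (int m) - R * bc R S h (int m + 2)) * Bc (m + 1)))) / fls_X =
      ft (Sa (\<lambda>m. (bc R S h (int m) - R * bc R S h (int m + 2)) * Bc (m + 1)))"
    by (rule nonzero_mult_div_cancel_left) simp
  with q have C: "ft (Sa (\<lambda>m. (bc R S h (int m) - R * bc R S h (int m + 2)) * Bc (m + 1))) \<in> fld E" by (simp only:)
  have "finite E" using E0(1) A0(1) A1(1) by (simp add: E_def E1_def)
  moreover have "E0 \<subseteq> E" by (auto simp: E_def E1_def)
  ultimately show ?thesis using DE C by blast
qed

section \<open>Translation of multivariate series\<close>

abbreviation lk :: "('a \<Rightarrow>\<^sub>0 'b::zero) \<Rightarrow> 'a \<Rightarrow> 'b" where "lk \<equiv> Poly_Mapping.lookup"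

lemma mderiv_comm: "mderiv i (mderiv j A) = mderiv j (mderiv i A)"
  by (rule ext) (auto simp: mderiv_def lookup_add lookup_single when_def ac_simps)

lemma mderiv_funpow_comm: "mderiv i ((mderiv j ^^ k) A) = (mderiv j ^^ k) (mderiv i A)"
  by (induction k) (simp_all add: mderiv_comm[of i])

lemma mdiffs_cong: "(\<And>i. i < m \<Longrightarrow> lk \<alpha> i = lk \<beta> i) \<Longrightarrow> mdiffs m \<alpha> A = mdiffs m \<beta> A"
  by (induction m) auto

text \<open>\<open>mdiffs\<close> differentiates in a fixed order of the variables, so raising an
  inner index relies on the derivations commuting.\<close>

lemma mderiv_mdiffs: "i < m \<Longrightarrow> mderiv i (mdiffs m \<beta> A) = mdiffs m (\<beta> + Poly_Mapping.single i 1) A"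
proof (induction m)
  case (Suc m)
  show ?case
  proof (cases "i = m")
    case True
    have "mdiffs m (\<beta> + Poly_Mapping.single m 1) A = mdiffs m \<beta> A"
      by (rule mdiffs_cong) (simp add: lookup_add lookup_single when_def)
    then show ?thesis using True by (simp add: lookup_add)
  next
    case False
    then have "i < m" using Suc.prems by simp
    then show ?thesis using False by (simp add: mderiv_funpow_comm Suc.IH lookup_add lookup_single when_def)
  qed
qed simp

definition m4 :: "nat \<Rightarrow> nat \<Rightarrow> nat \<Rightarrow> nat \<Rightarrow> (nat \<Rightarrow>\<^sub>0 nat)" where
  "m4 a b c e = Poly_Mapping.single 0 a + Poly_Mapping.single 1 b + Poly_Mapping.single 2 c + Poly_Mapping.single 3 e"

lemma lk_m4: "lk (m4 a b c e) i = (if i = 0 then a else if i = 1 then b else if i = 2 then c else if i = 3 then e else 0)"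
  by (simp add: m4_def lookup_add lookup_single when_def)

lemma m4_eq: assumes "in_vars 4 \<gamma>" shows "\<gamma> = m4 (lk \<gamma> 0) (lk \<gamma> 1) (lk \<gamma> 2) (lk \<gamma> 3)"
proof (rule poly_mapping_eqI)
  fix i
  have "lk \<gamma> i = 0" if "i \<ge> 4" using assms that by (auto simp: in_vars_def in_keys_iff subset_iff not_less[symmetric])
  moreover have "i = 0 \<or> i = 1 \<or> i = 2 \<or> i = 3 \<or> i \<ge> 4" by linarith
  ultimately show "lk \<gamma> i = lk (m4 (lk \<gamma> 0) (lk \<gamma> 1) (lk \<gamma> 2) (lk \<gamma> 3)) i" by (auto simp: lk_m4)
qed

lemma mmul_m4: "mmul f g (m4 a b c e) = (\<Sum>l\<le>e. \<Sum>i\<le>c. \<Sum>j\<le>b. \<Sum>k\<le>a. f (m4 k j i l) * g (m4 (a - k) (b - j) (c - i) (e - l)))"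
proof -
  let ?B = "{..e} \<times> {..c} \<times> {..b} \<times> {..a}"
  let ?m = "\<lambda>(l, i, j, k). m4 k j i l"
  have inj: "inj_on ?m ?B"
  proof (rule inj_onI)
    fix x y assume "?m x = ?m y"
    then have "lk (?m x) i = lk (?m y) i" for i by simp
    from this[of 0] this[of 1] this[of 2] this[of 3] show "x = y" by (auto simp: lk_m4 split: prod.splits)
  qed
  have im: "{\<alpha>. \<forall>i. lk \<alpha> i \<le> lk (m4 a b c e) i} = ?m ` ?B"
  proof (intro equalityI subsetI)
    fix \<alpha> assume "\<alpha> \<in> {\<alpha>. \<forall>i. lk \<alpha> i \<le> lk (m4 a b c e) i}"
    then have le: "lk \<alpha> i \<le> lk (m4 a b c e) i" for i by simp
    have "lk \<alpha> i = 0" if "i \<ge> 4" for i using le[of i] that by (simp add: lk_m4)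
    then have "in_vars 4 \<alpha>" by (force simp: in_vars_def in_keys_iff not_less[symmetric])
    then have "\<alpha> = ?m (lk \<alpha> 3, lk \<alpha> 2, lk \<alpha> 1, lk \<alpha> 0)" using m4_eq by simp
    moreover have "(lk \<alpha> 3, lk \<alpha> 2, lk \<alpha> 1, lk \<alpha> 0) \<in> ?B" using le[of 0] le[of 1] le[of 2] le[of 3] by (simp add: lk_m4)
    ultimately show "\<alpha> \<in> ?m ` ?B" by blast
  qed (auto simp: lk_m4)
  have sub: "m4 a b c e - m4 k j i l = m4 (a - k) (b - j) (c - i) (e - l)" for k j i l
    by (rule poly_mapping_eqI) (simp add: lookup_minus lk_m4)
  have "mmul f g (m4 a b c e) = (\<Sum>x\<in>?B. f (?m x) * g (m4 a b c e - ?m x))"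
    unfolding mmul_def im by (rule sum.reindex[OF inj, unfolded comp_def])
  also have "\<dots> = (\<Sum>(l, i, j, k)\<in>?B. f (m4 k j i l) * g (m4 (a - k) (b - j) (c - i) (e - l)))"
    by (rule sum.cong) (auto simp: sub)
  finally show ?thesis by (simp add: sum.cartesian_product)
qed

type_synonym kk = "rat fls fls"

text \<open>Power series in u over power series in z are embedded in iterated Laurent series, which
  form a field; the linear algebra over subfields needs one.\<close>

definition lift :: "rat fps fps \<Rightarrow> kk" where
  "lift x = fps_to_fls (Abs_fps (\<lambda>b. fps_to_fls (x $ b)))"

lemma lift_nth: "lift x $$ int b $$ int a = x $ b $ a" by (simp add: lift_def)

lemma lift_add: "lift (x + y) = lift x + lift y"
  unfolding lift_def fps_to_fls_plus[symmetric] by (intro arg_cong[of _ _ fps_to_fls] fps_ext) simp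

lemma lift_0: "lift 0 = 0" by (simp add: lift_def fps_zero_def[symmetric])

lemma lift_mult: "lift (x * y) = lift x * lift y"
  unfolding lift_def ft_mult[symmetric]
  by (intro arg_cong[of _ _ fps_to_fls] fps_ext)
    (simp add: fps_mult_nth additive_sum[of fps_to_fls] fls_times_fps_to_fls)

text \<open>\<open>J A e\<close> is the coefficient of the fourth variable to the power \<open>e\<close> in \<open>A\<close>, as a series in \<open>t\<close> (outermost), \<open>u\<close>, \<open>z\<close>
  (innermost).\<close>

definition J :: "mser \<Rightarrow> nat \<Rightarrow> kk fps" where
  "J A e = Abs_fps (\<lambda>c. lift (Abs_fps (\<lambda>b. Abs_fps (\<lambda>a. A (m4 a b c e)))))"

lemma J_nth: "J A e $ c = lift (Abs_fps (\<lambda>b. Abs_fps (\<lambda>a. A (m4 a b c e))))" by (simp add: J_def)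

lemma J_nth3: "J A e $ c $$ int b $$ int a = A (m4 a b c e)" by (simp add: J_nth lift_nth)

lemma lift_ext: "(\<And>n. n < 0 \<Longrightarrow> X $$ n = 0) \<Longrightarrow> (\<And>n k. k < 0 \<Longrightarrow> X $$ n $$ k = 0) \<Longrightarrow> (\<And>a b. X $$ int b $$ int a = x $ b $ a) \<Longrightarrow> X = lift x"
proof (rule fls_eqI, rule fls_eqI)
  fix n k
  assume X: "\<And>n. n < 0 \<Longrightarrow> X $$ n = 0" "\<And>n k. k < 0 \<Longrightarrow> X $$ n $$ k = 0" "\<And>a b. X $$ int b $$ int a = x $ b $ a"
  show "X $$ n $$ k = lift x $$ n $$ k"
  proof (cases "n < 0 \<or> k < 0")
    case True then show ?thesis using X(1,2) by (auto simp: lift_def)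
  next
    case False then show ?thesis using X(3)[of "nat n" "nat k"] lift_nth[of x "nat n" "nat k"] by simp
  qed
qed

lemma J_add: "J (\<lambda>\<gamma>. A \<gamma> + B \<gamma>) e = J A e + J B e"
  by (rule fps_ext) (simp add: J_nth flip: lift_add, simp add: fps_plus_def)

lemma J_0: "J (\<lambda>_. 0) e = 0"
  by (rule fps_ext) (simp add: J_nth flip: fps_zero_def lift_0)

lemma J_msum: "J (msum F f) e = (\<Sum>x\<in>F. J (f x) e)"
proof (induction F rule: infinite_finite_induct)
  case (insert x F)
  then have "msum (insert x F) f = (\<lambda>\<gamma>. f x \<gamma> + msum F f \<gamma>)" by (simp add: msum_def)
  then show ?case using insert by (simp add: J_add)
qed (simp_all add: msum_def J_0)

lemma J_mmul: "J (mmul f g) = conv (J f) (J g)"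
proof
  fix e
  show "J (mmul f g) e = conv (J f) (J g) e"
  proof (rule fps_ext)
    fix c
    have "conv (J f) (J g) e $ c = (\<Sum>l\<le>e. \<Sum>i=0..c. lift (Abs_fps (\<lambda>b. Abs_fps (\<lambda>a. f (m4 a b i l))) * Abs_fps (\<lambda>b. Abs_fps (\<lambda>a. g (m4 a b (c - i) (e - l))))))"
      by (simp add: conv_def fps_sum_nth fps_mult_nth J_nth lift_mult)
    also have "\<dots> = lift (\<Sum>l\<le>e. \<Sum>i=0..c. Abs_fps (\<lambda>b. Abs_fps (\<lambda>a. f (m4 a b i l))) * Abs_fps (\<lambda>b. Abs_fps (\<lambda>a. g (m4 a b (c - i) (e - l)))))"
      by (simp add: additive_sum[of lift, OF lift_add lift_0])
    also have "\<dots> = J (mmul f g) e $ c"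
      unfolding J_nth
      by (intro arg_cong[of _ _ lift] fps_ext) (simp add: fps_sum_nth fps_mult_nth mmul_m4 atLeast0AtMost)
    finally show "J (mmul f g) e $ c = conv (J f) (J g) e $ c" by simp
  qed
qed

abbreviation \<iota> :: "mser \<Rightarrow> kk fps" where "\<iota> A \<equiv> J A 0"

lemma iota_mmul: "\<iota> (mmul f g) = \<iota> f * \<iota> g" by (simp add: J_mmul conv_def)

definition mono4 :: "rat \<Rightarrow> nat \<Rightarrow> nat \<Rightarrow> nat \<Rightarrow> kk fps" where
  "mono4 q a b c = fps_const (fls_const (fls_const q * fls_X ^ a) * fls_X ^ b) * fps_X ^ c"

lemma mono4_nth: "mono4 q a b c $ c' = (if c' = c then fls_const (fls_const q * fls_X ^ a) * fls_X ^ b else 0)"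
  by (simp add: mono4_def)

lemma fls_cX_nth: "(fls_const y * fls_X ^ b) $$ k = (if k = int b then y else (0 :: 'a::comm_ring_1))"
  by (simp add: fls_X_power_nth)

lemma J_single: "J (\<lambda>\<gamma>. if \<gamma> = m4 a b c e then q else 0) e' = (if e' = e then mono4 q a b c else 0)"
proof (rule fps_ext)
  fix c'
  have eq: "m4 a' b' c' e' = m4 a b c e \<longleftrightarrow> a' = a \<and> b' = b \<and> c' = c \<and> e' = e" for a' b'
  proof
    assume "m4 a' b' c' e' = m4 a b c e"
    then have "lk (m4 a' b' c' e') i = lk (m4 a b c e) i" for i by simp
    from this[of 0] this[of 1] this[of 2] this[of 3] show "a' = a \<and> b' = b \<and> c' = c \<and> e' = e" by (simp add: lk_m4)
  qed simp
  show "J (\<lambda>\<gamma>. if \<gamma> = m4 a b c e then q else 0) e' $ c' = (if e' = e then mono4 q a b c else 0) $ c'"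
    unfolding J_nth
    by (rule lift_ext[symmetric]) (auto simp: mono4_nth fls_cX_nth eq)
qed

definition zz :: "kk fps" where "zz = \<iota> (mvar 0)"
definition uu :: "kk fps" where "uu = \<iota> (mvar 1)"

lemma mono4_conv: "zz = mono4 1 1 0 0" "uu = mono4 1 0 1 0" "\<iota> (mvar 2) = mono4 1 0 0 1" "\<iota> (mconst q) = mono4 q 0 0 0"
proof -
  have s: "Poly_Mapping.single 0 1 = m4 1 0 0 0" "Poly_Mapping.single 1 1 = m4 0 1 0 0" "Poly_Mapping.single 2 1 = m4 0 0 1 0" "0 = m4 0 0 0 0"
    by (simp_all add: m4_def)
  show "zz = mono4 1 1 0 0" unfolding zz_def mvar_def s J_single by simp
  show "uu = mono4 1 0 1 0" unfolding uu_def mvar_def s J_single by simp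
  show "\<iota> (mvar 2) = mono4 1 0 0 1" unfolding mvar_def s J_single by simp
  show "\<iota> (mconst q) = mono4 q 0 0 0" unfolding mconst_def s J_single by simp
qed

lemma iota_t: "\<iota> (mvar 2) = fps_X" unfolding mono4_conv mono4_def by simp
lemma iota_1: "\<iota> (mconst 1) = 1" unfolding mono4_conv mono4_def by simp

lemma mono4_mult: "mono4 q a b c = mono4 q 0 0 0 * zz ^ a * uu ^ b * fps_X ^ c"
  unfolding mono4_conv mono4_def
  by (simp add: fps_const_power fls_const_power flip: fps_const_mult fls_const_mult_const)

lemma fls_const_of_rat: "fls_const (of_rat q :: 'a::field_char_0) = of_rat q"
proof (cases q)
  case (Fract a b)
  then have b: "b \<noteq> 0" by simp
  have "of_int b * fls_const (of_rat q :: 'a) = of_int a"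
    using b by (simp add: Fract fls_of_int of_rat_rat)
  then show ?thesis using b by (simp add: Fract of_rat_rat field_simps)
qed

lemma ft_const: "ft (mono4 q 0 0 0) = of_rat q"
proof -
  have "ft (mono4 q 0 0 0) = fls_const (fls_const (fls_const (of_rat q)))" by (simp add: mono4_def)
  then show ?thesis unfolding fls_const_of_rat by simp
qed

lemma iota_mpow: "\<iota> (mpow A n) = \<iota> A ^ n"
  by (induction n) (simp_all add: iota_1 iota_mmul)

lemma iota_mprod: "\<iota> (mprod_upto N f) = (\<Prod>k<N. \<iota> (f k))"
  by (induction N) (simp_all add: iota_1 iota_mmul)

lemma iota_meval: "ft (\<iota> (meval N vals P)) =
  (\<Sum>\<mu>\<in>Poly_Mapping.keys P. of_rat (lk P \<mu>) * (\<Prod>j<N. ft (\<iota> (vals j)) ^ lk \<mu> j))"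
proof -
  have prod: "ft (\<Prod>j<N. x j ^ k j) = (\<Prod>j<N. ft (x j) ^ k j)" for x :: "nat \<Rightarrow> kk fps" and k
    by (induction N) (simp_all add: ft_mult fps_to_fls_power)
  show ?thesis unfolding meval_def J_msum iota_mmul iota_mprod iota_mpow mono4_conv(4)
    by (simp add: additive_sum[of ft] ft_mult ft_const prod)
qed

definition dd :: "nat \<Rightarrow> kk fps \<Rightarrow> kk fps" where
  "dd s x = (if s = 0 then Abs_fps (\<lambda>n. flmap fls_deriv (x $ n)) else if s = 1 then Abs_fps (\<lambda>n. fls_deriv (x $ n)) else fps_deriv x)"

definition Df :: "nat \<Rightarrow> kk fls \<Rightarrow> kk fls" where
  "Df s = (if s = 0 then flmap (flmap fls_deriv) else if s = 1 then flmap fls_deriv else fls_deriv)"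

definition DDf :: "nat \<Rightarrow> kk fls fls \<Rightarrow> kk fls fls" where
  "DDf s = (if s = 0 then flmap (flmap (flmap fls_deriv)) else if s = 1 then flmap (flmap fls_deriv) else fls_deriv)"

lemma flmap_0: "f 0 = 0 \<Longrightarrow> flmap f 0 = 0"
  by (rule fls_eqI) (simp add: flmap_nth)

lemma of_int_fls_nth: "(of_int m * x) $$ k = of_int m * (x $$ k :: 'a::comm_ring_1)"
  by (simp add: fls_of_int)

lemma Df_compat: "compat (Df s) (DDf s)"
proof -
  have 0: "is_der (flmap fls_deriv :: kk \<Rightarrow> kk)" "is_der (flmap fls_deriv :: kk fls \<Rightarrow> kk fls)"
    by (intro flmap_der fls_deriv_der)+
  have d: "is_der (Df s)" "is_der (DDf s)"
    unfolding Df_def DDf_def by (auto intro!: flmap_der fls_deriv_der)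
  have "cf k (DDf s f) = Df s (cf k f)" for k f
    by (rule fls_eqI) (simp add: Df_def DDf_def cf_nth flmap_nth flmap_0 of_int_fls_nth del: of_int_add)
  then show ?thesis using d unfolding compat_def by blast
qed

lemma Df_ft: "Df s (ft x) = ft (dd s x)"
proof (cases "s = 0 \<or> s = 1")
  case True
  then show ?thesis by (intro fls_eqI) (auto simp: Df_def dd_def flmap_nth flmap_0)
qed (simp add: Df_def dd_def fls_deriv_fps_to_fls)

lemma dd_loc: "(\<And>l. l \<le> m + 1 \<Longrightarrow> x $ l = 0) \<Longrightarrow> dd s x $ m = 0"
  by (simp add: dd_def flmap_0)

text \<open>Each variable sits at its own nesting level, so its derivation is
  \<open>fls_deriv\<close> or \<open>fps_deriv\<close> at that level, mapped over the levels outside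
  it.\<close>

lemma J_mderiv: assumes "i < 3" shows "J (mderiv i A) e = dd i (J A e)"
proof (rule fps_ext)
  fix c
  have s: "m4 a b c e + Poly_Mapping.single 0 1 = m4 (a + 1) b c e" "m4 a b c e + Poly_Mapping.single 1 1 = m4 a (b + 1) c e"
    "m4 a b c e + Poly_Mapping.single 2 1 = m4 a b (c + 1) e" for a b c
    by (rule poly_mapping_eqI, simp add: lk_m4 lookup_add lookup_single when_def)+
  have i: "i = 0 \<or> i = 1 \<or> i = 2" using assms by auto
  have neg: "J A e $ c $$ n = 0" if "n < 0" for n c using that by (simp add: J_nth lift_def)
  have neg2: "J A e $ c $$ n $$ k = 0" if "k < 0" for n k c using that by (cases "n < 0") (simp_all add: J_nth lift_def)
  have nn: "J A e $ c $$ (int b + 1) $$ int a = A (m4 a (b + 1) c e)" "J A e $ c $$ int b $$ (int a + 1) = A (m4 (a + 1) b c e)" for a b c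
    using J_nth3[of A e c "b + 1" a] J_nth3[of A e c b "a + 1"] by (simp_all add: add.commute)
  consider "i = 0" | "i = 1" | "i = 2" using i by blast
  then show "J (mderiv i A) e $ c = dd i (J A e) $ c"
  proof cases
    case 1
    have "flmap fls_deriv (J A e $ c) = J (mderiv 0 A) e $ c" unfolding J_nth[of "mderiv 0 A"]
    proof (rule lift_ext)
      show "flmap fls_deriv (J A e $ c) $$ n = 0" if "n < 0" for n using that by (simp add: flmap_nth neg)
      show "flmap fls_deriv (J A e $ c) $$ n $$ k = 0" if "k < 0" for n k
        using that neg2[of "k + 1" c n] by (cases "k = -1") (simp_all add: flmap_nth)
      show "flmap fls_deriv (J A e $ c) $$ int b $$ int a = Abs_fps (\<lambda>b. Abs_fps (\<lambda>a. mderiv 0 A (m4 a b c e))) $ b $ a" for a b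
        by (simp add: flmap_nth nn mderiv_def s[unfolded One_nat_def] lk_m4)
    qed
    then show ?thesis using 1 by (simp add: dd_def)
  next
    case 2
    have "fls_deriv (J A e $ c) = J (mderiv 1 A) e $ c" unfolding J_nth[of "mderiv 1 A"]
    proof (rule lift_ext)
      show "fls_deriv (J A e $ c) $$ n = 0" if "n < 0" for n using that neg[of "n + 1" c] by (cases "n = -1") simp_all
      show "fls_deriv (J A e $ c) $$ n $$ k = 0" if "k < 0" for n k using that by (simp add: of_int_fls_nth neg2 del: of_int_add)
      show "fls_deriv (J A e $ c) $$ int b $$ int a = Abs_fps (\<lambda>b. Abs_fps (\<lambda>a. mderiv 1 A (m4 a b c e))) $ b $ a" for a b
        by (simp only: fls_deriv_nth of_int_fls_nth nn)
          (simp add: mderiv_def s[unfolded One_nat_def] lk_m4 add.commute[of 1 "rat_of_nat b"])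
    qed
    then show ?thesis using 2 by (simp add: dd_def)
  next
    case 3
    have "of_int (int c + 1) * J A e $ (c + 1) = J (mderiv 2 A) e $ c" unfolding J_nth[of "mderiv 2 A"]
    proof (rule lift_ext)
      show "(of_int (int c + 1) * J A e $ (c + 1)) $$ n = 0" if "n < 0" for n using that by (simp only: of_int_fls_nth neg mult_zero_right)
      show "(of_int (int c + 1) * J A e $ (c + 1)) $$ n $$ k = 0" if "k < 0" for n k using that by (simp only: of_int_fls_nth neg2 mult_zero_right)
      show "(of_int (int c + 1) * J A e $ (c + 1)) $$ int b $$ int a = Abs_fps (\<lambda>b. Abs_fps (\<lambda>a. mderiv 2 A (m4 a b c e))) $ b $ a" for a b
        unfolding of_int_fls_nth J_nth3 by (simp add: mderiv_def s[unfolded One_nat_def] lk_m4 add.commute[of 1 "rat_of_nat c"])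
    qed
    then show ?thesis using 3 by (simp add: dd_def add.commute)
  qed
qed

lemma J_mderiv3: "J (mderiv 3 A) = vd (J A)"
proof
  fix e
  have s: "m4 a b c e + Poly_Mapping.single 3 1 = m4 a b c (Suc e)" for a b c
    by (rule poly_mapping_eqI) (simp add: lk_m4 lookup_add lookup_single when_def)
  show "J (mderiv 3 A) e = vd (J A) e"
  proof (rule fps_ext)
    fix c
    have nth: "vd (J A) e $ c = of_int (int (Suc e)) * J A (Suc e) $ c"
      unfolding vd_def by (simp only: fps_mult_of_nat_nth of_int_of_nat_eq)
    show "J (mderiv 3 A) e $ c = vd (J A) e $ c"
      unfolding J_nth[of "mderiv 3 A"] nth
    proof (rule lift_ext[symmetric])
      show "(of_int (int (Suc e)) * J A (Suc e) $ c) $$ n = 0" if "n < 0" for n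
        using that by (simp only: of_int_fls_nth J_nth) (simp add: lift_def)
      show "(of_int (int (Suc e)) * J A (Suc e) $ c) $$ n $$ k = 0" if "k < 0" for n k
        using that by (simp only: of_int_fls_nth J_nth) (simp add: lift_def)
      show "(of_int (int (Suc e)) * J A (Suc e) $ c) $$ int b $$ int a = Abs_fps (\<lambda>b. Abs_fps (\<lambda>a. mderiv 3 A (m4 a b c e))) $ b $ a" for a b
        unfolding of_int_fls_nth J_nth3 by (simp add: mderiv_def s[unfolded One_nat_def] lk_m4)
    qed
  qed
qed

lemma in_vars_3_4: "in_vars 3 \<gamma> \<Longrightarrow> in_vars 4 \<gamma> \<and> lk \<gamma> 3 = 0"
  by (force simp: in_vars_def in_keys_iff)

text \<open>A series in z, u, t has no monomial with the fourth variable, so its coefficients all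
  appear in index 0 of \<open>J\<close>.\<close>

lemma iota_inj: assumes "mser_in 3 A" "\<iota> A = 0" shows "A = mconst 0"
proof
  fix \<gamma>
  show "A \<gamma> = mconst 0 \<gamma>"
  proof (cases "in_vars 3 \<gamma>")
    case True
    have g: "\<gamma> = m4 (lk \<gamma> 0) (lk \<gamma> 1) (lk \<gamma> 2) 0" using m4_eq[of \<gamma>] in_vars_3_4[OF True] by simp
    have "A (m4 a b c 0) = 0" for a b c using J_nth3[of A 0 c b a] assms(2) by simp
    then show ?thesis using g by (metis (full_types) mconst_def)
  next
    case False
    then show ?thesis using assms(1) by (auto simp: mser_in_def mconst_def)
  qed
qed

lemma mser_in_mconst: "mser_in m (mconst c)"
  by (auto simp: mser_in_def mconst_def in_vars_def)

lemma mser_in_mvar: "i < m \<Longrightarrow> mser_in m (mvar i)"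
  by (auto simp: mser_in_def mvar_def in_vars_def split: if_splits)

lemma mser_in_mmul: assumes "mser_in m f" "mser_in m g" shows "mser_in m (mmul f g)"
  unfolding mser_in_def
proof (intro allI impI)
  fix \<gamma> assume "mmul f g \<gamma> \<noteq> 0"
  then obtain \<alpha> where a: "\<forall>i. lk \<alpha> i \<le> lk \<gamma> i" "f \<alpha> * g (\<gamma> - \<alpha>) \<noteq> 0"
    unfolding mmul_def by (auto elim!: sum.not_neutral_contains_not_neutral)
  then have "f \<alpha> \<noteq> 0" "g (\<gamma> - \<alpha>) \<noteq> 0" by auto
  then have v: "in_vars m \<alpha>" "in_vars m (\<gamma> - \<alpha>)" using assms by (simp_all add: mser_in_def)
  show "in_vars m \<gamma>" unfolding in_vars_def
  proof
    fix i assume i: "i \<in> Poly_Mapping.keys \<gamma>"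
    then have "lk \<alpha> i \<noteq> 0 \<or> lk (\<gamma> - \<alpha>) i \<noteq> 0" by (auto simp: in_keys_iff lookup_minus)
    then show "i \<in> {..<m}" using v by (auto simp: in_vars_def in_keys_iff subset_iff)
  qed
qed

lemma mser_in_mpow: "mser_in m f \<or> n = 0 \<Longrightarrow> mser_in m (mpow f n)"
proof (induction n)
  case (Suc n) then show ?case by (cases n) (simp_all add: mser_in_mmul mser_in_mconst)
qed (simp add: mser_in_mconst)

lemma mser_in_mprod: "(\<And>k. k < N \<Longrightarrow> mser_in m (f k)) \<Longrightarrow> mser_in m (mprod_upto N f)"
  by (induction N) (simp_all add: mser_in_mconst mser_in_mmul)

lemma mser_in_msum: assumes "\<And>x. x \<in> F \<Longrightarrow> mser_in m (f x)" shows "mser_in m (msum F f)"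
  unfolding mser_in_def msum_def
proof (intro allI impI)
  fix \<gamma> assume "(\<Sum>x\<in>F. f x \<gamma>) \<noteq> 0"
  then obtain x where "x \<in> F" "f x \<gamma> \<noteq> 0" by (rule sum.not_neutral_contains_not_neutral)
  then show "in_vars m \<gamma>" using assms by (auto simp: mser_in_def)
qed

lemma mser_in_mderiv: assumes "mser_in m f" shows "mser_in m (mderiv i f)"
  unfolding mser_in_def
proof (intro allI impI)
  fix \<gamma> assume "mderiv i f \<gamma> \<noteq> 0"
  then have "f (\<gamma> + Poly_Mapping.single i 1) \<noteq> 0" by (simp add: mderiv_def)
  then have "in_vars m (\<gamma> + Poly_Mapping.single i 1)" using assms by (simp add: mser_in_def)
  then show "in_vars m \<gamma>" by (auto simp: in_vars_def in_keys_iff lookup_add subset_iff)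
qed

lemma mser_in_funpow: "mser_in m f \<Longrightarrow> mser_in m ((mderiv i ^^ j) f)"
  by (induction j) (simp_all add: mser_in_mderiv)

definition E0 :: "kk fls set" where "E0 = {ft zz, ft uu, fls_X}"

text \<open>Coefficients are taken from the field generated by z, u and t, which contains the
  polynomials occurring in the definition of holonomicity.\<close>

definition ZZ :: "kk fps set" where "ZZ = {x. ft x \<in> fld E0}"

lemma mono4_ZZ: "mono4 q a b c \<in> ZZ"
proof -
  note s = subfldD[OF subfld_fld[of E0]]
  have rat: "of_rat q \<in> fld E0"
  proof (cases q)
    case (Fract a b) then show ?thesis by (simp add: of_rat_rat s)
  qed
  have g: "ft zz \<in> fld E0" "ft uu \<in> fld E0" "fls_X \<in> fld E0" by (auto simp: E0_def intro: fld_incl)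
  have "ft (mono4 q a b c) = of_rat q * ft zz ^ a * ft uu ^ b * fls_X ^ c"
    by (subst mono4_mult) (simp add: ft_mult fps_to_fls_power ft_const)
  also have "\<dots> \<in> fld E0" by (intro s(4,9) rat g)
  finally show ?thesis by (simp add: ZZ_def)
qed

lemma mpoly_Pol: assumes "mpoly_in 4 p" shows "J p \<in> Pol ZZ"
proof -
  define S where "S = {\<gamma>. p \<gamma> \<noteq> 0}"
  have S: "finite S" and v: "\<And>\<gamma>. \<gamma> \<in> S \<Longrightarrow> in_vars 4 \<gamma>" using assms by (auto simp: S_def mpoly_in_def mser_in_def)
  have "p = msum S (\<lambda>\<gamma> \<gamma>'. if \<gamma>' = \<gamma> then p \<gamma> else 0)"
    using S by (auto simp: msum_def fun_eq_iff S_def)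
  then have "J p e = (\<Sum>\<gamma>\<in>S. J (\<lambda>\<gamma>'. if \<gamma>' = \<gamma> then p \<gamma> else 0) e)" for e by (metis J_msum)
  also have "(\<Sum>\<gamma>\<in>S. J (\<lambda>\<gamma>'. if \<gamma>' = \<gamma> then p \<gamma> else 0) e) =
      (\<Sum>\<gamma>\<in>S. if e = lk \<gamma> 3 then mono4 (p \<gamma>) (lk \<gamma> 0) (lk \<gamma> 1) (lk \<gamma> 2) else 0)" for e
  proof (rule sum.cong[OF refl])
    fix \<gamma> assume "\<gamma> \<in> S"
    then have "\<gamma> = m4 (lk \<gamma> 0) (lk \<gamma> 1) (lk \<gamma> 2) (lk \<gamma> 3)" by (intro m4_eq v)
    then show "J (\<lambda>\<gamma>'. if \<gamma>' = \<gamma> then p \<gamma> else 0) e = (if e = lk \<gamma> 3 then mono4 (p \<gamma>) (lk \<gamma> 0) (lk \<gamma> 1) (lk \<gamma> 2) else 0)"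
      using J_single[of "lk \<gamma> 0" "lk \<gamma> 1" "lk \<gamma> 2" "lk \<gamma> 3" "p \<gamma>" e] by metis
  qed
  finally have eq: "J p e = (\<Sum>\<gamma>\<in>S. if e = lk \<gamma> 3 then mono4 (p \<gamma>) (lk \<gamma> 0) (lk \<gamma> 1) (lk \<gamma> 2) else 0)" for e .
  have "{e. J p e \<noteq> 0} \<subseteq> (\<lambda>\<gamma>. lk \<gamma> 3) ` S"
  proof
    fix e assume "e \<in> {e. J p e \<noteq> 0}"
    then obtain \<gamma> where "\<gamma> \<in> S" "(if e = lk \<gamma> 3 then mono4 (p \<gamma>) (lk \<gamma> 0) (lk \<gamma> 1) (lk \<gamma> 2) else 0) \<noteq> 0"
      unfolding eq by (auto elim!: sum.not_neutral_contains_not_neutral)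
    then show "e \<in> (\<lambda>\<gamma>. lk \<gamma> 3) ` S" by (auto split: if_splits)
  qed
  then have "finite {e. J p e \<noteq> 0}" using S finite_subset by blast
  moreover have "J p e \<in> ZZ" for e
  proof -
    note s = subfldD[OF subfld_fld[of E0]]
    have "ft (J p e) = (\<Sum>\<gamma>\<in>S. ft (if e = lk \<gamma> 3 then mono4 (p \<gamma>) (lk \<gamma> 0) (lk \<gamma> 1) (lk \<gamma> 2) else 0))"
      unfolding eq by (rule additive_sum) simp_all
    also have "\<dots> \<in> fld E0" by (rule s(12)) (use mono4_ZZ s(1) in \<open>auto simp: ZZ_def\<close>)
    finally show ?thesis by (simp add: ZZ_def)
  qed
  ultimately show ?thesis by (simp add: Pol_def)
qed

lemma J_nonzero: assumes "mser_in 4 p" "p \<noteq> mconst 0" shows "J p \<noteq> (\<lambda>_. 0)"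
proof -
  obtain \<gamma> where g: "p \<gamma> \<noteq> 0" using assms(2) by (auto simp: mconst_def fun_eq_iff)
  then have "\<gamma> = m4 (lk \<gamma> 0) (lk \<gamma> 1) (lk \<gamma> 2) (lk \<gamma> 3)" using assms(1) by (intro m4_eq) (simp add: mser_in_def)
  then have "J p (lk \<gamma> 3) $ lk \<gamma> 2 $$ int (lk \<gamma> 1) $$ int (lk \<gamma> 0) \<noteq> 0" using g by (simp add: J_nth3)
  then have "J p (lk \<gamma> 3) \<noteq> 0" by force
  then show ?thesis by metis
qed

text \<open>A derivative of a generator is again a partial derivative of \<open>A\<close>, with one
  index raised, and so lies in the span of the family \<open>F\<close> by holonomicity.\<close>

lemma holonomic_dfin: assumes "holonomic 4 A"
  shows "\<exists>F :: (nat \<Rightarrow>\<^sub>0 nat) set. dfin ZZ dd F (\<lambda>\<beta>. J (mdiffs 4 \<beta> A)) (J A)"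
proof -
  obtain F where F: "finite F" "\<forall>\<beta>\<in>F. in_vars 4 \<beta>" and
    h: "\<And>\<alpha>. in_vars 4 \<alpha> \<Longrightarrow> \<exists>p q. mpoly_in 4 p \<and> p \<noteq> mconst 0 \<and> (\<forall>\<beta>\<in>F. mpoly_in 4 (q \<beta>)) \<and>
                  mmul p (mdiffs 4 \<alpha> A) = msum F (\<lambda>\<beta>. mmul (q \<beta>) (mdiffs 4 \<beta> A))"
    using assms unfolding holonomic_def by blast
  have sp: "pspan ZZ F (\<lambda>\<beta>. J (mdiffs 4 \<beta> A)) (J (mdiffs 4 \<alpha> A))" if v: "in_vars 4 \<alpha>" for \<alpha>
  proof -
    obtain p q where pq: "mpoly_in 4 p" "p \<noteq> mconst 0" "\<forall>\<beta>\<in>F. mpoly_in 4 (q \<beta>)"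
        "mmul p (mdiffs 4 \<alpha> A) = msum F (\<lambda>\<beta>. mmul (q \<beta>) (mdiffs 4 \<beta> A))"
      using h[OF v] by blast
    have "conv (J p) (J (mdiffs 4 \<alpha> A)) = (\<lambda>n. \<Sum>\<beta>\<in>F. conv (J (q \<beta>)) (J (mdiffs 4 \<beta> A)) n)"
      unfolding J_mmul[symmetric] pq(4) by (rule ext) (rule J_msum)
    moreover have "J p \<noteq> (\<lambda>_. 0)" using J_nonzero pq(1,2) by (simp add: mpoly_in_def)
    moreover have "\<forall>\<beta>\<in>F. J (q \<beta>) \<in> Pol ZZ" using mpoly_Pol pq(3) by blast
    ultimately show ?thesis unfolding pspan_def using mpoly_Pol[OF pq(1)] by (intro exI[of _ "J p"] exI[of _ "\<lambda>\<beta>. J (q \<beta>)"] conjI)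
  qed
  have vsum: "in_vars 4 (\<beta> + Poly_Mapping.single i 1)" if "in_vars 4 \<beta>" "i < 4" for \<beta> i
    using that by (auto simp: in_vars_def in_keys_iff lookup_add lookup_single when_def subset_iff split: if_splits)
  have der: "pspan ZZ F (\<lambda>\<beta>. J (mdiffs 4 \<beta> A)) (vd (J (mdiffs 4 \<beta> A)))"
      "s < 3 \<Longrightarrow> pspan ZZ F (\<lambda>\<beta>. J (mdiffs 4 \<beta> A)) (\<lambda>j. dd s (J (mdiffs 4 \<beta> A) j))" if "in_vars 4 \<beta>" for \<beta> s
  proof -
    show "pspan ZZ F (\<lambda>\<beta>. J (mdiffs 4 \<beta> A)) (vd (J (mdiffs 4 \<beta> A)))"
      unfolding J_mderiv3[symmetric] using sp[OF vsum[OF that, of 3]] by (simp add: mderiv_mdiffs)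
    assume s: "s < 3"
    have "(\<lambda>j. dd s (J (mdiffs 4 \<beta> A) j)) = J (mderiv s (mdiffs 4 \<beta> A))" using J_mderiv[OF s] by (simp add: fun_eq_iff)
    then show "pspan ZZ F (\<lambda>\<beta>. J (mdiffs 4 \<beta> A)) (\<lambda>j. dd s (J (mdiffs 4 \<beta> A) j))"
      using sp[OF vsum[OF that, of s]] s by (simp add: mderiv_mdiffs)
  qed
  have z: "in_vars 4 0" by (simp add: in_vars_def)
  have z': "mdiffs 4 0 A = A" by (simp add: numeral_eq_Suc)
  show ?thesis unfolding dfin_def
    using F(1) sp[OF z] der[OF z] der F(2) unfolding z' by blast
qed

text \<open>Index 0 is set to 0, as in \<open>vgen\<close>; in a map with edges every vertex has
  positive degree.\<close>

definition cseq :: "(nat \<Rightarrow> mser) \<Rightarrow> nat \<Rightarrow> kk fps" where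
  "cseq g k = (if k = 0 then 0 else \<iota> (g k))"

lemma J_vgen: "J (vgen g) = cseq g"
proof
  fix e
  have s: "m4 a b c e - Poly_Mapping.single 3 e = m4 a b c 0" for a b c
    by (rule poly_mapping_eqI) (simp add: lookup_minus lk_m4 lookup_single when_def)
  show "J (vgen g) e = cseq g e"
  proof (cases "e = 0")
    case True
    then have "vgen g (m4 a b c e) = 0" for a b c by (simp add: vgen_def lk_m4)
    then show ?thesis using True by (intro fps_ext) (simp add: J_nth cseq_def flip: fps_zero_def lift_0)
  next
    case False
    then have "vgen g (m4 a b c e) = g e (m4 a b c 0)" for a b c using s by (simp add: vgen_def lk_m4)
    then show ?thesis using False by (intro fps_ext) (simp add: J_nth cseq_def)
  qed
qed

lemma cnt_0: "cnt t 0 = 0" by (induction t) auto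
lemma rdeg_pos: "edges t > 0 \<Longrightarrow> rdeg t > 0" by (cases t) auto

lemma iota_tw: assumes "t \<in> Tm n" "n > 0"
  shows "\<iota> (tw g h n t) = fps_X ^ n * (wt zz uu (cseq g) t * cseq h (rdeg t))"
proof -
  have t: "valid t" "edges t = n" using assms(1) by (auto simp: Tm_def)
  have "rdeg t > 0" using rdeg_pos t assms(2) by simp
  moreover have "(\<Prod>k<2 * n + 1. \<iota> (g k) ^ cnt t k) = (\<Prod>k<2 * n + 1. cseq g k ^ cnt t k)"
    by (rule prod.cong) (auto simp: cseq_def cnt_0)
  moreover have "wt zz uu (cseq g) t = zz ^ faces t * (uu ^ nonroot t * (\<Prod>k<2 * n + 1. cseq g k ^ cnt t k))"
    by (rule wt_prod) (use t in auto)
  ultimately show ?thesis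
    unfolding tw_def iota_mmul iota_mpow iota_mprod iota_t by (simp add: cseq_def zz_def uu_def ac_simps)
qed

lemma Cmaps_terms: "Cmaps g h \<gamma> = mvar 0 \<gamma> + (\<Sum>n\<in>{1..lk \<gamma> 2}. \<Sum>t\<in>Tm n. tw g h n t \<gamma>)"
  unfolding Cmaps_def Tm_def by (simp add: sum_classes)

lemma iota_Cmaps: "\<iota> (Cmaps g h) = zz + Sa (\<lambda>n. fps_X ^ n * (\<Sum>t\<in>Tm n. wt zz uu (cseq g) t * cseq h (rdeg t)))"
proof (rule fps_ext)
  fix c
  let ?f = "\<lambda>n. fps_X ^ n * (\<Sum>t\<in>Tm n. wt zz uu (cseq g) t * cseq h (rdeg t))"
  have "J (Cmaps g h) 0 $ c = J (\<lambda>\<gamma>. mvar 0 \<gamma> + msum {1..c} (\<lambda>n. msum (Tm n) (tw g h n)) \<gamma>) 0 $ c"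
    unfolding J_nth Cmaps_terms by (simp add: lk_m4 msum_def)
  also have "\<dots> = zz $ c + (\<Sum>n\<in>{1..c}. \<Sum>t\<in>Tm n. \<iota> (tw g h n t)) $ c"
    unfolding J_add J_msum by (simp add: zz_def)
  also have "(\<Sum>n\<in>{1..c}. \<Sum>t\<in>Tm n. \<iota> (tw g h n t)) = (\<Sum>n\<in>{1..c}. ?f n)"
    by (rule sum.cong) (simp_all add: iota_tw sum_distrib_left)
  also have "\<dots> = (\<Sum>n<Suc c. ?f n)"
    \<comment> \<open>The term n = 0 vanishes because \<open>cseq h 0 = 0\<close>; the vertex map is
      counted by \<open>zz\<close> instead.\<close>
    by (rule sum.mono_neutral_left) (auto simp: Tm_0 cseq_def Suc_le_eq)
  also have "\<dots> $ c = Sa ?f $ c"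
    unfolding fps_sum_nth by (rule Sa_nth[symmetric]) (simp add: fps_X_power_mult_nth)
  finally show "J (Cmaps g h) 0 $ c = (zz + Sa ?f) $ c" by simp
qed

text \<open>The values \<open>g 0\<close> and \<open>h 0\<close> are arbitrary series. They do no
  harm, because a term with edges has no vertex of degree 0: the exponent of \<open>g 0\<close> is 0
  and the root degree is positive.\<close>

lemma mser_in_Cmaps:
  assumes "\<forall>k\<ge>1. mser_in 3 (g k)" "\<forall>k\<ge>1. mser_in 3 (h k)" shows "mser_in 3 (Cmaps g h)"
  unfolding mser_in_def
proof (intro allI impI, rule ccontr)
  fix \<gamma> assume nz: "Cmaps g h \<gamma> \<noteq> 0" and v: "\<not> in_vars 3 \<gamma>"
  have z: "f \<gamma> = 0" if "mser_in 3 f" for f using that v by (auto simp: mser_in_def)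
  have "tw g h n t \<gamma> = 0" if t: "t \<in> Tm n" and n: "n \<ge> 1" for n t
  proof (rule z)
    have "rdeg t \<ge> 1" using rdeg_pos[of t] t n by (simp add: Tm_def)
    then have b: "mser_in 3 (h (rdeg t))" using assms(2) by simp
    have a: "mser_in 3 (mprod_upto (2 * n + 1) (\<lambda>k. mpow (g k) (cnt t k)))"
    proof (rule mser_in_mprod)
      show "mser_in 3 (mpow (g k) (cnt t k))" for k
        using assms(1) cnt_0 by (cases k) (auto intro!: mser_in_mpow mser_in_mconst)
    qed
    show "mser_in 3 (tw g h n t)" unfolding tw_def
      by (intro mser_in_mmul mser_in_mpow[OF disjI1] mser_in_mvar a b) simp_all
  qed
  moreover have "mvar 0 \<gamma> = 0" by (rule z) (simp add: mser_in_mvar)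
  ultimately show False using nz unfolding Cmaps_terms by simp
qed

lemma Df_E0: assumes "e \<in> E0" shows "Df s e \<in> fld E0"
proof -
  note f = subfldD[OF subfld_fld[of E0]]
  have z: "zz = fps_const (fls_const fls_X)" and u: "uu = fps_const fls_X" by (simp_all add: mono4_conv mono4_def)
  have c: "flmap fls_deriv (fls_const x :: kk) = fls_const (fls_deriv x)" for x
    by (rule fls_eqI) (simp add: flmap_nth)
  have cX: "flmap fls_deriv (fls_X :: kk) = 0" "flmap fls_deriv (1 :: kk) = 0"
    by (rule fls_eqI, simp add: flmap_nth)+
  consider "s = 0" | "s = 1" | "s \<noteq> 0" "s \<noteq> 1" by blast
  then have "dd s zz = (if s = 0 then 1 else 0) \<and> dd s uu = (if s = 1 then 1 else 0) \<and>
    dd s fps_X = (if s = 0 \<or> s = 1 then 0 else 1)"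
  proof cases
    case 1
    have "dd 0 zz = 1" "dd 0 uu = 0" "dd 0 fps_X = 0"
      by (rule fps_ext, simp add: dd_def z u c cX flmap_0)+
    then show ?thesis using 1 by simp
  next
    case 2
    have "dd 1 zz = 0" "dd 1 uu = 1" "dd 1 fps_X = 0"
      by (rule fps_ext, simp add: dd_def z u)+
    then show ?thesis using 2 by simp
  next
    case 3
    then show ?thesis by (simp add: dd_def z u)
  qed
  moreover have "Df s fls_X = ft (dd s fps_X)" using Df_ft[of s fps_X] by simp
  ultimately show ?thesis using assms f(1,2) unfolding E0_def by (auto simp: Df_ft split: if_splits)
qed

theorem diff_alg_Cmaps:
  assumes "\<forall>k\<ge>1. mser_in 3 (g k)" "\<forall>k\<ge>1. mser_in 3 (h k)" "holonomic 4 (vgen g)" "holonomic 4 (vgen h)" and i: "i < 3"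
  shows "diff_alg 3 i (Cmaps g h)"
proof -
  obtain F where F: "dfin ZZ dd F (\<lambda>\<beta>. J (mdiffs 4 \<beta> (vgen g))) (cseq g)"
    using holonomic_dfin[OF assms(3)] unfolding J_vgen by blast
  obtain H where H: "dfin ZZ dd H (\<lambda>\<beta>. J (mdiffs 4 \<beta> (vgen h))) (cseq h)"
    using holonomic_dfin[OF assms(4)] unfolding J_vgen by blast
  obtain Q R S where oc: "one_cut zz uu Q R S (shl (cseq g))" using ex_one_cut by blast
  have g0: "cseq g 0 = 0" by (simp add: cseq_def)
  have E0': "finite E0" "ft ` ZZ \<subseteq> fld E0" "ft zz \<in> fld E0" "ft uu \<in> fld E0" "fls_X \<in> fld E0"
    by (auto simp: E0_def ZZ_def intro: fld_incl)
  obtain E where E: "finite E" "E0 \<subseteq> E" "\<forall>s<3. \<forall>x\<in>fld E. Df s x \<in> fld E"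
    "ft (Sa (\<lambda>m. (bc R S (cseq h) (int m) - R * bc R S (cseq h) (int m + 2)) * one_cut.Bc uu Q R S (shl (cseq g)) (m + 1))) \<in> fld E"
    using one_cut_finite[OF oc g0 Df_compat Df_ft dd_loc E0'(1,2) Df_E0 E0'(3-5) F H] by blast
  define C where "C = Cmaps g h"
  have oc': "one_cut zz uu Q R S (\<lambda>j. cseq g (Suc j))" using oc unfolding shl_def[abs_def] .
  have E0E: "x \<in> fld E" if "x \<in> fld E0" for x using fld_mono[OF E(2)] that by blast
  have "\<iota> C = zz + Sa (\<lambda>m. (bc R S (cseq h) (int m) - R * bc R S (cseq h) (int m + 2)) * one_cut.Bc uu Q R S (shl (cseq g)) (m + 1))"
    unfolding C_def iota_Cmaps terms_one_cut[OF oc'] shl_def[abs_def] ..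
  then have C: "ft (\<iota> C) \<in> fld E" using subfldD(3)[OF subfld_fld E0E[OF E0'(3)] E(4)] by simp
  \<comment> \<open>The n + 1 derivatives together with z, u, t are n + 4 elements of a field with n
    generators, hence algebraically dependent over the rationals.\<close>
  define n where "n = card E"
  define vals where "vals = (\<lambda>j. if j \<le> n then (mderiv i ^^ j) C else mvar (j - n - 1))"
  have der: "ft (\<iota> ((mderiv i ^^ j) C)) \<in> fld E" for j
    by (induction j) (use C E(3) i in \<open>simp_all add: J_mderiv flip: Df_ft\<close>)
  have vals: "ft (\<iota> (vals j)) \<in> fld E" if "j < n + 1 + 3" for j
  proof (cases "j \<le> n")
    case True then show ?thesis using der by (simp add: vals_def)
  next
    case False
    then have "j - n - 1 = 0 \<or> j - n - 1 = 1 \<or> j - n - 1 = 2" using that by linarith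
    then show ?thesis using False E0E E0'(3-5) by (auto simp: vals_def zz_def uu_def iota_t)
  qed
  have "card E < n + 1 + 3" by (simp add: n_def)
  from alg_dependent[OF E(1), of "n + 1 + 3" "\<lambda>j. ft (\<iota> (vals j))", OF vals this]
  obtain P :: "(nat \<Rightarrow>\<^sub>0 nat) \<Rightarrow>\<^sub>0 rat" where P: "P \<noteq> 0" "\<forall>\<mu>\<in>Poly_Mapping.keys P. Poly_Mapping.keys \<mu> \<subseteq> {..<n + 1 + 3}"
    "(\<Sum>\<mu>\<in>Poly_Mapping.keys P. of_rat (lk P \<mu>) * (\<Prod>j<n + 1 + 3. ft (\<iota> (vals j)) ^ lk \<mu> j)) = 0"
    by blast
  have "ft (\<iota> (meval (n + 1 + 3) vals P)) = 0" unfolding iota_meval by (rule P(3))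
  then have z: "\<iota> (meval (n + 1 + 3) vals P) = 0" by simp
  have "mser_in 3 C" unfolding C_def by (rule mser_in_Cmaps) (use assms in auto)
  then have "mser_in 3 (vals j)" if "j < n + 1 + 3" for j
    using that by (auto simp: vals_def intro!: mser_in_funpow mser_in_mvar)
  then have "mser_in 3 (meval (n + 1 + 3) vals P)"
    unfolding meval_def by (intro mser_in_msum mser_in_mmul mser_in_mconst mser_in_mprod mser_in_mpow disjI1)
  then have "meval (n + 1 + 3) vals P = mconst 0" using z by (rule iota_inj)
  then show ?thesis unfolding diff_alg_def C_def[symmetric] using P(1,2) unfolding vals_def by blast
qed

theorem theorem4p1p1:
  fixes g h :: "nat \<Rightarrow> mser"
  assumes "\<forall>k\<ge>1. mser_in 3 (g k)"
    and "\<forall>k\<ge>1. mser_in 3 (h k)"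
    and "holonomic 4 (vgen g)"
    and "holonomic 4 (vgen h)"
  shows "diff_alg 3 2 (Cmaps g h) \<and> diff_alg 3 1 (Cmaps g h) \<and> diff_alg 3 0 (Cmaps g h)"
  using assms diff_alg_Cmaps by simp

end
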